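(* Let $X_\Omega\subset\mathbb{R}^4$ be any star-shaped toric domain. Then there exist $C^0$-small perturbations of $X_\Omega$ in terms of the volume which are again star-shaped toric domains, are not symplectically convex, and for which the product $\mathrm{ru}\cdot\mathrm{sys}^{1/2}$ is arbitrarily small or arbitrarily large. Precisely: for all $\delta>0$, $\eta>0$ and $M>0$ there exist star-shaped toric domains $X_{\widehat\Omega_1}$ and $X_{\widehat\Omega_2}$ in $\mathbb{R}^4$ such that (1) for $i=1,2$, the symmetric difference of $X_{\widehat\Omega_i}$ and $X_\Omega$ has volume less than $\delta$; (2) $\mathrm{ru}(X_{\widehat\Omega_1})\cdot \mathrm{sys}(X_{\widehat\Omega_1})^{1/2}<\eta$; (3) $\mathrm{ru}(X_{\widehat\Omega_2})\cdot \mathrm{sys}(X_{\widehat\Omega_2})^{1/2}>M$; (4) neither $X_{\widehat\Omega_1}$ nor $X_{\widehat\Omega_2}$ is symplectically convex.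
   Context: Identify $\mathbb{R}^4$ with $\mathbb{C}^2$, with coordinates $z_j=x_j+iy_j$, standard symplectic form $\omega_{\rm std}=dx_1\wedge dy_1+dx_2\wedge dy_2$ and primitive $\lambda_{\rm std}=\frac12\sum_{i}(x_i\,dy_i-y_i\,dx_i)$. Let $\mu:\mathbb{C}^2\to\mathbb{R}^2_{\ge 0}$, $\mu(z_1,z_2)=(\pi|z_1|^2,\pi|z_2|^2)$. A toric domain is $X_\Omega:=\mu^{-1}(\Omega)$, where $\Omega\subset\mathbb{R}^2_{\geq 0}$ is a compact domain containing a neighborhood of the origin in $\mathbb{R}^2_{\ge0}$. Put $\partial_+\Omega:=\partial\Omega\cap\mathbb{R}^2_{>0}$; its closure $\overline{\partial_+\Omega}$ is always assumed to be smooth. $X_\Omega$ is star-shaped if the radial vector field of $\mathbb{R}^4$ is transverse to $\partial X_\Omega$ and each ray from the origin meets $\partial X_\Omega$ exactly once (equivalently, every ray in $\mathbb{R}^2_{\ge0}$ from the origin is transverse to $\overline{\partial_+\Omega}$ and meets it once). Then $\lambda:=\lambda_{\rm std}|_{Y}$ is a contact form on $Y:=\partial X_\Omega\cong S^3$. A toric domain $X_\Omega$ is symplectically convex if there is a symplectomorphism $\phi$ of $(\mathbb{R}^4,\omega_{\rm std})$ such that $\phi(X_\Omega)$ is (geometrically) convex. Volume of a subset of $\mathbb{R}^4$ means volume with respect to $\frac12\omega_{\rm std}^2$, i.e. Lebesgue measure. For a closed contact 3-manifold $(Y,\lambda)$ let $\mathrm{Vol}(Y,\lambda)=\int_Y\lambda\wedge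 d\lambda$. Ruelle invariant: for $Y$ a homology 3-sphere, let $\tau$ be a global symplectic trivialization of $\xi=\ker\lambda$ (unique up to homotopy). For $y\in Y$ and $T\ge0$, the linearized Reeb flow on $\xi$ along the Reeb trajectory of $y$ over $[0,T]$, expressed in $\tau$, is a path in $\mathrm{Sp}(2)$ starting at the identity, i.e. an element of $\widetilde{\mathrm{Sp}}(2)$; let $\rho(y,T,\tau)\in\mathbb{R}$ be its rotation number, where $\rho:\widetilde{\mathrm{Sp}}(2)\to\mathbb{R}$ is the translation number of the lifted action on oriented lines through $0$ in $\mathbb{R}^2$ (a full positive $2\pi$-rotation having rotation number $1$). Put $\mathrm{rot}(y)=\lim_{T\to\infty}\rho(y,T,\tau)/T$ (an integrable function on $Y$) and $\mathrm{Ru}(Y,\lambda)=\int_Y \mathrm{rot}\;\lambda\wedge d\lambda$. Ruelle ratio and systolic ratio: $\mathrm{ru}(Y,\lambda)=\mathrm{Ru}(Y,\lambda)/\mathrm{Vol}(Y,\lambda)^{1/2}$ and $\mathrm{sys}(Y,\lambda)=T_{\min}^2/\mathrm{Vol}(Y,\lambda)$, where $T_{\min}$ is the minimal period of a closed Reeb orbit of $(Y,\lambda)$. For a star-shaped toric domain, $\mathrm{ru}(X_\Omega):=\mathrm{ru}(\partial X_\Omega,\lambda)$ and $\mathrm{sys}(X_\Omega):=\mathrm{sys}(\partial X_\Omega,\lambda)$. *)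

theory Defs
  imports "HOL-Analysis.Analysis"
begin

section \<open>Smooth maps and submanifolds of Euclidean spaces\<close>

text \<open>These notions are meant for an open set \<open>U\<close>.\<close>

primrec Ck_on :: "nat \<Rightarrow> 'a::euclidean_space set \<Rightarrow> ('a \<Rightarrow> 'b::euclidean_space) \<Rightarrow> bool" where
  "Ck_on 0 U f \<longleftrightarrow> continuous_on U f"
| "Ck_on (Suc k) U f \<longleftrightarrow>
     (\<forall>x\<in>U. f differentiable (at x)) \<and> (\<forall>v. Ck_on k U (\<lambda>x. frechet_derivative f (at x) v))"

definition smooth_on :: "'a::euclidean_space set \<Rightarrow> ('a \<Rightarrow> 'b::euclidean_space) \<Rightarrow> bool" where
  "smooth_on U f \<longleftrightarrow> (\<forall>k. Ck_on k U f)"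

definition diffeomorphism ::
  "'a::euclidean_space set \<Rightarrow> 'b::euclidean_space set \<Rightarrow> ('a \<Rightarrow> 'b) \<Rightarrow> bool" where
  "diffeomorphism U V \<Phi> \<longleftrightarrow>
     open U \<and> open V \<and> bij_betw \<Phi> U V \<and> smooth_on U \<Phi> \<and> smooth_on V (inv_into U \<Phi>)"

definition smooth_submanifold :: "nat \<Rightarrow> 'a::euclidean_space set \<Rightarrow> bool" where
  "smooth_submanifold k S \<longleftrightarrow>
     (\<forall>p\<in>S. \<exists>U (V :: 'a set) \<Phi> L.
        p \<in> U \<and> diffeomorphism U V \<Phi> \<and> subspace L \<and> dim L = k \<and> \<Phi> ` (S \<inter> U) = V \<inter> L)"

text \<open>Submanifolds with (possibly empty) boundary. The normal \<open>n\<close> of the half-space may be \<open>0\<close>,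
  in which case the half-space is all of \<open>L\<close>.\<close>

definition smooth_submanifold_with_boundary :: "nat \<Rightarrow> 'a::euclidean_space set \<Rightarrow> bool" where
  "smooth_submanifold_with_boundary k S \<longleftrightarrow>
     (\<forall>p\<in>S. \<exists>U (V :: 'a set) \<Phi> L n.
        p \<in> U \<and> diffeomorphism U V \<Phi> \<and> subspace L \<and> dim L = k \<and> n \<in> L \<and>
        \<Phi> ` (S \<inter> U) = V \<inter> L \<inter> {x. 0 \<le> n \<bullet> x})"

definition tangent_space :: "'a::euclidean_space set \<Rightarrow> 'a \<Rightarrow> 'a set" where
  "tangent_space S p =
     {v. \<exists>c \<epsilon>. 0 < \<epsilon> \<and> smooth_on {-\<epsilon><..<\<epsilon>} c \<and> c ` {-\<epsilon><..<\<epsilon>} \<subseteq> S \<and> c (0::real) = p \<and>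
               (c has_vector_derivative v) (at 0)}"

text \<open>The differential of \<open>f\<close>, defined on the submanifold \<open>S\<close>, at \<open>p\<close>. A derivative within \<open>S\<close>
  is determined only on vectors tangent to \<open>S\<close>, so this is meaningful for
  \<open>v \<in> tangent_space S p\<close>.\<close>

definition differential_on ::
  "'a::euclidean_space set \<Rightarrow> ('a \<Rightarrow> 'b::euclidean_space) \<Rightarrow> 'a \<Rightarrow> 'a \<Rightarrow> 'b" where
  "differential_on S f p v = (THE w. \<exists>D. (f has_derivative D) (at p within S) \<and> D v = w)"


section \<open>Standard symplectic geometry of \<open>\<complex>\<^sup>2\<close>\<close>

type_synonym C2 = "complex \<times> complex"

text \<open>\<open>dx \<and> dy (u, v) = Im (cnj u * v)\<close> on \<open>\<complex>\<close>.\<close>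

definition omega_std :: "C2 \<Rightarrow> C2 \<Rightarrow> real" where
  "omega_std u v = Im (cnj (fst u) * fst v) + Im (cnj (snd u) * snd v)"

definition lambda_std :: "C2 \<Rightarrow> C2 \<Rightarrow> real" where
  "lambda_std z v =
     (1/2) * ((Re (fst z) * Im (fst v) - Im (fst z) * Re (fst v)) +
              (Re (snd z) * Im (snd v) - Im (snd z) * Re (snd v)))"

definition symplectomorphism :: "(C2 \<Rightarrow> C2) \<Rightarrow> bool" where
  "symplectomorphism \<phi> \<longleftrightarrow> diffeomorphism UNIV UNIV \<phi> \<and>
     (\<forall>z u v. omega_std (frechet_derivative \<phi> (at z) u) (frechet_derivative \<phi> (at z) v) = omega_std u v)"

definition symplectically_convex :: "C2 set \<Rightarrow> bool" where
  "symplectically_convex X \<longleftrightarrow> (\<exists>\<phi>. symplectomorphism \<phi> \<and> convex (\<phi> ` X))"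


section \<open>Toric domains\<close>

definition quadrant :: "(real \<times> real) set" where
  "quadrant = {w. 0 \<le> fst w \<and> 0 \<le> snd w}"

definition open_quadrant :: "(real \<times> real) set" where
  "open_quadrant = {w. 0 < fst w \<and> 0 < snd w}"

definition moment_map :: "C2 \<Rightarrow> real \<times> real" where
  "moment_map z = (pi * (cmod (fst z))\<^sup>2, pi * (cmod (snd z))\<^sup>2)"

definition X_toric :: "(real \<times> real) set \<Rightarrow> C2 set" where
  "X_toric \<Omega> = moment_map -` \<Omega>"

definition boundary_plus :: "(real \<times> real) set \<Rightarrow> (real \<times> real) set" where
  "boundary_plus \<Omega> = frontier \<Omega> \<inter> open_quadrant"

text \<open>A compact domain is a compact set that is the closure of its connected interior.\<close>

definition toric_region :: "(real \<times> real) set \<Rightarrow> bool" where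
  "toric_region \<Omega> \<longleftrightarrow>
     \<Omega> \<subseteq> quadrant \<and> compact \<Omega> \<and> connected (interior \<Omega>) \<and> closure (interior \<Omega>) = \<Omega> \<and>
     (\<exists>\<epsilon>>0. ball 0 \<epsilon> \<inter> quadrant \<subseteq> \<Omega>) \<and>
     smooth_submanifold_with_boundary 1 (closure (boundary_plus \<Omega>))"

text \<open>The radial vector field at \<open>y\<close> is \<open>y\<close>; it is transverse to a hypersurface iff it is
  nowhere tangent to it.\<close>

definition star_shaped :: "C2 set \<Rightarrow> bool" where
  "star_shaped X \<longleftrightarrow>
     smooth_submanifold 3 (frontier X) \<and>
     (\<forall>y\<in>frontier X. y \<notin> tangent_space (frontier X) y) \<and>
     (\<forall>u. u \<noteq> 0 \<longrightarrow> (\<exists>!t. 0 \<le> t \<and> t *\<^sub>R u \<in> frontier X))"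

definition star_shaped_toric :: "(real \<times> real) set \<Rightarrow> bool" where
  "star_shaped_toric \<Omega> \<longleftrightarrow> toric_region \<Omega> \<and> star_shaped (X_toric \<Omega>)"


section \<open>Reeb dynamics on a hypersurface \<open>Y\<close> with contact form \<open>\<lambda>_std|_Y\<close>\<close>

text \<open>Since \<open>d \<lambda>_std = \<omega>_std\<close>, the contact volume form \<open>\<lambda> \<and> d\<lambda>\<close> is the
  alternating 3-form below.\<close>

definition lambda_wedge_dlambda :: "C2 \<Rightarrow> C2 \<Rightarrow> C2 \<Rightarrow> C2 \<Rightarrow> real" where
  "lambda_wedge_dlambda z a b c =
     lambda_std z a * omega_std b c - lambda_std z b * omega_std a c + lambda_std z c * omega_std a b"

definition contact_plane :: "C2 set \<Rightarrow> C2 \<Rightarrow> C2 set" where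
  "contact_plane Y y = {v \<in> tangent_space Y y. lambda_std y v = 0}"

definition reeb_field :: "C2 set \<Rightarrow> C2 \<Rightarrow> C2" where
  "reeb_field Y y =
     (THE R. R \<in> tangent_space Y y \<and> lambda_std y R = 1 \<and> (\<forall>v\<in>tangent_space Y y. omega_std R v = 0))"

definition reeb_trajectory :: "C2 set \<Rightarrow> (real \<Rightarrow> C2) \<Rightarrow> bool" where
  "reeb_trajectory Y \<gamma> \<longleftrightarrow>
     (\<forall>t. \<gamma> t \<in> Y \<and> (\<gamma> has_vector_derivative reeb_field Y (\<gamma> t)) (at t))"

definition reeb_flow :: "C2 set \<Rightarrow> real \<Rightarrow> C2 \<Rightarrow> C2" where
  "reeb_flow Y t y = (THE \<gamma>. reeb_trajectory Y \<gamma> \<and> \<gamma> 0 = y) t"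

definition T_min :: "C2 set \<Rightarrow> real" where
  "T_min Y = Inf {T. 0 < T \<and> (\<exists>\<gamma>. reeb_trajectory Y \<gamma> \<and> \<gamma> T = \<gamma> 0)}"


section \<open>Integration against \<open>\<lambda> \<and> d\<lambda>\<close>\<close>

type_synonym R3 = "real \<times> real \<times> real"

definition local_parametrization :: "C2 set \<Rightarrow> R3 set \<Rightarrow> (R3 \<Rightarrow> C2) \<Rightarrow> bool" where
  "local_parametrization Y U \<psi> \<longleftrightarrow>
     open U \<and> smooth_on U \<psi> \<and> inj_on \<psi> U \<and> (\<forall>x\<in>U. inj (frechet_derivative \<psi> (at x))) \<and>
     openin (top_of_set Y) (\<psi> ` U)"

definition contact_density :: "(R3 \<Rightarrow> C2) \<Rightarrow> R3 \<Rightarrow> real" where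
  "contact_density \<psi> x =
     \<bar>lambda_wedge_dlambda (\<psi> x)
        (frechet_derivative \<psi> (at x) (1, 0, 0))
        (frechet_derivative \<psi> (at x) (0, 1, 0))
        (frechet_derivative \<psi> (at x) (0, 0, 1))\<bar>"

text \<open>The Borel measure on \<open>Y\<close> given by the volume form \<open>\<lambda> \<and> d\<lambda>\<close>, that is, the unique measure
  with the prescribed density in every local parametrization. The absolute value in the density
  reflects that a contact manifold is oriented by \<open>\<lambda> \<and> d\<lambda>\<close>.\<close>

definition contact_measure :: "C2 set \<Rightarrow> C2 measure" where
  "contact_measure Y = (THE \<mu>. sets \<mu> = sets (restrict_space borel Y) \<and>
     (\<forall>U \<psi> A. local_parametrization Y U \<psi> \<longrightarrow> A \<in> sets \<mu> \<longrightarrow> A \<subseteq> \<psi> ` U \<longrightarrow>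
        emeasure \<mu> A = (\<integral>\<^sup>+x\<in>U \<inter> \<psi> -` A. ennreal (contact_density \<psi> x) \<partial>lborel)))"

definition contact_volume :: "C2 set \<Rightarrow> real" where
  "contact_volume Y = (\<integral>y. 1 \<partial>contact_measure Y)"


section \<open>Rotation numbers and the Ruelle invariant\<close>

text \<open>The fibre \<open>\<real>\<^sup>2\<close> of a trivialization is \<open>\<complex>\<close> with area form \<open>Im (cnj a * b)\<close>. The map \<open>\<tau> y\<close>
  is linear on the whole of \<open>\<complex>\<^sup>2\<close>, but only its restriction to \<open>contact_plane Y y\<close> matters.\<close>

definition symplectic_trivialization :: "C2 set \<Rightarrow> (C2 \<Rightarrow> C2 \<Rightarrow> complex) \<Rightarrow> bool" where
  "symplectic_trivialization Y \<tau> \<longleftrightarrow>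
     (\<forall>y\<in>Y. linear (\<tau> y) \<and> bij_betw (\<tau> y) (contact_plane Y y) UNIV \<and>
        (\<forall>u\<in>contact_plane Y y. \<forall>v\<in>contact_plane Y y. Im (cnj (\<tau> y u) * \<tau> y v) = omega_std u v)) \<and>
     continuous_on (Sigma Y (contact_plane Y)) (\<lambda>(y, v). \<tau> y v)"

text \<open>The linearized Reeb flow on \<open>\<xi>\<close> along the trajectory of \<open>y\<close>, expressed in \<open>\<tau>\<close>:
  a path in \<open>Sp(2)\<close> starting at the identity.\<close>

definition linearized_reeb_flow ::
  "C2 set \<Rightarrow> (C2 \<Rightarrow> C2 \<Rightarrow> complex) \<Rightarrow> C2 \<Rightarrow> real \<Rightarrow> complex \<Rightarrow> complex" where
  "linearized_reeb_flow Y \<tau> y t w =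
     \<tau> (reeb_flow Y t y)
       (differential_on Y (reeb_flow Y t) y (inv_into (contact_plane Y y) (\<tau> y) w))"

text \<open>The path \<open>A\<close> over \<open>[0, T]\<close> represents an element of the universal cover of \<open>Sp(2)\<close>;
  \<open>lifted_action A T\<close> is its action on the universal cover \<open>\<real>\<close> of the circle \<open>\<real>/\<int>\<close> of
  oriented lines in \<open>\<complex>\<close>, where \<open>s\<close> lies over the oriented line spanned by \<open>cis (2 * pi * s)\<close>.\<close>

definition lifted_action :: "(real \<Rightarrow> complex \<Rightarrow> complex) \<Rightarrow> real \<Rightarrow> real \<Rightarrow> real" where
  "lifted_action A T s =
     (THE x. \<exists>\<theta>. continuous_on {0..T} \<theta> \<and> \<theta> 0 = s \<and> \<theta> T = x \<and>
        (\<forall>t\<in>{0..T}. \<exists>r>0. A t (cis (2 * pi * s)) = r *\<^sub>R cis (2 * pi * \<theta> t)))"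

definition translation_number :: "(real \<Rightarrow> real) \<Rightarrow> real" where
  "translation_number F = lim (\<lambda>n. (F ^^ n) 0 / real n)"

definition rotation_number :: "C2 set \<Rightarrow> (C2 \<Rightarrow> C2 \<Rightarrow> complex) \<Rightarrow> C2 \<Rightarrow> real \<Rightarrow> real" where
  "rotation_number Y \<tau> y T = translation_number (lifted_action (linearized_reeb_flow Y \<tau> y) T)"

definition rot :: "C2 set \<Rightarrow> (C2 \<Rightarrow> C2 \<Rightarrow> complex) \<Rightarrow> C2 \<Rightarrow> real" where
  "rot Y \<tau> y = Lim at_top (\<lambda>T. rotation_number Y \<tau> y T / T)"

text \<open>On a homology sphere the global trivialization is unique up to homotopy, so the choice of \<open>\<tau>\<close>
  does not affect \<open>rot\<close>.\<close>

definition ruelle_invariant :: "C2 set \<Rightarrow> real" where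
  "ruelle_invariant Y =
     (\<integral>y. rot Y (SOME \<tau>. symplectic_trivialization Y \<tau>) y \<partial>contact_measure Y)"

definition ruelle_ratio :: "C2 set \<Rightarrow> real" where
  "ruelle_ratio Y = ruelle_invariant Y / sqrt (contact_volume Y)"

definition systolic_ratio :: "C2 set \<Rightarrow> real" where
  "systolic_ratio Y = (T_min Y)\<^sup>2 / contact_volume Y"

definition ru :: "(real \<times> real) set \<Rightarrow> real" where
  "ru \<Omega> = ruelle_ratio (frontier (X_toric \<Omega>))"

definition sys :: "(real \<times> real) set \<Rightarrow> real" where
  "sys \<Omega> = systolic_ratio (frontier (X_toric \<Omega>))"

end

theory Submission
  imports Defs
begin

text \<open>
  After a small change of \<open>\<Omega>\<close> in volume, \<open>X_toric \<Omega>\<close> is the set where the degree-one homogeneous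
  function \<open>(a + b) k (b / (a + b))\<close> of \<open>a = \<pi> \<bar>z\<^sub>1\<bar>\<^sup>2\<close>, \<open>b = \<pi> \<bar>z\<^sub>2\<bar>\<^sup>2\<close> is at most one, with \<open>k\<close> smooth and
  positive on \<open>[0, 1]\<close>. On the boundary the Reeb flow rotates the two coordinates with the frequencies
  \<open>f1\<close>, \<open>f2\<close> given by the gradient of that function, and the contact measure is the cone measure. A section
  of the contact structure tangent to the invariant tori is preserved by the flow, and every global
  trivialization winds once around it along each generating circle; hence the mean rotation is
  \<open>f1 + f2\<close>. Integration yields \<open>Ru = 1 / k 0 + 1 / k 1\<close>, so that
  \<open>ru sys\<^sup>1\<^sup>/\<^sup>2 = (1 / k 0 + 1 / k 1) T\<^sub>m\<^sub>i\<^sub>n / Vol\<close>.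

  Multiply \<open>k\<close> by a factor that equals \<open>\<kappa>\<close> at \<open>0\<close> and is close to \<open>1\<close> outside a tiny neighbourhood of \<open>0\<close>. For
  large \<open>\<kappa>\<close> this creates a notch with a short orbit, and the product is small. For small \<open>\<kappa>\<close> it creates a
  spike along which \<open>1 / k 0\<close> is huge while the minimal period stays bounded below, and the product is large.

  To destroy convexity, choose \<open>k' 1 = 3 k 1\<close>, which makes the frequency quotient \<open>f1 / f2\<close> on the
  exceptional orbit \<open>z\<^sub>1 = 0\<close> equal to \<open>-2\<close>. If a symplectomorphism \<open>\<phi>\<close> had convex image, then along this orbit
  the argument of the complex determinant of the Lagrangian plane spanned by the images of the orbit
  direction and of a flow-invariant normal vector would be nondecreasing. But shrinking the orbit to
  the origin deforms this loop of Lagrangian planes to a linear one of winding number \<open>1 - 2 = -1\<close>.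
\<close>

section \<open>Calculus of smooth maps\<close>

text \<open>The perturbation decouples three quantities. The Ruelle integrand
  \<open>(f1 + f2) / k^2\<close> is an exact derivative in \<open>t\<close>, so it sees only the end
  values of \<open>k\<close>; the volume is the integral of \<open>1 / k^2\<close> and hardly
  notices a change near one point; convexity is tested at \<open>t = 1\<close> alone, through the
  ratio \<open>k1 1 / k 1\<close>. The ratio 3 comes from the winding number
  \<open>1 + f1 1 / f2 1\<close>: an integer quotient lets the loop of frames close after one
  period, and -2 is the first integer making the winding number negative; -1 would give 0, which a
  nondecreasing phase permits. The delicate point is the minimal period of a spike. As the spike
  narrows, \<open>f2\<close> blows up near \<open>t = 0\<close>, so the frequencies are not
  uniformly bounded. But a closed orbit off \<open>z_1 = 0\<close> is already constrained by
  \<open>f1\<close> unless \<open>f1\<close> vanishes, and \<open>f1\<close> stays bounded for all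
  widths and is positive near the spike. Thus \<open>f2\<close> must be estimated only at zeros of
  \<open>f1\<close> and at \<open>t = 1\<close>.\<close>

lemma Ck_on_mono: "Ck_on k U f \<Longrightarrow> V \<subseteq> U \<Longrightarrow> Ck_on k V f"
  by (induction k arbitrary: f) (auto intro: continuous_on_subset)

lemma Ck_on_cong:
  assumes "open U" "\<And>x. x \<in> U \<Longrightarrow> f x = g x" "Ck_on k U f"
  shows "Ck_on k U g"
  using assms(2,3)
proof (induction k arbitrary: f g)
  case 0
  then show ?case by (metis Ck_on.simps(1) continuous_on_cong)
next
  case (Suc k)
  have der: "(g has_derivative frechet_derivative f (at x)) (at x)" if "x \<in> U" for x
    using Suc.prems that assms(1)
    by (auto simp: frechet_derivative_works intro: has_derivative_transform_within_open)
  have eq: "frechet_derivative f (at x) = frechet_derivative g (at x)" if "x \<in> U" for x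
    using der[OF that] by (rule frechet_derivative_at)
  have "Ck_on k U (\<lambda>x. frechet_derivative g (at x) v)" for v
  proof (rule Suc.IH)
    show "frechet_derivative f (at x) v = frechet_derivative g (at x) v" if "x \<in> U" for x
      using eq[OF that] by simp
    show "Ck_on k U (\<lambda>x. frechet_derivative f (at x) v)"
      using Suc.prems(2) by auto
  qed
  then show ?case using der by (auto intro: differentiableI)
qed

text \<open>Regularity may be checked on any explicit formula for the derivative instead of on
  \<open>frechet_derivative\<close>; the closure properties below are inductions on the order
  through this rule.\<close>

lemma Ck_on_SucI:
  assumes "open U" "\<And>x. x \<in> U \<Longrightarrow> (f has_derivative D x) (at x)" "\<And>v. Ck_on k U (\<lambda>x. D x v)"
  shows "Ck_on (Suc k) U f"
proof -
  have "D x = frechet_derivative f (at x)" if "x \<in> U" for x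
    using assms(2)[OF that] by (rule frechet_derivative_at)
  then show ?thesis
    using assms(2) Ck_on_cong[OF assms(1) _ assms(3)] by (auto intro: differentiableI)
qed

lemma Ck_on_continuous: "Ck_on k U f \<Longrightarrow> continuous_on U f"
  by (cases k) (auto intro: differentiable_imp_continuous_on simp: differentiable_on_def differentiable_at_withinI)

lemma Ck_on_SucD: "Ck_on (Suc k) U f \<Longrightarrow> Ck_on k U f"
proof (induction k arbitrary: f)
  case 0
  then show ?case using Ck_on_continuous[OF 0] by simp
next
  case (Suc k)
  then show ?case by auto
qed

lemma Ck_on_const: "Ck_on k U (\<lambda>x. c)"
  by (induction k arbitrary: c) auto

lemma Ck_on_bounded_linear:
  assumes "bounded_linear f" "open U"
  shows "Ck_on k U f"
proof (cases k)
  case 0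
  then show ?thesis using assms(1) by (simp add: linear_continuous_on)
next
  case (Suc k)
  show ?thesis unfolding Suc
    by (rule Ck_on_SucI[OF assms(2), of _ "\<lambda>x. f"])
       (use assms in \<open>auto intro: Ck_on_const bounded_linear_imp_has_derivative\<close>)
qed

lemma Ck_on_linear_compose:
  assumes "bounded_linear h" "Ck_on k U f" "open U"
  shows "Ck_on k U (\<lambda>x. h (f x))"
  using assms(2)
proof (induction k arbitrary: f)
  case 0
  then show ?case using assms(1) by (auto intro: bounded_linear.continuous_on)
next
  case (Suc k)
  show ?case
  proof (rule Ck_on_SucI[OF assms(3)])
    show "((\<lambda>x. h (f x)) has_derivative (\<lambda>v. h (frechet_derivative f (at x) v))) (at x)"
      if "x \<in> U" for x
      using Suc.prems that assms(1)
      by (auto simp: frechet_derivative_works intro: bounded_linear.has_derivative)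
  qed (use Suc in auto)
qed

lemma Ck_on_add:
  assumes "Ck_on k U f" "Ck_on k U g" "open U"
  shows "Ck_on k U (\<lambda>x. f x + g x)"
  using assms(1,2)
proof (induction k arbitrary: f g)
  case 0
  then show ?case by (auto intro: continuous_intros)
next
  case (Suc k)
  show ?case
  proof (rule Ck_on_SucI[OF assms(3)])
    show "((\<lambda>x. f x + g x) has_derivative
        (\<lambda>v. frechet_derivative f (at x) v + frechet_derivative g (at x) v)) (at x)"
      if "x \<in> U" for x
      using Suc.prems that
      by (auto simp: frechet_derivative_works intro: has_derivative_add)
  qed (use Suc in auto)
qed

lemma Ck_on_bilinear:
  assumes "bounded_bilinear B" "Ck_on k U f" "Ck_on k U g" "open U"
  shows "Ck_on k U (\<lambda>x. B (f x) (g x))"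
  using assms(2,3)
proof (induction k arbitrary: f g)
  case 0
  then show ?case using assms(1) by (auto intro: bounded_bilinear.continuous_on)
next
  case (Suc k)
  show ?case
  proof (rule Ck_on_SucI[OF assms(4)])
    show "((\<lambda>x. B (f x) (g x)) has_derivative
        (\<lambda>v. B (f x) (frechet_derivative g (at x) v) + B (frechet_derivative f (at x) v) (g x))) (at x)"
      if "x \<in> U" for x
      using Suc.prems that
      by (auto simp: frechet_derivative_works intro: bounded_bilinear.FDERIV[OF assms(1)])
    show "Ck_on k U (\<lambda>x. B (f x) (frechet_derivative g (at x) v) + B (frechet_derivative f (at x) v) (g x))"
      for v
      using Suc.prems by (intro Ck_on_add Suc.IH assms(4) Ck_on_SucD[of k U f] Ck_on_SucD[of k U g]) auto
  qed
qed

lemma Ck_on_sum: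
  assumes "\<And>i. i \<in> A \<Longrightarrow> Ck_on k U (f i)" "open U"
  shows "Ck_on k U (\<lambda>x. \<Sum>i\<in>A. f i x)"
  using assms(1)
  by (induction A rule: infinite_finite_induct) (auto intro: Ck_on_const Ck_on_add assms(2))

lemma Ck_on_compose:
  assumes "Ck_on k V g" "Ck_on k U f" "open U" "f ` U \<subseteq> V"
  shows "Ck_on k U (\<lambda>x. g (f x))"
  using assms(1,2)
proof (induction k arbitrary: g)
  case 0
  then show ?case using assms(4) by (simp add: continuous_on_compose2)
next
  case (Suc k)
  show ?case
  proof (rule Ck_on_SucI[OF assms(3)])
    \<comment> \<open>\<open>Ck_on\<close> speaks of derivatives in a fixed direction only, while in
      the chain rule the direction moves with \<open>x\<close>. Expanding it in \<open>Basis\<close>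
      leaves scalar coefficients times derivatives of \<open>g\<close> in constant directions, to
      which the induction hypothesis applies.\<close>
    show "((\<lambda>x. g (f x)) has_derivative
        (\<lambda>v. \<Sum>i\<in>Basis. (frechet_derivative f (at x) v \<bullet> i) *\<^sub>R frechet_derivative g (at (f x)) i)) (at x)"
      if "x \<in> U" for x
    proof -
      have f: "(f has_derivative frechet_derivative f (at x)) (at x)"
        using Suc.prems(2) that by (auto simp: frechet_derivative_works)
      have g: "(g has_derivative frechet_derivative g (at (f x))) (at (f x))"
        using Suc.prems(1) that assms(4) by (auto simp: frechet_derivative_works)
      have "linear (frechet_derivative g (at (f x)))"
        using g has_derivative_linear by blast
      then have lin: "frechet_derivative g (at (f x)) w = (\<Sum>i\<in>Basis. (w \<bullet> i) *\<^sub>R frechet_derivative g (at (f x)) i)" for w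
        using linear_sum[of "frechet_derivative g (at (f x))" "\<lambda>i. (w \<bullet> i) *\<^sub>R i" Basis]
        by (simp add: euclidean_representation linear_cmul)
      show ?thesis
        by (rule has_derivative_eq_rhs[OF has_derivative_compose[OF f g]]) (rule ext, rule lin)
    qed
    show "Ck_on k U (\<lambda>x. \<Sum>i\<in>Basis. (frechet_derivative f (at x) v \<bullet> i) *\<^sub>R frechet_derivative g (at (f x)) i)"
      for v
    proof (intro Ck_on_sum assms(3) Ck_on_bilinear[OF bounded_bilinear_scaleR])
      show "Ck_on k U (\<lambda>x. frechet_derivative f (at x) v \<bullet> i)" for i
        using Suc.prems(2) by (intro Ck_on_linear_compose[OF bounded_linear_inner_left] assms(3)) auto
      show "Ck_on k U (\<lambda>x. frechet_derivative g (at (f x)) i)" for i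
        using Suc.prems(1) Ck_on_SucD[OF Suc.prems(2)] by (intro Suc.IH) auto
    qed
  qed
qed

text \<open>The derivative is a polynomial in \<open>inverse\<close> itself, so the induction on the
  order closes up.\<close>

lemma Ck_on_inverse: "Ck_on k {x::real. x \<noteq> 0} inverse"
proof (induction k)
  case 0
  then show ?case by (auto intro: continuous_intros)
next
  case (Suc k)
  show ?case
  proof (rule Ck_on_SucI)
    show "open {x::real. x \<noteq> 0}"
      by (simp add: open_Collect_neq)
    show "(inverse has_derivative (\<lambda>v. - (inverse x * v * inverse x))) (at x)" if "x \<in> {x::real. x \<noteq> 0}" for x
      using that has_derivative_inverse'[of x UNIV] by simp
    show "Ck_on k {x::real. x \<noteq> 0} (\<lambda>x. - (inverse x * v * inverse x))" for v
      using Ck_on_linear_compose[OF bounded_linear_mult_right[of "-v"]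
          Ck_on_bilinear[OF bounded_bilinear_mult Suc Suc], OF \<open>open _\<close> \<open>open _\<close>]
      by (simp add: mult_ac)
  qed
qed

lemma Ck_on_sqrt: "Ck_on k {x::real. 0 < x} sqrt"
proof (induction k)
  case 0
  then show ?case by (auto intro: continuous_intros)
next
  case (Suc k)
  show ?case
  proof (rule Ck_on_SucI)
    show o: "open {x::real. 0 < x}"
      by (simp add: open_Collect_less)
    show "(sqrt has_derivative (\<lambda>v. (1/2 * v) * inverse (sqrt x))) (at x)" if "x \<in> {x::real. 0 < x}" for x
      using that by (auto intro!: derivative_eq_intros simp: divide_simps)
    have "Ck_on k {x::real. 0 < x} (\<lambda>x. inverse (sqrt x))"
      by (rule Ck_on_compose[OF Ck_on_inverse Suc o]) auto
    from Ck_on_linear_compose[OF bounded_linear_mult_right this o]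
    show "Ck_on k {x::real. 0 < x} (\<lambda>x. (1/2 * v) * inverse (sqrt x))" for v .
  qed
qed

lemma smooth_on_mono: "smooth_on U f \<Longrightarrow> V \<subseteq> U \<Longrightarrow> smooth_on V f"
  unfolding smooth_on_def using Ck_on_mono by blast

lemma smooth_on_cong:
  "open U \<Longrightarrow> (\<And>x. x \<in> U \<Longrightarrow> f x = g x) \<Longrightarrow> smooth_on U f \<Longrightarrow> smooth_on U g"
  unfolding smooth_on_def using Ck_on_cong by blast

lemma smooth_on_const: "smooth_on U (\<lambda>x. c)"
  by (simp add: smooth_on_def Ck_on_const)

lemma smooth_on_bounded_linear: "bounded_linear f \<Longrightarrow> open U \<Longrightarrow> smooth_on U f"
  by (simp add: smooth_on_def Ck_on_bounded_linear)

lemma smooth_on_linear_compose: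
  "bounded_linear h \<Longrightarrow> smooth_on U f \<Longrightarrow> open U \<Longrightarrow> smooth_on U (\<lambda>x. h (f x))"
  by (simp add: smooth_on_def Ck_on_linear_compose)

lemma smooth_on_bilinear:
  "bounded_bilinear B \<Longrightarrow> smooth_on U f \<Longrightarrow> smooth_on U g \<Longrightarrow> open U \<Longrightarrow> smooth_on U (\<lambda>x. B (f x) (g x))"
  by (simp add: smooth_on_def Ck_on_bilinear)

lemma smooth_on_ident: "open U \<Longrightarrow> smooth_on U (\<lambda>x. x)"
  by (rule smooth_on_bounded_linear[OF bounded_linear_ident])

lemma smooth_on_add:
  "smooth_on U f \<Longrightarrow> smooth_on U g \<Longrightarrow> open U \<Longrightarrow> smooth_on U (\<lambda>x. f x + g x)"
  by (simp add: smooth_on_def Ck_on_add)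

lemma smooth_on_minus: "smooth_on U f \<Longrightarrow> open U \<Longrightarrow> smooth_on U (\<lambda>x. - f x)"
  by (rule smooth_on_linear_compose[OF bounded_linear_minus[OF bounded_linear_ident]])

lemma smooth_on_diff:
  "smooth_on U f \<Longrightarrow> smooth_on U g \<Longrightarrow> open U \<Longrightarrow> smooth_on U (\<lambda>x. f x - g x)"
  using smooth_on_add[of U f "\<lambda>x. - g x"] by (simp add: smooth_on_minus)

lemma smooth_on_scaleR:
  "smooth_on U f \<Longrightarrow> smooth_on U g \<Longrightarrow> open U \<Longrightarrow> smooth_on U (\<lambda>x. f x *\<^sub>R g x)"
  by (rule smooth_on_bilinear[OF bounded_bilinear_scaleR])

lemma smooth_on_mult:
  fixes f g :: "'a::euclidean_space \<Rightarrow> real"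
  shows "smooth_on U f \<Longrightarrow> smooth_on U g \<Longrightarrow> open U \<Longrightarrow> smooth_on U (\<lambda>x. f x * g x)"
  by (rule smooth_on_bilinear[OF bounded_bilinear_mult])

lemma smooth_on_inner:
  "smooth_on U f \<Longrightarrow> smooth_on U g \<Longrightarrow> open U \<Longrightarrow> smooth_on U (\<lambda>x. f x \<bullet> g x)"
  by (rule smooth_on_bilinear[OF bounded_bilinear_inner])

lemma smooth_on_compose:
  "smooth_on V g \<Longrightarrow> smooth_on U f \<Longrightarrow> open U \<Longrightarrow> f ` U \<subseteq> V \<Longrightarrow> smooth_on U (\<lambda>x. g (f x))"
  unfolding smooth_on_def using Ck_on_compose by blast

lemma smooth_on_inverse:
  "smooth_on U f \<Longrightarrow> open U \<Longrightarrow> (\<And>x. x \<in> U \<Longrightarrow> f x \<noteq> 0) \<Longrightarrow> smooth_on U (\<lambda>x. inverse (f x :: real))"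
  using smooth_on_compose[where V = "{x. x \<noteq> 0}" and g = inverse and f = f and U = U]
  by (simp add: smooth_on_def Ck_on_inverse image_subset_iff)

lemma smooth_on_divide:
  fixes f g :: "'a::euclidean_space \<Rightarrow> real"
  shows "smooth_on U f \<Longrightarrow> smooth_on U g \<Longrightarrow> open U \<Longrightarrow> (\<And>x. x \<in> U \<Longrightarrow> g x \<noteq> 0) \<Longrightarrow>
    smooth_on U (\<lambda>x. f x / g x)"
  unfolding divide_inverse by (intro smooth_on_mult smooth_on_inverse)

lemma smooth_on_sqrt:
  "smooth_on U f \<Longrightarrow> open U \<Longrightarrow> (\<And>x. x \<in> U \<Longrightarrow> 0 < f x) \<Longrightarrow> smooth_on U (\<lambda>x. sqrt (f x))"
  using smooth_on_compose[where V = "{x. 0 < x}" and g = sqrt and f = f and U = U]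
  by (simp add: smooth_on_def Ck_on_sqrt image_subset_iff)

lemma smooth_on_power:
  fixes f :: "'a::euclidean_space \<Rightarrow> real"
  shows "smooth_on U f \<Longrightarrow> open U \<Longrightarrow> smooth_on U (\<lambda>x. f x ^ n)"
  by (induction n) (simp_all add: smooth_on_const smooth_on_mult)

lemma smooth_on_Pair:
  fixes f :: "'a::euclidean_space \<Rightarrow> 'b::euclidean_space" and g :: "'a \<Rightarrow> 'c::euclidean_space"
  assumes "smooth_on U f" "smooth_on U g" "open U"
  shows "smooth_on U (\<lambda>x. (f x, g x))"
proof -
  have b: "bounded_linear (\<lambda>y::'b. (y, 0::'c))" "bounded_linear (\<lambda>y::'c. (0::'b, y))"
    by (rule bounded_linear_Pair[OF bounded_linear_ident bounded_linear_zero] bounded_linear_Pair[OF bounded_linear_zero bounded_linear_ident])+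
  note 1 = smooth_on_linear_compose[OF b(1) assms(1,3)] and 2 = smooth_on_linear_compose[OF b(2) assms(2,3)]
  show ?thesis using smooth_on_add[OF 1 2 assms(3)] by simp
qed

lemma smooth_on_fst: "smooth_on U f \<Longrightarrow> open U \<Longrightarrow> smooth_on U (\<lambda>x. fst (f x))"
  by (rule smooth_on_linear_compose[OF bounded_linear_fst])

lemma smooth_on_snd: "smooth_on U f \<Longrightarrow> open U \<Longrightarrow> smooth_on U (\<lambda>x. snd (f x))"
  by (rule smooth_on_linear_compose[OF bounded_linear_snd])

lemmas smooth_intros = smooth_on_const smooth_on_ident smooth_on_add smooth_on_minus smooth_on_diff
  smooth_on_scaleR smooth_on_mult smooth_on_inner smooth_on_inverse smooth_on_divide smooth_on_sqrt
  smooth_on_power smooth_on_Pair smooth_on_fst smooth_on_snd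

lemma smooth_on_imp_continuous: "smooth_on U f \<Longrightarrow> continuous_on U f"
  unfolding smooth_on_def using Ck_on.simps(1) by blast

lemma smooth_on_has_derivative:
  "smooth_on U f \<Longrightarrow> x \<in> U \<Longrightarrow> (f has_derivative frechet_derivative f (at x)) (at x)"
  unfolding smooth_on_def by (metis Ck_on.simps(2) frechet_derivative_works)

lemma smooth_on_frechet_derivative:
  "smooth_on U f \<Longrightarrow> smooth_on U (\<lambda>x. frechet_derivative f (at x) v)"
  unfolding smooth_on_def by (metis Ck_on.simps(2))

lemma diffeomorphismI:
  assumes "open U" "open V" "smooth_on U f" "smooth_on V g"
    "\<And>x. x \<in> U \<Longrightarrow> f x \<in> V" "\<And>y. y \<in> V \<Longrightarrow> g y \<in> U"
    "\<And>x. x \<in> U \<Longrightarrow> g (f x) = x" "\<And>y. y \<in> V \<Longrightarrow> f (g y) = y"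
  shows "diffeomorphism U V f"
proof -
  have bij: "bij_betw f U V"
    by (rule bij_betw_byWitness[where f' = g]) (use assms in auto)
  have "g y = inv_into U f y" if "y \<in> V" for y
    using assms that bij by (metis bij_betw_imp_inj_on inv_into_f_eq)
  from smooth_on_cong[OF assms(2) this assms(4)] bij assms(1-3) show ?thesis
    unfolding diffeomorphism_def by auto
qed

text \<open>A level set of a positive function that is homogeneous of degree two is a graph over the
  directions in a half-space, which gives global charts on half-spaces.\<close>

lemma smooth_submanifold_homogeneous:
  fixes F :: "'a::euclidean_space \<Rightarrow> real"
  assumes sm: "smooth_on (-{0}) F" and hom: "\<And>t x. 0 < t \<Longrightarrow> F (t *\<^sub>R x) = t\<^sup>2 * F x"
    and pos: "\<And>x. x \<noteq> 0 \<Longrightarrow> 0 < F x"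
  shows "smooth_submanifold (DIM('a) - 1) {x. F x = 1}"
  unfolding smooth_submanifold_def
proof
  fix p assume "p \<in> {x. F x = 1}"
  then have p1: "F p = 1" by simp
  have "F 0 = 0"
    using hom[of 2 0] by simp
  then have p0: "p \<noteq> 0" using p1 by auto
  define e where "e = p /\<^sub>R norm p"
  have ee: "e \<bullet> e = 1" using p0 by (simp add: e_def dot_square_norm power2_eq_square)
  define U where "U = {y. 0 < y \<bullet> e}"
  define V where "V = {x. - 1 < x \<bullet> e}"
  \<comment> \<open>The first two terms project \<open>y\<close> radially to the affine hyperplane
    of points with \<open>e\<close>-component 1 and translate it to pass through 0; the last one
    stores \<open>F y - 1\<close> as the \<open>e\<close>-component, so the level set lands in the
    hyperplane orthogonal to \<open>e\<close>. Conversely \<open>q x\<close> recovers the point of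
    the affine hyperplane, and the root in \<open>g\<close> is the scaling for which
    \<open>F\<close> equals 1 plus the \<open>e\<close>-component of \<open>x\<close>.\<close>
  define f where "f = (\<lambda>y. (1 / (y \<bullet> e)) *\<^sub>R y - e + (F y - 1) *\<^sub>R e)"
  define q where "q = (\<lambda>x. x + (1 - x \<bullet> e) *\<^sub>R e)"
  define g where "g = (\<lambda>x. sqrt ((x \<bullet> e + 1) / F (q x)) *\<^sub>R q x)"
  have oU: "open U" and oV: "open V"
    unfolding U_def V_def by (intro open_Collect_less continuous_intros)+
  have U0: "U \<subseteq> -{0}" unfolding U_def by auto
  have fe: "f y \<bullet> e = F y - 1" if "y \<in> U" for y
    using that by (simp add: f_def U_def inner_diff_left inner_add_left ee)
  have qe: "q x \<bullet> e = 1" for x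
    by (simp add: q_def inner_add_left ee)
  have q0: "q x \<noteq> 0" for x using qe[of x] by auto
  have fV: "f y \<in> V" if "y \<in> U" for y
    using fe[OF that] pos[of y] U0 that by (auto simp: V_def)
  have gU: "g x \<in> U" if "x \<in> V" for x
    using that pos[OF q0, of x] qe[of x] by (simp add: g_def U_def V_def)
  have gf: "g (f y) = y" if y: "y \<in> U" for y
  proof -
    have "y \<bullet> e > 0" using y by (simp add: U_def)
    have "q (f y) = (1 / (y \<bullet> e)) *\<^sub>R y"
      unfolding q_def fe[OF y] by (simp add: f_def algebra_simps scaleR_2)
    moreover have "F ((1 / (y \<bullet> e)) *\<^sub>R y) = (1 / (y \<bullet> e))\<^sup>2 * F y"
      using \<open>y \<bullet> e > 0\<close> by (intro hom) simp
    moreover have "F y > 0" using pos[of y] U0 y by auto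
    ultimately show ?thesis
      using \<open>y \<bullet> e > 0\<close> by (simp add: g_def fe[OF y] power_divide real_sqrt_divide)
  qed
  have fg: "f (g x) = x" if x: "x \<in> V" for x
  proof -
    have s: "x \<bullet> e + 1 > 0" using x by (simp add: V_def)
    define r where "r = sqrt ((x \<bullet> e + 1) / F (q x))"
    have r: "r > 0" using s pos[OF q0, of x] by (simp add: r_def)
    have "F (g x) = r\<^sup>2 * F (q x)"
      unfolding g_def r_def[symmetric] using r by (rule hom)
    also have "\<dots> = x \<bullet> e + 1"
      using s pos[OF q0, of x] by (simp add: r_def)
    finally have F: "F (g x) = x \<bullet> e + 1" .
    have "(1 / (g x \<bullet> e)) *\<^sub>R g x = q x"
      unfolding g_def r_def[symmetric] using r by (simp add: qe)
    then show ?thesis by (simp add: f_def F) (simp add: q_def algebra_simps)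
  qed
  have sf: "smooth_on U f"
    unfolding f_def
    by (intro smooth_intros smooth_on_mono[OF sm] U0 oU) (auto simp: U_def)
  have sq: "smooth_on V q"
    unfolding q_def by (intro smooth_intros oV)
  have sg: "smooth_on V g"
    unfolding g_def
    by (intro smooth_intros smooth_on_compose[OF sm] sq oV)
       (use q0 pos[OF q0] in \<open>auto simp: V_def less_imp_neq[symmetric] less_imp_neq[THEN not_sym]\<close>)
  show "\<exists>U (V :: 'a set) \<Phi> L. p \<in> U \<and> diffeomorphism U V \<Phi> \<and> subspace L \<and> dim L = DIM('a) - 1 \<and>
      \<Phi> ` ({x. F x = 1} \<inter> U) = V \<inter> L"
  proof (intro exI conjI)
    show "p \<in> U" using p0 by (simp add: U_def e_def)
    show "diffeomorphism U V f"
      by (rule diffeomorphismI[OF oU oV sf sg fV gU gf fg])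
    show "subspace {x. e \<bullet> x = 0}" by (rule subspace_hyperplane)
    show "dim {x. e \<bullet> x = 0} = DIM('a) - 1" using ee by (intro dim_hyperplane) auto
    show "f ` ({x. F x = 1} \<inter> U) = V \<inter> {x. e \<bullet> x = 0}"
    proof safe
      fix y assume "y \<in> U" "F y = 1"
      then show "f y \<in> V" "e \<bullet> f y = 0" using fV fe by (auto simp: inner_commute)
    next
      fix x assume x: "x \<in> V" "e \<bullet> x = 0"
      then have "F (g x) = 1"
        using fe[OF gU[OF x(1)]] fg[OF x(1)] by (simp add: inner_commute)
      then show "x \<in> f ` ({x. F x = 1} \<inter> U)"
        using gU[OF x(1)] fg[OF x(1)] by (metis (mono_tags, lifting) IntI imageI mem_Collect_eq)
    qed
  qed
qed

text \<open>For the inclusion of the kernel, the straight line through \<open>y\<close> with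
  velocity \<open>v\<close> is normalised radially back to the level set. As \<open>D v = 0\<close>,
  the normalising factor has derivative 0 at the start, so the velocity remains
  \<open>v\<close>.\<close>

lemma tangent_space_homogeneous:
  fixes F :: "'a::euclidean_space \<Rightarrow> real"
  assumes sm: "smooth_on (-{0}) F" and hom: "\<And>t x. 0 < t \<Longrightarrow> F (t *\<^sub>R x) = t\<^sup>2 * F x"
    and pos: "\<And>x. x \<noteq> 0 \<Longrightarrow> 0 < F x" and y: "F y = 1"
    and D: "(F has_derivative D) (at y)"
  shows "tangent_space {x. F x = 1} y = {v. D v = 0}"
proof safe
  fix v assume "v \<in> tangent_space {x. F x = 1} y"
  then obtain c \<epsilon> where c: "0 < \<epsilon>" "c ` {-\<epsilon><..<\<epsilon>} \<subseteq> {x. F x = 1}" "c (0::real) = y"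
    "(c has_vector_derivative v) (at 0)"
    unfolding tangent_space_def mem_Collect_eq by (elim exE conjE) (rule that; assumption)
  have "((\<lambda>t. F (c t)) has_derivative (\<lambda>t. D (t *\<^sub>R v))) (at 0)"
    using has_derivative_compose[OF c(4)[unfolded has_vector_derivative_def], of F D] D c(3) by simp
  moreover have "((\<lambda>t. F (c t)) has_derivative (\<lambda>t. 0)) (at 0)"
    by (rule has_derivative_transform_within_open[OF has_derivative_const[of 1], where s = "{-\<epsilon><..<\<epsilon>}"])
       (use c in \<open>auto simp: image_subset_iff\<close>)
  ultimately have "(\<lambda>t. D (t *\<^sub>R v)) = (\<lambda>t. 0)" by (rule has_derivative_unique)
  then have "D (1 *\<^sub>R v) = 0" by (rule fun_cong)
  then show "D v = 0" by simp
next
  fix v assume Dv: "D v = 0"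
  have "F 0 = 0" using hom[of 2 0] by simp
  then have y0: "y \<noteq> 0" using y by auto
  define l where "l = (\<lambda>t::real. y + t *\<^sub>R v)"
  have "open (l -` (-{0}))"
    unfolding l_def by (intro open_vimage continuous_intros)
  moreover have "0 \<in> l -` (-{0})" using y0 by (simp add: l_def)
  ultimately obtain \<epsilon> where \<epsilon>: "\<epsilon> > 0" "ball 0 \<epsilon> \<subseteq> l -` (-{0})"
    by (metis openE)
  then have \<epsilon>: "\<epsilon> > 0" "\<And>t. \<bar>t\<bar> < \<epsilon> \<Longrightarrow> l t \<noteq> 0"
    by (auto simp: subset_iff)
  define c where "c = (\<lambda>t. (1 / sqrt (F (l t))) *\<^sub>R l t)"
  have sl: "smooth_on {-\<epsilon><..<\<epsilon>} l"
    unfolding l_def by (intro smooth_intros open_greaterThanLessThan)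
  have "smooth_on {-\<epsilon><..<\<epsilon>} (\<lambda>t. F (l t))"
    by (rule smooth_on_compose[OF sm sl]) (use \<epsilon> in auto)
  then have "smooth_on {-\<epsilon><..<\<epsilon>} c"
    unfolding c_def
    by (intro smooth_intros sl) (use \<epsilon> pos in \<open>auto simp: less_imp_neq[THEN not_sym]\<close>)
  moreover have "F (c t) = 1" if "\<bar>t\<bar> < \<epsilon>" for t
    using hom[of "1 / sqrt (F (l t))" "l t"] pos[OF \<epsilon>(2)[OF that]]
    by (simp add: c_def power_divide)
  then have "c ` {-\<epsilon><..<\<epsilon>} \<subseteq> {x. F x = 1}" by auto
  moreover have "c 0 = y" by (simp add: c_def l_def y)
  moreover have "(c has_vector_derivative v) (at 0)"
  proof -
    have l': "(l has_derivative (\<lambda>t. t *\<^sub>R v)) (at 0)"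
      unfolding l_def by (auto intro!: derivative_eq_intros)
    have lin: "linear D" using D has_derivative_linear by blast
    have "((\<lambda>t. F (l t)) has_derivative (\<lambda>t. D (t *\<^sub>R v))) (at 0)"
      by (rule has_derivative_compose[OF l']) (simp add: l_def D)
    then have Fl: "((\<lambda>t. F (l t)) has_derivative (\<lambda>t. 0)) (at 0)"
      using Dv lin by (simp add: linear_cmul)
    have F0: "F (l 0) = 1" by (simp add: l_def y)
    have "((\<lambda>t. 1 / sqrt (F (l t))) has_derivative (\<lambda>t. 0)) (at 0)"
      by (rule has_derivative_eq_rhs, rule derivative_intros Fl | simp add: F0)+
    then show ?thesis unfolding c_def has_vector_derivative_def
      by (rule has_derivative_eq_rhs[OF has_derivative_scaleR[OF _ l']]) (simp add: F0)
  qed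
  ultimately show "v \<in> tangent_space {x. F x = 1} y"
    unfolding tangent_space_def mem_Collect_eq using \<epsilon>(1) by (intro exI conjI)
qed

text \<open>Applied to open subsets of a sublevel set of a homogeneous function: since a larger
  multiple of each point still lies in the sublevel set, the function is strictly below the level
  there.\<close>

lemma open_contains_scaled:
  fixes x :: "'a::real_normed_vector"
  assumes "open S" "x \<in> S"
  obtains t where "1 < t" "t *\<^sub>R x \<in> S"
proof -
  have "open ((\<lambda>t. t *\<^sub>R x) -` S)"
    using assms(1) by (intro open_vimage continuous_intros)
  moreover have "1 \<in> (\<lambda>t. t *\<^sub>R x) -` S" using assms(2) by simp
  ultimately obtain e where "e > 0" "ball 1 e \<subseteq> (\<lambda>t. t *\<^sub>R x) -` S"
    by (metis openE)
  then show thesis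
    by (intro that[of "1 + e/2"]) (auto simp: subset_iff dist_real_def)
qed

section \<open>Toric domains given by a gauge function\<close>

text \<open>In the coordinates \<open>S = a + b\<close>, \<open>t = b / (a + b)\<close> on the quadrant, the region is \<open>S k t \<le> 1\<close>, and
  \<open>(f1, f2)\<close> is the gradient of \<open>K = S k t\<close>.\<close>

locale toric_gauge =
  fixes k :: "real \<Rightarrow> real" and I :: "real set"
  assumes open_I: "open I" and I01: "{0..1} \<subseteq> I"
    and smooth_k: "smooth_on I k" and k_pos: "\<And>t. t \<in> I \<Longrightarrow> 0 < k t"
begin

definition "k1 = deriv k"
definition "k2 = deriv k1"
definition "f1 t = k t - t * k1 t"
definition "f2 t = k t + (1 - t) * k1 t"
text \<open>The parameter \<open>t\<close> of the moment image pulled back to \<complex>^2, as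
  \<open>FF\<close> is \<open>K\<close> pulled back. Division by zero gives
  \<open>tau 0 = 0\<close>, so \<open>tau\<close> takes values in [0, 1] everywhere.\<close>

definition tau :: "C2 \<Rightarrow> real" where "tau z = (snd z \<bullet> snd z) / (z \<bullet> z)"
definition FF :: "C2 \<Rightarrow> real" where "FF z = pi * (z \<bullet> z) * k (tau z)"
definition K :: "real \<times> real \<Rightarrow> real" where "K w = (fst w + snd w) * k (snd w / (fst w + snd w))"
definition Om :: "(real \<times> real) set" where "Om = {w \<in> quadrant. K w \<le> 1}"
definition Y :: "C2 set" where "Y = {z. FF z = 1}"

lemma DERIV_k: "t \<in> I \<Longrightarrow> (k has_field_derivative k1 t) (at t)"
  using smooth_on_has_derivative[OF smooth_k] unfolding k1_def
  by (auto simp: DERIV_deriv_iff_real_differentiable differentiable_def)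

lemma smooth_k1: "smooth_on I k1"
proof (rule smooth_on_cong[OF open_I _ smooth_on_frechet_derivative[OF smooth_k, of 1]])
  fix t assume "t \<in> I"
  from DERIV_k[OF this] have "frechet_derivative k (at t) = (*) (k1 t)"
    unfolding has_field_derivative_def by (rule frechet_derivative_at[symmetric])
  then show "frechet_derivative k (at t) 1 = k1 t" by simp
qed

lemma DERIV_k1: "t \<in> I \<Longrightarrow> (k1 has_field_derivative k2 t) (at t)"
  using smooth_on_has_derivative[OF smooth_k1] unfolding k2_def
  by (auto simp: DERIV_deriv_iff_real_differentiable differentiable_def)

lemma cont_k: "continuous_on I k" and cont_k1: "continuous_on I k1"
  using smooth_k smooth_k1 smooth_on_imp_continuous by auto

lemma inner_C2: "z \<bullet> v = fst z \<bullet> fst v + snd z \<bullet> snd v" for z v :: C2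
  by (simp add: inner_prod_def)

lemma tau_ge_0: "0 \<le> tau z" and tau_le_1: "tau z \<le> 1"
  by (auto simp: tau_def inner_C2 divide_le_eq_1 add_nonneg_nonneg)
     (metis add_nonneg_nonneg inner_ge_zero not_less_iff_gr_or_eq order_less_le_trans)

lemma tau_I: "tau z \<in> I"
  using I01 tau_ge_0[of z] tau_le_1[of z] by auto

lemma tau_mult: "tau z * (z \<bullet> z) = snd z \<bullet> snd z"
  by (cases "z = 0") (auto simp: tau_def)

lemma one_minus_tau_mult: "(1 - tau z) * (z \<bullet> z) = fst z \<bullet> fst z"
  using tau_mult[of z] by (simp add: algebra_simps inner_C2)

lemma tau_scale: "c \<noteq> 0 \<Longrightarrow> tau (c *\<^sub>R z) = tau z"
  by (simp add: tau_def)

lemma FF_scale: "FF (c *\<^sub>R z) = c\<^sup>2 * FF z"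
  by (cases "c = 0") (auto simp: FF_def tau_scale power2_eq_square)

lemma FF_0 [simp]: "FF 0 = 0"
  by (simp add: FF_def)

lemma FF_pos: "z \<noteq> 0 \<Longrightarrow> 0 < FF z"
  using k_pos[OF tau_I, of z] by (simp add: FF_def)

lemma smooth_tau: "smooth_on (-{0}) tau"
  unfolding tau_def by (intro smooth_intros) auto

lemma smooth_FF: "smooth_on (-{0}) FF"
proof -
  have "smooth_on (-{0}) (\<lambda>z. k (tau z))"
    by (rule smooth_on_compose[OF smooth_k smooth_tau]) (use tau_I in auto)
  then show ?thesis
    unfolding FF_def by (intro smooth_intros) auto
qed

lemma tau_has_derivative:
  assumes "z \<noteq> 0"
  shows "(tau has_derivative (\<lambda>v. (2 * (snd z \<bullet> snd v) - 2 * tau z * (z \<bullet> v)) / (z \<bullet> z))) (at z)"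
proof -
  have "((\<lambda>z. (snd z \<bullet> snd z) / (z \<bullet> z)) has_derivative
      (\<lambda>v. (2 * (snd z \<bullet> snd v) - 2 * tau z * (z \<bullet> v)) / (z \<bullet> z))) (at z)"
    using assms
    by (auto intro!: derivative_eq_intros ext simp: tau_def inner_commute divide_simps)
  then show ?thesis unfolding tau_def .
qed

lemma FF_has_derivative:
  assumes "z \<noteq> 0"
  shows "(FF has_derivative (\<lambda>v. 2 * pi * (f1 (tau z) * (fst z \<bullet> fst v) + f2 (tau z) * (snd z \<bullet> snd v)))) (at z)"
proof -
  have k': "((\<lambda>z. k (tau z)) has_derivative
     (\<lambda>v. (2 * (snd z \<bullet> snd v) - 2 * tau z * (z \<bullet> v)) / (z \<bullet> z) * k1 (tau z))) (at z)"
    using DERIV_compose_FDERIV[OF DERIV_k[OF tau_I] tau_has_derivative[OF assms]] .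
  have "((\<lambda>z. pi * (z \<bullet> z) * k (tau z)) has_derivative (\<lambda>v. pi * (z \<bullet> z) *
     ((2 * (snd z \<bullet> snd v) - 2 * tau z * (z \<bullet> v)) / (z \<bullet> z) * k1 (tau z)) +
      pi * (z \<bullet> v + v \<bullet> z) * k (tau z))) (at z)"
    by (rule has_derivative_mult[OF _ k']) (auto intro!: derivative_eq_intros)
  then have "(FF has_derivative (\<lambda>v. pi * (z \<bullet> z) *
     ((2 * (snd z \<bullet> snd v) - 2 * tau z * (z \<bullet> v)) / (z \<bullet> z) * k1 (tau z)) +
      pi * (z \<bullet> v + v \<bullet> z) * k (tau z))) (at z)"
    unfolding FF_def .
  then show ?thesis
  proof (rule has_derivative_eq_rhs, intro ext)
    fix v
    have "pi * (z \<bullet> z) * ((2 * (snd z \<bullet> snd v) - 2 * tau z * (z \<bullet> v)) / (z \<bullet> z) * k1 (tau z))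
      = pi * (2 * (snd z \<bullet> snd v) - 2 * tau z * (z \<bullet> v)) * k1 (tau z)"
      using assms by simp
    then show "pi * (z \<bullet> z) * ((2 * (snd z \<bullet> snd v) - 2 * tau z * (z \<bullet> v)) / (z \<bullet> z) * k1 (tau z)) +
      pi * (z \<bullet> v + v \<bullet> z) * k (tau z) =
      2 * pi * (f1 (tau z) * (fst z \<bullet> fst v) + f2 (tau z) * (snd z \<bullet> snd v))"
      by (simp add: f1_def f2_def inner_commute[of v z]) (simp add: inner_C2 algebra_simps)
  qed
qed

lemma Y_nonzero: "z \<in> Y \<Longrightarrow> z \<noteq> 0"
  by (auto simp: Y_def)

lemma tangent_space_Y:
  assumes "y \<in> Y"
  shows "tangent_space Y y = {v. f1 (tau y) * (fst y \<bullet> fst v) + f2 (tau y) * (snd y \<bullet> snd v) = 0}"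
  using tangent_space_homogeneous[OF smooth_FF FF_scale FF_pos _ FF_has_derivative[OF Y_nonzero[OF assms]]]
    assms by (simp add: Y_def)

lemma f_sum: "(1 - t) * f1 t + t * f2 t = k t"
  by (simp add: f1_def f2_def algebra_simps)

text \<open>Euler's identity for the homogeneous function \<open>K\<close>. It is behind both the
  transversality of the radial field and the normalisation \<open>lambda_std y (R y) = 1\<close> of
  the Reeb field.\<close>

lemma f_weighted_sum: "pi * (f1 (tau y) * (fst y \<bullet> fst y) + f2 (tau y) * (snd y \<bullet> snd y)) = FF y"
proof -
  have "FF y = pi * ((1 - tau y) * f1 (tau y) + tau y * f2 (tau y)) * (y \<bullet> y)"
    by (simp add: FF_def f_sum)
  also have "\<dots> = pi * (f1 (tau y) * ((1 - tau y) * (y \<bullet> y)) + f2 (tau y) * (tau y * (y \<bullet> y)))"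
    by (simp add: algebra_simps)
  finally show ?thesis by (simp add: tau_mult one_minus_tau_mult)
qed

lemma moment_map_inner: "moment_map z = (pi * (fst z \<bullet> fst z), pi * (snd z \<bullet> snd z))"
  by (simp add: moment_map_def power2_norm_eq_inner)

lemma K_moment_map: "K (moment_map z) = FF z"
  by (simp add: K_def FF_def moment_map_inner tau_def inner_C2 flip: distrib_left)

lemma moment_map_quadrant: "moment_map z \<in> quadrant"
  by (simp add: quadrant_def moment_map_def)

lemma X_eq: "X_toric Om = {z. FF z \<le> 1}"
  by (auto simp: X_toric_def Om_def K_moment_map moment_map_quadrant)

text \<open>The point with \<open>K\<close> equal to \<open>fst p\<close> on the ray through
  \<open>(1 - snd p, snd p)\<close>. The region becomes the image of a closed square and its
  interior the image of the open square, from which compactness, connectedness and the closure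
  statements are read off.\<close>

definition pt :: "real \<times> real \<Rightarrow> real \<times> real" where
  "pt p = (fst p / k (snd p) * (1 - snd p), fst p / k (snd p) * snd p)"

lemma pt_sum: "fst (pt p) + snd (pt p) = fst p / k (snd p)"
  by (simp add: pt_def right_diff_distrib flip: add_divide_distrib)

lemma k_pos01: "0 \<le> t \<Longrightarrow> t \<le> 1 \<Longrightarrow> 0 < k t"
  using I01 k_pos by auto

lemma K_pt: "0 \<le> t \<Longrightarrow> t \<le> 1 \<Longrightarrow> K (pt (s, t)) = s"
  using k_pos01[of t] pt_sum[of "(s, t)"] by (cases "s = 0") (auto simp: K_def pt_def)

lemma pt_quadrant: "0 \<le> s \<Longrightarrow> 0 \<le> t \<Longrightarrow> t \<le> 1 \<Longrightarrow> pt (s, t) \<in> quadrant"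
  using k_pos01[of t] by (auto simp: pt_def quadrant_def)

lemma quadrant_pt:
  assumes "w \<in> quadrant"
  shows "w = pt (K w, snd w / (fst w + snd w))" "0 \<le> snd w / (fst w + snd w)"
    "snd w / (fst w + snd w) \<le> 1" "0 \<le> K w" "w \<noteq> 0 \<Longrightarrow> 0 < K w" "w \<noteq> 0 \<Longrightarrow> 0 < fst w + snd w"
proof -
  have w: "0 \<le> fst w" "0 \<le> snd w" using assms by (auto simp: quadrant_def)
  show t: "0 \<le> snd w / (fst w + snd w)" "snd w / (fst w + snd w) \<le> 1"
    using w by (auto simp: divide_le_eq_1)
  from k_pos01[OF this] have k: "0 < k (snd w / (fst w + snd w))" .
  show "0 \<le> K w" unfolding K_def using w k by simp
  show S: "0 < fst w + snd w" if "w \<noteq> 0"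
    using that w by (auto simp: prod_eq_iff)
  then show "0 < K w" if "w \<noteq> 0" unfolding K_def using k that by simp
  show "w = pt (K w, snd w / (fst w + snd w))"
  proof (cases "w = 0")
    case True
    then show ?thesis by (simp add: pt_def K_def prod_eq_iff)
  next
    case False
    then show ?thesis using S k by (simp add: pt_def K_def prod_eq_iff right_diff_distrib)
  qed
qed

lemma K_scale: "0 < c \<Longrightarrow> K (c *\<^sub>R w) = c * K w"
  by (simp add: K_def distrib_left[symmetric])

lemma continuous_pt: "continuous_on (UNIV \<times> {0..1}) pt"
proof -
  have "continuous_on (UNIV \<times> {0..1}) (\<lambda>p::real \<times> real. k (snd p))"
    by (rule continuous_on_compose2[OF cont_k]) (use I01 in \<open>auto intro!: continuous_intros\<close>)
  then show ?thesis
    unfolding pt_def using k_pos01 by (intro continuous_intros) (auto simp: less_imp_neq[THEN not_sym])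
qed

lemma Om_image: "Om = pt ` ({0..1} \<times> {0..1})"
proof (intro set_eqI iffI)
  fix w assume "w \<in> Om"
  then have w: "w \<in> quadrant" "K w \<le> 1" by (auto simp: Om_def)
  show "w \<in> pt ` ({0..1} \<times> {0..1})"
    by (rule image_eqI[where f = pt, OF quadrant_pt(1)[OF w(1)]]) (use quadrant_pt(2-4)[OF w(1)] w(2) in auto)
next
  fix w assume "w \<in> pt ` ({0..1} \<times> {0..1})"
  then obtain s t where "w = pt (s, t)" "0 \<le> s" "s \<le> 1" "0 \<le> t" "t \<le> 1" by auto
  then show "w \<in> Om" by (simp add: Om_def K_pt pt_quadrant)
qed

lemma compact_Om: "compact Om"
  unfolding Om_image
  by (intro compact_continuous_image continuous_on_subset[OF continuous_pt] compact_Times) auto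

definition "Oi = {w \<in> open_quadrant. K w < 1}"

lemma pt_open_quadrant: "0 < s \<Longrightarrow> 0 < t \<Longrightarrow> t < 1 \<Longrightarrow> pt (s, t) \<in> open_quadrant"
  using k_pos01[of t] by (auto simp: open_quadrant_def pt_def)

lemma Oi_image: "Oi = pt ` ({0<..<1} \<times> {0<..<1})"
proof (intro set_eqI iffI)
  fix w assume "w \<in> Oi"
  then have w: "w \<in> quadrant" "K w < 1" "fst w > 0" "snd w > 0"
    by (auto simp: Oi_def quadrant_def open_quadrant_def)
  then have "w \<noteq> 0" by auto
  then show "w \<in> pt ` ({0<..<1} \<times> {0<..<1})"
    using quadrant_pt(5)[OF w(1)] w
    by (intro image_eqI[where f = pt, OF quadrant_pt(1)[OF w(1)]]) auto
next
  fix w assume "w \<in> pt ` ({0<..<1} \<times> {0<..<1})"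
  then obtain s t where "w = pt (s, t)" "0 < s" "s < 1" "0 < t" "t < 1" by auto
  then show "w \<in> Oi" by (simp add: Oi_def K_pt pt_open_quadrant)
qed

lemma continuous_K: "continuous_on open_quadrant K"
proof -
  have "continuous_on open_quadrant (\<lambda>w. k (snd w / (fst w + snd w)))"
    by (rule continuous_on_compose2[OF cont_k])
       (use I01 in \<open>auto simp: open_quadrant_def subset_iff intro!: continuous_intros\<close>)
  then show ?thesis unfolding K_def by (intro continuous_intros)
qed

lemma open_open_quadrant: "open open_quadrant"
  unfolding open_quadrant_def by (intro open_Collect_conj open_Collect_less continuous_intros)

lemma open_Oi: "open Oi"
proof -
  have "Oi = open_quadrant \<inter> K -` {..<1}" by (auto simp: Oi_def)
  then show ?thesis
    using continuous_on_open_vimage[OF open_open_quadrant] continuous_K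
    by (metis Int_commute open_lessThan)
qed

text \<open>Two displacements inside an open subset of \<open>Om\<close> suffice: scaling outwards
  forces \<open>K w < 1\<close>, and moving along the negative diagonal forces both coordinates to
  be positive.\<close>

lemma interior_Om: "interior Om = Oi"
proof (rule interior_unique)
  show "Oi \<subseteq> Om" by (auto simp: Oi_def Om_def open_quadrant_def quadrant_def)
  show "open Oi" by (rule open_Oi)
  fix T assume T: "T \<subseteq> Om" "open T"
  show "T \<subseteq> Oi"
  proof
    fix w assume w: "w \<in> T"
    obtain t where t: "1 < t" "t *\<^sub>R w \<in> T" by (rule open_contains_scaled[OF T(2) w])
    have "w \<in> quadrant" using T(1) w by (auto simp: Om_def)
    have "t * K w \<le> 1" using T(1) t K_scale[of t w] by (auto simp: Om_def)
    have "K w < 1"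
    proof (rule ccontr)
      assume "\<not> K w < 1"
      then have "t * 1 \<le> t * K w" using t(1) by (intro mult_left_mono) auto
      then show False using \<open>t * K w \<le> 1\<close> t(1) by linarith
    qed
    moreover
    have "open ((\<lambda>e. w - (e, e)) -` T)"
      using T(2) by (intro open_vimage continuous_intros)
    moreover have "0 \<in> (\<lambda>e. w - (e, e)) -` T" using w by (simp flip: zero_prod_def)
    ultimately obtain e where e: "e > 0" "ball 0 e \<subseteq> (\<lambda>e. w - (e, e)) -` T"
      by (metis openE)
    then have "w - (e/2, e/2) \<in> T" by (auto simp: subset_iff)
    then have "w - (e/2, e/2) \<in> quadrant" using T(1) by (auto simp: Om_def)
    then have "w \<in> open_quadrant" using e(1) by (auto simp: quadrant_def open_quadrant_def)
    then show "w \<in> Oi" using \<open>K w < 1\<close> by (simp add: Oi_def)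
  qed
qed

lemma k_bounds: obtains m M where "0 < m" "\<And>t. 0 \<le> t \<Longrightarrow> t \<le> 1 \<Longrightarrow> m \<le> k t \<and> k t \<le> M"
proof -
  have c: "continuous_on {0..1} k" using cont_k I01 continuous_on_subset by blast
  obtain x where x: "x \<in> {0..1}" "\<forall>y\<in>{0..1}. k y \<le> k x"
    using continuous_attains_sup[OF _ _ c] by auto
  obtain y where y: "y \<in> {0..1}" "\<forall>x\<in>{0..1}. k y \<le> k x"
    using continuous_attains_inf[OF _ _ c] by auto
  show thesis using x y k_pos01[of y] by (intro that[of "k y" "k x"]) auto
qed

lemma ball_Om: "\<exists>\<epsilon>>0. ball 0 \<epsilon> \<inter> quadrant \<subseteq> Om"
proof -
  obtain m M where mM: "0 < m" "\<And>t. 0 \<le> t \<Longrightarrow> t \<le> 1 \<Longrightarrow> m \<le> k t \<and> k t \<le> M"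
    using k_bounds by blast
  then have M: "0 < M" by force
  have "w \<in> Om" if w: "w \<in> ball 0 (1 / (2 * M)) \<inter> quadrant" for w
  proof -
    have q: "w \<in> quadrant" using w by simp
    have "\<bar>fst w\<bar> < 1 / (2 * M)" "\<bar>snd w\<bar> < 1 / (2 * M)"
      using w norm_fst_le[of "fst w" "snd w"] norm_snd_le[of "snd w" "fst w"] by auto
    then have S: "fst w + snd w \<le> 1 / M" by (simp add: field_simps abs_less_iff)
    have "K w \<le> (1 / M) * M" unfolding K_def
      using mM quadrant_pt[OF q] q S M k_pos01 by (intro mult_mono) (auto simp: less_imp_le)
    then show ?thesis using q M by (simp add: Om_def)
  qed
  then show ?thesis using M by (intro exI[of _ "1 / (2 * M)"]) auto
qed

lemma boundary_plus_Om: "boundary_plus Om = (\<lambda>t. pt (1, t)) ` {0<..<1}"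
proof -
  have "boundary_plus Om = {w \<in> open_quadrant. K w = 1}"
    unfolding boundary_plus_def frontier_def interior_Om closure_closed[OF compact_imp_closed[OF compact_Om]]
    by (auto simp: Om_def Oi_def open_quadrant_def quadrant_def)
  also have "\<dots> = (\<lambda>t. pt (1, t)) ` {0<..<1}"
  proof (intro set_eqI iffI)
    fix w assume "w \<in> {w \<in> open_quadrant. K w = 1}"
    then have w: "w \<in> quadrant" "K w = 1" "fst w > 0" "snd w > 0"
      by (auto simp: open_quadrant_def quadrant_def)
    show "w \<in> (\<lambda>t. pt (1, t)) ` {0<..<1}"
      by (rule image_eqI[where f = "\<lambda>t. pt (1, t)", OF quadrant_pt(1)[OF w(1), unfolded w(2)]])
         (use w in auto)
  next
    fix w assume "w \<in> (\<lambda>t. pt (1, t)) ` {0<..<1}"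
    then obtain t where "w = pt (1, t)" "0 < t" "t < 1" by auto
    then show "w \<in> {w \<in> open_quadrant. K w = 1}" by (simp add: K_pt pt_open_quadrant)
  qed
  finally show ?thesis .
qed

lemma closure_boundary_plus: "closure (boundary_plus Om) = (\<lambda>t. pt (1, t)) ` {0..1}"
proof
  have c: "continuous_on {0..1} (\<lambda>t. pt (1, t))"
    by (rule continuous_on_compose2[OF continuous_pt]) (auto intro!: continuous_intros)
  have "compact ((\<lambda>t. pt (1, t)) ` {0..1})"
    by (rule compact_continuous_image[OF c]) simp
  then show "closure (boundary_plus Om) \<subseteq> (\<lambda>t. pt (1, t)) ` {0..1}"
    unfolding boundary_plus_Om by (intro closure_minimal compact_imp_closed image_mono) auto
  have "(\<lambda>t. pt (1, t)) ` closure {0<..<1} \<subseteq> closure ((\<lambda>t. pt (1, t)) ` {0<..<1})"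
    by (rule image_closure_subset) (use c in \<open>auto simp: closure_subset\<close>)
  then show "(\<lambda>t. pt (1, t)) ` {0..1} \<subseteq> closure (boundary_plus Om)"
    unfolding boundary_plus_Om by simp
qed

lemma closure_Oi: "closure (interior Om) = Om"
proof
  show "closure (interior Om) \<subseteq> Om"
    using compact_imp_closed[OF compact_Om] by (simp add: closure_minimal interior_subset)
  have "pt ` closure ({0<..<1} \<times> {0<..<1}) \<subseteq> closure (pt ` ({0<..<1} \<times> {0<..<1}))"
    by (rule image_closure_subset)
       (auto simp: closure_subset closure_Times intro!: continuous_on_subset[OF continuous_pt])
  then show "Om \<subseteq> closure (interior Om)"
    unfolding interior_Om unfolding Oi_image Om_image by (simp add: closure_Times)
qed

lemma connected_Oi: "connected (interior Om)"
  unfolding interior_Om Oi_image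
  by (intro connected_continuous_image continuous_on_subset[OF continuous_pt] connected_Times) auto

end

declare split_paired_All [simp del] split_paired_Ex [simp del]

section \<open>Charts of the boundary curve; the domain is star-shaped\<close>

context toric_gauge begin

lemma smooth_K_sector:
  assumes "open U" "\<And>w. w \<in> U \<Longrightarrow> 0 < fst w + snd w \<and> snd w / (fst w + snd w) \<in> I"
  shows "smooth_on U (\<lambda>w. snd w / (fst w + snd w))" "smooth_on U K"
proof -
  show t: "smooth_on U (\<lambda>w. snd w / (fst w + snd w))"
    by (intro smooth_intros assms(1)) (use assms(2) in force)
  have "smooth_on U (\<lambda>w. k (snd w / (fst w + snd w)))"
    by (rule smooth_on_compose[OF smooth_k t assms(1)]) (use assms(2) in auto)
  then show "smooth_on U K" unfolding K_def by (intro smooth_intros assms(1))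
qed

text \<open>The chart is \<open>w\<close> mapped to \<open>(l t, K w - 1)\<close>. The affine
  involution \<open>l\<close> is \<open>t\<close> itself on a set \<open>J\<close> omitting the end
  1, and \<open>1 - t\<close> on a set omitting the end 0, so that in both cases the remaining end
  of the curve becomes the boundary point 0 of a half-line.\<close>

lemma curve_chart:
  fixes l :: "real \<Rightarrow> real"
  assumes l: "l = (\<lambda>x. \<alpha> + \<beta> * x)" "\<And>x. l (l x) = x" and J: "open J" "J \<subseteq> I"
    and half: "\<And>t. t \<in> J \<Longrightarrow> 0 \<le> l t \<longleftrightarrow> 0 \<le> t \<and> t \<le> 1"
    and t0: "t0 \<in> J" "0 \<le> t0" "t0 \<le> 1"
  shows "\<exists>U (V :: (real \<times> real) set) \<Phi> L n. pt (1, t0) \<in> U \<and> diffeomorphism U V \<Phi> \<and> subspace L \<and> dim L = 1 \<and> n \<in> L \<and>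
      \<Phi> ` ((\<lambda>t. pt (1, t)) ` {0..1} \<inter> U) = V \<inter> L \<inter> {x. 0 \<le> n \<bullet> x}"
proof -
  define S where "S = (\<lambda>w::real \<times> real. fst w + snd w)"
  define U where "U = {w. 0 < S w \<and> snd w / S w \<in> J}"
  define V where "V = {x :: real \<times> real. l (fst x) \<in> J \<and> -1 < snd x}"
  define f where "f = (\<lambda>w. (l (snd w / S w), K w - 1))"
  define g where "g = (\<lambda>x. pt (snd x + 1, l (fst x)))"
  have oU: "open U"
  proof -
    have o: "open {w. 0 < S w}" unfolding S_def by (intro open_Collect_less continuous_intros)
    have "continuous_on {w. 0 < S w} (\<lambda>w. snd w / S w)"
      unfolding S_def by (intro continuous_intros) auto
    then have "open ((\<lambda>w. snd w / S w) -` J \<inter> {w. 0 < S w})"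
      using continuous_on_open_vimage[OF o] J(1) by blast
    moreover have "(\<lambda>w. snd w / S w) -` J \<inter> {w. 0 < S w} = U" by (auto simp: U_def)
    ultimately show ?thesis by simp
  qed
  have oV: "open V"
  proof -
    have "open ((\<lambda>x::real\<times>real. l (fst x)) -` J)"
      unfolding l(1) by (intro open_vimage J(1) continuous_intros)
    moreover have "open {x::real\<times>real. -1 < snd x}" by (intro open_Collect_less continuous_intros)
    moreover have "V = (\<lambda>x. l (fst x)) -` J \<inter> {x. -1 < snd x}" by (auto simp: V_def)
    ultimately show ?thesis by auto
  qed
  have kJ: "0 < k t" if "t \<in> J" for t using that J(2) k_pos by auto
  have pS: "S (pt (s, t)) = s / k t" for s t by (simp add: S_def pt_sum)
  have ptau: "snd (pt (s, t)) / S (pt (s, t)) = t" and pK: "K (pt (s, t)) = s" if "s > 0" "t \<in> J" for s t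
  proof -
    show *: "snd (pt (s, t)) / S (pt (s, t)) = t"
      unfolding pS using that kJ[OF that(2)] by (simp add: pt_def)
    show "K (pt (s, t)) = s"
      using * kJ[OF that(2)] pt_sum[of "(s, t)"] by (simp add: K_def S_def)
  qed
  have fV: "f w \<in> V" if w: "w \<in> U" for w
    using w kJ by (auto simp: f_def U_def V_def l(2) K_def S_def)
  have gU: "g x \<in> U" if x: "x \<in> V" for x
    using x kJ ptau by (auto simp: g_def U_def V_def pS)
  have gf: "g (f w) = w" if w: "w \<in> U" for w
  proof -
    have Kw: "K w = S w * k (snd w / S w)" and S: "S w \<noteq> 0" "k (snd w / S w) \<noteq> 0"
      using w kJ[of "snd w / S w"] by (auto simp: K_def S_def U_def)
    have "fst (g (f w)) = S w - snd w" "snd (g (f w)) = snd w"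
      using S by (simp_all add: g_def f_def l(2) pt_def Kw right_diff_distrib)
    then show ?thesis by (simp add: S_def prod_eq_iff)
  qed
  have fg: "f (g x) = x" if x: "x \<in> V" for x
    using x ptau[of "snd x + 1" "l (fst x)"] pK[of "snd x + 1" "l (fst x)"]
    by (simp add: g_def f_def V_def l(2))
  have UI: "0 < fst w + snd w \<and> snd w / (fst w + snd w) \<in> I" if "w \<in> U" for w
    using that J(2) by (auto simp: U_def S_def)
  have sf: "smooth_on U f"
    unfolding f_def l(1) S_def by (intro smooth_intros smooth_K_sector[OF oU UI] oU)
  have sl: "smooth_on V (\<lambda>x. l (fst x))"
    unfolding l(1) by (intro smooth_intros oV)
  have sk: "smooth_on V (\<lambda>x. k (l (fst x)))"
    by (rule smooth_on_compose[OF smooth_k sl oV]) (use J(2) in \<open>auto simp: V_def\<close>)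
  have sg: "smooth_on V g"
    unfolding g_def pt_def fst_conv snd_conv
    by (intro smooth_intros sl sk oV) (use kJ in \<open>force simp: V_def\<close>)+
  show ?thesis
  proof (intro exI conjI)
    show "pt (1, t0) \<in> U" using ptau[OF _ t0(1), of 1] t0(1) kJ by (simp add: U_def pS)
    show "diffeomorphism U V f" by (rule diffeomorphismI[OF oU oV sf sg fV gU gf fg])
    show "subspace {x. (0, 1) \<bullet> x = (0::real)}" by (rule subspace_hyperplane)
    show "dim {x. (0::real, 1::real) \<bullet> x = 0} = 1" by (subst dim_hyperplane) (auto simp: zero_prod_def)
    show "(1, 0) \<in> {x. (0::real, 1::real) \<bullet> x = 0}" by simp
    show "f ` ((\<lambda>t. pt (1, t)) ` {0..1} \<inter> U) = V \<inter> {x. (0, 1) \<bullet> x = 0} \<inter> {x. 0 \<le> (1, 0) \<bullet> x}"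
    proof (intro set_eqI iffI)
      fix x assume "x \<in> f ` ((\<lambda>t. pt (1, t)) ` {0..1} \<inter> U)"
      then obtain t where t: "0 \<le> t" "t \<le> 1" "pt (1, t) \<in> U" "x = f (pt (1, t))" by auto
      have "0 < k t" using k_pos01 t by auto
      then have "snd (pt (1, t)) / S (pt (1, t)) = t" unfolding pS by (simp add: pt_def)
      then have "t \<in> J" using t(3) by (simp add: U_def)
      then have "x = (l t, 0)" using ptau[of 1 t] pK[of 1 t] t(4) by (simp add: f_def)
      moreover have "x \<in> V" using fV t by simp
      ultimately show "x \<in> V \<inter> {x. (0, 1) \<bullet> x = 0} \<inter> {x. 0 \<le> (1, 0) \<bullet> x}"
        using half[OF \<open>t \<in> J\<close>] t by simp
    next
      fix x assume x: "x \<in> V \<inter> {x. (0, 1) \<bullet> x = 0} \<inter> {x. 0 \<le> (1, 0) \<bullet> x}"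
      then have x': "snd x = 0" "0 \<le> fst x" "x \<in> V" by (auto simp: inner_prod_def)
      have "l (fst x) \<in> J" using x' by (simp add: V_def)
      then have "0 \<le> l (fst x)" "l (fst x) \<le> 1" using half[of "l (fst x)"] x' by (auto simp: l(2))
      moreover have "g x = pt (1, l (fst x))" using x' by (simp add: g_def)
      ultimately have "g x \<in> (\<lambda>t. pt (1, t)) ` {0..1} \<inter> U" using gU[OF x'(3)] by auto
      then show "x \<in> f ` ((\<lambda>t. pt (1, t)) ` {0..1} \<inter> U)" using fg[OF x'(3)] by (metis imageI)
    qed
  qed
qed

lemma toric_region_Om: "toric_region Om"
proof -
  have "smooth_submanifold_with_boundary 1 (closure (boundary_plus Om))"
    unfolding smooth_submanifold_with_boundary_def
  proof
    fix p assume "p \<in> closure (boundary_plus Om)"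
    then obtain t0 where t0: "0 \<le> t0" "t0 \<le> 1" and p: "p = pt (1, t0)"
      unfolding closure_boundary_plus by auto
    show "\<exists>U (V :: (real \<times> real) set) \<Phi> L n. p \<in> U \<and> diffeomorphism U V \<Phi> \<and> subspace L \<and> dim L = 1 \<and> n \<in> L \<and>
        \<Phi> ` (closure (boundary_plus Om) \<inter> U) = V \<inter> L \<inter> {x. 0 \<le> n \<bullet> x}"
    proof (cases "t0 < 1")
      case True
      show ?thesis unfolding p closure_boundary_plus
        by (rule curve_chart[of "\<lambda>x. x" 0 1 "I \<inter> {..<1}"]) (use t0 True I01 open_I in \<open>auto intro!: open_Int\<close>)
    next
      case False
      show ?thesis unfolding p closure_boundary_plus
        by (rule curve_chart[of "\<lambda>x. 1 - x" 1 "-1" "I \<inter> {0<..}"]) (use t0 False I01 open_I in \<open>auto intro!: open_Int\<close>)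
    qed
  qed
  then show ?thesis
    unfolding toric_region_def using compact_Om connected_Oi closure_Oi ball_Om
    by (auto simp: Om_def)
qed

lemma closed_X: "closed (X_toric Om)"
  unfolding X_toric_def
  by (intro closed_vimage compact_imp_closed compact_Om)
     (auto simp: moment_map_def intro!: continuous_intros)

lemma continuous_FF: "continuous_on (-{0}) FF"
  using smooth_FF smooth_on_imp_continuous by blast

text \<open>Continuity of \<open>FF\<close> comes from smoothness away from the origin; an explicit
  ball, obtained from an upper bound for \<open>k\<close>, covers the origin.\<close>

lemma open_FF_less: "open {z. FF z < 1}"
proof -
  have "open (FF -` {..<1} \<inter> -{0})"
    using continuous_on_open_vimage[of "-{0}" FF] continuous_FF by (simp add: open_Compl)
  obtain m M where mM: "0 < m" "\<And>t. 0 \<le> t \<Longrightarrow> t \<le> 1 \<Longrightarrow> m \<le> k t \<and> k t \<le> M"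
    using k_bounds by blast
  then have M: "0 < M" by force
  define e where "e = 1 / sqrt (pi * M)"
  have e: "e > 0" using M by (simp add: e_def)
  have "FF z < 1" if "z \<in> ball 0 e" for z
  proof -
    have "(norm z)\<^sup>2 < e\<^sup>2" using that by (intro power_strict_mono) auto
    also have "e\<^sup>2 = 1 / (pi * M)" using M by (simp add: e_def power_divide)
    finally have "pi * (z \<bullet> z) * M < 1" using M by (simp add: power2_norm_eq_inner field_simps)
    moreover have "FF z \<le> pi * (z \<bullet> z) * M"
      unfolding FF_def using mM(2)[OF tau_ge_0 tau_le_1, of z] by (intro mult_left_mono) auto
    ultimately show ?thesis by simp
  qed
  then have "{z. FF z < 1} = (FF -` {..<1} \<inter> -{0}) \<union> ball 0 e" using e by auto
  then show ?thesis using \<open>open (FF -` {..<1} \<inter> -{0})\<close> by (simp add: open_Un)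
qed

lemma frontier_X: "frontier (X_toric Om) = Y"
proof -
  have int: "interior (X_toric Om) = {z. FF z < 1}"
  proof (rule interior_unique)
    show "{z. FF z < 1} \<subseteq> X_toric Om" unfolding X_eq by auto
    show "open {z. FF z < 1}" by (rule open_FF_less)
    fix T assume T: "T \<subseteq> X_toric Om" "open T"
    show "T \<subseteq> {z. FF z < 1}"
    proof
      fix z assume "z \<in> T"
      obtain t where t: "1 < t" "t *\<^sub>R z \<in> T" by (rule open_contains_scaled[OF T(2) \<open>z \<in> T\<close>])
      have le: "t\<^sup>2 * FF z \<le> 1" using T(1) t FF_scale[of t z] unfolding X_eq by auto
      have t2: "1 < t\<^sup>2" using t(1) by (simp add: one_less_power)
      have "FF z < 1"
      proof (rule ccontr)
        assume "\<not> FF z < 1"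
        then have "t\<^sup>2 * 1 \<le> t\<^sup>2 * FF z" by (intro mult_left_mono) auto
        then show False using le t2 by linarith
      qed
      then show "z \<in> {z. FF z < 1}" by simp
    qed
  qed
  show ?thesis
    unfolding frontier_def closure_closed[OF closed_X] int unfolding X_eq Y_def
    by (rule set_eqI) (simp only: Diff_iff mem_Collect_eq, linarith)
qed

lemma star_shaped_X: "star_shaped (X_toric Om)"
  unfolding star_shaped_def frontier_X
proof (intro conjI ballI allI impI)
  show "smooth_submanifold 3 Y"
    using smooth_submanifold_homogeneous[OF smooth_FF FF_scale FF_pos] by (simp add: Y_def)
next
  fix y assume y: "y \<in> Y"
  show "y \<notin> tangent_space Y y"
    unfolding tangent_space_Y[OF y] using f_weighted_sum[of y] y by (auto simp: Y_def)
next
  fix u :: C2 assume "u \<noteq> 0"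
  then have F: "0 < FF u" by (rule FF_pos)
  show "\<exists>!t. 0 \<le> t \<and> t *\<^sub>R u \<in> Y"
  proof (rule ex1I)
    show "0 \<le> 1 / sqrt (FF u) \<and> (1 / sqrt (FF u)) *\<^sub>R u \<in> Y"
      using F by (simp add: Y_def FF_scale power_divide del: scaleR_Pair)
    fix t assume "0 \<le> t \<and> t *\<^sub>R u \<in> Y"
    then have "0 \<le> t" "t\<^sup>2 * FF u = 1" by (auto simp: Y_def FF_scale)
    then have "t = sqrt (1 / FF u)" using F by (intro real_sqrt_unique[symmetric]) (simp_all add: field_simps)
    then show "t = 1 / sqrt (FF u)" by (simp add: real_sqrt_divide)
  qed
qed

lemma star_shaped_toric_Om: "star_shaped_toric Om"
  by (simp add: star_shaped_toric_def toric_region_Om star_shaped_X)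

end

section \<open>Lebesgue measure and symplectic linear algebra in coordinates\<close>

text \<open>A relabelling of coordinates pulls boxes back to boxes with the same side lengths, and
  boxes determine Lebesgue measure. It carries determinant computations on \<open>real^4\<close>
  over to \<open>C2\<close> and to \<open>real \<times> R3\<close>.\<close>

lemma distr_lborel_coordinates:
  fixes f :: "real^'n \<Rightarrow> 'b::euclidean_space"
  assumes \<pi>: "bij_betw \<pi> (Basis :: 'b set) (UNIV :: 'n set)"
    and f: "\<And>v i. i \<in> Basis \<Longrightarrow> f v \<bullet> i = v $ \<pi> i" and fm: "f \<in> borel_measurable borel"
  shows "distr lborel borel f = lborel"
proof (rule lborel_eqI[symmetric])
  fix l u :: 'b
  assume lu: "\<And>b. b \<in> Basis \<Longrightarrow> l \<bullet> b \<le> u \<bullet> b"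
  define g where "g = (\<lambda>x::'b. \<chi> j. x \<bullet> inv_into Basis \<pi> j)"
  have gi: "g x $ \<pi> i = x \<bullet> i" if "i \<in> Basis" for x i
    using \<pi> that by (simp add: g_def bij_betw_def)
  have pre: "f -` box l u = box (g l) (g u)"
  proof (intro set_eqI)
    fix v
    have "v \<in> box (g l) (g u) \<longleftrightarrow> (\<forall>j. g l $ j < v $ j \<and> v $ j < g u $ j)"
      by (simp add: mem_box_cart)
    also have "\<dots> \<longleftrightarrow> (\<forall>i\<in>Basis. g l $ \<pi> i < v $ \<pi> i \<and> v $ \<pi> i < g u $ \<pi> i)"
      using \<pi> unfolding bij_betw_def by (metis UNIV_I imageE)
    also have "\<dots> \<longleftrightarrow> f v \<in> box l u"
      by (simp add: mem_box gi f)
    finally show "v \<in> f -` box l u \<longleftrightarrow> v \<in> box (g l) (g u)" by simp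
  qed
  have gle: "g l $ j \<le> g u $ j" for j
  proof -
    obtain i where "i \<in> Basis" "j = \<pi> i" using \<pi> unfolding bij_betw_def by (metis UNIV_I imageE)
    then show ?thesis using lu by (simp add: gi)
  qed
  have "emeasure (distr lborel borel f) (box l u) = emeasure lborel (box (g l) (g u))"
    using fm by (simp add: emeasure_distr pre)
  also have "\<dots> = ennreal (\<Prod>b\<in>Basis. (g u - g l) \<bullet> b)"
    by (rule emeasure_lborel_box) (auto simp: Basis_vec_def inner_axis gle)
  also have "(\<Prod>b\<in>Basis. (g u - g l) \<bullet> b) = (\<Prod>j\<in>UNIV. (g u - g l) $ j)"
  proof -
    have inj: "inj (\<lambda>j::'n. axis j (1::real))" by (auto intro!: injI simp: axis_eq_axis)
    have B: "(Basis :: (real^'n) set) = (\<lambda>j. axis j 1) ` UNIV" by (auto simp: Basis_vec_def)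
    show ?thesis unfolding B prod.reindex[OF inj] by (simp add: inner_axis)
  qed
  also have "\<dots> = (\<Prod>i\<in>Basis. (g u - g l) $ \<pi> i)"
    by (rule prod.reindex_bij_betw[OF \<pi>, symmetric])
  also have "\<dots> = (\<Prod>i\<in>Basis. (u - l) \<bullet> i)"
    by (rule prod.cong) (auto simp: gi inner_diff_left)
  finally show "emeasure (distr lborel borel f) (box l u) = (\<Prod>b\<in>Basis. (u - l) \<bullet> b)" .
qed simp

definition vec_C2 :: "real^4 \<Rightarrow> C2" where
  "vec_C2 v = (Complex (v$1) (v$2), Complex (v$3) (v$4))"

definition C2_vec :: "C2 \<Rightarrow> real^4" where
  "C2_vec z = vector [Re (fst z), Im (fst z), Re (snd z), Im (snd z)]"

definition vec_R4 :: "real^4 \<Rightarrow> real \<times> R3" where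
  "vec_R4 v = (v$1, v$2, v$3, v$4)"

lemma distr_vec_C2: "distr lborel borel vec_C2 = lborel"
proof -
  define \<pi> :: "C2 \<Rightarrow> 4" where
    "\<pi> i = (if i = (1, 0) then 1 else if i = (\<i>, 0) then 2 else if i = (0, 1) then 3 else 4)" for i
  have B: "(Basis :: C2 set) = {(1, 0), (\<i>, 0), (0, 1), (0, \<i>)}"
    by (auto simp: Basis_prod_def Basis_complex_def)
  show ?thesis
  proof (rule distr_lborel_coordinates[where \<pi> = \<pi>])
    show "bij_betw \<pi> Basis UNIV"
      unfolding B UNIV_4 bij_betw_def \<pi>_def by auto
    show "vec_C2 v \<bullet> i = v $ \<pi> i" if "i \<in> Basis" for v i
      using that unfolding B by (auto simp: vec_C2_def \<pi>_def inner_complex_def)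
    have "continuous_on UNIV vec_C2"
      unfolding vec_C2_def Complex_eq by (intro continuous_intros)
    then show "vec_C2 \<in> borel_measurable borel" by (rule borel_measurable_continuous_onI)
  qed
qed

lemma distr_vec_R4: "distr lborel borel vec_R4 = lborel"
proof -
  define \<pi> :: "real \<times> R3 \<Rightarrow> 4" where
    "\<pi> i = (if i = (1, 0) then 1 else if i = (0, 1, 0) then 2 else if i = (0, 0, 1, 0) then 3 else 4)" for i
  have B: "(Basis :: (real \<times> R3) set) = {(1, 0), (0, 1, 0), (0, 0, 1, 0), (0, 0, 0, 1)}"
    by (auto simp: Basis_prod_def)
  show ?thesis
  proof (rule distr_lborel_coordinates[where \<pi> = \<pi>])
    show "bij_betw \<pi> Basis UNIV"
      unfolding B UNIV_4 bij_betw_def \<pi>_def by (auto simp: zero_prod_def)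
    show "vec_R4 v \<bullet> i = v $ \<pi> i" if "i \<in> Basis" for v i
      using that unfolding B by (auto simp: vec_R4_def \<pi>_def zero_prod_def)
    have "continuous_on UNIV vec_R4"
      unfolding vec_R4_def by (intro continuous_intros)
    then show "vec_R4 \<in> borel_measurable borel" by (rule borel_measurable_continuous_onI)
  qed
qed

lemma vec_4 [simp]: "(vector [a,b,c,d] :: 'a::zero^4) $ 1 = a" "(vector [a,b,c,d] :: 'a::zero^4) $ 2 = b"
  "(vector [a,b,c,d] :: 'a::zero^4) $ 3 = c" "(vector [a,b,c,d] :: 'a::zero^4) $ 4 = d"
  by (simp_all add: vector_def)

lemma vec_C2_vec [simp]: "vec_C2 (C2_vec z) = z"
  by (simp add: vec_C2_def C2_vec_def prod_eq_iff complex_eq_iff)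

lemma C2_vec_vec [simp]: "C2_vec (vec_C2 v) = v"
  by (simp add: vec_C2_def C2_vec_def vec_eq_iff forall_4)

lemma det_4:
  "det (A::real^4^4) =
    A$1$1 * (A$2$2 * (A$3$3 * A$4$4 - A$3$4 * A$4$3) - A$2$3 * (A$3$2 * A$4$4 - A$3$4 * A$4$2) + A$2$4 * (A$3$2 * A$4$3 - A$3$3 * A$4$2)) -
    A$1$2 * (A$2$1 * (A$3$3 * A$4$4 - A$3$4 * A$4$3) - A$2$3 * (A$3$1 * A$4$4 - A$3$4 * A$4$1) + A$2$4 * (A$3$1 * A$4$3 - A$3$3 * A$4$1)) +
    A$1$3 * (A$2$1 * (A$3$2 * A$4$4 - A$3$4 * A$4$2) - A$2$2 * (A$3$1 * A$4$4 - A$3$4 * A$4$1) + A$2$4 * (A$3$1 * A$4$2 - A$3$2 * A$4$1)) -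
    A$1$4 * (A$2$1 * (A$3$2 * A$4$3 - A$3$3 * A$4$2) - A$2$2 * (A$3$1 * A$4$3 - A$3$3 * A$4$1) + A$2$3 * (A$3$1 * A$4$2 - A$3$2 * A$4$1))"
proof -
  have f: "finite {2::4, 3, 4}" "1 \<notin> {2::4, 3, 4}" "finite {3::4, 4}" "2 \<notin> {3::4, 4}" "finite {4::4}" "3 \<notin> {4::4}"
    by auto
  show ?thesis
    unfolding det_def UNIV_4
    unfolding sum_over_permutations_insert[OF f(1,2)]
    unfolding sum_over_permutations_insert[OF f(3,4)]
    unfolding sum_over_permutations_insert[OF f(5,6)]
    unfolding permutes_sing
    by (simp add: sign_swap_id permutation_swap_id sign_compose sign_id swap_id_eq permutation_compose algebra_simps)
qed

text \<open>The Euclidean volume form is half of \<open>omega_std \<and> omega_std\<close>.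
  Expanding it along its first argument \<open>y\<close> gives
  \<open>omega_std y a * omega_std b c\<close> and its signed permutations, and
  \<open>omega_std y\<close> is twice \<open>lambda_std y\<close>.\<close>

lemma det_C2:
  "det (matrix (\<lambda>v. C2_vec (v$1 *\<^sub>R y + v$2 *\<^sub>R a + v$3 *\<^sub>R b + v$4 *\<^sub>R c))) = 2 * lambda_wedge_dlambda y a b c"
  unfolding det_4 matrix_def lambda_wedge_dlambda_def lambda_std_def omega_std_def C2_vec_def
  by (simp add: axis_def) (simp add: algebra_simps)

lemma lambda_std_omega: "lambda_std z v = omega_std z v / 2"
  by (simp add: lambda_std_def omega_std_def algebra_simps)

lemma inner_cnj: "a \<bullet> b = Re (cnj a * b)" for a b :: complex
  by (simp add: inner_complex_def)

lemma omega_std_nondegenerate: "(\<And>w. omega_std u w = 0) \<Longrightarrow> u = 0"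
proof -
  assume *: "\<And>w. omega_std u w = 0"
  have "omega_std u (\<i> * fst u, \<i> * snd u) = u \<bullet> u"
    by (simp add: omega_std_def inner_prod_def inner_complex_def algebra_simps)
  then show "u = 0" using * by simp
qed

lemma omega_std_add_right: "omega_std u (v + w) = omega_std u v + omega_std u w"
  and omega_std_add_left: "omega_std (v + w) u = omega_std v u + omega_std w u"
  and omega_std_diff_right: "omega_std u (v - w) = omega_std u v - omega_std u w"
  and omega_std_diff_left: "omega_std (v - w) u = omega_std v u - omega_std w u"
  and omega_std_scaleR_right: "omega_std u (c *\<^sub>R v) = c * omega_std u v"
  and omega_std_scaleR_left: "omega_std (c *\<^sub>R v) u = c * omega_std v u"
  and omega_std_commute: "omega_std u v = - omega_std v u"
  and omega_std_self: "omega_std u u = 0"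
  by (simp_all add: omega_std_def algebra_simps)

text \<open>Composition with a curve in \<open>S\<close> of velocity \<open>v\<close> turns every
  derivative within \<open>S\<close> into an ordinary derivative in one variable, which is
  unique.\<close>

lemma differential_on_eq:
  assumes f: "(f has_derivative D) (at p within S)" and v: "v \<in> tangent_space S p"
  shows "differential_on S f p v = D v"
proof -
  obtain c \<epsilon> where c: "0 < \<epsilon>" "c ` {-\<epsilon><..<\<epsilon>} \<subseteq> S" "c (0::real) = p" "(c has_vector_derivative v) (at 0)"
    using v unfolding tangent_space_def by blast
  have unique: "((\<lambda>t. f (c t)) has_vector_derivative D' v) (at 0)"
    if "(f has_derivative D') (at p within S)" for D'
  proof -
    have c': "(c has_derivative (\<lambda>t. t *\<^sub>R v)) (at 0 within {-\<epsilon><..<\<epsilon>})"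
      using c(4) by (simp add: has_vector_derivative_def has_derivative_at_withinI)
    have "(f has_derivative D') (at (c 0) within c ` {-\<epsilon><..<\<epsilon>})"
      using has_derivative_subset[OF that c(2)] c(3) by simp
    from has_derivative_in_compose[OF c' this]
    have "((\<lambda>t. f (c t)) has_derivative (\<lambda>t. D' (t *\<^sub>R v))) (at 0)"
      using c(1) by (simp add: at_within_open[of 0 "{-\<epsilon><..<\<epsilon>}"])
    moreover have "D' (t *\<^sub>R v) = t *\<^sub>R D' v" for t
      using has_derivative_linear[OF that] by (simp add: linear_cmul)
    ultimately show ?thesis by (simp add: has_vector_derivative_def)
  qed
  show ?thesis
    unfolding differential_on_def
  proof (rule the_equality)
    show "\<exists>D'. (f has_derivative D') (at p within S) \<and> D' v = D v" using f by blast
    fix w assume "\<exists>D'. (f has_derivative D') (at p within S) \<and> D' v = w"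
    then show "w = D v" using unique[OF f] unique vector_derivative_unique_at by blast
  qed
qed

section \<open>The Reeb field, its flow and its periods\<close>

context toric_gauge begin

text \<open>The Hamiltonian field of \<open>FF\<close> in the sign convention that
  \<open>omega_std (R z)\<close> is minus the differential of \<open>FF\<close>; its kernel at a
  point of \<open>Y\<close> is therefore the tangent space.\<close>

definition R :: "C2 \<Rightarrow> C2" where
  "R z = (of_real (2 * pi * f1 (tau z)) * \<i> * fst z, of_real (2 * pi * f2 (tau z)) * \<i> * snd z)"

lemma omega_R: "omega_std (R z) v = - 2 * pi * (f1 (tau z) * (fst z \<bullet> fst v) + f2 (tau z) * (snd z \<bullet> snd v))"
  by (simp add: omega_std_def R_def inner_complex_def algebra_simps)

lemma tangent_space_omega: "y \<in> Y \<Longrightarrow> tangent_space Y y = {v. omega_std (R y) v = 0}"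
  by (simp add: tangent_space_Y omega_R)

lemma omega_R_self: "omega_std (R z) z = - 2 * FF z"
  using f_weighted_sum[of z] by (simp add: omega_R)

lemma lambda_R: "lambda_std z (R z) = FF z"
  using omega_R_self[of z] by (simp add: lambda_std_omega omega_std_commute[of z])

lemma R_tangent: "y \<in> Y \<Longrightarrow> R y \<in> tangent_space Y y"
  by (simp add: tangent_space_omega omega_std_self)

lemma reeb_field_Y:
  assumes y: "y \<in> Y"
  shows "reeb_field Y y = R y"
  unfolding reeb_field_def
proof (rule the_equality)
  have FF: "FF y = 1" using y by (simp add: Y_def)
  show "R y \<in> tangent_space Y y \<and> lambda_std y (R y) = 1 \<and> (\<forall>v\<in>tangent_space Y y. omega_std (R y) v = 0)"
    using y R_tangent[OF y] FF by (simp add: lambda_R tangent_space_omega)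
  fix R' assume R': "R' \<in> tangent_space Y y \<and> lambda_std y R' = 1 \<and> (\<forall>v\<in>tangent_space Y y. omega_std R' v = 0)"
  have "R' - R y = 0"
  proof (rule omega_std_nondegenerate)
    fix w
    \<comment> \<open>\<open>omega_std (R y) y = - 2\<close> on \<open>Y\<close>, so this multiple
      of the radial vector makes \<open>w\<close> tangent. The difference \<open>R' - R y\<close> is
      symplectically orthogonal to tangent vectors and to \<open>y\<close>, hence to
      everything.\<close>
    define v where "v = w + (omega_std (R y) w / 2) *\<^sub>R y"
    have "v \<in> tangent_space Y y"
      using y by (simp add: tangent_space_omega v_def omega_std_add_right omega_std_scaleR_right omega_R_self FF)
    then have "omega_std (R' - R y) v = 0"
      using R' y by (simp add: omega_std_diff_left tangent_space_omega)
    moreover have "omega_std (R' - R y) y = 0"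
      using R' lambda_R[of y] FF by (simp add: omega_std_commute[of _ y] lambda_std_omega omega_std_diff_right)
    ultimately show "omega_std (R' - R y) w = 0"
      by (simp add: v_def omega_std_add_right omega_std_scaleR_right)
  qed
  then show "R' = R y" by simp
qed

definition flow :: "real \<Rightarrow> C2 \<Rightarrow> C2" where
  "flow t z = (cis (2 * pi * f1 (tau z) * t) * fst z, cis (2 * pi * f2 (tau z) * t) * snd z)"

lemma inner_cis: "(cis a * x) \<bullet> (cis a * y) = x \<bullet> y"
proof -
  have "cnj (cis a * x) * (cis a * y) = (cnj (cis a) * cis a) * (cnj x * y)" by (simp add: mult_ac)
  also have "cnj (cis a) * cis a = 1" by (simp add: cis_cnj cis_mult)
  finally show ?thesis unfolding inner_cnj by (simp only: mult_1)
qed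

lemma tau_flow [simp]: "tau (flow t z) = tau z"
  by (simp add: tau_def flow_def inner_C2 inner_cis)

lemma FF_flow [simp]: "FF (flow t z) = FF z"
  by (simp add: FF_def) (simp add: flow_def inner_C2 inner_cis)

lemma flow_Y [simp]: "flow t y \<in> Y \<longleftrightarrow> y \<in> Y"
  by (simp add: Y_def)

lemma flow_0 [simp]: "flow 0 z = z"
  by (simp add: flow_def)

lemma cis_has_vector_derivative:
  "((\<lambda>t. cis (c * t) * x) has_vector_derivative (of_real c * \<i> * (cis (c * t) * x))) (at t)"
proof -
  have "((\<lambda>t. exp (t *\<^sub>R (\<i> * of_real c)) * x) has_vector_derivative
      (exp (t *\<^sub>R (\<i> * of_real c)) * (\<i> * of_real c) * x)) (at t)"
    by (rule has_vector_derivative_mult_left, rule exp_scaleR_has_vector_derivative_right)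
  then show ?thesis by (simp add: cis_conv_exp scaleR_conv_of_real mult_ac)
qed

lemma reeb_trajectory_flow:
  assumes "y \<in> Y"
  shows "reeb_trajectory Y (\<lambda>t. flow t y)"
proof -
  have "((\<lambda>t. flow t y) has_vector_derivative R (flow t y)) (at t)" for t
    unfolding R_def tau_flow
    unfolding flow_def fst_conv snd_conv by (intro has_vector_derivative_Pair cis_has_vector_derivative)
  then show ?thesis
    using assms unfolding reeb_trajectory_def by (auto simp: reeb_field_Y)
qed

lemma rotation_ode_unique:
  fixes x :: "real \<Rightarrow> complex"
  assumes "\<And>t. (x has_vector_derivative (of_real c * \<i> * x t)) (at t)"
  shows "x t = cis (c * t) * x 0"
proof -
  define u where "u = (\<lambda>t. cis (- c * t) * x t)"
  have u: "(u has_vector_derivative 0) (at t)" for t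
  proof -
    have "((\<lambda>t. cis (- c * t) * 1) has_vector_derivative (of_real (- c) * \<i> * (cis (- c * t) * 1))) (at t)"
      by (rule cis_has_vector_derivative)
    from has_vector_derivative_mult[OF this assms]
    show ?thesis unfolding u_def by (simp add: algebra_simps)
  qed
  have "u t = u 0"
    using has_vector_derivative_zero_constant[of UNIV u] u
    by (metis (no_types, lifting) UNIV_I convex_UNIV)
  then have "cis (c * t) * (cis (- c * t) * x t) = cis (c * t) * x 0" by (simp add: u_def)
  then show ?thesis by (simp add: cis_mult flip: mult.assoc)
qed

lemma inner_constant:
  fixes x :: "real \<Rightarrow> complex"
  assumes "\<And>t. (x has_vector_derivative (of_real (c t) * \<i> * x t)) (at t)"
  shows "x t \<bullet> x t = x 0 \<bullet> x 0"
proof -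
  have "((\<lambda>t. x t \<bullet> x t) has_vector_derivative 0) (at t)" for t
  proof -
    have "((\<lambda>t. x t \<bullet> x t) has_derivative
        (\<lambda>h. x t \<bullet> (h *\<^sub>R (of_real (c t) * \<i> * x t)) + (h *\<^sub>R (of_real (c t) * \<i> * x t)) \<bullet> x t)) (at t)"
      using assms unfolding has_vector_derivative_def by (intro has_derivative_inner) auto
    moreover have "x t \<bullet> (h *\<^sub>R (of_real (c t) * \<i> * x t)) + (h *\<^sub>R (of_real (c t) * \<i> * x t)) \<bullet> x t = 0" for h
      by (simp add: inner_complex_def algebra_simps)
    ultimately show ?thesis by (simp add: has_vector_derivative_def)
  qed
  then show ?thesis
    using has_vector_derivative_zero_constant[of UNIV "\<lambda>t. x t \<bullet> x t"]
    by (metis (no_types, lifting) UNIV_I convex_UNIV)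
qed

text \<open>Along any trajectory each coordinate is multiplied by an imaginary number, so both
  moduli and hence \<open>tau\<close> are constant. The frequencies are then constant too, and the
  system splits into two linear equations solved by rotations.\<close>

lemma reeb_trajectory_unique:
  assumes "reeb_trajectory Y \<gamma>"
  shows "\<gamma> t = flow t (\<gamma> 0)"
proof -
  have g: "(\<gamma> has_vector_derivative R (\<gamma> t)) (at t)" for t
    using assms unfolding reeb_trajectory_def by (metis reeb_field_Y)
  have g1: "((\<lambda>t. fst (\<gamma> t)) has_vector_derivative (of_real (2 * pi * f1 (tau (\<gamma> t))) * \<i> * fst (\<gamma> t))) (at t)" for t
    using bounded_linear.has_vector_derivative[OF bounded_linear_fst g] by (simp add: R_def)
  have g2: "((\<lambda>t. snd (\<gamma> t)) has_vector_derivative (of_real (2 * pi * f2 (tau (\<gamma> t))) * \<i> * snd (\<gamma> t))) (at t)" for t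
    using bounded_linear.has_vector_derivative[OF bounded_linear_snd g] by (simp add: R_def)
  have tc: "tau (\<gamma> t) = tau (\<gamma> 0)" for t
    unfolding tau_def inner_C2 using inner_constant[OF g1, of t] inner_constant[OF g2, of t] by simp
  have "fst (\<gamma> t) = cis (2 * pi * f1 (tau (\<gamma> 0)) * t) * fst (\<gamma> 0)"
    by (rule rotation_ode_unique) (use g1 tc in metis)
  moreover have "snd (\<gamma> t) = cis (2 * pi * f2 (tau (\<gamma> 0)) * t) * snd (\<gamma> 0)"
    by (rule rotation_ode_unique) (use g2 tc in metis)
  ultimately show ?thesis by (simp add: flow_def prod_eq_iff)
qed

lemma reeb_flow_Y:
  assumes "y \<in> Y"
  shows "reeb_flow Y t y = flow t y"
proof -
  have "(THE \<gamma>. reeb_trajectory Y \<gamma> \<and> \<gamma> 0 = y) = (\<lambda>t. flow t y)"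
  proof (rule the_equality)
    fix \<gamma> assume *: "reeb_trajectory Y \<gamma> \<and> \<gamma> 0 = y"
    then have "\<gamma> t = flow t y" for t using reeb_trajectory_unique[of \<gamma> t] by simp
    then show "\<gamma> = (\<lambda>t. flow t y)" by (rule ext)
  qed (simp add: reeb_trajectory_flow assms)
  then show ?thesis by (simp add: reeb_flow_def)
qed

definition "periods = {T. 0 < T \<and> (\<exists>\<gamma>. reeb_trajectory Y \<gamma> \<and> \<gamma> T = \<gamma> 0)}"

text \<open>The orbit in \<open>z_2 = 0\<close> has frequency \<open>f1 0 = k 0\<close>. It makes
  the set of periods nonempty, so that its infimum is meaningful, and bounds the minimal period from
  above for a deep notch.\<close>

lemma period_axis: "1 / k 0 \<in> periods"
proof -
  define y :: C2 where "y = (of_real (1 / sqrt (pi * k 0)), 0)"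
  have k0: "0 < k 0" using k_pos01[of 0] by simp
  have [simp]: "tau y = 0" by (simp add: tau_def y_def)
  have "fst y \<bullet> fst y = 1 / (pi * k 0)" "snd y = 0"
    using k0 by (simp_all add: y_def inner_complex_def power_divide flip: power2_eq_square)
  then have "y \<in> Y" using k0 by (simp add: Y_def FF_def inner_C2)
  moreover have "flow (1 / k 0) y = flow 0 y"
    using k0 by (simp add: flow_def y_def[symmetric] f1_def) (simp add: y_def)
  ultimately show ?thesis
    using reeb_trajectory_flow[of y] k0 unfolding periods_def mem_Collect_eq
    by (intro conjI exI[of _ "\<lambda>t. flow t y"]) simp_all
qed

lemma T_min_periods: "T_min Y = Inf periods"
  by (simp add: T_min_def periods_def)

lemma T_min_le: "T_min Y \<le> 1 / k 0"
  unfolding T_min_periods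
  by (rule cInf_lower[OF period_axis]) (auto simp: periods_def intro: bdd_belowI[of _ 0])

lemma T_min_nonneg: "0 \<le> T_min Y"
  unfolding T_min_periods
  using period_axis by (intro cInf_greatest) (blast, simp add: periods_def)

lemma cis_eq_self_imp_Ints:
  assumes "cis (2 * pi * a) * x = x" "x \<noteq> 0"
  shows "a \<in> \<int>"
proof -
  have "cis (2 * pi * a) = 1" using assms by simp
  then have "exp (\<i> * of_real (2 * pi * a)) = 1" by (simp add: cis_conv_exp)
  then obtain n :: int where "2 * pi * a = of_int (2 * n) * pi"
    unfolding exp_eq_1 by auto
  then have "a = of_int n" by (simp add: field_simps)
  then show ?thesis by simp
qed

text \<open>A period times the frequency of a nonvanishing coordinate is an integer, and it is at
  least 1 in absolute value once that frequency is nonzero. The first coordinate serves unless it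
  vanishes, where \<open>t = 1\<close>, or \<open>f1 t = 0\<close>, where \<open>0 < t\<close> keeps
  the second coordinate nonzero and \<open>f_sum\<close> gives \<open>f2 t \<noteq> 0\<close>. Hence
  the asymmetric hypotheses: \<open>f2\<close> may be huge elsewhere.\<close>

lemma T_min_ge:
  assumes C: "0 < C" "\<And>t. 0 \<le> t \<Longrightarrow> t \<le> 1 \<Longrightarrow> \<bar>f1 t\<bar> \<le> C" "\<bar>f2 1\<bar> \<le> C"
    "\<And>t. 0 \<le> t \<Longrightarrow> t \<le> 1 \<Longrightarrow> f1 t = 0 \<Longrightarrow> 0 < t \<and> \<bar>f2 t\<bar> \<le> C"
  shows "1 / C \<le> T_min Y"
  unfolding T_min_periods
proof (rule cInf_greatest)
  show "periods \<noteq> {}" using period_axis by auto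
  fix T assume "T \<in> periods"
  then obtain \<gamma> where T: "0 < T" and g: "reeb_trajectory Y \<gamma>" "\<gamma> T = \<gamma> 0" by (auto simp: periods_def)
  define y where "y = \<gamma> 0"
  have y: "y \<in> Y" using g(1) by (auto simp: reeb_trajectory_def y_def)
  have fl: "flow T y = y" using reeb_trajectory_unique[OF g(1), of T] g(2) by (simp add: y_def)
  define t where "t = tau y"
  have t: "0 \<le> t" "t \<le> 1" by (simp_all add: t_def tau_ge_0 tau_le_1)
  have i1: "fst y \<noteq> 0 \<Longrightarrow> f1 t * T \<in> \<int>" and i2: "snd y \<noteq> 0 \<Longrightarrow> f2 t * T \<in> \<int>"
    using fl cis_eq_self_imp_Ints[of "f1 t * T" "fst y"] cis_eq_self_imp_Ints[of "f2 t * T" "snd y"]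
    by (simp_all add: flow_def prod_eq_iff t_def mult_ac)
  have main: "1 / C \<le> T" if "f * T \<in> \<int>" "f \<noteq> 0" "\<bar>f\<bar> \<le> C" for f
  proof -
    have "1 \<le> \<bar>f * T\<bar>"
      using that(1,2) T Ints_nonzero_abs_ge1[of "f * T"] by simp
    also have "\<dots> \<le> C * T" using that(3) T by (simp add: abs_mult mult_right_mono)
    finally show ?thesis using C(1) by (simp add: field_simps)
  qed
  show "1 / C \<le> T"
  proof (cases "fst y = 0")
    case True
    then have "snd y \<noteq> 0" using Y_nonzero[OF y] by (auto simp: prod_eq_iff)
    then have "t = 1" using True by (simp add: t_def tau_def inner_C2)
    moreover have "f2 1 \<noteq> 0" using k_pos01[of 1] by (simp add: f2_def)
    ultimately show ?thesis using main[OF i2[OF \<open>snd y \<noteq> 0\<close>]] C(3) by simp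
  next
    case False
    show ?thesis
    proof (cases "f1 t = 0")
      case True
      then have t': "0 < t" "\<bar>f2 t\<bar> \<le> C" using C(4) t by auto
      have "f2 t \<noteq> 0" using f_sum[of t] True k_pos01[OF t] by auto
      moreover have "snd y \<noteq> 0" using t'(1) by (auto simp: t_def tau_def)
      ultimately show ?thesis using main[OF i2] t' by simp
    next
      case False
      then show ?thesis using main[OF i1[OF \<open>fst y \<noteq> 0\<close>]] C(2) t by simp
    qed
  qed
qed

definition dtau :: "C2 \<Rightarrow> C2 \<Rightarrow> real" where
  "dtau z v = (2 * (snd z \<bullet> snd v) - 2 * tau z * (z \<bullet> v)) / (z \<bullet> z)"

text \<open>A rotation composed with a shear along the invariant tori. The shear is proportional to
  \<open>dtau z v\<close>, so it vanishes on vectors tangent to the tori.\<close>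

definition Dflow :: "real \<Rightarrow> C2 \<Rightarrow> C2 \<Rightarrow> C2" where
  "Dflow t z v =
    (cis (2 * pi * f1 (tau z) * t) * (fst v + of_real (2 * pi * t * (- tau z * k2 (tau z)) * dtau z v) * \<i> * fst z),
     cis (2 * pi * f2 (tau z) * t) * (snd v + of_real (2 * pi * t * ((1 - tau z) * k2 (tau z)) * dtau z v) * \<i> * snd z))"

lemma DERIV_f1: "t \<in> I \<Longrightarrow> (f1 has_field_derivative (- t * k2 t)) (at t)"
  unfolding f1_def by (auto intro!: derivative_eq_intros DERIV_k DERIV_k1)

lemma DERIV_f2: "t \<in> I \<Longrightarrow> (f2 has_field_derivative ((1 - t) * k2 t)) (at t)"
  unfolding f2_def by (auto intro!: derivative_eq_intros DERIV_k DERIV_k1 simp: algebra_simps)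

lemma f_tau_has_derivative:
  assumes "z \<noteq> 0"
  shows "((\<lambda>z. f1 (tau z)) has_derivative (\<lambda>v. - tau z * k2 (tau z) * dtau z v)) (at z)"
    "((\<lambda>z. f2 (tau z)) has_derivative (\<lambda>v. (1 - tau z) * k2 (tau z) * dtau z v)) (at z)"
  using DERIV_compose_FDERIV[OF DERIV_f1[OF tau_I] tau_has_derivative[OF assms]]
    DERIV_compose_FDERIV[OF DERIV_f2[OF tau_I] tau_has_derivative[OF assms]]
  by (simp_all add: dtau_def mult_ac)

lemma cis_has_derivative:
  assumes f: "(f has_derivative f') (at z)"
  shows "((\<lambda>z. cis (f z)) has_derivative (\<lambda>v. of_real (f' v) * \<i> * cis (f z))) (at z)"
proof -
  have "((\<lambda>t. cis (1 * t) * 1) has_derivative (\<lambda>h. h *\<^sub>R (of_real 1 * \<i> * (cis (1 * f z) * 1)))) (at (f z))"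
    using cis_has_vector_derivative[of 1 1 "f z"] unfolding has_vector_derivative_def .
  from has_derivative_compose[OF f this] show ?thesis by (simp add: scaleR_conv_of_real mult_ac)
qed

lemma flow_has_derivative:
  assumes "z \<noteq> 0"
  shows "(flow t has_derivative Dflow t z) (at z)"
proof -
  have 1: "((\<lambda>z. 2 * pi * f1 (tau z) * t) has_derivative
      (\<lambda>v. 2 * pi * (- tau z * k2 (tau z) * dtau z v) * t)) (at z)"
    by (intro derivative_intros f_tau_has_derivative assms)
  have 2: "((\<lambda>z. 2 * pi * f2 (tau z) * t) has_derivative
      (\<lambda>v. 2 * pi * ((1 - tau z) * k2 (tau z) * dtau z v) * t)) (at z)"
    by (intro derivative_intros f_tau_has_derivative assms)
  have "((\<lambda>z. (cis (2 * pi * f1 (tau z) * t) * fst z, cis (2 * pi * f2 (tau z) * t) * snd z))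
    has_derivative Dflow t z) (at z)"
    apply (rule has_derivative_eq_rhs)
     apply (rule has_derivative_Pair)
      apply (rule has_derivative_mult[OF cis_has_derivative[OF 1] has_derivative_fst[OF has_derivative_ident]])
     apply (rule has_derivative_mult[OF cis_has_derivative[OF 2] has_derivative_snd[OF has_derivative_ident]])
    apply (simp add: Dflow_def fun_eq_iff algebra_simps)
    done
  moreover have "flow t = (\<lambda>z. (cis (2 * pi * f1 (tau z) * t) * fst z, cis (2 * pi * f2 (tau z) * t) * snd z))"
    by (simp add: flow_def fun_eq_iff)
  ultimately show ?thesis by simp
qed

lemma differential_on_reeb_flow:
  assumes y: "y \<in> Y" and v: "v \<in> tangent_space Y y"
  shows "differential_on Y (reeb_flow Y t) y v = Dflow t y v"
proof (rule differential_on_eq[OF _ v])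
  have "(flow t has_derivative Dflow t y) (at y within Y)"
    using flow_has_derivative[OF Y_nonzero[OF y]] by (rule has_derivative_at_withinI)
  then show "(reeb_flow Y t has_derivative Dflow t y) (at y within Y)"
    by (rule has_derivative_transform[rotated 2]) (use y in \<open>auto simp: reeb_flow_Y\<close>)
qed

end

section \<open>The contact measure\<close>

lemma linear_R3:
  fixes f :: "R3 \<Rightarrow> 'a::real_vector"
  assumes "linear f"
  shows "f (a, b, c) = a *\<^sub>R f (1,0,0) + b *\<^sub>R f (0,1,0) + c *\<^sub>R f (0,0,1)"
proof -
  have eq: "(a, b, c) = a *\<^sub>R (1,0,0) + b *\<^sub>R (0,1,0) + c *\<^sub>R (0,0,1::real)" by simp
  show ?thesis by (subst eq) (simp only: linear_add[OF assms] linear_cmul[OF assms])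
qed

lemma lambda_wedge_scaleR:
  "lambda_wedge_dlambda y (s *\<^sub>R a) (s *\<^sub>R b) (s *\<^sub>R c) = s ^ 3 * lambda_wedge_dlambda y a b c"
  by (simp add: lambda_wedge_dlambda_def lambda_std_omega omega_std_scaleR_left omega_std_scaleR_right
      power3_eq_cube algebra_simps)

lemma bounded_linear_C2_vec: "bounded_linear C2_vec"
proof -
  have "linear C2_vec"
    by (rule linearI) (simp_all add: C2_vec_def vec_eq_iff forall_4)
  then show ?thesis by (rule linear_conv_bounded_linear[THEN iffD1])
qed

lemma bounded_linear_vec_R4: "bounded_linear vec_R4"
proof -
  have "linear vec_R4"
    by (rule linearI) (simp_all add: vec_R4_def)
  then show ?thesis by (rule linear_conv_bounded_linear[THEN iffD1])
qed

lemma emeasure_C2_vec: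
  assumes "C \<in> sets borel"
  shows "emeasure lborel C = emeasure lborel (C2_vec ` C)" "C2_vec ` C \<in> sets borel"
proof -
  have m: "vec_C2 \<in> borel_measurable borel"
    unfolding vec_C2_def Complex_eq
    by (intro borel_measurable_continuous_onI continuous_intros)
  have eq: "C2_vec ` C = vec_C2 -` C"
  proof (intro set_eqI iffI)
    fix v assume "v \<in> vec_C2 -` C"
    then show "v \<in> C2_vec ` C" by (intro image_eqI[of v C2_vec "vec_C2 v"]) simp_all
  qed auto
  show "C2_vec ` C \<in> sets borel" unfolding eq using measurable_sets[OF m assms] by simp
  show "emeasure lborel C = emeasure lborel (C2_vec ` C)"
    unfolding eq using m assms by (subst distr_vec_C2[symmetric]) (simp add: emeasure_distr)
qed

lemma nn_integral_cube: "(\<integral>\<^sup>+s. ennreal (2 * s ^ 3) * indicator {0<..1} s \<partial>lborel) = ennreal (1/2)"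
proof -
  have "(\<integral>\<^sup>+s. ennreal (2 * s ^ 3) * indicator {0<..1} s \<partial>lborel) =
      (\<integral>\<^sup>+s. ennreal (2 * s ^ 3) * indicator {0..1} s \<partial>lborel)"
    by (intro nn_integral_cong) (auto simp: indicator_def)
  also have "\<dots> = ennreal (1 ^ 4 / 2 - 0 ^ 4 / 2)"
    by (rule nn_integral_FTC_Icc) (auto intro!: derivative_eq_intros)
  finally show ?thesis by simp
qed

lemma contact_density_nonneg: "0 \<le> contact_density \<psi> x"
  by (simp add: contact_density_def)

lemma contact_density_continuous:
  assumes "open U" "smooth_on U \<psi>"
  shows "continuous_on U (contact_density \<psi>)"
  unfolding contact_density_def lambda_wedge_dlambda_def lambda_std_def omega_std_def
  by (intro continuous_intros smooth_on_imp_continuous[OF assms(2)]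
      smooth_on_imp_continuous[OF smooth_on_frechet_derivative[OF assms(2)]])

text \<open>The cone over \<open>\<psi> ` V\<close> is the image of \<open>(0, 1] \<times> V\<close> under \<open>(s, x) \<mapsto> s \<cdot> \<psi> x\<close>, whose
  Jacobian is \<open>2 s\<^sup>3\<close> times the contact density because \<open>\<omega> \<and> \<omega> / 2\<close> is the Euclidean volume form.\<close>

lemma emeasure_cone:
  fixes \<psi> :: "R3 \<Rightarrow> C2"
  assumes U: "open U" "smooth_on U \<psi>" and V: "V \<in> sets borel" "V \<subseteq> U"
    and inj: "\<And>s x s' x'. 0 < s \<Longrightarrow> 0 < s' \<Longrightarrow> x \<in> U \<Longrightarrow> x' \<in> U \<Longrightarrow> s *\<^sub>R \<psi> x = s' *\<^sub>R \<psi> x' \<Longrightarrow> s = s' \<and> x = x'"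
    and C: "C = (\<lambda>(s, x). s *\<^sub>R \<psi> x) ` ({0<..1} \<times> V)" "C \<in> sets borel" "emeasure lborel C < \<infinity>"
  shows "2 * emeasure lborel C = (\<integral>\<^sup>+x\<in>V. ennreal (contact_density \<psi> x) \<partial>lborel)"
proof -
  define D where "D = (\<lambda>x. frechet_derivative \<psi> (at x))"
  define S where "S = vec_R4 -` ({0<..1} \<times> V)"
  define G where "G = (\<lambda>v. C2_vec (fst (vec_R4 v) *\<^sub>R \<psi> (snd (vec_R4 v))))"
  define G' where "G' = (\<lambda>v h. C2_vec (fst (vec_R4 v) *\<^sub>R D (snd (vec_R4 v)) (snd (vec_R4 h)) + fst (vec_R4 h) *\<^sub>R \<psi> (snd (vec_R4 v))))"
  have mR: "vec_R4 \<in> borel_measurable borel"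
    using bounded_linear.continuous_on[OF bounded_linear_vec_R4 continuous_on_id]
    by (simp add: borel_measurable_continuous_onI)
  have S: "S \<in> sets borel"
    unfolding S_def using measurable_sets[OF mR, of "{0<..1} \<times> V"] V(1)
    by (simp add: borel_Times)
  have der: "(G has_derivative G' v) (at v within S)" if v: "v \<in> S" for v
  proof -
    have x: "snd (vec_R4 v) \<in> U" using v V(2) by (auto simp: S_def)
    have d1: "(vec_R4 has_derivative vec_R4) (at v)"
      by (rule bounded_linear_imp_has_derivative[OF bounded_linear_vec_R4])
    have "((\<lambda>v. \<psi> (snd (vec_R4 v))) has_derivative (\<lambda>h. D (snd (vec_R4 v)) (snd (vec_R4 h)))) (at v)"
      unfolding D_def
      by (rule has_derivative_compose[OF has_derivative_snd[OF d1] smooth_on_has_derivative[OF U(2) x]])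
    from bounded_linear.has_derivative[OF bounded_linear_C2_vec has_derivative_scaleR[OF has_derivative_fst[OF d1] this]]
    show ?thesis unfolding G_def G'_def by (rule has_derivative_at_withinI)
  qed
  have det: "\<bar>det (matrix (G' v))\<bar> = 2 * (fst (vec_R4 v)) ^ 3 * contact_density \<psi> (snd (vec_R4 v))"
    if v: "v \<in> S" for v
  proof -
    define s x where "s = fst (vec_R4 v)" and "x = snd (vec_R4 v)"
    have s: "0 < s" and x: "x \<in> U" using v V(2) by (auto simp: S_def s_def x_def)
    have lin: "linear (D x)"
      unfolding D_def using smooth_on_has_derivative[OF U(2) x] has_derivative_linear by blast
    have "G' v = (\<lambda>h. C2_vec (h$1 *\<^sub>R \<psi> x + h$2 *\<^sub>R (s *\<^sub>R D x (1,0,0)) + h$3 *\<^sub>R (s *\<^sub>R D x (0,1,0)) +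
        h$4 *\<^sub>R (s *\<^sub>R D x (0,0,1))))"
    proof
      fix h
      have "D x (snd (vec_R4 h)) = h$2 *\<^sub>R D x (1,0,0) + h$3 *\<^sub>R D x (0,1,0) + h$4 *\<^sub>R D x (0,0,1)"
        unfolding vec_R4_def snd_conv by (rule linear_R3[OF lin])
      moreover have "fst (vec_R4 h) = h$1" by (simp add: vec_R4_def)
      ultimately show "G' v h = C2_vec (h$1 *\<^sub>R \<psi> x + h$2 *\<^sub>R (s *\<^sub>R D x (1,0,0)) + h$3 *\<^sub>R (s *\<^sub>R D x (0,1,0)) +
        h$4 *\<^sub>R (s *\<^sub>R D x (0,0,1)))"
        unfolding G'_def s_def[symmetric] x_def[symmetric] by (simp add: algebra_simps)
    qed
    then have "det (matrix (G' v)) = 2 * (s ^ 3 * lambda_wedge_dlambda (\<psi> x) (D x (1,0,0)) (D x (0,1,0)) (D x (0,0,1)))"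
      by (simp only: det_C2 lambda_wedge_scaleR)
    then show ?thesis
      using s unfolding contact_density_def s_def[symmetric] x_def[symmetric] D_def by (simp add: abs_mult)
  qed
  have injG: "inj_on G S"
  proof (rule inj_onI)
    fix v w assume vw: "v \<in> S" "w \<in> S" "G v = G w"
    then have "fst (vec_R4 v) *\<^sub>R \<psi> (snd (vec_R4 v)) = fst (vec_R4 w) *\<^sub>R \<psi> (snd (vec_R4 w))"
      unfolding G_def by (metis vec_C2_vec)
    then have "fst (vec_R4 v) = fst (vec_R4 w) \<and> snd (vec_R4 v) = snd (vec_R4 w)"
      using vw(1,2) V(2) by (intro inj) (auto simp: S_def)
    then show "v = w" by (simp add: vec_R4_def vec_eq_iff forall_4)
  qed
  have GS: "G ` S = C2_vec ` C"
  proof -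
    have "surj vec_R4"
      by (rule surjI[of _ "\<lambda>(s, a, b, c). vector [s, a, b, c]"]) (simp add: vec_R4_def split: prod.split)
    then have "vec_R4 ` S = {0<..1} \<times> V"
      unfolding S_def by (rule surj_image_vimage_eq)
    moreover have "G = C2_vec \<circ> (\<lambda>(s, x). s *\<^sub>R \<psi> x) \<circ> vec_R4"
      by (auto simp: G_def case_prod_beta)
    ultimately show ?thesis unfolding C(1) by (metis image_comp)
  qed
  have lm: "G ` S \<in> lmeasurable"
    unfolding GS using emeasure_C2_vec[OF C(2)] C(3)
    by (intro fmeasurableI) auto
  have "((\<lambda>v. \<bar>det (matrix (G' v))\<bar>) has_integral (measure lebesgue (G ` S))) S"
    using has_measure_differentiable_image[of S G G' "measure lebesgue (G ` S)"] S der injG lm by auto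
  then have "(\<integral>\<^sup>+v. ennreal \<bar>det (matrix (G' v))\<bar> * indicator S v \<partial>lborel) = ennreal (measure lebesgue (G ` S))"
    by (intro nn_integral_has_integral_lebesgue') auto
  also have "\<dots> = emeasure lborel C"
    unfolding GS using emeasure_C2_vec[OF C(2)] C(3) lm[unfolded GS]
    by (simp add: measure_def)
  finally have 1: "emeasure lborel C = (\<integral>\<^sup>+v. ennreal \<bar>det (matrix (G' v))\<bar> * indicator S v \<partial>lborel)" ..
  \<comment> \<open>The Jacobian splits into a function of the radius and one of the chart variable,
    so after returning to \<open>real \<times> R3\<close> Fubini leaves the constant integral of
    \<open>2 s^3\<close>.\<close>
  define h where "h = (\<lambda>(s, x). (ennreal (2 * s ^ 3) * indicator {0<..1} s) * (ennreal (contact_density \<psi> x) * indicator V x))"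
  have dm: "(\<lambda>x. ennreal (contact_density \<psi> x) * indicator V x) \<in> borel_measurable borel"
  proof -
    have "(\<lambda>x. indicator V x *\<^sub>R contact_density \<psi> x) \<in> borel_measurable borel"
      by (rule borel_measurable_continuous_on_indicator[OF V(1)])
         (rule continuous_on_subset[OF contact_density_continuous[OF U] V(2)])
    then have "(\<lambda>x. ennreal (indicator V x *\<^sub>R contact_density \<psi> x)) \<in> borel_measurable borel"
      by simp
    moreover have "(\<lambda>x. ennreal (indicator V x *\<^sub>R contact_density \<psi> x)) = (\<lambda>x. ennreal (contact_density \<psi> x) * indicator V x)"
      by (auto simp: indicator_def)
    ultimately show ?thesis by simp
  qed
  have hm: "h \<in> borel_measurable borel"
  proof -
    have "h \<in> borel_measurable (borel \<Otimes>\<^sub>M borel)"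
      unfolding h_def using dm by measurable
    then show ?thesis by (simp add: borel_prod)
  qed
  have "(\<integral>\<^sup>+v. ennreal \<bar>det (matrix (G' v))\<bar> * indicator S v \<partial>lborel) = (\<integral>\<^sup>+v. h (vec_R4 v) \<partial>lborel)"
  proof (intro nn_integral_cong)
    fix v
    show "ennreal \<bar>det (matrix (G' v))\<bar> * indicator S v = h (vec_R4 v)"
    proof (cases "v \<in> S")
      case True
      then have "0 < fst (vec_R4 v)" "fst (vec_R4 v) \<le> 1" "snd (vec_R4 v) \<in> V" by (auto simp: S_def)
      then show ?thesis using det[OF True] True
        by (simp add: h_def case_prod_beta ennreal_mult contact_density_nonneg)
    next
      case False
      then have "\<not> (fst (vec_R4 v) \<in> {0<..1} \<and> snd (vec_R4 v) \<in> V)" by (auto simp: S_def mem_Times_iff)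
      then show ?thesis using False by (auto simp: h_def case_prod_beta)
    qed
  qed
  also have "\<dots> = (\<integral>\<^sup>+p. h p \<partial>distr lborel borel vec_R4)"
    using mR hm by (simp add: nn_integral_distr)
  also have "\<dots> = (\<integral>\<^sup>+p. h p \<partial>(lborel \<Otimes>\<^sub>M lborel))"
    by (simp add: distr_vec_R4 lborel_prod)
  also have "\<dots> = (\<integral>\<^sup>+s. (\<integral>\<^sup>+x. h (s, x) \<partial>lborel) \<partial>lborel)"
    by (rule lborel.nn_integral_fst[symmetric]) (use hm in \<open>simp add: lborel_prod\<close>)
  also have "\<dots> = (\<integral>\<^sup>+s. (ennreal (2 * s ^ 3) * indicator {0<..1} s) * (\<integral>\<^sup>+x\<in>V. ennreal (contact_density \<psi> x) \<partial>lborel) \<partial>lborel)"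
    unfolding h_def prod.case using dm by (intro nn_integral_cong nn_integral_cmult) simp
  also have "\<dots> = ennreal (1/2) * (\<integral>\<^sup>+x\<in>V. ennreal (contact_density \<psi> x) \<partial>lborel)"
    by (subst nn_integral_multc) (auto simp: nn_integral_cube)
  finally have "2 * emeasure lborel C = (2 * ennreal (1/2)) * (\<integral>\<^sup>+x\<in>V. ennreal (contact_density \<psi> x) \<partial>lborel)"
    unfolding 1 by (simp add: mult.assoc)
  also have "2 * ennreal (1/2) = 1"
    using ennreal_mult[of 2 "1/2"] by simp
  finally show ?thesis by simp
qed

text \<open>One covering set is peeled off at a time, by additivity on \<open>A \<inter> S\<close>
  and \<open>A - S\<close>. This turns agreement inside charts into equality of measures.\<close>

lemma measure_eq_on_finite_cover:
  assumes "finite \<F>" "\<F> \<subseteq> sets M" "sets N = sets M"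
    and eq: "\<And>S A. S \<in> \<F> \<Longrightarrow> A \<in> sets M \<Longrightarrow> A \<subseteq> S \<Longrightarrow> emeasure M A = emeasure N A"
    and "A \<in> sets M" "A \<subseteq> \<Union>\<F>"
  shows "emeasure M A = emeasure N A"
  using assms(1,2,4-6)
proof (induction \<F> arbitrary: A rule: finite_induct)
  case empty
  then show ?case by simp
next
  case (insert S \<F>)
  have S: "S \<in> sets M" using insert.prems by simp
  have split: "A \<inter> S \<union> (A - S) = A" "(A \<inter> S) \<inter> (A - S) = {}" by blast+
  have "emeasure M A = emeasure M (A \<inter> S) + emeasure M (A - S)"
    using plus_emeasure[of "A \<inter> S" M "A - S"] S insert.prems(3) unfolding split by (simp add: sets.Int sets.Diff)
  also have "emeasure M (A \<inter> S) = emeasure N (A \<inter> S)"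
    using insert.prems(2)[of S "A \<inter> S"] insert.prems(3) S by (simp add: sets.Int)
  also have "emeasure M (A - S) = emeasure N (A - S)"
  proof (rule insert.IH)
    show "\<F> \<subseteq> sets M" "A - S \<in> sets M" "A - S \<subseteq> \<Union>\<F>"
      using insert.prems S by auto
    show "emeasure M B = emeasure N B" if "T \<in> \<F>" "B \<in> sets M" "B \<subseteq> T" for T B
      using insert.prems(2)[of T B] that by simp
  qed
  also have "emeasure N (A \<inter> S) + emeasure N (A - S) = emeasure N A"
    using plus_emeasure[of "A \<inter> S" N "A - S"] S insert.prems(3) assms(3) unfolding split by (simp add: sets.Int sets.Diff)
  finally show ?case .
qed

section \<open>The cone measure is the contact measure\<close>

context toric_gauge begin

definition B :: "C2 set" where "B = {z. z \<noteq> 0 \<and> FF z \<le> 1}"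

lemma Y_nonempty: "\<exists>y. y \<in> Y"
proof -
  have "(1 / sqrt (FF (1, 0))) *\<^sub>R (1, 0) \<in> Y"
    using FF_pos[of "(1, 0)"] by (simp add: Y_def FF_scale power_divide zero_prod_def del: scaleR_Pair)
  then show ?thesis by blast
qed

text \<open>Radial projection to \<open>Y\<close>. The origin is sent to an arbitrary point of
  \<open>Y\<close>, so that the map takes values in \<open>Y\<close> everywhere and a push-forward
  to \<open>Y\<close> makes sense.\<close>

definition proj :: "C2 \<Rightarrow> C2" where
  "proj z = (if z = 0 then SOME y. y \<in> Y else (1 / sqrt (FF z)) *\<^sub>R z)"

lemma proj_Y: "proj z \<in> Y"
proof (cases "z = 0")
  case True
  then show ?thesis using someI_ex[OF Y_nonempty] by (simp add: proj_def)
next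
  case False
  then show ?thesis using FF_pos[OF False] by (simp add: proj_def Y_def FF_scale power_divide del: scaleR_Pair)
qed

lemma closed_Y: "closed Y"
  unfolding frontier_X[symmetric] by simp

lemma borel_FF: "FF \<in> borel_measurable borel"
proof -
  have "(\<lambda>z. indicator (-{0}) z *\<^sub>R FF z) \<in> borel_measurable borel"
    by (rule borel_measurable_continuous_on_indicator) (auto intro: continuous_FF)
  moreover have "(\<lambda>z. indicator (-{0}) z *\<^sub>R FF z) = FF"
    by (rule ext) (auto simp: indicator_def)
  ultimately show ?thesis by simp
qed

lemma borel_proj: "proj \<in> borel_measurable borel"
  unfolding proj_def using borel_FF by measurable

lemma measurable_proj: "proj \<in> measurable lborel (restrict_space borel Y)"
  by (rule measurable_restrict_space2) (use borel_proj proj_Y in auto)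

lemma borel_B: "B \<in> sets borel"
proof -
  have "B = (FF -` {..1} \<inter> space borel) \<inter> -{0}" by (auto simp: B_def)
  also have "\<dots> \<in> sets borel"
    by (intro sets.Int measurable_sets[OF borel_FF]) auto
  finally show ?thesis .
qed

lemma bounded_X: "bounded {z. FF z \<le> 1}"
proof -
  obtain m M where mM: "0 < m" "\<And>t. 0 \<le> t \<Longrightarrow> t \<le> 1 \<Longrightarrow> m \<le> k t \<and> k t \<le> M"
    using k_bounds by blast
  have "norm z \<le> sqrt (1 / (pi * m))" if "FF z \<le> 1" for z
  proof -
    have "pi * (z \<bullet> z) * m \<le> FF z"
      unfolding FF_def using mM(2)[OF tau_ge_0 tau_le_1, of z] by (intro mult_left_mono) auto
    then have "(norm z)\<^sup>2 \<le> 1 / (pi * m)"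
      using that mM(1) by (simp add: power2_norm_eq_inner field_simps)
    then show ?thesis by (rule real_le_rsqrt)
  qed
  then show ?thesis unfolding bounded_iff by blast
qed

lemma emeasure_B_finite: "emeasure lborel B < \<infinity>"
proof -
  have "B \<subseteq> {z. FF z \<le> 1}" unfolding B_def by blast
  then show ?thesis using bounded_subset[OF bounded_X] emeasure_bounded_finite by blast
qed

text \<open>The measure of \<open>A\<close> is twice the volume of the cone over \<open>A\<close>;
  the factor 2 compensates for the radial integral of \<open>2 s^3\<close> over (0, 1], which is
  1/2.\<close>

definition cone_measure :: "C2 measure" where
  "cone_measure = distr (density lborel (\<lambda>z. 2 * indicator B z)) (restrict_space borel Y) proj"

lemma sets_cone_measure [simp]: "sets cone_measure = sets (restrict_space borel Y)"
  by (simp add: cone_measure_def)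

lemma emeasure_cone_measure:
  assumes "A \<in> sets (restrict_space borel Y)"
  shows "emeasure cone_measure A = 2 * emeasure lborel (proj -` A \<inter> B)"
proof -
  have pA: "proj -` A \<in> sets borel"
    using measurable_sets[OF measurable_proj assms] by simp
  have "emeasure cone_measure A = emeasure (density lborel (\<lambda>z. 2 * indicator B z)) (proj -` A)"
    unfolding cone_measure_def using measurable_proj assms by (subst emeasure_distr) auto
  also have "\<dots> = (\<integral>\<^sup>+z. 2 * indicator B z * indicator (proj -` A) z \<partial>lborel)"
    using pA borel_B by (subst emeasure_density) auto
  also have "\<dots> = (\<integral>\<^sup>+z. 2 * indicator (proj -` A \<inter> B) z \<partial>lborel)"
    by (intro nn_integral_cong) (auto simp: indicator_def)
  also have "\<dots> = 2 * emeasure lborel (proj -` A \<inter> B)"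
    using pA borel_B by (subst nn_integral_cmult_indicator) auto
  finally show ?thesis .
qed

lemma sets_Y: "A \<in> sets (restrict_space borel Y) \<longleftrightarrow> A \<in> sets borel \<and> A \<subseteq> Y"
  using closed_Y by (subst sets_restrict_space_iff) auto

lemma scale_inj_Y:
  assumes "y \<in> Y" "y' \<in> Y" "0 < s" "0 < s'" "s *\<^sub>R y = s' *\<^sub>R y'"
  shows "s = s' \<and> y = y'"
proof -
  have "s\<^sup>2 = s'\<^sup>2"
    using FF_scale[of s y] FF_scale[of s' y'] assms by (simp add: Y_def)
  then have "s = s'" using assms by simp
  then show ?thesis using assms by simp
qed

lemma cone_eq:
  assumes "A \<subseteq> Y" "A \<subseteq> \<psi> ` U"
  shows "proj -` A \<inter> B = (\<lambda>(s, x). s *\<^sub>R \<psi> x) ` ({0<..1} \<times> (U \<inter> \<psi> -` A))"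
proof (intro set_eqI iffI)
  fix z assume z: "z \<in> proj -` A \<inter> B"
  then have z0: "z \<noteq> 0" "FF z \<le> 1" "proj z \<in> A" by (auto simp: B_def)
  then obtain x where x: "x \<in> U" "proj z = \<psi> x" using assms(2) by auto
  have "z = sqrt (FF z) *\<^sub>R \<psi> x"
    using x(2) z0(1) FF_pos[OF z0(1)] by (simp add: proj_def flip: x(2))
  moreover have "sqrt (FF z) \<in> {0<..1}" using FF_pos[OF z0(1)] z0(2) by simp
  ultimately show "z \<in> (\<lambda>(s, x). s *\<^sub>R \<psi> x) ` ({0<..1} \<times> (U \<inter> \<psi> -` A))"
    using x z0(3) by (intro image_eqI[of _ _ "(sqrt (FF z), x)"]) auto
next
  fix z assume "z \<in> (\<lambda>(s, x). s *\<^sub>R \<psi> x) ` ({0<..1} \<times> (U \<inter> \<psi> -` A))"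
  then obtain s x where z: "0 < s" "s \<le> 1" "x \<in> U" "\<psi> x \<in> A" "z = s *\<^sub>R \<psi> x" by auto
  have y: "\<psi> x \<in> Y" using z assms by auto
  then have F: "FF z = s\<^sup>2" by (simp add: z(5) FF_scale Y_def)
  have "z \<noteq> 0" using z(1,5) Y_nonzero[OF y] by simp
  moreover have "proj z = \<psi> x" using \<open>z \<noteq> 0\<close> F z(1) by (simp add: proj_def) (simp add: z(5))
  moreover have "FF z \<le> 1" using F z(1,2) by (simp add: power_le_one)
  ultimately show "z \<in> proj -` A \<inter> B" using z(4) by (auto simp: B_def)
qed

lemma cone_measure_parametrization:
  assumes \<psi>: "local_parametrization Y U \<psi>" and A: "A \<in> sets (restrict_space borel Y)" "A \<subseteq> \<psi> ` U"
  shows "emeasure cone_measure A = (\<integral>\<^sup>+x\<in>U \<inter> \<psi> -` A. ennreal (contact_density \<psi> x) \<partial>lborel)"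
proof -
  have U: "open U" "smooth_on U \<psi>" "inj_on \<psi> U" and sub: "\<psi> ` U \<subseteq> Y"
    using \<psi> unfolding local_parametrization_def by (auto dest: openin_imp_subset)
  have A': "A \<in> sets borel" "A \<subseteq> Y" using A sets_Y by auto
  have V: "U \<inter> \<psi> -` A \<in> sets borel"
  proof -
    have "\<psi> \<in> borel_measurable (restrict_space borel U)"
      by (rule borel_measurable_continuous_on_restrict[OF smooth_on_imp_continuous[OF U(2)]])
    then have "\<psi> -` A \<inter> U \<in> sets (restrict_space borel U)"
      using measurable_sets[of \<psi> "restrict_space borel U" borel A] A'(1) by (simp add: space_restrict_space)
    then show ?thesis using U(1) by (simp add: sets_restrict_space_iff Int_commute)
  qed
  have "2 * emeasure lborel (proj -` A \<inter> B) = (\<integral>\<^sup>+x\<in>U \<inter> \<psi> -` A. ennreal (contact_density \<psi> x) \<partial>lborel)"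
  proof (rule emeasure_cone[OF U(1,2) V])
    show "s = s' \<and> x = x'" if "0 < s" "0 < s'" "x \<in> U" "x' \<in> U" "s *\<^sub>R \<psi> x = s' *\<^sub>R \<psi> x'" for s x s' x'
      using scale_inj_Y[of "\<psi> x" "\<psi> x'" s s'] that sub U(3) by (auto dest: inj_onD)
    show "proj -` A \<inter> B = (\<lambda>(s, x). s *\<^sub>R \<psi> x) ` ({0<..1} \<times> (U \<inter> \<psi> -` A))"
      by (rule cone_eq[OF A'(2) A(2)])
    show "proj -` A \<inter> B \<in> sets borel"
      using measurable_sets[OF measurable_proj A(1)] borel_B by auto
    show "emeasure lborel (proj -` A \<inter> B) < \<infinity>"
      by (rule le_less_trans[OF emeasure_mono emeasure_B_finite]) (use borel_B in auto)
  qed auto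
  then show ?thesis using emeasure_cone_measure[OF A(1)] by simp
qed

text \<open>The affine hyperplane at height 1 over \<open>e\<close>, identified isometrically with
  \<real>^3, is pushed radially to \<open>Y\<close>. The map is an immersion because the
  \<open>e\<close>-component of its derivative detects the change of the radial factor, after which
  only the isometry remains.\<close>

lemma half_space_parametrization:
  assumes e: "e \<bullet> e = (1::real)"
  obtains \<psi> where "local_parametrization Y UNIV \<psi>" "\<psi> ` UNIV = {y \<in> Y. 0 < y \<bullet> e}"
proof -
  have e0: "e \<noteq> 0" using e by auto
  have "dim {x::C2. e \<bullet> x = 0} = dim (UNIV :: R3 set)"
    using dim_hyperplane[OF e0] by simp
  then obtain \<iota> :: "R3 \<Rightarrow> C2" where \<iota>: "linear \<iota>" "\<iota> ` UNIV = {x. e \<bullet> x = 0}" "\<And>x. norm (\<iota> x) = norm x"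
    using isometries_subspaces[of "UNIV :: R3 set" "{x. e \<bullet> x = 0}"] subspace_hyperplane[of e]
    by (metis UNIV_I subspace_UNIV)
  have \<iota>e: "\<iota> x \<bullet> e = 0" for x using \<iota>(2) by (auto simp: inner_commute)
  have \<iota>0: "\<iota> x = 0 \<Longrightarrow> x = 0" for x using \<iota>(3)[of x] by simp
  have bl: "bounded_linear \<iota>" using \<iota>(1) by (rule linear_conv_bounded_linear[THEN iffD1])
  define q where "q = (\<lambda>x. e + \<iota> x)"
  have qe: "q x \<bullet> e = 1" for x by (simp add: q_def inner_add_left e \<iota>e)
  have q0: "q x \<noteq> 0" for x using qe[of x] by auto
  define r where "r = (\<lambda>x. 1 / sqrt (FF (q x)))"
  have r: "0 < r x" for x using FF_pos[OF q0, of x] by (simp add: r_def)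
  define \<psi> where "\<psi> = (\<lambda>x. r x *\<^sub>R q x)"
  have sq: "smooth_on UNIV q"
    unfolding q_def by (intro smooth_intros smooth_on_bounded_linear[OF bl] open_UNIV)
  have sr: "smooth_on UNIV r"
    unfolding r_def
    by (intro smooth_intros smooth_on_compose[OF smooth_FF sq] open_UNIV)
       (use q0 FF_pos[OF q0] in \<open>auto simp: less_imp_neq[THEN not_sym]\<close>)
  have s\<psi>: "smooth_on UNIV \<psi>"
    unfolding \<psi>_def by (intro smooth_intros sr sq open_UNIV)
  have \<psi>e: "\<psi> x \<bullet> e = r x" for x by (simp add: \<psi>_def qe)
  have \<psi>Y: "\<psi> x \<in> Y" for x
    using FF_pos[OF q0, of x] by (simp add: Y_def \<psi>_def FF_scale r_def power_divide)
  have inj: "inj \<psi>"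
  proof (rule injI)
    fix x y assume eq: "\<psi> x = \<psi> y"
    then have "r x = r y" using \<psi>e by metis
    then have "q x = q y" using eq r[of y] by (simp add: \<psi>_def)
    then have "\<iota> (x - y) = 0" using \<iota>(1) by (simp add: q_def linear_diff)
    then show "x = y" using \<iota>0 by fastforce
  qed
  have range: "\<psi> ` UNIV = {y \<in> Y. 0 < y \<bullet> e}"
  proof (intro set_eqI iffI)
    fix y assume "y \<in> \<psi> ` UNIV"
    then show "y \<in> {y \<in> Y. 0 < y \<bullet> e}" using \<psi>Y \<psi>e r by auto
  next
    fix y assume y: "y \<in> {y \<in> Y. 0 < y \<bullet> e}"
    define c where "c = y \<bullet> e"
    have c: "0 < c" "y \<in> Y" using y by (auto simp: c_def)
    have "e \<bullet> ((1/c) *\<^sub>R y - e) = 0" using c e by (simp add: inner_diff_right c_def inner_commute)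
    then obtain x where "\<iota> x = (1/c) *\<^sub>R y - e" using \<iota>(2) by (metis (mono_tags, lifting) imageE mem_Collect_eq)
    then have qx: "q x = (1/c) *\<^sub>R y" by (simp add: q_def)
    have "r x = c" using c by (simp add: r_def qx FF_scale Y_def power_divide real_sqrt_divide)
    then have "\<psi> x = y" using c by (simp add: \<psi>_def qx)
    then show "y \<in> \<psi> ` UNIV" by blast
  qed
  have "inj (frechet_derivative \<psi> (at x))" for x
  proof -
    define r' where "r' = frechet_derivative r (at x)"
    have dr: "(r has_derivative r') (at x)"
      unfolding r'_def using smooth_on_has_derivative[OF sr] by simp
    have dq: "(q has_derivative \<iota>) (at x)"
      unfolding q_def using bounded_linear_imp_has_derivative[OF bl, of "at x"]
      by (auto intro!: derivative_eq_intros)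
    have d: "(\<psi> has_derivative (\<lambda>v. r x *\<^sub>R \<iota> v + r' v *\<^sub>R q x)) (at x)"
      unfolding \<psi>_def by (rule has_derivative_scaleR[OF dr dq])
    then have lin: "linear (\<lambda>v. r x *\<^sub>R \<iota> v + r' v *\<^sub>R q x)" by (rule has_derivative_linear)
    have "v = 0" if v: "r x *\<^sub>R \<iota> v + r' v *\<^sub>R q x = 0" for v
    proof -
      have "(r x *\<^sub>R \<iota> v + r' v *\<^sub>R q x) \<bullet> e = 0" using v by simp
      then have "r' v = 0" by (simp add: inner_add_left \<iota>e qe)
      then have "\<iota> v = 0" using v r[of x] by simp
      then show "v = 0" by (rule \<iota>0)
    qed
    then show ?thesis
      unfolding frechet_derivative_at[OF d, symmetric] linear_injective_0[OF lin] by blast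
  qed
  moreover have "openin (top_of_set Y) (\<psi> ` UNIV)"
  proof -
    have "open {y::C2. 0 < y \<bullet> e}" by (intro open_Collect_less continuous_intros)
    moreover have "\<psi> ` UNIV = Y \<inter> {y. 0 < y \<bullet> e}" unfolding range by auto
    ultimately show ?thesis by (simp add: openin_open_Int)
  qed
  ultimately have "local_parametrization Y UNIV \<psi>"
    unfolding local_parametrization_def using s\<psi> inj by simp
  then show thesis using range that by blast
qed

text \<open>For uniqueness, some coordinate of each point of \<open>Y\<close> is nonzero, so the
  eight half-spaces belonging to the basis vectors and their negatives cover \<open>Y\<close>, and
  in each of them the prescribed density fixes the measure.\<close>

lemma contact_measure_Y: "contact_measure Y = cone_measure"
  unfolding contact_measure_def
proof (rule the_equality)
  show "sets cone_measure = sets (restrict_space borel Y) \<and>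
    (\<forall>U \<psi> A. local_parametrization Y U \<psi> \<longrightarrow> A \<in> sets cone_measure \<longrightarrow> A \<subseteq> \<psi> ` U \<longrightarrow>
        emeasure cone_measure A = (\<integral>\<^sup>+x\<in>U \<inter> \<psi> -` A. ennreal (contact_density \<psi> x) \<partial>lborel))"
    using cone_measure_parametrization by simp
next
  fix \<mu> assume \<mu>: "sets \<mu> = sets (restrict_space borel Y) \<and>
    (\<forall>U \<psi> A. local_parametrization Y U \<psi> \<longrightarrow> A \<in> sets \<mu> \<longrightarrow> A \<subseteq> \<psi> ` U \<longrightarrow>
        emeasure \<mu> A = (\<integral>\<^sup>+x\<in>U \<inter> \<psi> -` A. ennreal (contact_density \<psi> x) \<partial>lborel))"
  define E where "E = (Basis :: C2 set) \<union> uminus ` Basis"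
  define \<F> where "\<F> = (\<lambda>e. {y \<in> Y. 0 < y \<bullet> e}) ` E"
  have \<F>: "finite \<F>" "\<F> \<subseteq> sets \<mu>"
  proof -
    show "finite \<F>" unfolding \<F>_def E_def by simp
    have "{y \<in> Y. 0 < y \<bullet> e} \<in> sets (restrict_space borel Y)" for e
    proof -
      have "open {y::C2. 0 < y \<bullet> e}" by (intro open_Collect_less continuous_intros)
      then have "Y \<inter> {y. 0 < y \<bullet> e} \<in> sets borel" using closed_Y by auto
      moreover have "Y \<inter> {y. 0 < y \<bullet> e} = {y \<in> Y. 0 < y \<bullet> e}" by auto
      ultimately show ?thesis by (simp add: sets_Y)
    qed
    then show "\<F> \<subseteq> sets \<mu>" using \<mu> by (auto simp: \<F>_def)
  qed
  have cover: "Y \<subseteq> \<Union>\<F>"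
  proof
    fix y assume y: "y \<in> Y"
    then obtain b where b: "b \<in> Basis" "y \<bullet> b \<noteq> 0"
      using Y_nonzero euclidean_all_zero_iff by blast
    then have "0 < y \<bullet> b \<or> 0 < y \<bullet> (- b)" by auto
    then show "y \<in> \<Union>\<F>" using b(1) y unfolding \<F>_def E_def by blast
  qed
  have agree: "emeasure \<mu> A = emeasure cone_measure A" if S: "S \<in> \<F>" "A \<in> sets \<mu>" "A \<subseteq> S" for S A
  proof -
    obtain e where e: "e \<in> E" "S = {y \<in> Y. 0 < y \<bullet> e}" using S(1) by (auto simp: \<F>_def)
    consider b where "b \<in> Basis" "e = b" | b where "b \<in> Basis" "e = - b"
      using e(1) unfolding E_def by blast
    then have "e \<bullet> e = 1" by cases (simp_all add: inner_same_Basis del: inner_Pair)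
    then obtain \<psi> where "local_parametrization Y UNIV \<psi>" "\<psi> ` UNIV = {y \<in> Y. 0 < y \<bullet> e}"
      by (rule half_space_parametrization)
    then have \<psi>: "local_parametrization Y UNIV \<psi>" "\<psi> ` UNIV = S" by (simp_all only: e(2))
    have A: "A \<in> sets (restrict_space borel Y)" using S \<mu> by simp
    have "A \<subseteq> \<psi> ` UNIV" using \<psi>(2) S(3) by simp
    moreover from this have "emeasure \<mu> A = (\<integral>\<^sup>+x\<in>UNIV \<inter> \<psi> -` A. ennreal (contact_density \<psi> x) \<partial>lborel)"
      using conjunct2[OF \<mu>] \<psi>(1) S(2) by blast
    ultimately show ?thesis
      using cone_measure_parametrization[OF \<psi>(1) A] by simp
  qed
  show "\<mu> = cone_measure"
  proof (rule measure_eqI)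
    show "sets \<mu> = sets cone_measure" using \<mu> by simp
    fix A assume A: "A \<in> sets \<mu>"
    then have "A \<subseteq> \<Union>\<F>" using \<mu> cover sets_Y by auto
    then show "emeasure \<mu> A = emeasure cone_measure A"
      using measure_eq_on_finite_cover[OF \<F>, of cone_measure A] agree A \<mu> by simp
  qed
qed

end

text \<open>The device behind the winding number comparisons: a normalised difference of two
  continuous arguments of the same quantity is a continuous integer.\<close>

lemma Ints_valued_constant:
  fixes f :: "'a::topological_space \<Rightarrow> real"
  assumes "connected S" "continuous_on S f" "\<And>x. x \<in> S \<Longrightarrow> f x \<in> \<int>" "x \<in> S" "y \<in> S"
  shows "f x = f y"
proof -
  have "f constant_on S"
  proof (rule continuous_discrete_range_constant[OF assms(1,2)])
    fix x assume x: "x \<in> S"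
    have "1 \<le> norm (f y - f x)" if "y \<in> S" "f y \<noteq> f x" for y
      using Ints_nonzero_abs_ge1[of "f y - f x"] assms(3)[OF x] assms(3)[OF that(1)] that(2) by simp
    then show "\<exists>e>0. \<forall>y. y \<in> S \<and> f y \<noteq> f x \<longrightarrow> e \<le> norm (f y - f x)"
      by (intro exI[of _ 1]) auto
  qed
  then show ?thesis using assms(4,5) unfolding constant_on_def by metis
qed

lemma cis_eq_1_Ints: "cis (2 * pi * x) = 1 \<longleftrightarrow> x \<in> \<int>"
proof
  assume "cis (2 * pi * x) = 1"
  then have "exp (\<i> * of_real (2 * pi * x)) = 1" by (simp add: cis_conv_exp)
  then obtain n :: int where "2 * pi * x = of_int (2 * n) * pi"
    unfolding exp_eq_1 by auto
  then have "x = of_int n" by (simp add: field_simps)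
  then show "x \<in> \<int>" by simp
next
  assume "x \<in> \<int>"
  then show "cis (2 * pi * x) = 1" by (elim Ints_cases) simp
qed

section \<open>Translation numbers of paths of linear maps\<close>

text \<open>The continuous angle over which \<open>lifted_action\<close> quantifies, made explicit
  so that existence and uniqueness of its end value can be treated separately.\<close>

definition is_lift :: "(real \<Rightarrow> complex \<Rightarrow> complex) \<Rightarrow> real \<Rightarrow> real \<Rightarrow> (real \<Rightarrow> real) \<Rightarrow> bool" where
  "is_lift A T s \<theta> \<longleftrightarrow> continuous_on {0..T} \<theta> \<and> \<theta> 0 = s \<and>
        (\<forall>t\<in>{0..T}. \<exists>r>0. A t (cis (2 * pi * s)) = r *\<^sub>R cis (2 * pi * \<theta> t))"

lemma is_lift_unique:
  assumes "0 \<le> T" "is_lift A T s \<theta>" "is_lift A T s \<theta>'"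
  shows "\<theta> T = \<theta>' T"
proof -
  define d where "d = (\<lambda>t. \<theta> t - \<theta>' t)"
  have "d t \<in> \<int>" if t: "t \<in> {0..T}" for t
  proof -
    obtain r r' where r: "0 < r" "0 < r'" "r *\<^sub>R cis (2 * pi * \<theta> t) = r' *\<^sub>R cis (2 * pi * \<theta>' t)"
      using assms(2,3) t unfolding is_lift_def by metis
    then have "norm (r *\<^sub>R cis (2 * pi * \<theta> t)) = norm (r' *\<^sub>R cis (2 * pi * \<theta>' t))" by simp
    then have "r = r'" using r(1,2) by simp
    then have "cis (2 * pi * \<theta> t) = cis (2 * pi * \<theta>' t)" using r by simp
    then have "cis (2 * pi * \<theta> t - 2 * pi * \<theta>' t) = 1" by (simp flip: cis_divide)
    then show ?thesis using cis_eq_1_Ints[of "d t"] by (simp add: d_def right_diff_distrib)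
  qed
  moreover have "continuous_on {0..T} d"
    using assms(2,3) unfolding is_lift_def d_def by (intro continuous_intros) auto
  ultimately have "d T = d 0"
    using assms(1) by (intro Ints_valued_constant[of "{0..T}" d]) auto
  then show ?thesis using assms(2,3) by (simp add: d_def is_lift_def)
qed

lemma lifted_action_eq:
  assumes "0 \<le> T" "is_lift A T s \<theta>"
  shows "lifted_action A T s = \<theta> T"
  unfolding lifted_action_def
proof (rule the_equality)
  show "\<exists>\<theta>'. continuous_on {0..T} \<theta>' \<and> \<theta>' 0 = s \<and> \<theta>' T = \<theta> T \<and>
      (\<forall>t\<in>{0..T}. \<exists>r>0. A t (cis (2 * pi * s)) = r *\<^sub>R cis (2 * pi * \<theta>' t))"
    using assms(2) unfolding is_lift_def by blast
  fix x assume "\<exists>\<theta>'. continuous_on {0..T} \<theta>' \<and> \<theta>' 0 = s \<and> \<theta>' T = x \<and>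
      (\<forall>t\<in>{0..T}. \<exists>r>0. A t (cis (2 * pi * s)) = r *\<^sub>R cis (2 * pi * \<theta>' t))"
  then obtain \<theta>' where "is_lift A T s \<theta>'" "\<theta>' T = x" unfolding is_lift_def by blast
  then show "x = \<theta> T" using is_lift_unique[OF assms(1,2)] by simp
qed

text \<open>The two properties of the lifted action that make the translation number well behaved;
  they are stable under iteration.\<close>

definition half_translation :: "(real \<Rightarrow> real) \<Rightarrow> bool" where
  "half_translation F \<longleftrightarrow> (\<forall>s. F (s + 1/2) = F s + 1/2) \<and>
     (\<forall>s s'. s < s' \<longrightarrow> s' < s + 1/2 \<longrightarrow> F s < F s' \<and> F s' < F s + 1/2)"

lemma half_translation_funpow:
  assumes "half_translation F"
  shows "half_translation (F ^^ n)"
proof (induction n)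
  case 0
  then show ?case by (simp add: half_translation_def)
next
  case (Suc n)
  then show ?case using assms unfolding half_translation_def by simp
qed

lemma half_translation_int:
  assumes "half_translation F"
  shows "F (s + of_int n / 2) = F s + of_int n / 2"
proof (induction n rule: int_induct[of _ 0])
  case base
  then show ?case by simp
next
  case (step1 i)
  have "F ((s + of_int i / 2) + 1/2) = F (s + of_int i / 2) + 1/2"
    using assms unfolding half_translation_def by blast
  then show ?case using step1 by (simp add: add_divide_distrib add.assoc)
next
  case (step2 i)
  have "F ((s + of_int (i - 1) / 2) + 1/2) = F (s + of_int (i - 1) / 2) + 1/2"
    using assms unfolding half_translation_def by blast
  moreover have "(s + of_int (i - 1) / 2) + 1/2 = s + of_int i / 2" by (simp add: field_simps)
  ultimately show ?case using step2 by (simp add: field_simps)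
qed

text \<open>The displacement \<open>F s - s\<close> has period 1/2, so \<open>s'\<close> may be
  moved into the half-open interval of length 1/2 starting at \<open>s\<close>, where the order
  property confines both \<open>F\<close> and the identity to a growth in [0, 1/2).\<close>

lemma half_translation_displacement:
  assumes F: "half_translation F"
  shows "\<bar>(F s - s) - (F s' - s')\<bar> \<le> 1/2"
proof -
  define n where "n = \<lfloor>2 * (s' - s)\<rfloor>"
  define x where "x = s' - of_int n / 2"
  have "of_int n \<le> 2 * (s' - s)" "2 * (s' - s) < of_int n + 1"
    unfolding n_def using floor_correct[of "2 * (s' - s)"] by auto
  then have x: "s \<le> x" "x < s + 1/2"
    by (simp_all add: x_def field_simps)
  have "F s' - s' = F x - x"
    using half_translation_int[OF F, of x n] by (simp add: x_def)
  moreover have "\<bar>(F s - s) - (F x - x)\<bar> \<le> 1/2"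
  proof (cases "s = x")
    case False
    then have "F s < F x \<and> F x < F s + 1/2"
      using F x unfolding half_translation_def by auto
    then show ?thesis using x by linarith
  qed simp
  ultimately show ?thesis by simp
qed

text \<open>Splitting \<open>n * m\<close> into \<open>n\<close> blocks shows that
  \<open>a (n * m) / (n * m)\<close> is within \<open>c / m\<close> of \<open>a m / m\<close>.
  Exchanging \<open>n\<close> and \<open>m\<close> compares \<open>a n / n\<close> with
  \<open>a m / m\<close>, so the averages form a Cauchy sequence, and \<open>m = 1\<close> gives the
  bound on the limit.\<close>

lemma quasi_additive_limit:
  fixes a :: "nat \<Rightarrow> real"
  assumes a: "\<And>n m. \<bar>a (n + m) - a n - a m\<bar> \<le> c"
  shows "\<bar>lim (\<lambda>n. a n / real n) - a 1\<bar> \<le> c"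
proof -
  have c: "0 \<le> c" using a[of 0 0] by linarith
  have mult: "\<bar>a (Suc n * m) - real (Suc n) * a m\<bar> \<le> real (Suc n) * c" for n m
  proof (induction n)
    case 0
    then show ?case using c by simp
  next
    case (Suc n)
    have "a (Suc (Suc n) * m) = a (Suc n * m + m)" by (simp add: algebra_simps)
    moreover have "real (Suc (Suc n)) * a m = real (Suc n) * a m + a m"
      "real (Suc (Suc n)) * c = real (Suc n) * c + c" by (simp_all add: algebra_simps)
    ultimately show ?case using Suc a[of "Suc n * m" m] by linarith
  qed
  have one: "\<bar>a (n * m) / real (n * m) - a m / real m\<bar> \<le> c / real m" if "0 < n" "0 < m" for n m
  proof -
    obtain n' where n': "n = Suc n'" using \<open>0 < n\<close> gr0_implies_Suc by blast
    have "\<bar>a (n * m) - real n * a m\<bar> \<le> real n * c" using mult[of n' m] n' by simp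
    then have "\<bar>a (n * m) - real n * a m\<bar> / real (n * m) \<le> real n * c / real (n * m)"
      by (intro divide_right_mono) auto
    moreover have "a (n * m) / real (n * m) - a m / real m = (a (n * m) - real n * a m) / real (n * m)"
      using that by (simp add: field_simps)
    moreover have "real n * c / real (n * m) = c / real m" using that by simp
    ultimately show ?thesis by (simp only: abs_divide abs_of_nat)
  qed
  have two: "\<bar>a n / real n - a m / real m\<bar> \<le> c / real n + c / real m" if "0 < n" "0 < m" for n m
    using one[of n m] one[of m n] that by (simp add: mult.commute)
  have "Cauchy (\<lambda>n. a n / real n)"
  proof (rule metric_CauchyI)
    fix e :: real assume e: "0 < e"
    obtain N0 where N0: "2 * c / e < real N0" using reals_Archimedean2 by blast
    define N where "N = Suc N0"
    have N: "2 * c / e < real N" "0 < N" using N0 by (simp_all add: N_def)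
    have small: "c / real n < e / 2" if "N \<le> n" for n
    proof -
      have "2 * c / e < real n" "0 < real n" using N that by simp_all
      then show ?thesis using e by (simp add: field_simps)
    qed
    show "\<exists>M. \<forall>m\<ge>M. \<forall>n\<ge>M. dist (a m / real m) (a n / real n) < e"
    proof (intro exI allI impI)
      fix m n assume mn: "N \<le> m" "N \<le> n"
      then have "0 < m" "0 < n" using N by auto
      then show "dist (a m / real m) (a n / real n) < e"
        using two[OF \<open>0 < m\<close> \<open>0 < n\<close>] small[OF mn(1)] small[OF mn(2)] unfolding dist_real_def by linarith
    qed
  qed
  then have lim: "(\<lambda>n. a n / real n) \<longlonglongrightarrow> lim (\<lambda>n. a n / real n)"
    by (simp add: Cauchy_convergent_iff convergent_LIMSEQ_iff)
  have "\<bar>a n / real n - a 1\<bar> \<le> c" if "0 < n" for n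
    using one[of n 1] that by simp
  then have ev: "eventually (\<lambda>n. \<bar>a n / real n - a 1\<bar> \<le> c) sequentially"
    by (auto intro: eventually_sequentiallyI[of 1])
  have "(\<lambda>n. \<bar>a n / real n - a 1\<bar>) \<longlonglongrightarrow> \<bar>lim (\<lambda>n. a n / real n) - a 1\<bar>"
    by (intro tendsto_intros lim)
  then show ?thesis
    by (rule tendsto_upperbound[OF _ ev]) simp
qed

text \<open>All iterates of \<open>F\<close> have displacements oscillating by at most 1/2, so the
  orbit of 0 is quasi-additive with constant 1/2; moving the base point from 0 to \<open>s\<close>
  costs another 1/2.\<close>

lemma translation_number_displacement:
  assumes F: "half_translation F"
  shows "\<bar>translation_number F - (F s - s)\<bar> \<le> 1"
proof -
  define a where "a = (\<lambda>n. (F ^^ n) 0)"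
  have "\<bar>a (n + m) - a n - a m\<bar> \<le> 1/2" for n m
  proof -
    have "a (n + m) = (F ^^ m) (a n)" unfolding a_def by (metis add.commute comp_apply funpow_add)
    then show ?thesis
      using half_translation_displacement[OF half_translation_funpow[OF F], of m "a n" 0]
      by (simp add: a_def)
  qed
  then have "\<bar>lim (\<lambda>n. a n / real n) - a 1\<bar> \<le> 1/2" by (rule quasi_additive_limit)
  then have "\<bar>translation_number F - F 0\<bar> \<le> 1/2" by (simp add: translation_number_def a_def)
  then show ?thesis
    using half_translation_displacement[OF F, of 0 s] by linarith
qed

lemma exp_eq_norm_cis: "exp z = exp (Re z) *\<^sub>R cis (Im z)"
  by (simp add: exp_eq_polar scaleR_conv_of_real exp_of_real)

text \<open>Turns a continuous logarithm of a moving vector into an angle lift. The factor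
  \<open>c\<close> accommodates an initial vector that is not of unit length.\<close>

lemma is_lift_exp:
  assumes g: "continuous_on {0..T} g" "\<And>t. t \<in> {0..T} \<Longrightarrow> A t (cis (2 * pi * s)) = c *\<^sub>R exp (g t)"
    and c: "0 < c" and A0: "A 0 (cis (2 * pi * s)) = cis (2 * pi * s)" and T: "0 \<le> T"
  shows "is_lift A T s (\<lambda>t. s + (Im (g t) - Im (g 0)) / (2 * pi))"
  unfolding is_lift_def
proof (intro conjI ballI)
  show "continuous_on {0..T} (\<lambda>t. s + (Im (g t) - Im (g 0)) / (2 * pi))"
    by (intro continuous_intros g(1)) simp
  fix t assume t: "t \<in> {0..T}"
  have "cis (2 * pi * s) = (c * exp (Re (g 0))) *\<^sub>R cis (Im (g 0))"
    using g(2)[of 0] T A0 exp_eq_norm_cis[of "g 0"] by simp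
  moreover from this have "norm (cis (2 * pi * s)) = norm ((c * exp (Re (g 0))) *\<^sub>R cis (Im (g 0)))" by simp
  then have "c * exp (Re (g 0)) = 1" using c by simp
  ultimately have e: "cis (2 * pi * s) = cis (Im (g 0))" by simp
  have "2 * pi * (s + (Im (g t) - Im (g 0)) / (2 * pi)) = 2 * pi * s + Im (g t) - Im (g 0)"
    by (simp add: distrib_left)
  then have "cis (2 * pi * (s + (Im (g t) - Im (g 0)) / (2 * pi))) = cis (2 * pi * s) * cis (Im (g t)) / cis (Im (g 0))"
    by (simp only: cis_mult cis_divide)
  then have "cis (2 * pi * (s + (Im (g t) - Im (g 0)) / (2 * pi))) = cis (Im (g t))" using e by simp
  then show "\<exists>r>0. A t (cis (2 * pi * s)) = r *\<^sub>R cis (2 * pi * (s + (Im (g t) - Im (g 0)) / (2 * pi)))"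
    using g(2)[OF t] c exp_eq_norm_cis[of "g t"] by (intro exI[of _ "c * exp (Re (g t))"]) simp
qed simp

locale linear_path =
  fixes A :: "real \<Rightarrow> complex \<Rightarrow> complex"
  assumes lin: "\<And>t. 0 \<le> t \<Longrightarrow> linear (A t)" and inj0: "\<And>t w. 0 \<le> t \<Longrightarrow> A t w = 0 \<Longrightarrow> w = 0"
    and A0: "\<And>w. A 0 w = w" and cont: "\<And>T w. continuous_on {0..T} (\<lambda>t. A t w)"
begin

lemma ex_lift:
  assumes "0 \<le> T"
  obtains \<theta> where "is_lift A T s \<theta>"
proof -
  have "A t (cis (2 * pi * s)) \<noteq> 0" if "t \<in> {0..T}" for t
    using inj0[of t "cis (2 * pi * s)"] that by auto
  then obtain g where g: "continuous_on {0..T} g" "\<And>t. t \<in> {0..T} \<Longrightarrow> A t (cis (2 * pi * s)) = exp (g t)"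
    using continuous_logarithm_on_contractible[OF cont, of T "cis (2 * pi * s)"] convex_imp_contractible
    by (metis convex_real_interval(5))
  show thesis
    by (rule that, rule is_lift_exp[OF g(1), where c = 1]) (use g(2) A0 assms in auto)
qed

lemma lift_half:
  assumes "is_lift A T s \<theta>"
  shows "is_lift A T (s + 1/2) (\<lambda>t. \<theta> t + 1/2)"
proof -
  have c: "cis (2 * pi * (x + 1/2)) = - cis (2 * pi * x)" for x
    by (simp add: distrib_left flip: cis_mult)
  have "\<exists>r>0. A t (- cis (2 * pi * s)) = r *\<^sub>R (- cis (2 * pi * \<theta> t))" if t: "t \<in> {0..T}" for t
  proof -
    obtain r where "r > 0" "A t (cis (2 * pi * s)) = r *\<^sub>R cis (2 * pi * \<theta> t)"
      using assms t unfolding is_lift_def by blast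
    then show ?thesis using linear_neg[OF lin[of t]] t by (intro exI[of _ r]) simp
  qed
  then show ?thesis using assms unfolding is_lift_def c by (auto intro: continuous_intros)
qed

text \<open>Independent directions never become parallel under the linear isomorphisms \<open>A t\<close>, so the
  angle between them stays strictly between zero and a half turn.\<close>

lemma lift_order:
  assumes T: "0 \<le> T" and l: "is_lift A T s \<theta>" "is_lift A T s' \<theta>'" and s: "s < s'" "s' < s + 1/2"
  shows "\<theta> T < \<theta>' T \<and> \<theta>' T < \<theta> T + 1/2"
proof -
  define d where "d = (\<lambda>t. \<theta>' t - \<theta> t)"
  have cd: "continuous_on {0..T} d"
    using l unfolding is_lift_def d_def by (intro continuous_intros) auto
  have d0: "d 0 = s' - s" using l by (simp add: d_def is_lift_def)
  have not: "2 * d t \<notin> \<int>" if t: "t \<in> {0..T}" for t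
  proof
    assume "2 * d t \<in> \<int>"
    then have cc: "cis (2 * pi * (2 * d t)) = 1" by (simp only: cis_eq_1_Ints)
    define e where "e = cis (2 * pi * d t)"
    have "2 * pi * d t + 2 * pi * d t = 2 * pi * (2 * d t)" by simp
    then have "e\<^sup>2 = 1" using cc unfolding e_def power2_eq_square cis_mult by simp
    then have e: "e = 1 \<or> e = -1" by (simp add: power2_eq_1_iff)
    obtain r where r: "r > 0" "A t (cis (2 * pi * s)) = r *\<^sub>R cis (2 * pi * \<theta> t)"
      using l(1) t unfolding is_lift_def by blast
    obtain r' where r': "r' > 0" "A t (cis (2 * pi * s')) = r' *\<^sub>R cis (2 * pi * \<theta>' t)"
      using l(2) t unfolding is_lift_def by blast
    have "cis (2 * pi * \<theta>' t) = e * cis (2 * pi * \<theta> t)"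
      by (simp add: e_def d_def cis_mult algebra_simps)
    then obtain \<rho> :: real where "cis (2 * pi * \<theta>' t) = \<rho> *\<^sub>R cis (2 * pi * \<theta> t)"
      using e by (metis mult_1 mult_minus_left scaleR_minus1_left scaleR_one)
    then have "A t (cis (2 * pi * s')) = (r' * \<rho> / r) *\<^sub>R A t (cis (2 * pi * s))"
      using r r' by simp
    then have "A t (cis (2 * pi * s') - (r' * \<rho> / r) *\<^sub>R cis (2 * pi * s)) = 0"
      using lin[of t] t by (simp add: linear_diff linear_cmul)
    then have "cis (2 * pi * s') = (r' * \<rho> / r) *\<^sub>R cis (2 * pi * s)"
      using inj0[of t] t by fastforce
    then have "cis (2 * pi * s') / cis (2 * pi * s) = of_real (r' * \<rho> / r)"
      by (simp add: scaleR_conv_of_real)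
    then have "cis (2 * pi * (s' - s)) = of_real (r' * \<rho> / r)"
      by (simp add: cis_divide right_diff_distrib)
    then have "sin (2 * pi * (s' - s)) = 0" by (metis Im_complex_of_real cis.simps(2))
    moreover have "0 < sin (2 * pi * (s' - s))"
    proof (rule sin_gt_zero)
      have "pi * (2 * (s' - s)) < pi * 1" using s by (intro mult_strict_left_mono) auto
      then show "2 * pi * (s' - s) < pi" by (simp add: mult_ac)
    qed (use s in simp)
    ultimately show False by simp
  qed
  have "0 < d T"
  proof (rule ccontr)
    assume "\<not> 0 < d T"
    then obtain t where "0 \<le> t" "t \<le> T" "d t = 0"
      using IVT2'[of d T 0 0] T cd d0 s by auto
    then show False using not[of t] by simp
  qed
  moreover have "d T < 1/2"
  proof (rule ccontr)
    assume "\<not> d T < 1/2"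
    then obtain t where "0 \<le> t" "t \<le> T" "d t = 1/2"
      using IVT'[of d 0 "1/2" T] T cd d0 s by auto
    moreover from this have "2 * d t = 1" by simp
    then have "2 * d t \<in> \<int>" by (simp only: Ints_1)
    ultimately show False using not[of t] by simp
  qed
  ultimately show ?thesis by (simp add: d_def)
qed

lemma half_translation_lifted_action:
  assumes T: "0 \<le> T"
  shows "half_translation (lifted_action A T)"
  unfolding half_translation_def
proof (intro conjI allI impI)
  fix s
  obtain \<theta> where \<theta>: "is_lift A T s \<theta>" using ex_lift[OF T] .
  show "lifted_action A T (s + 1/2) = lifted_action A T s + 1/2"
    by (simp add: lifted_action_eq[OF T \<theta>] lifted_action_eq[OF T lift_half[OF \<theta>]])
next
  fix s s' :: real assume s: "s < s'" "s' < s + 1/2"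
  obtain \<theta> where \<theta>: "is_lift A T s \<theta>" using ex_lift[OF T] .
  obtain \<theta>' where \<theta>': "is_lift A T s' \<theta>'" using ex_lift[OF T] .
  show "lifted_action A T s < lifted_action A T s'" "lifted_action A T s' < lifted_action A T s + 1/2"
    using lift_order[OF T \<theta> \<theta>' s] by (simp_all add: lifted_action_eq[OF T \<theta>] lifted_action_eq[OF T \<theta>'])
qed

text \<open>The translation number differs by at most 1 from the displacement of the lift through
  any one direction, and this error disappears after division by \<open>T\<close>. It therefore
  suffices to follow a single vector whose motion is known explicitly.\<close>

lemma mean_rotation:
  assumes w: "w \<noteq> 0" and g: "continuous_on {0..} g" "\<And>t. 0 \<le> t \<Longrightarrow> A t w = exp (g t)"
    and lim: "((\<lambda>t. Im (g t) / t) \<longlongrightarrow> 2 * pi * L) at_top"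
  shows "Lim at_top (\<lambda>T. translation_number (lifted_action A T) / T) = L"
proof -
  define s where "s = Im (g 0) / (2 * pi)"
  define c where "c = 1 / norm w"
  have c: "0 < c" using w by (simp add: c_def)
  have w0: "w = exp (g 0)" using g(2)[of 0] A0[of w] by simp
  then have cw: "cis (2 * pi * s) = c *\<^sub>R w"
    using exp_eq_norm_cis[of "g 0"] by (simp add: s_def c_def)
  have bound: "\<bar>translation_number (lifted_action A T) - (Im (g T) - Im (g 0)) / (2 * pi)\<bar> \<le> 1"
    if T: "0 \<le> T" for T
  proof -
    have "is_lift A T s (\<lambda>t. s + (Im (g t) - Im (g 0)) / (2 * pi))"
    proof (rule is_lift_exp[where A = A and g = g and s = s and T = T, OF _ _ c A0 T])
      show "continuous_on {0..T} g" by (rule continuous_on_subset[OF g(1)]) auto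
      show "A t (cis (2 * pi * s)) = c *\<^sub>R exp (g t)" if "t \<in> {0..T}" for t
        using that g(2)[of t] linear_cmul[OF lin[of t]] by (simp add: cw)
    qed
    from translation_number_displacement[OF half_translation_lifted_action[OF T], of s]
    show ?thesis unfolding lifted_action_eq[OF T \<open>is_lift A T s _\<close>] by simp
  qed
  have "((\<lambda>T. (translation_number (lifted_action A T) - (Im (g T) - Im (g 0)) / (2 * pi)) / T) \<longlongrightarrow> 0) at_top"
  proof (rule Lim_null_comparison)
    show "eventually (\<lambda>T. norm ((translation_number (lifted_action A T) - (Im (g T) - Im (g 0)) / (2 * pi)) / T) \<le> 1 / T) at_top"
      using eventually_gt_at_top[of 0]
    proof eventually_elim
      case (elim T)
      then show ?case using bound[of T] by (simp add: divide_right_mono)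
    qed
    show "((\<lambda>T. 1 / T) \<longlongrightarrow> (0::real)) at_top"
      by (rule tendsto_divide_0[OF tendsto_const filterlim_at_top_imp_at_infinity[OF filterlim_ident]])
  qed
  moreover have "((\<lambda>T. Im (g T) / T / (2 * pi) - Im (g 0) / (2 * pi) / T) \<longlongrightarrow> 2 * pi * L / (2 * pi) - 0) at_top"
    by (intro tendsto_intros lim tendsto_divide_0[OF tendsto_const filterlim_at_top_imp_at_infinity[OF filterlim_ident]]) simp
  ultimately have "((\<lambda>T. (translation_number (lifted_action A T) - (Im (g T) - Im (g 0)) / (2 * pi)) / T +
     (Im (g T) / T / (2 * pi) - Im (g 0) / (2 * pi) / T)) \<longlongrightarrow> 0 + (2 * pi * L / (2 * pi) - 0)) at_top"
    by (rule tendsto_add)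
  moreover have "(translation_number (lifted_action A T) - (Im (g T) - Im (g 0)) / (2 * pi)) / T +
     (Im (g T) / T / (2 * pi) - Im (g 0) / (2 * pi) / T) = translation_number (lifted_action A T) / T" for T
    by (simp add: diff_divide_distrib mult.commute)
  ultimately have "((\<lambda>T. translation_number (lifted_action A T) / T) \<longlongrightarrow> L) at_top" by simp
  then show ?thesis by (intro tendsto_Lim) auto
qed

end

section \<open>The Ruelle invariant\<close>

lemma real_linear_complex:
  fixes L :: "complex \<Rightarrow> complex"
  assumes "linear L"
  shows "L c = (L 1 - \<i> * L \<i>) / 2 * c + (L 1 + \<i> * L \<i>) / 2 * cnj c"
proof -
  have "c = Re c *\<^sub>R 1 + Im c *\<^sub>R \<i>" by (simp add: complex_eq_iff)
  then have "L c = Re c *\<^sub>R L 1 + Im c *\<^sub>R L \<i>"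
    using assms by (metis linear_add linear_cmul)
  then show ?thesis by (simp add: complex_eq_iff field_simps)
qed

text \<open>An orientation-preserving linear map of the plane is \<open>c \<mapsto> P c + Q cnj c\<close> with
  \<open>\<bar>Q\<bar> < \<bar>P\<bar>\<close>, so the unit circle is mapped to a loop of winding number one.\<close>

lemma winding_linear:
  fixes g :: "real \<Rightarrow> complex"
  assumes L: "linear L" "0 < Im (cnj (L 1) * L \<i>)"
    and g: "continuous_on UNIV g" "\<And>\<theta>. exp (g \<theta>) = L (cis \<theta>)"
  shows "Im (g (2 * pi)) - Im (g 0) = 2 * pi"
proof -
  define P Q where "P = (L 1 - \<i> * L \<i>) / 2" and "Q = (L 1 + \<i> * L \<i>) / 2"
  have "(cmod P)\<^sup>2 - (cmod Q)\<^sup>2 = Im (cnj (L 1) * L \<i>)"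
    unfolding P_def Q_def cmod_power2 by (simp add: power2_eq_square field_simps)
  then have "(cmod Q)\<^sup>2 < (cmod P)\<^sup>2" using L(2) by linarith
  then have PQ: "cmod Q < cmod P" by (rule power_less_imp_less_base) simp
  have P0: "P \<noteq> 0"
  proof
    assume "P = 0"
    then have "cmod P = 0" by simp
    then show False using PQ norm_ge_zero[of Q] by linarith
  qed
  \<comment> \<open>\<open>u \<theta>\<close> is the quotient of \<open>L (cis \<theta>)\<close> by
    \<open>P * cis \<theta>\<close>. As the squared moduli of \<open>P\<close> and \<open>Q\<close>
    differ by the determinant of \<open>L\<close>, it stays in the right half-plane, where the
    principal logarithm is continuous and contributes no winding.\<close>
  define u where "u = (\<lambda>\<theta>. 1 + Q / P * cis (- 2 * \<theta>))"
  have uRe: "0 < Re (u \<theta>)" for \<theta>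
  proof -
    have "cmod (Q / P * cis (- 2 * \<theta>)) = cmod Q / cmod P" by (simp add: norm_mult norm_divide)
    also have "\<dots> < 1" using PQ norm_ge_zero[of Q] by (subst divide_less_eq_1_pos) linarith+
    finally have "cmod (Q / P * cis (- 2 * \<theta>)) < 1" .
    then have "\<bar>Re (Q / P * cis (- 2 * \<theta>))\<bar> < 1" using abs_Re_le_cmod le_less_trans by blast
    then show ?thesis by (simp add: u_def del: times_complex.simps)
  qed
  define h where "h = (\<lambda>\<theta>. \<i> * of_real \<theta> + Ln (u \<theta>) + Ln P)"
  have cu: "continuous_on UNIV u"
    unfolding u_def cis_conv_exp by (intro continuous_intros P0)
  have "u \<theta> \<notin> \<real>\<^sub>\<le>\<^sub>0" for \<theta>
    using uRe[of \<theta>] by (simp add: complex_nonpos_Reals_iff)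
  then have ch: "continuous_on UNIV h"
    unfolding h_def by (intro continuous_intros cu) simp_all
  have eh: "exp (h \<theta>) = L (cis \<theta>)" for \<theta>
  proof -
    have "u \<theta> \<noteq> 0" using uRe[of \<theta>] by auto
    then have "exp (h \<theta>) = cis \<theta> * u \<theta> * P" using P0 by (simp add: h_def exp_add cis_conv_exp)
    also have "\<dots> = P * cis \<theta> + Q * (cis \<theta> * cis (- 2 * \<theta>))"
      using P0 by (simp add: u_def field_simps)
    also have "cis \<theta> * cis (- 2 * \<theta>) = cnj (cis \<theta>)" by (simp add: cis_mult cis_cnj)
    finally show ?thesis using real_linear_complex[OF L(1), of "cis \<theta>"] by (simp add: P_def Q_def)
  qed
  define d where "d = (\<lambda>\<theta>. Im (g \<theta> - h \<theta>) / (2 * pi))"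
  have "d \<theta> \<in> \<int>" for \<theta>
  proof -
    have "exp (g \<theta>) = exp (h \<theta>)" using g(2) eh by simp
    then obtain n :: int where "g \<theta> = h \<theta> + (of_int (2 * n) * pi) * \<i>" unfolding exp_eq by blast
    then have "d \<theta> = of_int n" by (simp add: d_def)
    then show ?thesis by simp
  qed
  moreover have "continuous_on UNIV d" unfolding d_def by (intro continuous_intros g(1) ch) simp
  ultimately have "d (2 * pi) = d 0" by (intro Ints_valued_constant[of UNIV d]) auto
  then have "Im (g (2 * pi)) - Im (g 0) = Im (h (2 * pi)) - Im (h 0)"
    by (simp add: d_def)
  moreover have "u (2 * pi) = u 0"
  proof -
    have "cis (- 2 * (2 * pi)) = cis (2 * pi * (-2))" by (simp add: mult_ac)
    also have "\<dots> = 1" unfolding cis_eq_1_Ints by simp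
    finally show ?thesis by (simp add: u_def)
  qed
  ultimately show ?thesis by (simp add: h_def)
qed

text \<open>Used for the deviation of an argument on the torus from its linear part, which must
  remain bounded along an infinite trajectory.\<close>

lemma doubly_periodic_bounded:
  fixes b :: "real \<times> real \<Rightarrow> real"
  assumes c: "continuous_on UNIV b" and p: "0 < p"
    "\<And>x y. b (x + p, y) = b (x, y)" "\<And>x y. b (x, y + p) = b (x, y)"
  obtains M where "\<And>x. \<bar>b x\<bar> \<le> M"
proof -
  have p1: "b (x + of_int n * p, y) = b (x, y)" for x y n
  proof (induction n rule: int_induct[of _ 0])
    case (step1 i)
    then show ?case using p(2)[of "x + of_int i * p" y] by (simp add: algebra_simps)
  next
    case (step2 i)
    then show ?case using p(2)[of "x + of_int (i - 1) * p" y] by (simp add: algebra_simps)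
  qed simp
  have p2: "b (x, y + of_int n * p) = b (x, y)" for x y n
  proof (induction n rule: int_induct[of _ 0])
    case (step1 i)
    then show ?case using p(3)[of x "y + of_int i * p"] by (simp add: algebra_simps)
  next
    case (step2 i)
    then show ?case using p(3)[of x "y + of_int (i - 1) * p"] by (simp add: algebra_simps)
  qed simp
  have "compact (b ` ({0..p} \<times> {0..p}))"
    by (intro compact_continuous_image continuous_on_subset[OF c] compact_Times) auto
  from compact_imp_bounded[OF this] obtain M where "\<forall>v\<in>b ` ({0..p} \<times> {0..p}). norm v \<le> M"
    unfolding bounded_iff by blast
  then have M: "\<bar>b x\<bar> \<le> M" if "x \<in> {0..p} \<times> {0..p}" for x
    using that by fastforce
  have red: "\<exists>n::int. x - of_int n * p \<in> {0..p}" for x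
  proof (intro exI)
    show "x - of_int \<lfloor>x / p\<rfloor> * p \<in> {0..p}"
      using floor_divide_lower[OF p(1), of x] floor_divide_upper[OF p(1), of x] by (simp add: algebra_simps)
  qed
  show thesis
  proof (rule that)
    fix z :: "real \<times> real"
    obtain x y where z: "z = (x, y)" by (cases z)
    obtain n m :: int where nm: "x - of_int n * p \<in> {0..p}" "y - of_int m * p \<in> {0..p}" using red by blast
    have "b (x, y) = b (x - of_int n * p, y - of_int m * p)"
      using p1[of "x - of_int n * p" n y] p2[of "x - of_int n * p" "y - of_int m * p" m] by simp
    then show "\<bar>b z\<bar> \<le> M" using M nm z by simp
  qed
qed

section \<open>A global trivialization, the invariant tori and the mean rotation\<close>

context toric_gauge begin

lemma contact_plane_Y:
  "y \<in> Y \<Longrightarrow> contact_plane Y y = {v. omega_std (R y) v = 0 \<and> omega_std y v = 0}"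
  by (auto simp: contact_plane_def tangent_space_omega lambda_std_omega)

text \<open>The complex determinant of \<open>y\<close> and \<open>v\<close>, that is, the Hermitian
  pairing of \<open>v\<close> with \<open>(- cnj (snd y), cnj (fst y))\<close>, a vector orthogonal
  to the complex line of \<open>y\<close>. It projects the contact plane isomorphically along that
  line.\<close>

definition \<tau>0 :: "C2 \<Rightarrow> C2 \<Rightarrow> complex" where
  "\<tau>0 y v = (fst y * snd v - snd y * fst v) / of_real (norm y)"

text \<open>Imaginary part of the Hermitian Gram identity in \<complex>^2. For \<open>u\<close> and
  \<open>v\<close> in the contact plane the two correction terms vanish, since
  \<open>omega_std y\<close> is zero there.\<close>

lemma hermitian_decomposition:
  "Im (cnj (fst y * snd u - snd y * fst u) * (fst y * snd v - snd y * fst v)) =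
    (y \<bullet> y) * omega_std u v - (y \<bullet> u) * omega_std y v + omega_std y u * (y \<bullet> v)"
  by (simp add: omega_std_def inner_C2 inner_complex_def algebra_simps)

lemma hermitian_decomposition_Re:
  "(cmod (fst y * snd u - snd y * fst u))\<^sup>2 =
    (y \<bullet> y) * (u \<bullet> u) - (y \<bullet> u)\<^sup>2 - (omega_std y u)\<^sup>2"
  unfolding cmod_power2
  by (simp add: omega_std_def inner_C2 inner_complex_def power2_eq_square algebra_simps)

lemma symplectic_trivialization_\<tau>0: "symplectic_trivialization Y \<tau>0"
  unfolding symplectic_trivialization_def
proof (intro conjI ballI)
  fix y assume y: "y \<in> Y"
  have y0: "y \<noteq> 0" using Y_nonzero[OF y] .
  have FFy: "FF y = 1" using y by (simp add: Y_def)
  show lin: "linear (\<tau>0 y)"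
    by (rule linearI) (use y0 in \<open>simp_all add: \<tau>0_def scaleR_conv_of_real field_simps\<close>)
  show "bij_betw (\<tau>0 y) (contact_plane Y y) UNIV"
    unfolding bij_betw_def
  proof
    show "inj_on (\<tau>0 y) (contact_plane Y y)"
    proof (rule inj_onI)
      fix v w assume vw: "v \<in> contact_plane Y y" "w \<in> contact_plane Y y" "\<tau>0 y v = \<tau>0 y w"
      define u where "u = v - w"
      have u: "omega_std (R y) u = 0" "omega_std y u = 0"
        using vw contact_plane_Y[OF y] by (auto simp: u_def omega_std_diff_right)
      have "\<tau>0 y u = 0" using vw(3) lin by (simp add: u_def linear_diff)
      then have q: "fst y * snd u - snd y * fst u = 0" using y0 by (simp add: \<tau>0_def)
      \<comment> \<open>Without its radial part, \<open>u\<close> is orthogonal to the complex line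
        of \<open>y\<close> and has zero determinant with \<open>y\<close>, so it vanishes. Thus
        \<open>u\<close> is radial, and a nonzero radial vector is not tangent.\<close>
      define c where "c = (y \<bullet> u) / (y \<bullet> y)"
      define u' where "u' = u - c *\<^sub>R y"
      have q': "fst y * snd u' - snd y * fst u' = 0" using q by (simp add: u'_def algebra_simps)
      have "y \<bullet> u' = 0" using y0 by (simp add: u'_def c_def inner_diff_right)
      moreover have "omega_std y u' = 0" using u(2) by (simp add: u'_def omega_std_diff_right omega_std_scaleR_right omega_std_self)
      ultimately have "(y \<bullet> y) * (u' \<bullet> u') = 0"
        using hermitian_decomposition_Re[of y u'] q' by simp
      then have "u' = 0" using y0 by simp
      then have uc: "u = c *\<^sub>R y" by (simp add: u'_def)
      then have "c = 0" using u(1) y by (simp add: omega_std_scaleR_right omega_R_self Y_def)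
      then show "v = w" using uc by (simp add: u_def)
    qed
    show "\<tau>0 y ` contact_plane Y y = UNIV"
    proof (intro set_eqI iffI UNIV_I)
      fix w :: complex
      define w' where "w' = w / of_real (norm y)"
      \<comment> \<open>The preimage of \<open>w\<close> orthogonal to the complex line of
        \<open>y\<close>. Adding a multiple of \<open>y\<close> makes it tangent and alters neither
        its determinant with \<open>y\<close> nor its pairing \<open>omega_std y\<close>.\<close>
      define j where "j = (- cnj (snd y) * w', cnj (fst y) * w')"
      define v where "v = (omega_std (R y) j / 2) *\<^sub>R y + j"
      have "omega_std y j = 0" by (simp add: j_def omega_std_def algebra_simps)
      then have "v \<in> contact_plane Y y"
        using FFy by (simp add: contact_plane_Y[OF y] v_def omega_std_add_right omega_std_scaleR_right omega_std_self omega_R_self)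
      moreover have "\<tau>0 y v = w"
      proof -
        have "fst y * snd v - snd y * fst v = (fst y * cnj (fst y) + snd y * cnj (snd y)) * w'"
          by (simp add: v_def j_def algebra_simps)
        also have "fst y * cnj (fst y) + snd y * cnj (snd y) = of_real ((norm y)\<^sup>2)"
          by (simp only: complex_norm_square[symmetric]) (simp add: norm_prod_def)
        finally show ?thesis using y0 by (simp add: \<tau>0_def w'_def power2_eq_square)
      qed
      ultimately show "w \<in> \<tau>0 y ` contact_plane Y y" by blast
    qed
  qed
  fix u v assume uv: "u \<in> contact_plane Y y" "v \<in> contact_plane Y y"
  then have "omega_std y u = 0" "omega_std y v = 0" using contact_plane_Y[OF y] by auto
  then have "Im (cnj (fst y * snd u - snd y * fst u) * (fst y * snd v - snd y * fst v)) = (y \<bullet> y) * omega_std u v"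
    using hermitian_decomposition[of y u v] by simp
  moreover have "cnj (\<tau>0 y u) * \<tau>0 y v =
      (cnj (fst y * snd u - snd y * fst u) * (fst y * snd v - snd y * fst v)) / of_real (y \<bullet> y)"
    by (simp add: \<tau>0_def power2_eq_square dot_square_norm)
  ultimately show "Im (cnj (\<tau>0 y u) * \<tau>0 y v) = omega_std u v"
    using y0 by (simp only: Im_divide_of_real) simp
next
  show "continuous_on (Sigma Y (contact_plane Y)) (\<lambda>(y, v). \<tau>0 y v)"
    unfolding \<tau>0_def case_prod_beta
    by (intro continuous_intros) (use Y_nonzero in auto)
qed

definition rad1 :: "real \<Rightarrow> real" where "rad1 q = sqrt ((1 - q) / (pi * k q))"
definition rad2 :: "real \<Rightarrow> real" where "rad2 q = sqrt (q / (pi * k q))"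

definition torus :: "real \<times> real \<times> real \<Rightarrow> C2" where
  "torus p = (of_real (rad1 (fst p)) * cis (fst (snd p)), of_real (rad2 (fst p)) * cis (snd (snd p)))"

text \<open>A section of the contact structure that is tangent to the invariant tori and therefore
  preserved by the Reeb flow; it is normalised so that it does not vanish on the two exceptional orbits.\<close>

definition torus_section :: "real \<times> real \<times> real \<Rightarrow> C2" where
  "torus_section p = (\<i> * of_real (rad2 (fst p)) * cis (fst (snd p)), - \<i> * of_real (rad1 (fst p)) * cis (snd (snd p)))"

lemma inner_real_cis: "(of_real a * cis x) \<bullet> (of_real b * cis x) = a * b"
proof -
  have "(cis x * of_real a) \<bullet> (cis x * of_real b) = a * b"
    unfolding inner_cis by (simp add: inner_complex_def)
  then show ?thesis by (simp only: mult.commute)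
qed

lemma torus_Y:
  assumes "0 \<le> q" "q \<le> 1"
  shows "torus (q, a) \<in> Y" "tau (torus (q, a)) = q"
proof -
  have kq: "0 < k q" using k_pos01 assms by simp
  have i: "fst (torus (q, a)) \<bullet> fst (torus (q, a)) = (1 - q) / (pi * k q)"
    "snd (torus (q, a)) \<bullet> snd (torus (q, a)) = q / (pi * k q)"
    using assms kq by (simp_all only: torus_def fst_conv snd_conv inner_real_cis) (simp_all add: rad1_def rad2_def)
  have N: "torus (q, a) \<bullet> torus (q, a) = 1 / (pi * k q)"
    unfolding inner_C2 i by (simp add: diff_divide_distrib)
  show t: "tau (torus (q, a)) = q"
    unfolding tau_def N i using kq by simp
  show "torus (q, a) \<in> Y" unfolding Y_def FF_def mem_Collect_eq t N using kq by simp
qed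

lemma torus_surj:
  assumes "y \<in> Y"
  obtains a b where "y = torus (tau y, a, b)"
proof -
  have kq: "0 < k (tau y)" using k_pos tau_I by simp
  have N: "y \<bullet> y = 1 / (pi * k (tau y))" using assms kq by (simp add: Y_def FF_def field_simps)
  have "(cmod (fst y))\<^sup>2 = (1 - tau y) / (pi * k (tau y))"
    using one_minus_tau_mult[of y] N by (simp add: power2_norm_eq_inner)
  then have 1: "cmod (fst y) = rad1 (tau y)" unfolding rad1_def by (metis norm_ge_zero real_sqrt_unique)
  have "(cmod (snd y))\<^sup>2 = tau y / (pi * k (tau y))"
    using tau_mult[of y] N by (simp add: power2_norm_eq_inner)
  then have 2: "cmod (snd y) = rad2 (tau y)" unfolding rad2_def by (metis norm_ge_zero real_sqrt_unique)
  have "y = torus (tau y, Arg (fst y), Arg (snd y))"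
    using rcis_cmod_Arg[of "fst y"] rcis_cmod_Arg[of "snd y"] by (simp add: torus_def prod_eq_iff 1 2 rcis_def)
  then show thesis by (rule that)
qed

lemma torus_section_plane:
  assumes "0 \<le> q" "q \<le> 1"
  shows "torus_section (q, a) \<in> contact_plane Y (torus (q, a))"
  unfolding contact_plane_Y[OF torus_Y(1)[OF assms]] mem_Collect_eq omega_R
  by (simp add: torus_def torus_section_def omega_std_def inner_complex_def algebra_simps)
     (simp add: cis_cnj flip: distrib_left power2_eq_square)

lemma torus_section_nonzero:
  assumes "0 \<le> q" "q \<le> 1"
  shows "torus_section (q, a) \<noteq> 0"
proof
  assume "torus_section (q, a) = 0"
  then have "rad1 q = 0" "rad2 q = 0" by (simp_all add: torus_section_def zero_prod_def)
  then show False using k_pos01[OF assms] by (auto simp: rad1_def rad2_def)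
qed

lemma continuous_rad: "continuous_on {0..1} rad1" "continuous_on {0..1} rad2"
proof -
  have "continuous_on {0..1} k" using cont_k I01 continuous_on_subset by blast
  then show "continuous_on {0..1} rad1" "continuous_on {0..1} rad2"
    unfolding rad1_def rad2_def using k_pos01
    by (auto intro!: continuous_intros simp: less_imp_neq[THEN not_sym])
qed

lemma continuous_torus: "continuous_on ({0..1} \<times> UNIV) torus" "continuous_on ({0..1} \<times> UNIV) torus_section"
proof -
  have r: "continuous_on ({0..1} \<times> (UNIV :: (real \<times> real) set)) (\<lambda>p. rad1 (fst p))"
    "continuous_on ({0..1} \<times> (UNIV :: (real \<times> real) set)) (\<lambda>p. rad2 (fst p))"
    by (auto intro!: continuous_on_compose2[OF continuous_rad(1)] continuous_on_compose2[OF continuous_rad(2)] continuous_intros)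
  show "continuous_on ({0..1} \<times> UNIV) torus" "continuous_on ({0..1} \<times> UNIV) torus_section"
    unfolding torus_def torus_section_def cis_conv_exp by (intro continuous_intros r)+
qed

lemma flow_torus:
  assumes "0 \<le> q" "q \<le> 1"
  shows "flow t (torus (q, a, b)) = torus (q, a + 2 * pi * f1 q * t, b + 2 * pi * f2 q * t)"
  unfolding flow_def torus_Y(2)[OF assms] by (simp add: torus_def mult_ac add.commute flip: cis_mult)

lemma Dflow_torus_section:
  assumes "0 \<le> q" "q \<le> 1"
  shows "Dflow t (torus (q, a, b)) (torus_section (q, a, b)) = torus_section (q, a + 2 * pi * f1 q * t, b + 2 * pi * f2 q * t)"
proof -
  have o: "fst (torus (q, a, b)) \<bullet> fst (torus_section (q, a, b)) = 0" "snd (torus (q, a, b)) \<bullet> snd (torus_section (q, a, b)) = 0"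
    by (simp_all add: torus_def torus_section_def inner_complex_def)
  then have "dtau (torus (q, a, b)) (torus_section (q, a, b)) = 0"
    by (simp add: dtau_def inner_C2)
  then show ?thesis
    unfolding Dflow_def torus_Y(2)[OF assms] by (simp add: torus_section_def mult_ac add.commute flip: cis_mult)
qed

lemma Dflow_linear: "z \<noteq> 0 \<Longrightarrow> linear (Dflow t z)"
  using flow_has_derivative has_derivative_linear by blast

text \<open>Rotations preserve both conditions. The shear could change only
  \<open>omega_std y\<close>, by a multiple of \<open>(1 - t) * (- t) + t * (1 - t)\<close>, which
  is zero; this is the relation \<open>(1 - t) * f1' + t * f2' = 0\<close> obtained from Euler's
  identity.\<close>

lemma Dflow_plane:
  assumes y: "y \<in> Y" and v: "v \<in> contact_plane Y y"
  shows "Dflow t y v \<in> contact_plane Y (flow t y)"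
proof -
  define a1 a2 where "a1 = 2 * pi * t * (- tau y * k2 (tau y)) * dtau y v"
    and "a2 = 2 * pi * t * ((1 - tau y) * k2 (tau y)) * dtau y v"
  have D: "Dflow t y v = (cis (2 * pi * f1 (tau y) * t) * (fst v + of_real a1 * \<i> * fst y),
      cis (2 * pi * f2 (tau y) * t) * (snd v + of_real a2 * \<i> * snd y))"
    by (simp add: Dflow_def a1_def a2_def)
  have perp: "x \<bullet> (u + of_real a * \<i> * x) = x \<bullet> u" for x u :: complex and a
    by (simp add: inner_complex_def algebra_simps)
  have om: "Im (cnj (cis s * x) * (cis s * (u + of_real a * \<i> * x))) = Im (cnj x * u) + a * (x \<bullet> x)" for s a x u
  proof -
    have "cnj (cis s * x) * (cis s * (u + of_real a * \<i> * x)) = (cnj (cis s) * cis s) * (cnj x * (u + of_real a * \<i> * x))"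
      by (simp add: mult_ac)
    also have "cnj (cis s) * cis s = 1" by (simp add: cis_cnj cis_mult)
    finally show ?thesis by (simp add: inner_complex_def algebra_simps)
  qed
  have "omega_std (R (flow t y)) (Dflow t y v) = omega_std (R y) v"
    unfolding omega_R tau_flow D by (simp add: flow_def inner_cis perp)
  moreover have "omega_std (flow t y) (Dflow t y v) = omega_std y v + (a1 * (fst y \<bullet> fst y) + a2 * (snd y \<bullet> snd y))"
    unfolding omega_std_def D flow_def fst_conv snd_conv om by simp
  moreover have "a1 * (fst y \<bullet> fst y) + a2 * (snd y \<bullet> snd y) = 0"
    unfolding tau_mult[of y, symmetric] one_minus_tau_mult[of y, symmetric] by (simp add: a1_def a2_def)
  ultimately show ?thesis
    using y v by (simp add: contact_plane_Y)
qed

text \<open>A vector in the kernel would be the negative of its own shear, hence tangent to the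
  torus; then \<open>dtau\<close> vanishes on it and so does the shear.\<close>

lemma Dflow_eq_0:
  assumes y: "y \<in> Y" and D: "Dflow t y v = 0"
  shows "v = 0"
proof -
  have e: "fst v = - of_real (2 * pi * t * (- tau y * k2 (tau y)) * dtau y v) * \<i> * fst y"
    "snd v = - of_real (2 * pi * t * ((1 - tau y) * k2 (tau y)) * dtau y v) * \<i> * snd y"
    using D by (simp_all add: Dflow_def zero_prod_def add_eq_0_iff2)
  then have "fst y \<bullet> fst v = 0" "snd y \<bullet> snd v = 0"
    by (simp_all add: inner_complex_def)
  then have "dtau y v = 0" by (simp add: dtau_def inner_C2)
  then show ?thesis using e by (simp add: prod_eq_iff)
qed

lemma contact_plane_subspace: "y \<in> Y \<Longrightarrow> subspace (contact_plane Y y)"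
  by (auto simp: contact_plane_Y subspace_def omega_std_add_right omega_std_scaleR_right)
     (simp_all add: omega_std_def)

text \<open>Along the tori interpolating between the two exceptional orbits a trivialized section has a
  continuous argument. Near each exceptional orbit one of the two angles of the torus only rotates the
  section in a fixed plane, so the argument increases by \<open>2 \<pi>\<close> along each of the two generating circles.\<close>

lemma torus_argument:
  assumes \<tau>: "symplectic_trivialization Y \<tau>"
  shows "\<exists>g. continuous_on ({0..1} \<times> UNIV) g \<and>
    (\<forall>p. fst p \<in> {0..1} \<longrightarrow> \<tau> (torus p) (torus_section p) = exp (g p)) \<and>
    (\<forall>q a b. q \<in> {0..1} \<longrightarrow> Im (g (q, a + 2 * pi, b)) = Im (g (q, a, b)) + 2 * pi) \<and>
    (\<forall>q a b. q \<in> {0..1} \<longrightarrow> Im (g (q, a, b + 2 * pi)) = Im (g (q, a, b)) + 2 * pi)"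
proof -
  define S where "S = {0..1::real} \<times> (UNIV :: (real \<times> real) set)"
  have inS: "p \<in> S \<longleftrightarrow> fst p \<in> {0..1}" for p by (auto simp: S_def mem_Times_iff)
  have tY: "torus p \<in> Y" and vP: "torus_section p \<in> contact_plane Y (torus p)" and v0: "torus_section p \<noteq> 0" if "p \<in> S" for p
    using torus_Y(1)[of "fst p" "snd p"] torus_section_plane[of "fst p" "snd p"] torus_section_nonzero[of "fst p" "snd p"] that
    by (simp_all add: inS)
  have lin: "linear (\<tau> y)" and bij: "bij_betw (\<tau> y) (contact_plane Y y) UNIV"
    and form: "\<And>u v. u \<in> contact_plane Y y \<Longrightarrow> v \<in> contact_plane Y y \<Longrightarrow> Im (cnj (\<tau> y u) * \<tau> y v) = omega_std u v"
    if "y \<in> Y" for y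
    using \<tau> that unfolding symplectic_trivialization_def by auto
  have c\<tau>: "continuous_on (Sigma Y (contact_plane Y)) (\<lambda>(y, v). \<tau> y v)"
    using \<tau> unfolding symplectic_trivialization_def by auto
  have inj0: "v = 0" if "y \<in> Y" "v \<in> contact_plane Y y" "\<tau> y v = 0" for y v
  proof -
    have "\<tau> y v = \<tau> y 0" using that lin[OF that(1)] by (simp add: linear_0)
    moreover have "0 \<in> contact_plane Y y" using contact_plane_subspace[OF that(1)] by (simp add: subspace_0)
    ultimately show ?thesis using bij[OF that(1)] that(2) by (auto simp: bij_betw_def dest: inj_onD)
  qed
  define G where "G = (\<lambda>p. \<tau> (torus p) (torus_section p))"
  have "continuous_on S (\<lambda>p. (torus p, torus_section p))"
    unfolding S_def by (intro continuous_intros continuous_torus)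
  moreover have "(\<lambda>p. (torus p, torus_section p)) ` S \<subseteq> Sigma Y (contact_plane Y)" using tY vP by blast
  ultimately have cG: "continuous_on S G"
    unfolding G_def using continuous_on_compose2[OF c\<tau>] by fastforce
  have G0: "G p \<noteq> 0" if "p \<in> S" for p
    using inj0[OF tY[OF that] vP[OF that]] v0[OF that] by (auto simp: G_def)
  have cS: "convex S" unfolding S_def by (intro convex_Times) auto
  obtain g where g: "continuous_on S g" "\<And>p. p \<in> S \<Longrightarrow> G p = exp (g p)"
    using continuous_logarithm_on_contractible[OF cG convex_imp_contractible[OF cS] G0] by blast
  have conn: "connected S" using cS by (rule convex_connected)
  \<comment> \<open>Advancing an angle by a full turn leaves the trivialized section unchanged, so
    the argument grows by an integer number of turns. By connectedness that number may be computed
    on whichever torus is most convenient, namely a degenerate one.\<close>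
  have shift_const: "Im (g (s p)) - Im (g p) = Im (g (s p')) - Im (g p')"
    if s: "continuous_on S s" "\<And>p. p \<in> S \<Longrightarrow> s p \<in> S" "\<And>p. p \<in> S \<Longrightarrow> G (s p) = G p" and p: "p \<in> S" "p' \<in> S" for s p p'
  proof -
    define d where "d = (\<lambda>p. Im (g (s p) - g p) / (2 * pi))"
    have "d p \<in> \<int>" if "p \<in> S" for p
    proof -
      have "exp (g (s p)) = exp (g p)" using g(2) s that by metis
      then obtain n :: int where "g (s p) = g p + (of_int (2 * n) * pi) * \<i>" unfolding exp_eq by blast
      then have "d p = of_int n" by (simp add: d_def)
      then show ?thesis by simp
    qed
    moreover have "continuous_on S (\<lambda>p. g (s p))"
      by (rule continuous_on_compose2[OF g(1) s(1)]) (use s(2) in blast)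
    then have "continuous_on S d"
      unfolding d_def by (intro continuous_intros g(1)) simp_all
    ultimately have "d p = d p'" by (intro Ints_valued_constant[OF conn]) (use p in auto)
    then show ?thesis by (simp add: d_def)
  qed
  have cis2: "cis (x + 2 * pi) = cis x" for x by (simp flip: cis_mult)
  have k0: "0 < k 0" "0 < k 1" using k_pos01 by auto
  have s1: "Im (g (q, a + 2 * pi, b)) - Im (g (q, a, b)) = 2 * pi" if q: "q \<in> {0..1}" for q a b
  proof -
    define s where "s = (\<lambda>p::real\<times>real\<times>real. (fst p, fst (snd p) + 2 * pi, snd (snd p)))"
    have "Im (g (s (q, a, b))) - Im (g (q, a, b)) = Im (g (s (1, 0, 0))) - Im (g (1, 0, 0))"
    proof (rule shift_const)
      show "continuous_on S s" unfolding s_def by (intro continuous_intros)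
    qed (use q in \<open>auto simp: inS s_def G_def torus_def torus_section_def cis2\<close>)
    moreover have "Im (g (1, 2 * pi, 0)) - Im (g (1, 0, 0)) = 2 * pi"
    proof -
      define y where "y = torus (1, 0, 0)"
      have y: "y \<in> Y" unfolding y_def by (rule tY) (simp add: inS)
      have ye: "torus (1, a, 0) = y" for a by (simp add: y_def torus_def rad1_def)
      have r2: "0 < rad2 1" using k0 by (simp add: rad2_def)
      define L where "L = (\<lambda>c. \<tau> y (\<i> * of_real (rad2 1) * c, 0))"
      have te: "torus_section (1, a, 0) = (\<i> * of_real (rad2 1) * cis a, 0)" for a by (simp add: torus_section_def rad1_def)
      have plane: "(c, 0) \<in> contact_plane Y y" for c
        using y by (simp add: contact_plane_Y omega_R) (simp add: y_def torus_def rad1_def omega_std_def)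
      show ?thesis
      proof (rule winding_linear[of L "\<lambda>a. g (1, a, 0)"])
        show "linear L"
        proof (rule linearI)
          fix c c' :: complex and r :: real
          show "L (c + c') = L c + L c'"
            unfolding L_def using linear_add[OF lin[OF y], of "(\<i> * of_real (rad2 1) * c, 0)" "(\<i> * of_real (rad2 1) * c', 0)"]
            by (simp add: distrib_left)
          show "L (r *\<^sub>R c) = r *\<^sub>R L c"
            unfolding L_def using linear_cmul[OF lin[OF y], of r "(\<i> * of_real (rad2 1) * c, 0)"]
            by simp
        qed
        have "Im (cnj (L 1) * L \<i>) = omega_std (\<i> * of_real (rad2 1) * 1, 0) (\<i> * of_real (rad2 1) * \<i>, 0)"
          unfolding L_def by (rule form[OF y plane plane])
        then show "0 < Im (cnj (L 1) * L \<i>)" using r2 by (simp add: omega_std_def)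
        show "continuous_on UNIV (\<lambda>a. g (1, a, 0))"
          by (rule continuous_on_compose2[OF g(1)]) (auto simp: inS intro!: continuous_intros)
        show "exp (g (1, a, 0)) = L (cis a)" for a
          using g(2)[of "(1, a, 0)"] by (simp add: inS G_def ye te L_def)
      qed
    qed
    ultimately show ?thesis by (simp add: s_def)
  qed
  have s2: "Im (g (q, a, b + 2 * pi)) - Im (g (q, a, b)) = 2 * pi" if q: "q \<in> {0..1}" for q a b
  proof -
    define s where "s = (\<lambda>p::real\<times>real\<times>real. (fst p, fst (snd p), snd (snd p) + 2 * pi))"
    have "Im (g (s (q, a, b))) - Im (g (q, a, b)) = Im (g (s (0, 0, 0))) - Im (g (0, 0, 0))"
    proof (rule shift_const)
      show "continuous_on S s" unfolding s_def by (intro continuous_intros)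
    qed (use q in \<open>auto simp: inS s_def G_def torus_def torus_section_def cis2\<close>)
    moreover have "Im (g (0, 0, 2 * pi)) - Im (g (0, 0, 0)) = 2 * pi"
    proof -
      define y where "y = torus (0, 0, 0)"
      have y: "y \<in> Y" unfolding y_def by (rule tY) (simp add: inS)
      have ye: "torus (0, 0, b) = y" for b by (simp add: y_def torus_def rad2_def)
      have r1: "0 < rad1 0" using k0 by (simp add: rad1_def)
      define L where "L = (\<lambda>c. \<tau> y (0, - \<i> * of_real (rad1 0) * c))"
      have te: "torus_section (0, 0, b) = (0, - \<i> * of_real (rad1 0) * cis b)" for b by (simp add: torus_section_def rad2_def)
      have plane: "(0, c) \<in> contact_plane Y y" for c
        using y by (simp add: contact_plane_Y omega_R) (simp add: y_def torus_def rad2_def omega_std_def)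
      show ?thesis
      proof (rule winding_linear[of L "\<lambda>b. g (0, 0, b)"])
        show "linear L"
        proof (rule linearI)
          fix c c' :: complex and r :: real
          show "L (c + c') = L c + L c'"
            unfolding L_def using linear_add[OF lin[OF y], of "(0, - \<i> * of_real (rad1 0) * c)" "(0, - \<i> * of_real (rad1 0) * c')"]
            by (simp add: distrib_left)
          show "L (r *\<^sub>R c) = r *\<^sub>R L c"
            unfolding L_def using linear_cmul[OF lin[OF y], of r "(0, - \<i> * of_real (rad1 0) * c)"]
            by simp
        qed
        have "Im (cnj (L 1) * L \<i>) = omega_std (0, - \<i> * of_real (rad1 0) * 1) (0, - \<i> * of_real (rad1 0) * \<i>)"
          unfolding L_def by (rule form[OF y plane plane])
        then show "0 < Im (cnj (L 1) * L \<i>)" using r1 by (simp add: omega_std_def)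
        show "continuous_on UNIV (\<lambda>b. g (0, 0, b))"
          by (rule continuous_on_compose2[OF g(1)]) (auto simp: inS intro!: continuous_intros)
        show "exp (g (0, 0, b)) = L (cis b)" for b
          using g(2)[of "(0, 0, b)"] by (simp add: inS G_def ye te L_def)
      qed
    qed
    ultimately show ?thesis by (simp add: s_def)
  qed
  show ?thesis
  proof (intro exI[of _ g] conjI allI impI)
    show "continuous_on ({0..1} \<times> UNIV) g" using g(1) by (simp add: S_def)
    show "\<tau> (torus p) (torus_section p) = exp (g p)" if "fst p \<in> {0..1}" for p
      using g(2)[of p] that by (simp add: inS G_def)
    show "Im (g (q, a + 2 * pi, b)) = Im (g (q, a, b)) + 2 * pi" if "q \<in> {0..1}" for q a b
      using s1[OF that, of a b] by linarith
    show "Im (g (q, a, b + 2 * pi)) = Im (g (q, a, b)) + 2 * pi" if "q \<in> {0..1}" for q a b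
      using s2[OF that, of a b] by linarith
  qed
qed

text \<open>The two angles advance at the constant speeds \<open>2 * pi * f1 q\<close> and
  \<open>2 * pi * f2 q\<close>, and the argument of the transported section is their sum up to a
  bounded error, whichever trivialization is used.\<close>

lemma rot_Y:
  assumes \<tau>: "symplectic_trivialization Y \<tau>" and y: "y \<in> Y"
  shows "rot Y \<tau> y = f1 (tau y) + f2 (tau y)"
proof -
  obtain g where g: "continuous_on ({0..1} \<times> UNIV) g"
    "\<And>p. fst p \<in> {0..1} \<Longrightarrow> \<tau> (torus p) (torus_section p) = exp (g p)"
    "\<And>q a b. q \<in> {0..1} \<Longrightarrow> Im (g (q, a + 2 * pi, b)) = Im (g (q, a, b)) + 2 * pi"
    "\<And>q a b. q \<in> {0..1} \<Longrightarrow> Im (g (q, a, b + 2 * pi)) = Im (g (q, a, b)) + 2 * pi"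
    using torus_argument[OF \<tau>] by blast
  define q where "q = tau y"
  have q: "0 \<le> q" "q \<le> 1" by (simp_all add: q_def tau_ge_0 tau_le_1)
  obtain a b where yt: "y = torus (q, a, b)" using torus_surj[OF y] unfolding q_def .
  define w where "w = \<tau> y (torus_section (q, a, b))"
  define P where "P = inv_into (contact_plane Y y) (\<tau> y)"
  have fY: "flow t y \<in> Y" for t using y by simp
  have lin: "linear (\<tau> y)" and bij: "bij_betw (\<tau> y) (contact_plane Y y) UNIV" if "y \<in> Y" for y
    using \<tau> that unfolding symplectic_trivialization_def by auto
  have c\<tau>: "continuous_on (Sigma Y (contact_plane Y)) (\<lambda>(y, v). \<tau> y v)"
    using \<tau> unfolding symplectic_trivialization_def by auto
  have inj0: "v = 0" if "y \<in> Y" "v \<in> contact_plane Y y" "\<tau> y v = 0" for y v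
  proof -
    have "\<tau> y v = \<tau> y 0" using that lin[OF that(1)] by (simp add: linear_0)
    moreover have "0 \<in> contact_plane Y y" using contact_plane_subspace[OF that(1)] by (simp add: subspace_0)
    ultimately show ?thesis using bij[OF that(1)] that(2) by (auto simp: bij_betw_def dest: inj_onD)
  qed
  have Pp: "P w \<in> contact_plane Y y" "\<tau> y (P w) = w" for w
    using bij[OF y] unfolding P_def bij_betw_def by (auto intro: inv_into_into f_inv_into_f)
  have P\<tau>: "P (\<tau> y v) = v" if "v \<in> contact_plane Y y" for v
    using bij[OF y] that unfolding P_def bij_betw_def by (simp add: inv_into_f_f)
  have linP: "linear P"
  proof (rule linearI)
    fix w w' :: complex and r :: real
    note sub = contact_plane_subspace[OF y]
    have "P (\<tau> y (P w + P w')) = P w + P w'" by (intro P\<tau> subspace_add[OF sub] Pp)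
    then show "P (w + w') = P w + P w'" by (simp add: linear_add[OF lin[OF y]] Pp)
    have "P (\<tau> y (r *\<^sub>R P w)) = r *\<^sub>R P w" by (intro P\<tau> subspace_scale[OF sub] Pp)
    then show "P (r *\<^sub>R w) = r *\<^sub>R P w" by (simp add: linear_cmul[OF lin[OF y]] Pp)
  qed
  define A where "A = linearized_reeb_flow Y \<tau> y"
  have A: "A t w = \<tau> (flow t y) (Dflow t y (P w))" for t w
  proof -
    have "P w \<in> tangent_space Y y" using Pp(1) unfolding contact_plane_def by simp
    then show ?thesis
      unfolding A_def linearized_reeb_flow_def P_def[symmetric]
      by (simp add: reeb_flow_Y[OF y] differential_on_reeb_flow[OF y])
  qed
  have path: "linear_path A"
  proof (rule linear_path.intro)
    show "linear (A t)" for t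
    proof -
      have "A t = \<tau> (flow t y) \<circ> (Dflow t y \<circ> P)" by (rule ext) (simp add: A)
      then show ?thesis
        using linear_compose[OF linear_compose[OF linP Dflow_linear[OF Y_nonzero[OF y]]] lin[OF fY]] by simp
    qed
    show "w = 0" if "A t w = 0" for t w
    proof -
      have "Dflow t y (P w) = 0"
        using that inj0[OF fY Dflow_plane[OF y Pp(1)]] by (simp add: A)
      then have "P w = 0" by (rule Dflow_eq_0[OF y])
      then show "w = 0" using Pp(2)[of w] lin[OF y] by (simp add: linear_0)
    qed
    show "A 0 w = w" for w
      by (simp add: A Dflow_def Pp)
    show "continuous_on {0..T} (\<lambda>t. A t w)" for T w
    proof -
      have "continuous_on {0..T} (\<lambda>t. (flow t y, Dflow t y (P w)))"
        unfolding flow_def Dflow_def cis_conv_exp by (intro continuous_intros)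
      moreover have "(\<lambda>t. (flow t y, Dflow t y (P w))) ` {0..T} \<subseteq> Sigma Y (contact_plane Y)"
        using fY Dflow_plane[OF y Pp(1)] by blast
      ultimately show ?thesis
        unfolding A using continuous_on_compose2[OF c\<tau>] by fastforce
    qed
  qed
  define c where "c = (\<lambda>t. (q, a + 2 * pi * f1 q * t, b + 2 * pi * f2 q * t))"
  have Aw: "A t w = exp (g (c t))" for t
  proof -
    have "torus_section (q, a, b) \<in> contact_plane Y y" unfolding yt by (rule torus_section_plane[OF q])
    then have "A t w = \<tau> (flow t y) (Dflow t y (torus_section (q, a, b)))" by (simp add: A w_def P\<tau>)
    also have "\<dots> = \<tau> (torus (c t)) (torus_section (c t))"
      unfolding yt flow_torus[OF q] Dflow_torus_section[OF q] c_def ..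
    also have "\<dots> = exp (g (c t))" by (rule g(2)) (use q in \<open>simp add: c_def\<close>)
    finally show ?thesis .
  qed
  \<comment> \<open>One turn of either angle raises the argument by one turn, so subtracting both
    angles leaves a doubly periodic function.\<close>
  define h where "h = (\<lambda>p. Im (g (q, p)) - fst p - snd p)"
  have "continuous_on UNIV h"
  proof -
    have "continuous_on UNIV (\<lambda>p. g (q, p))"
      by (rule continuous_on_compose2[OF g(1)]) (use q in \<open>auto intro!: continuous_intros\<close>)
    then show ?thesis unfolding h_def by (intro continuous_intros)
  qed
  then obtain M where M: "\<And>p. \<bar>h p\<bar> \<le> M"
  proof (rule doubly_periodic_bounded[where p = "2 * pi"])
    show "h (x + 2 * pi, y) = h (x, y)" "h (x, y + 2 * pi) = h (x, y)" for x y
      using g(3,4)[of q x y] q by (simp_all add: h_def)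
  qed auto
  have Img: "Im (g (c t)) = 2 * pi * (f1 q + f2 q) * t + (a + b + h (snd (c t)))" for t
    by (simp add: h_def c_def algebra_simps)
  have "((\<lambda>t. Im (g (c t)) / t) \<longlongrightarrow> 2 * pi * (f1 q + f2 q)) at_top"
  proof -
    have "((\<lambda>t. (a + b + h (snd (c t))) / t) \<longlongrightarrow> 0) at_top"
    proof (rule Lim_null_comparison)
      show "eventually (\<lambda>t. norm ((a + b + h (snd (c t))) / t) \<le> (\<bar>a + b\<bar> + M) / t) at_top"
        using eventually_gt_at_top[of 0]
      proof eventually_elim
        case (elim t)
        have "\<bar>a + b + h (snd (c t))\<bar> \<le> \<bar>a + b\<bar> + M" using M[of "snd (c t)"] by linarith
        then show ?case using elim by (simp add: divide_right_mono)
      qed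
      show "((\<lambda>t. (\<bar>a + b\<bar> + M) / t) \<longlongrightarrow> 0) at_top"
        by (rule tendsto_divide_0[OF tendsto_const filterlim_at_top_imp_at_infinity[OF filterlim_ident]])
    qed
    then have "((\<lambda>t. 2 * pi * (f1 q + f2 q) + (a + b + h (snd (c t))) / t) \<longlongrightarrow> 2 * pi * (f1 q + f2 q) + 0) at_top"
      by (intro tendsto_intros)
    moreover have "eventually (\<lambda>t. Im (g (c t)) / t = 2 * pi * (f1 q + f2 q) + (a + b + h (snd (c t))) / t) at_top"
      using eventually_gt_at_top[of 0] by eventually_elim (simp add: Img add_divide_distrib)
    ultimately show ?thesis by (simp add: tendsto_cong)
  qed
  moreover have "w \<noteq> 0" using Aw[of 0] linear_path.A0[OF path, of w] by simp
  moreover have "continuous_on {0..} (\<lambda>t. g (c t))"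
    by (rule continuous_on_compose2[OF g(1)]) (use q in \<open>auto simp: c_def intro!: continuous_intros\<close>)
  ultimately have "Lim at_top (\<lambda>T. translation_number (lifted_action A T) / T) = f1 q + f2 q"
    using Aw by (intro linear_path.mean_rotation[OF path]) auto
  then show ?thesis
    unfolding rot_def rotation_number_def A_def[symmetric] by (simp add: q_def)
qed

text \<open>The unspecified choice is harmless: \<open>\<tau>0\<close> shows that some
  trivialization exists, and \<open>rot_Y\<close> applies to every one.\<close>

lemma ruelle_integrand:
  "y \<in> Y \<Longrightarrow> rot Y (SOME \<tau>. symplectic_trivialization Y \<tau>) y = f1 (tau y) + f2 (tau y)"
  by (rule rot_Y[OF someI[of "symplectic_trivialization Y", OF symplectic_trivialization_\<tau>0]])

end

section \<open>Integration over toric domains\<close>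

text \<open>A disc on which \<open>\<pi> |z|^2\<close> is less than \<open>a\<close> has area
  \<open>a\<close>. Half-lines are stable under intersection and generate the Borel sets, so
  agreement on them is enough.\<close>

lemma distr_moment_coordinate:
  "distr (lborel :: complex measure) borel (\<lambda>z. pi * (z \<bullet> z)) = density lborel (indicator {0..})"
proof (rule measure_eqI_generator_eq[where E = "range lessThan" and \<Omega> = UNIV and A = "\<lambda>n. {..< real n}"])
  have m: "(\<lambda>z::complex. pi * (z \<bullet> z)) \<in> borel_measurable borel" by measurable
  show "Int_stable (range (lessThan :: real \<Rightarrow> _))"
  proof -
    have "{..<a} \<inter> {..<b} = {..<min a b}" for a b :: real by auto
    then show ?thesis unfolding Int_stable_def by blast
  qed
  show "sets (distr lborel borel (\<lambda>z::complex. pi * (z \<bullet> z))) = sigma_sets UNIV (range lessThan)"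
    "sets (density lborel (indicator {0..} :: real \<Rightarrow> ennreal)) = sigma_sets UNIV (range lessThan)"
    by (simp_all add: borel_Iio)
  have e: "emeasure (distr lborel borel (\<lambda>z::complex. pi * (z \<bullet> z))) {..<a} = ennreal (max a 0)" for a
  proof -
    have "emeasure (distr lborel borel (\<lambda>z::complex. pi * (z \<bullet> z))) {..<a} = emeasure lborel {z::complex. pi * (z \<bullet> z) < a}"
      using m by (subst emeasure_distr) (auto simp: vimage_def)
    also have "\<dots> = ennreal (max a 0)"
    proof (cases "0 < a")
      case True
      have "{z::complex. pi * (z \<bullet> z) < a} = ball 0 (sqrt (a / pi))"
      proof (intro set_eqI)
        fix z :: complex
        have "z \<in> ball 0 (sqrt (a / pi)) \<longleftrightarrow> norm z < sqrt (a / pi)" by simp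
        also have "\<dots> \<longleftrightarrow> (norm z)\<^sup>2 < a / pi"
          by (metis norm_ge_zero real_sqrt_less_iff real_sqrt_abs abs_of_nonneg)
        also have "\<dots> \<longleftrightarrow> pi * (z \<bullet> z) < a" by (simp add: power2_norm_eq_inner field_simps)
        finally show "z \<in> {z. pi * (z \<bullet> z) < a} \<longleftrightarrow> z \<in> ball 0 (sqrt (a / pi))" by simp
      qed
      then show ?thesis using True by (simp add: emeasure_ball unit_ball_vol_2)
    next
      case False
      have "\<not> pi * (z \<bullet> z) < a" for z :: complex
      proof -
        have "0 \<le> pi * (z \<bullet> z)" by simp
        then show ?thesis using False by linarith
      qed
      then show ?thesis using False by (simp add: max_def)
    qed
    finally show ?thesis .
  qed
  have d: "emeasure (density lborel (indicator {0..})) {..<a} = ennreal (max a 0)" for a :: real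
  proof -
    have "emeasure (density lborel (indicator {0..})) {..<a} = (\<integral>\<^sup>+x. indicator {0..} x * indicator {..<a} x \<partial>lborel)"
      by (subst emeasure_density) auto
    also have "\<dots> = (\<integral>\<^sup>+x. indicator {0..<a} x \<partial>lborel)"
      by (intro nn_integral_cong) (auto simp: indicator_def)
    also have "\<dots> = emeasure lborel {0..<a}" by simp
    also have "\<dots> = ennreal (max a 0)" by (cases "0 \<le> a") (auto simp: max_def)
    finally show ?thesis .
  qed
  show "emeasure (distr lborel borel (\<lambda>z::complex. pi * (z \<bullet> z))) X = emeasure (density lborel (indicator {0..})) X"
    if "X \<in> range lessThan" for X using that e d by auto
  show "emeasure (distr lborel borel (\<lambda>z::complex. pi * (z \<bullet> z))) {..< real n} \<noteq> \<infinity>" for n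
    by (simp add: e)
  show "(\<Union>n. {..< real n}) = UNIV" using reals_Archimedean2 by auto
qed auto

lemma nn_integral_moment_coordinate:
  fixes h :: "real \<Rightarrow> ennreal"
  assumes "h \<in> borel_measurable borel"
  shows "(\<integral>\<^sup>+z. h (pi * (z \<bullet> z)) \<partial>(lborel :: complex measure)) = (\<integral>\<^sup>+r. indicator {0..} r * h r \<partial>lborel)"
proof -
  have "(\<integral>\<^sup>+z. h (pi * (z \<bullet> z)) \<partial>(lborel :: complex measure)) = (\<integral>\<^sup>+r. h r \<partial>distr (lborel :: complex measure) borel (\<lambda>z. pi * (z \<bullet> z)))"
    using assms by (subst nn_integral_distr) auto
  also have "\<dots> = (\<integral>\<^sup>+r. indicator {0..} r * h r \<partial>lborel)"
    unfolding distr_moment_coordinate using assms by (subst nn_integral_density) auto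
  finally show ?thesis .
qed

lemma nn_integral_moment_map:
  fixes H :: "real \<times> real \<Rightarrow> ennreal"
  assumes H: "H \<in> borel_measurable borel"
  shows "(\<integral>\<^sup>+z. H (pi * (fst z \<bullet> fst z), pi * (snd z \<bullet> snd z)) \<partial>(lborel :: C2 measure)) =
    (\<integral>\<^sup>+b. indicator {0..} b * (\<integral>\<^sup>+a. indicator {0..} a * H (a, b) \<partial>lborel) \<partial>lborel)"
proof -
  have Hm [measurable]: "H \<in> borel_measurable (borel \<Otimes>\<^sub>M borel)" using H by (simp add: borel_prod)
  have "(\<lambda>z::C2. (pi * (fst z \<bullet> fst z), pi * (snd z \<bullet> snd z))) \<in> borel_measurable borel"
    by (intro borel_measurable_continuous_onI continuous_intros)
  then have m: "(\<lambda>z::C2. H (pi * (fst z \<bullet> fst z), pi * (snd z \<bullet> snd z))) \<in> borel_measurable (lborel \<Otimes>\<^sub>M lborel)"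
    using measurable_compose[OF _ H] by (simp add: lborel_prod)
  have "(\<integral>\<^sup>+z. H (pi * (fst z \<bullet> fst z), pi * (snd z \<bullet> snd z)) \<partial>(lborel :: C2 measure)) =
      (\<integral>\<^sup>+w. (\<integral>\<^sup>+z. H (pi * (z \<bullet> z), pi * (w \<bullet> w)) \<partial>(lborel :: complex measure)) \<partial>(lborel :: complex measure))"
    using lborel_pair.nn_integral_snd[OF m] by (simp add: lborel_prod)
  also have "\<dots> = (\<integral>\<^sup>+w. (\<integral>\<^sup>+a. indicator {0..} a * H (a, pi * (w \<bullet> w)) \<partial>lborel) \<partial>(lborel :: complex measure))"
    by (intro nn_integral_cong nn_integral_moment_coordinate) measurable
  also have "\<dots> = (\<integral>\<^sup>+b. indicator {0..} b * (\<integral>\<^sup>+a. indicator {0..} a * H (a, b) \<partial>lborel) \<partial>lborel)"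
    by (rule nn_integral_moment_coordinate) measurable
  finally show ?thesis .
qed

text \<open>The coordinates \<open>(S, t)\<close> with \<open>(a, b) = S (1 - t, t)\<close> have Jacobian \<open>S\<close>.\<close>

lemma nn_integral_quadrant_polar:
  fixes H :: "real \<times> real \<Rightarrow> ennreal"
  assumes H: "H \<in> borel_measurable borel"
  shows "(\<integral>\<^sup>+b. indicator {0..} b * (\<integral>\<^sup>+a. indicator {0..} a * H (a, b) \<partial>lborel) \<partial>lborel) =
    (\<integral>\<^sup>+t. indicator {0..1} t * (\<integral>\<^sup>+S. ennreal S * indicator {0<..} S * H (S * (1 - t), S * t) \<partial>lborel) \<partial>lborel)"
proof -
  have Hm [measurable]: "H \<in> borel_measurable (borel \<Otimes>\<^sub>M borel)" using H by (simp add: borel_prod)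
  have "(\<integral>\<^sup>+a. indicator {0..} a * H (a, b) \<partial>lborel) = (\<integral>\<^sup>+S. indicator {b..} S * H (S - b, b) \<partial>lborel)" for b
  proof -
    have "(\<integral>\<^sup>+a. indicator {0..} a * H (a, b) \<partial>lborel) =
        (\<integral>\<^sup>+S. indicator {0..} (- b + 1 * S) * H (- b + 1 * S, b) \<partial>lborel)"
      by (subst nn_integral_real_affine[where c = 1 and t = "- b"]) auto
    also have "\<dots> = (\<integral>\<^sup>+S. indicator {b..} S * H (S - b, b) \<partial>lborel)"
      by (intro nn_integral_cong) (auto simp: indicator_def)
    finally show ?thesis .
  qed
  then have "(\<integral>\<^sup>+b. indicator {0..} b * (\<integral>\<^sup>+a. indicator {0..} a * H (a, b) \<partial>lborel) \<partial>lborel) =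
      (\<integral>\<^sup>+b. indicator {0..} b * (\<integral>\<^sup>+S. indicator {b..} S * H (S - b, b) \<partial>lborel) \<partial>lborel)" by simp
  also have "\<dots> = (\<integral>\<^sup>+b. (\<integral>\<^sup>+S. (indicator {0..} b * indicator {0..} (S - b)) * H (S - b, b) \<partial>lborel) \<partial>lborel)"
  proof (intro nn_integral_cong)
    fix b :: real
    have "indicator {0..} b * (\<integral>\<^sup>+S. indicator {b..} S * H (S - b, b) \<partial>lborel) =
        (\<integral>\<^sup>+S. indicator {0..} b * (indicator {b..} S * H (S - b, b)) \<partial>lborel)"
      by (rule nn_integral_cmult[symmetric]) simp
    also have "\<dots> = (\<integral>\<^sup>+S. (indicator {0..} b * indicator {0..} (S - b)) * H (S - b, b) \<partial>lborel)"
      by (intro nn_integral_cong) (auto simp: indicator_def)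
    finally show "indicator {0..} b * (\<integral>\<^sup>+S. indicator {b..} S * H (S - b, b) \<partial>lborel) =
        (\<integral>\<^sup>+S. (indicator {0..} b * indicator {0..} (S - b)) * H (S - b, b) \<partial>lborel)" .
  qed
  also have "\<dots> = (\<integral>\<^sup>+S. (\<integral>\<^sup>+b. (indicator {0..} b * indicator {0..} (S - b)) * H (S - b, b) \<partial>lborel) \<partial>lborel)"
    by (rule lborel_pair.Fubini'[symmetric]) measurable
  also have "\<dots> = (\<integral>\<^sup>+S. (\<integral>\<^sup>+t. indicator {0..1} t * (ennreal S * indicator {0<..} S * H (S * (1 - t), S * t)) \<partial>lborel) \<partial>lborel)"
  proof (rule nn_integral_cong_AE)
    have "AE S in lborel. S \<noteq> (0::real)" by (rule AE_lborel_singleton)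
    then show "AE S in lborel. (\<integral>\<^sup>+b. (indicator {0..} b * indicator {0..} (S - b)) * H (S - b, b) \<partial>lborel) =
      (\<integral>\<^sup>+t. indicator {0..1} t * (ennreal S * indicator {0<..} S * H (S * (1 - t), S * t)) \<partial>lborel)"
    proof eventually_elim
      case (elim S)
      show ?case
      proof (cases "0 < S")
        case True
        have "(\<integral>\<^sup>+b. (indicator {0..} b * indicator {0..} (S - b)) * H (S - b, b) \<partial>lborel) =
          ennreal \<bar>S\<bar> * (\<integral>\<^sup>+t. (indicator {0..} (0 + S * t) * indicator {0..} (S - (0 + S * t))) * H (S - (0 + S * t), 0 + S * t) \<partial>lborel)"
          by (rule nn_integral_real_affine) (use elim in measurable)
        also have "\<dots> = (\<integral>\<^sup>+t. ennreal S * ((indicator {0..} (S * t) * indicator {0..} (S - S * t)) * H (S - S * t, S * t)) \<partial>lborel)"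
          using True by (subst nn_integral_cmult) auto
        also have "\<dots> = (\<integral>\<^sup>+t. indicator {0..1} t * (ennreal S * indicator {0<..} S * H (S * (1 - t), S * t)) \<partial>lborel)"
          using True by (intro nn_integral_cong) (auto simp: indicator_def right_diff_distrib zero_le_mult_iff)
        finally show ?thesis .
      next
        case False
        then have "(\<integral>\<^sup>+b. (indicator {0..} b * indicator {0..} (S - b)) * H (S - b, b) \<partial>lborel) = (\<integral>\<^sup>+b. 0 \<partial>(lborel :: real measure))"
          using elim by (intro nn_integral_cong) (auto simp: indicator_def)
        moreover have "(\<integral>\<^sup>+t. indicator {0..1} t * (ennreal S * indicator {0<..} S * H (S * (1 - t), S * t)) \<partial>lborel) = (\<integral>\<^sup>+t. 0 \<partial>(lborel :: real measure))"
          using False by (intro nn_integral_cong) (auto simp: indicator_def)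
        ultimately show ?thesis by simp
      qed
    qed
  qed
  also have "\<dots> = (\<integral>\<^sup>+t. (\<integral>\<^sup>+S. indicator {0..1} t * (ennreal S * indicator {0<..} S * H (S * (1 - t), S * t)) \<partial>lborel) \<partial>lborel)"
    by (rule lborel_pair.Fubini') measurable
  also have "\<dots> = (\<integral>\<^sup>+t. indicator {0..1} t * (\<integral>\<^sup>+S. ennreal S * indicator {0<..} S * H (S * (1 - t), S * t) \<partial>lborel) \<partial>lborel)"
    by (intro nn_integral_cong nn_integral_cmult) measurable
  finally show ?thesis .
qed

lemma nn_integral_toric:
  fixes H :: "real \<times> real \<Rightarrow> ennreal"
  assumes H: "H \<in> borel_measurable borel"
  shows "(\<integral>\<^sup>+z. H (pi * (z \<bullet> z), (snd z \<bullet> snd z) / (z \<bullet> z)) \<partial>(lborel :: C2 measure)) =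
    (\<integral>\<^sup>+t. indicator {0..1} t * (\<integral>\<^sup>+S. ennreal S * indicator {0<..} S * H (S, t) \<partial>lborel) \<partial>lborel)"
proof -
  define H' where "H' = (\<lambda>w. H (fst w + snd w, snd w / (fst w + snd w)))"
  have H'm: "H' \<in> borel_measurable borel"
  proof -
    have "(\<lambda>w. (fst w + snd w, snd w / (fst w + snd w))) \<in> measurable (borel \<Otimes>\<^sub>M borel) (borel \<Otimes>\<^sub>M (borel :: real measure))"
      by measurable
    then have "(\<lambda>w::real\<times>real. (fst w + snd w, snd w / (fst w + snd w))) \<in> borel_measurable borel"
      by (simp add: borel_prod)
    then show ?thesis unfolding H'_def by (rule measurable_compose[OF _ H])
  qed
  have "(\<integral>\<^sup>+z. H (pi * (z \<bullet> z), (snd z \<bullet> snd z) / (z \<bullet> z)) \<partial>(lborel :: C2 measure)) =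
      (\<integral>\<^sup>+z. H' (pi * (fst z \<bullet> fst z), pi * (snd z \<bullet> snd z)) \<partial>(lborel :: C2 measure))"
    by (intro nn_integral_cong) (simp add: H'_def inner_prod_def flip: distrib_left)
  also have "\<dots> = (\<integral>\<^sup>+t. indicator {0..1} t * (\<integral>\<^sup>+S. ennreal S * indicator {0<..} S * H' (S * (1 - t), S * t) \<partial>lborel) \<partial>lborel)"
    unfolding nn_integral_moment_map[OF H'm] by (rule nn_integral_quadrant_polar[OF H'm])
  also have "\<dots> = (\<integral>\<^sup>+t. indicator {0..1} t * (\<integral>\<^sup>+S. ennreal S * indicator {0<..} S * H (S, t) \<partial>lborel) \<partial>lborel)"
  proof -
    have "(\<integral>\<^sup>+S. ennreal S * indicator {0<..} S * H' (S * (1 - t), S * t) \<partial>lborel) =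
        (\<integral>\<^sup>+S. ennreal S * indicator {0<..} S * H (S, t) \<partial>lborel)" for t
    proof (intro nn_integral_cong)
      fix S :: real
      have "S * (1 - t) + S * t = S" by (simp add: right_diff_distrib)
      then show "ennreal S * indicator {0<..} S * H' (S * (1 - t), S * t) = ennreal S * indicator {0<..} S * H (S, t)"
        by (cases "0 < S") (simp_all add: H'_def)
    qed
    then show ?thesis by simp
  qed
  finally show ?thesis .
qed

lemma nn_integral_ident_Ioc:
  assumes "0 \<le> a" "a \<le> b"
  shows "(\<integral>\<^sup>+S. ennreal S * indicator {a<..b} S \<partial>lborel) = ennreal ((b\<^sup>2 - a\<^sup>2) / 2)"
proof -
  have "(\<integral>\<^sup>+S. ennreal S * indicator {a<..b} S \<partial>lborel) = (\<integral>\<^sup>+S. ennreal S * indicator {a..b} S \<partial>lborel)"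
  proof (rule nn_integral_cong_AE)
    have "AE S in lborel. S \<noteq> a" by (rule AE_lborel_singleton)
    then show "AE S in lborel. ennreal S * indicator {a<..b} S = ennreal S * indicator {a..b} S"
      by eventually_elim (auto simp: indicator_def)
  qed
  also have "\<dots> = ennreal (b\<^sup>2 / 2 - a\<^sup>2 / 2)"
    by (rule nn_integral_FTC_Icc) (use assms in \<open>auto intro!: derivative_eq_intros\<close>)
  finally show ?thesis by (simp add: diff_divide_distrib)
qed

lemma nn_integral_continuous_Icc:
  fixes h :: "real \<Rightarrow> real"
  assumes "continuous_on {a..b} h" "\<And>t. t \<in> {a..b} \<Longrightarrow> 0 \<le> h t"
  shows "(\<integral>\<^sup>+t. indicator {a..b} t * ennreal (h t) \<partial>lborel) = ennreal (integral {a..b} h)"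
proof -
  have "(h has_integral integral {a..b} h) {a..b}"
    by (rule integrable_integral[OF integrable_continuous_interval[OF assms(1)]])
  from nn_integral_has_integral_lebesgue'[OF assms(2) this]
  show ?thesis by (simp add: mult.commute)
qed

text \<open>Gauge and integrand are controlled on [0, 1] only. Since the quotient \<open>tau\<close>
  always lies there, replacing them by their extension by zero changes no integral and provides
  measurability on the whole line.\<close>

lemma borel_measurable_continuous_extension:
  fixes g :: "real \<Rightarrow> real"
  assumes "continuous_on {a..b} g"
  shows "(\<lambda>t. if t \<in> {a..b} then g t else 0) \<in> borel_measurable borel"
proof -
  have "(\<lambda>t. indicator {a..b} t *\<^sub>R g t) \<in> borel_measurable borel"
    by (rule borel_measurable_continuous_on_indicator[OF _ assms]) simp
  moreover have "(\<lambda>t. indicator {a..b} t *\<^sub>R g t) = (\<lambda>t. if t \<in> {a..b} then g t else 0)"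
    by (auto simp: indicator_def)
  ultimately show ?thesis by simp
qed

lemma tau_unit_interval:
  fixes z :: C2
  shows "(snd z \<bullet> snd z) / (z \<bullet> z) \<in> {0..1}"
proof -
  have "snd z \<bullet> snd z \<le> z \<bullet> z" by (simp add: inner_prod_def)
  then show ?thesis by (cases "z = 0") (simp_all add: divide_le_eq_1)
qed

text \<open>For fixed \<open>t\<close> the two regions differ in the values \<open>S\<close> between
  \<open>h1 t\<close> and \<open>h2 t\<close>, with density \<open>S\<close>, which integrates to
  half the difference of squares. Closeness in volume is thus closeness of \<open>h^2\<close> in the
  mean.\<close>

lemma emeasure_toric_sym_diff:
  fixes h1 h2 :: "real \<Rightarrow> real"
  assumes h: "continuous_on {0..1} h1" "continuous_on {0..1} h2"
    "\<And>t. t \<in> {0..1} \<Longrightarrow> 0 \<le> h1 t" "\<And>t. t \<in> {0..1} \<Longrightarrow> 0 \<le> h2 t"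
  shows "emeasure lborel (sym_diff {z::C2. pi * (z \<bullet> z) \<le> h1 ((snd z \<bullet> snd z) / (z \<bullet> z))}
      {z. pi * (z \<bullet> z) \<le> h2 ((snd z \<bullet> snd z) / (z \<bullet> z))}) =
    ennreal (integral {0..1} (\<lambda>t. \<bar>(h1 t)\<^sup>2 - (h2 t)\<^sup>2\<bar> / 2))"
proof -
  define e1 where "e1 = (\<lambda>t. if t \<in> {0..1} then h1 t else 0)"
  define e2 where "e2 = (\<lambda>t. if t \<in> {0..1} then h2 t else 0)"
  have [measurable]: "e1 \<in> borel_measurable borel" "e2 \<in> borel_measurable borel"
    unfolding e1_def e2_def
    by (rule borel_measurable_continuous_extension[OF h(1)] borel_measurable_continuous_extension[OF h(2)])+
  define H :: "real \<times> real \<Rightarrow> ennreal" where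
    "H = (\<lambda>p. if (fst p \<le> e1 (snd p)) \<noteq> (fst p \<le> e2 (snd p)) then 1 else 0)"
  have "H \<in> borel_measurable (borel \<Otimes>\<^sub>M borel)" unfolding H_def by measurable
  then have Hm: "H \<in> borel_measurable borel" by (simp add: borel_prod)
  define D where "D = sym_diff {z::C2. pi * (z \<bullet> z) \<le> h1 ((snd z \<bullet> snd z) / (z \<bullet> z))}
      {z. pi * (z \<bullet> z) \<le> h2 ((snd z \<bullet> snd z) / (z \<bullet> z))}"
  have HD: "H (pi * (z \<bullet> z), (snd z \<bullet> snd z) / (z \<bullet> z)) = indicator D z" for z :: C2
    using tau_unit_interval[of z] by (auto simp: H_def e1_def e2_def D_def indicator_def)
  have mD: "D \<in> sets borel"
  proof -
    have "(\<lambda>z::C2. (pi * (z \<bullet> z), (snd z \<bullet> snd z) / (z \<bullet> z))) \<in> measurable borel (borel \<Otimes>\<^sub>M borel)"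
    proof (rule measurable_Pair)
      show "(\<lambda>z::C2. pi * (z \<bullet> z)) \<in> borel_measurable borel" by measurable
      have "(\<lambda>z::C2. snd z \<bullet> snd z) \<in> borel_measurable borel"
        by (intro borel_measurable_continuous_onI continuous_intros)
      then show "(\<lambda>z::C2. (snd z \<bullet> snd z) / (z \<bullet> z)) \<in> borel_measurable borel" by measurable
    qed
    then have "(\<lambda>z::C2. (pi * (z \<bullet> z), (snd z \<bullet> snd z) / (z \<bullet> z))) \<in> borel_measurable borel"
      by (simp add: borel_prod)
    from measurable_compose[OF this Hm] have "(\<lambda>z. indicator D z :: ennreal) \<in> borel_measurable borel"
      by (simp add: HD)
    then show ?thesis by (simp add: borel_measurable_indicator_iff)
  qed
  have "emeasure lborel D = (\<integral>\<^sup>+z. H (pi * (z \<bullet> z), (snd z \<bullet> snd z) / (z \<bullet> z)) \<partial>(lborel :: C2 measure))"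
    using mD by (simp add: HD)
  also have "\<dots> = (\<integral>\<^sup>+t. indicator {0..1} t * (\<integral>\<^sup>+S. ennreal S * indicator {0<..} S * H (S, t) \<partial>lborel) \<partial>lborel)"
    by (rule nn_integral_toric[OF Hm])
  also have "\<dots> = (\<integral>\<^sup>+t. indicator {0..1} t * ennreal (\<bar>(h1 t)\<^sup>2 - (h2 t)\<^sup>2\<bar> / 2) \<partial>lborel)"
  proof (intro nn_integral_cong)
    fix t :: real
    show "indicator {0..1} t * (\<integral>\<^sup>+S. ennreal S * indicator {0<..} S * H (S, t) \<partial>lborel) =
      indicator {0..1} t * ennreal (\<bar>(h1 t)\<^sup>2 - (h2 t)\<^sup>2\<bar> / 2)"
    proof (cases "t \<in> {0..1}")
      case True
      define a b where "a = min (h1 t) (h2 t)" and "b = max (h1 t) (h2 t)"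
      have ab: "0 \<le> a" "a \<le> b" using h(3,4)[OF True] by (auto simp: a_def b_def)
      have "(\<integral>\<^sup>+S. ennreal S * indicator {0<..} S * H (S, t) \<partial>lborel) = (\<integral>\<^sup>+S. ennreal S * indicator {a<..b} S \<partial>lborel)"
        by (intro nn_integral_cong) (use ab True in \<open>auto simp: H_def e1_def e2_def a_def b_def indicator_def\<close>)
      also have "\<dots> = ennreal ((b\<^sup>2 - a\<^sup>2) / 2)" by (rule nn_integral_ident_Ioc[OF ab])
      also have "b\<^sup>2 - a\<^sup>2 = \<bar>(h1 t)\<^sup>2 - (h2 t)\<^sup>2\<bar>"
      proof (cases "h1 t \<le> h2 t")
        case le: True
        then have "(h1 t)\<^sup>2 \<le> (h2 t)\<^sup>2" using h(3)[OF True] by (intro power_mono) auto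
        then show ?thesis using le by (simp add: a_def b_def)
      next
        case gt: False
        then have "(h2 t)\<^sup>2 \<le> (h1 t)\<^sup>2" using h(4)[OF True] by (intro power_mono) auto
        then show ?thesis using gt by (simp add: a_def b_def)
      qed
      finally show ?thesis by simp
    qed simp
  qed
  also have "\<dots> = ennreal (integral {0..1} (\<lambda>t. \<bar>(h1 t)\<^sup>2 - (h2 t)\<^sup>2\<bar> / 2))"
    by (rule nn_integral_continuous_Icc) (auto intro!: continuous_intros h)
  finally show ?thesis by (simp only: D_def)
qed

section \<open>Contact volume and Ruelle invariant as integrals over \<open>t\<close>\<close>

context toric_gauge begin

lemma borel_tau: "tau \<in> borel_measurable borel"
proof -
  have "(\<lambda>z::C2. snd z \<bullet> snd z) \<in> borel_measurable borel"
    by (intro borel_measurable_continuous_onI continuous_intros)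
  then show ?thesis unfolding tau_def by measurable
qed

lemma tau_proj: "z \<noteq> 0 \<Longrightarrow> tau (proj z) = tau z"
  using FF_pos[of z] by (simp add: proj_def tau_scale)

lemma k_continuous01: "continuous_on {0..1} k"
  using cont_k I01 continuous_on_subset by blast

text \<open>Over each \<open>t\<close> the cone is \<open>S \<le> 1 / k t\<close>, where the density
  \<open>S\<close> integrates to \<open>1 / (2 * (k t)^2)\<close>; the factor 2 in
  \<open>cone_measure\<close> removes the 1/2.\<close>

lemma nn_integral_cone_measure:
  assumes g: "continuous_on {0..1} g" "\<And>t. t \<in> {0..1} \<Longrightarrow> 0 \<le> g t"
  shows "(\<integral>\<^sup>+y. ennreal (g (tau y)) \<partial>cone_measure) = ennreal (integral {0..1} (\<lambda>t. g t / (k t)\<^sup>2))"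
proof -
  define g' where "g' = (\<lambda>t. if t \<in> {0..1} then g t else 0)"
  define k' where "k' = (\<lambda>t. if t \<in> {0..1} then k t else 0)"
  have [measurable]: "g' \<in> borel_measurable borel" "k' \<in> borel_measurable borel"
    unfolding g'_def k'_def
    by (rule borel_measurable_continuous_extension[OF g(1)] borel_measurable_continuous_extension[OF k_continuous01])+
  have tau01: "tau z \<in> {0..1}" for z using tau_ge_0[of z] tau_le_1[of z] by simp
  have g't: "g (tau z) = g' (tau z)" "k (tau z) = k' (tau z)" for z
    using tau01[of z] by (simp_all add: g'_def k'_def)
  have tm: "tau \<in> borel_measurable lborel" using borel_tau by simp
  note [measurable] = borel_tau borel_proj borel_B
  have gm: "(\<lambda>y. ennreal (g' (tau y))) \<in> borel_measurable (restrict_space borel Y)"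
    by (intro measurable_restrict_space1) measurable
  have "(\<integral>\<^sup>+y. ennreal (g (tau y)) \<partial>cone_measure) =
      (\<integral>\<^sup>+z. ennreal (g' (tau (proj z))) \<partial>density lborel (\<lambda>z. 2 * indicator B z))"
    unfolding cone_measure_def g't
    by (rule nn_integral_distr) (use measurable_proj gm in \<open>simp_all\<close>)
  also have "\<dots> = (\<integral>\<^sup>+z. 2 * indicator B z * ennreal (g' (tau (proj z))) \<partial>lborel)"
    by (rule nn_integral_density) measurable
  also have "\<dots> = (\<integral>\<^sup>+z. 2 * (ennreal (g' (tau z)) * indicator {..1} (pi * (z \<bullet> z) * k' (tau z))) \<partial>lborel)"
  proof (rule nn_integral_cong_AE)
    have "AE z in lborel. z \<noteq> (0::C2)" by (rule AE_lborel_singleton)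
    then show "AE z in lborel. 2 * indicator B z * ennreal (g' (tau (proj z))) =
        2 * (ennreal (g' (tau z)) * indicator {..1} (pi * (z \<bullet> z) * k' (tau z)))"
    proof eventually_elim
      case (elim z)
      then show ?case
        by (auto simp: B_def tau_proj FF_def indicator_def g't)
    qed
  qed
  also have "\<dots> = (\<integral>\<^sup>+z. (\<lambda>p. 2 * (ennreal (g' (snd p)) * indicator {..1} (fst p * k' (snd p)))) (pi * (z \<bullet> z), (snd z \<bullet> snd z) / (z \<bullet> z)) \<partial>(lborel :: C2 measure))"
    by (simp add: tau_def)
  also have "\<dots> = (\<integral>\<^sup>+t. indicator {0..1} t * (\<integral>\<^sup>+S. ennreal S * indicator {0<..} S *
      (\<lambda>p. 2 * (ennreal (g' (snd p)) * indicator {..1} (fst p * k' (snd p)))) (S, t) \<partial>lborel) \<partial>lborel)"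
  proof (rule nn_integral_toric)
    have "(\<lambda>p. 2 * (ennreal (g' (snd p)) * indicator {..1} (fst p * k' (snd p))) :: ennreal) \<in> borel_measurable (borel \<Otimes>\<^sub>M borel)"
      by measurable
    then show "(\<lambda>p. 2 * (ennreal (g' (snd p)) * indicator {..1} (fst p * k' (snd p))) :: ennreal) \<in> borel_measurable borel"
      by (simp add: borel_prod)
  qed
  also have "\<dots> = (\<integral>\<^sup>+t. indicator {0..1} t * ennreal (g t / (k t)\<^sup>2) \<partial>lborel)"
  proof (intro nn_integral_cong)
    fix t :: real
    show "indicator {0..1} t * (\<integral>\<^sup>+S. ennreal S * indicator {0<..} S *
      (\<lambda>p. 2 * (ennreal (g' (snd p)) * indicator {..1} (fst p * k' (snd p)))) (S, t) \<partial>lborel) =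
      indicator {0..1} t * ennreal (g t / (k t)\<^sup>2)"
    proof (cases "t \<in> {0..1}")
      case True
      then have kt: "0 < k t" and e: "g' t = g t" "k' t = k t" using k_pos01[of t] by (simp_all add: g'_def k'_def)
      have "(\<integral>\<^sup>+S. ennreal S * indicator {0<..} S * (2 * (ennreal (g t) * indicator {..1} (S * k t))) \<partial>lborel) =
         (\<integral>\<^sup>+S. ennreal (2 * g t) * (ennreal S * indicator {0<..1 / k t} S) \<partial>lborel)"
        using g(2)[OF True] kt by (intro nn_integral_cong) (auto simp: indicator_def ennreal_mult field_simps)
      also have "\<dots> = ennreal (2 * g t) * ennreal (((1 / k t)\<^sup>2 - 0\<^sup>2) / 2)"
        using kt by (subst nn_integral_cmult) (simp_all add: nn_integral_ident_Ioc)
      also have "\<dots> = ennreal (g t / (k t)\<^sup>2)"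
        using g(2)[OF True] by (subst ennreal_mult[symmetric]) (simp_all add: power_divide)
      finally show ?thesis by (simp add: e)
    qed simp
  qed
  also have "\<dots> = ennreal (integral {0..1} (\<lambda>t. g t / (k t)\<^sup>2))"
    by (rule nn_integral_continuous_Icc)
       (use g k_pos01 in \<open>auto intro!: continuous_intros k_continuous01 simp: less_imp_neq[THEN not_sym]\<close>)
  finally show ?thesis .
qed

lemma integral_cone_measure_nonneg:
  assumes g: "continuous_on {0..1} g" "\<And>t. t \<in> {0..1} \<Longrightarrow> 0 \<le> g t"
  shows "integrable cone_measure (\<lambda>y. g (tau y))"
    "(\<integral>y. g (tau y) \<partial>cone_measure) = integral {0..1} (\<lambda>t. g t / (k t)\<^sup>2)"
proof -
  have tau01: "tau z \<in> {0..1}" for z using tau_ge_0[of z] tau_le_1[of z] by simp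
  define g' where "g' = (\<lambda>t. if t \<in> {0..1} then g t else 0)"
  have [measurable]: "g' \<in> borel_measurable borel"
    unfolding g'_def by (rule borel_measurable_continuous_extension[OF g(1)])
  note [measurable] = borel_tau
  have "(\<lambda>y. g' (tau y)) \<in> borel_measurable (restrict_space borel Y)"
    by (intro measurable_restrict_space1) measurable
  then have m: "(\<lambda>y. g (tau y)) \<in> borel_measurable cone_measure"
    using tau01 by (simp add: g'_def measurable_cong_sets[OF sets_cone_measure refl])
  have nn: "AE y in cone_measure. 0 \<le> g (tau y)" using g(2) tau01 by simp
  have pos: "0 \<le> integral {0..1} (\<lambda>t. g t / (k t)\<^sup>2)"
    by (rule integral_nonneg)
       (use g k_pos01 in \<open>auto intro!: integrable_continuous_interval continuous_intros k_continuous01 simp: less_imp_neq[THEN not_sym]\<close>)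
  show "integrable cone_measure (\<lambda>y. g (tau y))"
    using m nn nn_integral_cone_measure[OF g] by (intro integrableI_nonneg) auto
  show "(\<integral>y. g (tau y) \<partial>cone_measure) = integral {0..1} (\<lambda>t. g t / (k t)\<^sup>2)"
    using integral_eq_nn_integral[OF m nn] nn_integral_cone_measure[OF g] pos by simp
qed

text \<open>Adding a constant bound reduces to nonnegative integrands. Signed ones do occur: with
  \<open>k1 1 = 3 * k 1\<close> the mean rotation \<open>f1 + f2\<close> equals \<open>- k 1\<close>
  at \<open>t = 1\<close>.\<close>

lemma integral_cone_measure:
  assumes g: "continuous_on {0..1} g"
  shows "(\<integral>y. g (tau y) \<partial>cone_measure) = integral {0..1} (\<lambda>t. g t / (k t)\<^sup>2)"
proof -
  have "compact (g ` {0..1})" by (rule compact_continuous_image[OF g]) simp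
  from compact_imp_bounded[OF this] obtain C where C: "\<forall>v\<in>g ` {0..1}. norm v \<le> C" unfolding bounded_iff by blast
  then have C': "\<bar>g t\<bar> \<le> C" if "t \<in> {0..1}" for t using that by auto
  have "\<bar>g 0\<bar> \<le> C" by (rule C') simp
  then have C0: "0 \<le> C" using abs_ge_zero[of "g 0"] by linarith
  have c1: "continuous_on {0..1} (\<lambda>t. g t + C)" by (intro continuous_intros g)
  have n1: "0 \<le> g t + C" if "t \<in> {0..1}" for t using C'[OF that] by linarith
  have c2: "continuous_on {0..1} (\<lambda>t. C)" and n2: "\<And>t. t \<in> {0..1} \<Longrightarrow> 0 \<le> C" using C0 by auto
  note i1 = integral_cone_measure_nonneg[of "\<lambda>t. g t + C", OF c1 n1]
    and i2 = integral_cone_measure_nonneg[of "\<lambda>t. C", OF c2 n2]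
  have "(\<integral>y. g (tau y) \<partial>cone_measure) = (\<integral>y. (g (tau y) + C) - C \<partial>cone_measure)" by simp
  also have "\<dots> = (\<integral>y. g (tau y) + C \<partial>cone_measure) - (\<integral>y. C \<partial>cone_measure)"
    by (rule Bochner_Integration.integral_diff[OF i1(1) i2(1)])
  also have "\<dots> = integral {0..1} (\<lambda>t. (g t + C) / (k t)\<^sup>2) - integral {0..1} (\<lambda>t. C / (k t)\<^sup>2)"
    by (simp only: i1(2) i2(2))
  also have "\<dots> = integral {0..1} (\<lambda>t. (g t + C) / (k t)\<^sup>2 - C / (k t)\<^sup>2)"
    by (rule Henstock_Kurzweil_Integration.integral_diff[symmetric])
       (use k_pos01 in \<open>auto intro!: integrable_continuous_interval continuous_intros k_continuous01 g simp: less_imp_neq[THEN not_sym]\<close>)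
  also have "\<dots> = integral {0..1} (\<lambda>t. g t / (k t)\<^sup>2)"
    by (rule integral_cong) (simp add: add_divide_distrib)
  finally show ?thesis .
qed

definition Vol :: real where "Vol = integral {0..1} (\<lambda>t. 1 / (k t)\<^sup>2)"

lemma contact_volume_Y: "contact_volume Y = Vol"
  unfolding contact_volume_def contact_measure_Y Vol_def
  using integral_cone_measure[of "\<lambda>t. 1"] by simp

text \<open>The integrand \<open>(2 * k t + (1 - 2 * t) * k1 t) / (k t)^2\<close> is the derivative
  of \<open>- (1 - 2 * t) / k t\<close>, so only the two ends contribute, each with the inverse of
  \<open>k\<close>.\<close>

lemma ruelle_invariant_Y: "ruelle_invariant Y = 1 / k 0 + 1 / k 1"
proof -
  have space: "space cone_measure = Y" by (simp add: cone_measure_def space_restrict_space)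
  have "ruelle_invariant Y = (\<integral>y. (\<lambda>t. f1 t + f2 t) (tau y) \<partial>cone_measure)"
    unfolding ruelle_invariant_def contact_measure_Y
    by (rule Bochner_Integration.integral_cong[OF refl]) (simp add: space ruelle_integrand)
  also have "\<dots> = integral {0..1} (\<lambda>t. (f1 t + f2 t) / (k t)\<^sup>2)"
  proof (rule integral_cone_measure)
    have "continuous_on {0..1} k1" using cont_k1 I01 continuous_on_subset by blast
    then show "continuous_on {0..1} (\<lambda>t. f1 t + f2 t)"
      unfolding f1_def f2_def by (intro continuous_intros k_continuous01)
  qed
  also have "\<dots> = (- (1 - 2 * 1) / k 1) - (- (1 - 2 * 0) / k 0)"
  proof (rule integral_unique, rule fundamental_theorem_of_calculus)
    fix t :: real assume t: "t \<in> {0..1}"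
    have "((\<lambda>t. - (1 - 2 * t) / k t) has_real_derivative (2 * k t - - (1 - 2 * t) * k1 t) / (k t * k t)) (at t)"
      using t I01 k_pos01[of t] by (auto intro!: derivative_eq_intros DERIV_k)
    moreover have "(2 * k t - - (1 - 2 * t) * k1 t) / (k t * k t) = (f1 t + f2 t) / (k t)\<^sup>2"
      by (simp add: f1_def f2_def power2_eq_square algebra_simps)
    ultimately show "((\<lambda>t. - (1 - 2 * t) / k t) has_vector_derivative (f1 t + f2 t) / (k t)\<^sup>2) (at t within {0..1})"
      by (simp add: has_real_derivative_iff_has_vector_derivative has_vector_derivative_at_within)
  qed simp
  finally show ?thesis by simp
qed

lemma Vol_pos: "0 < Vol"
proof -
  obtain m M where mM: "0 < m" "\<And>t. 0 \<le> t \<Longrightarrow> t \<le> 1 \<Longrightarrow> m \<le> k t \<and> k t \<le> M"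
    using k_bounds by blast
  then have M: "0 < M" by force
  have "integral {0..1} (\<lambda>t::real. 1 / M\<^sup>2) \<le> Vol"
    unfolding Vol_def
  proof (rule integral_le)
    show "(\<lambda>t. 1 / (k t)\<^sup>2) integrable_on {0..1}"
      by (intro integrable_continuous_interval continuous_intros k_continuous01) (use k_pos01 in \<open>auto simp: less_imp_neq[THEN not_sym]\<close>)
    fix t :: real assume "t \<in> {0..1}"
    then show "1 / M\<^sup>2 \<le> 1 / (k t)\<^sup>2"
      using mM(2)[of t] k_pos01[of t] by (intro divide_left_mono power_mono) auto
  qed auto
  moreover have "integral {0..1} (\<lambda>t::real. 1 / M\<^sup>2) = 1 / M\<^sup>2" by simp
  moreover have "0 < 1 / M\<^sup>2" using M by simp
  ultimately show ?thesis by linarith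
qed

lemma ru_sys: "ru Om * sqrt (sys Om) = (1 / k 0 + 1 / k 1) * T_min Y / Vol"
proof -
  have "sqrt (sys Om) = T_min Y / sqrt Vol"
    using T_min_nonneg by (simp add: sys_def systolic_ratio_def frontier_X contact_volume_Y real_sqrt_divide)
  moreover have "ru Om = (1 / k 0 + 1 / k 1) / sqrt Vol"
    by (simp add: ru_def ruelle_ratio_def frontier_X contact_volume_Y ruelle_invariant_Y)
  ultimately show ?thesis using Vol_pos by (simp add: power2_eq_square flip: real_sqrt_mult)
qed

lemma X_polar: "X_toric Om = {z. pi * (z \<bullet> z) \<le> 1 / k ((snd z \<bullet> snd z) / (z \<bullet> z))}"
proof -
  have "FF z \<le> 1 \<longleftrightarrow> pi * (z \<bullet> z) \<le> 1 / k ((snd z \<bullet> snd z) / (z \<bullet> z))" for z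
    using k_pos[OF tau_I, of z] by (simp add: FF_def tau_def[symmetric] field_simps)
  then show ?thesis unfolding X_eq by simp
qed

end

section \<open>Convexity and Lagrangian frames\<close>

lemma has_vector_derivative_iff_tendsto:
  "(f has_vector_derivative D) (at x) \<longleftrightarrow> ((\<lambda>h. (f (x + h) - f x) /\<^sub>R h) \<longlongrightarrow> D) (at 0)"
proof -
  have "(f has_vector_derivative D) (at x) \<longleftrightarrow> ((\<lambda>h. norm (f (x + h) - f x - h *\<^sub>R D) / \<bar>h\<bar>) \<longlongrightarrow> 0) (at 0)"
    unfolding has_vector_derivative_def has_derivative_at by (simp add: bounded_linear_scaleR_left)
  also have "\<dots> \<longleftrightarrow> ((\<lambda>h. norm ((f (x + h) - f x) /\<^sub>R h - D)) \<longlongrightarrow> 0) (at 0)"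
  proof (rule tendsto_cong)
    have "eventually (\<lambda>h::real. h \<noteq> 0) (at 0)" by (simp add: eventually_at_filter)
    then show "\<forall>\<^sub>F h in at 0. norm (f (x + h) - f x - h *\<^sub>R D) / \<bar>h\<bar> = norm ((f (x + h) - f x) /\<^sub>R h - D)"
    proof eventually_elim
      case (elim h)
      then have "(f (x + h) - f x) /\<^sub>R h - D = (f (x + h) - f x - h *\<^sub>R D) /\<^sub>R h"
        by (simp add: scaleR_diff_right)
      then show ?case by (simp add: divide_inverse mult.commute)
    qed
  qed
  also have "\<dots> \<longleftrightarrow> ((\<lambda>h. (f (x + h) - f x) /\<^sub>R h) \<longlongrightarrow> D) (at 0)"
    by (subst tendsto_norm_zero_iff) (rule LIM_zero_iff)
  finally show ?thesis .
qed

section \<open>Second derivatives of a smooth map and their symmetry\<close>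

context
  fixes \<phi> :: "'a::euclidean_space \<Rightarrow> 'b::euclidean_space"
  assumes sm: "smooth_on UNIV \<phi>"
begin

definition D\<^sub>1 :: "'a \<Rightarrow> 'a \<Rightarrow> 'b" where "D\<^sub>1 z = frechet_derivative \<phi> (at z)"
definition D\<^sub>2 :: "'a \<Rightarrow> 'a \<Rightarrow> 'a \<Rightarrow> 'b" where "D\<^sub>2 z u = frechet_derivative (\<lambda>z. D\<^sub>1 z u) (at z)"

lemma D1_has_derivative: "(\<phi> has_derivative D\<^sub>1 z) (at z)"
  unfolding D\<^sub>1_def using smooth_on_has_derivative[OF sm] by simp

lemma D1_linear: "linear (D\<^sub>1 z)"
  using D1_has_derivative has_derivative_linear by blast

lemma D1_smooth: "smooth_on UNIV (\<lambda>z. D\<^sub>1 z u)"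
  unfolding D\<^sub>1_def by (rule smooth_on_frechet_derivative[OF sm])

lemma D2_has_derivative: "((\<lambda>z. D\<^sub>1 z u) has_derivative D\<^sub>2 z u) (at z)"
  unfolding D\<^sub>2_def using smooth_on_has_derivative[OF D1_smooth] by simp

lemma D2_continuous: "continuous_on UNIV (\<lambda>z. D\<^sub>2 z u v)"
  unfolding D\<^sub>2_def
  using smooth_on_imp_continuous[OF smooth_on_frechet_derivative[OF D1_smooth]] .

lemma line_has_derivative:
  fixes f :: "'a \<Rightarrow> 'c::real_normed_vector"
  assumes "(f has_derivative f') (at (z + s *\<^sub>R u))"
  shows "((\<lambda>s. f (z + s *\<^sub>R u)) has_vector_derivative f' u) (at s)"
proof -
  have "((\<lambda>s. z + s *\<^sub>R u) has_derivative (\<lambda>h. h *\<^sub>R u)) (at s)"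
    by (auto intro!: derivative_eq_intros)
  from has_derivative_compose[OF this assms] show ?thesis
    using linear_cmul[OF has_derivative_linear[OF assms]] by (simp add: has_vector_derivative_def)
qed

text \<open>The mean value theorem is applied in the direction \<open>u\<close> to the increment in
  the direction \<open>v\<close>, and then in the direction \<open>v\<close> to the resulting
  derivative. The pairing with \<open>b\<close> makes the functions real-valued.\<close>

lemma second_difference:
  assumes h: "0 < h"
  obtains s t where "0 < s" "s < h" "0 < t" "t < h"
    "(\<phi> (z + h *\<^sub>R u + h *\<^sub>R v) - \<phi> (z + h *\<^sub>R u) - \<phi> (z + h *\<^sub>R v) + \<phi> z) \<bullet> b
      = h * (h * (D\<^sub>2 (z + s *\<^sub>R u + t *\<^sub>R v) u v \<bullet> b))"
proof -
  define p where "p = (\<lambda>s. (\<phi> (z + h *\<^sub>R v + s *\<^sub>R u) - \<phi> (z + s *\<^sub>R u)) \<bullet> b)"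
  have dp: "(p has_real_derivative (D\<^sub>1 (z + h *\<^sub>R v + s *\<^sub>R u) u - D\<^sub>1 (z + s *\<^sub>R u) u) \<bullet> b) (at s)" for s
  proof -
    have "((\<lambda>s. \<phi> (z + h *\<^sub>R v + s *\<^sub>R u) - \<phi> (z + s *\<^sub>R u)) has_vector_derivative
        D\<^sub>1 (z + h *\<^sub>R v + s *\<^sub>R u) u - D\<^sub>1 (z + s *\<^sub>R u) u) (at s)"
      by (intro has_vector_derivative_diff line_has_derivative D1_has_derivative)
    from bounded_linear.has_vector_derivative[OF bounded_linear_inner_left[of b] this]
    show ?thesis by (simp add: p_def has_real_derivative_iff_has_vector_derivative)
  qed
  obtain s where s: "0 < s" "s < h" "p h - p 0 = (h - 0) * ((D\<^sub>1 (z + h *\<^sub>R v + s *\<^sub>R u) u - D\<^sub>1 (z + s *\<^sub>R u) u) \<bullet> b)"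
    using MVT2[OF h, of p "\<lambda>s. (D\<^sub>1 (z + h *\<^sub>R v + s *\<^sub>R u) u - D\<^sub>1 (z + s *\<^sub>R u) u) \<bullet> b"] dp by blast
  define r where "r = (\<lambda>t. D\<^sub>1 (z + s *\<^sub>R u + t *\<^sub>R v) u \<bullet> b)"
  have dr: "(r has_real_derivative (D\<^sub>2 (z + s *\<^sub>R u + t *\<^sub>R v) u v \<bullet> b)) (at t)" for t
  proof -
    have "((\<lambda>t. D\<^sub>1 (z + s *\<^sub>R u + t *\<^sub>R v) u) has_vector_derivative D\<^sub>2 (z + s *\<^sub>R u + t *\<^sub>R v) u v) (at t)"
      by (intro line_has_derivative D2_has_derivative)
    from bounded_linear.has_vector_derivative[OF bounded_linear_inner_left[of b] this]
    show ?thesis by (simp add: r_def has_real_derivative_iff_has_vector_derivative)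
  qed
  obtain t where t: "0 < t" "t < h" "r h - r 0 = (h - 0) * (D\<^sub>2 (z + s *\<^sub>R u + t *\<^sub>R v) u v \<bullet> b)"
    using MVT2[OF h, of r "\<lambda>t. D\<^sub>2 (z + s *\<^sub>R u + t *\<^sub>R v) u v \<bullet> b"] dr by blast
  have "r h - r 0 = (D\<^sub>1 (z + h *\<^sub>R v + s *\<^sub>R u) u - D\<^sub>1 (z + s *\<^sub>R u) u) \<bullet> b"
    by (simp add: r_def inner_diff_left add.assoc add.commute[of "h *\<^sub>R v"])
  then have "p h - p 0 = h * (h * (D\<^sub>2 (z + s *\<^sub>R u + t *\<^sub>R v) u v \<bullet> b))"
    using s(3) t(3) by simp
  moreover have "p h - p 0 = (\<phi> (z + h *\<^sub>R u + h *\<^sub>R v) - \<phi> (z + h *\<^sub>R u) - \<phi> (z + h *\<^sub>R v) + \<phi> z) \<bullet> b"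
    by (simp add: p_def inner_diff_left inner_add_left add.assoc add.commute[of "h *\<^sub>R v"])
  ultimately show thesis using that[of s t] s t by simp
qed

text \<open>The second difference is symmetric in \<open>u\<close> and \<open>v\<close>, and by
  continuity it determines the second derivative as \<open>h\<close> shrinks. The symmetry is what
  later identifies the derivative of an image vector along the Reeb orbit with the derivative of the
  image Reeb field in the direction of that vector.\<close>

lemma D2_symmetric: "D\<^sub>2 z u v = D\<^sub>2 z v u"
proof (rule euclidean_eqI, rule ccontr)
  fix b :: 'b assume "D\<^sub>2 z u v \<bullet> b \<noteq> D\<^sub>2 z v u \<bullet> b"
  define e where "e = \<bar>D\<^sub>2 z u v \<bullet> b - D\<^sub>2 z v u \<bullet> b\<bar> / 2"
  have e: "0 < e" using \<open>D\<^sub>2 z u v \<bullet> b \<noteq> D\<^sub>2 z v u \<bullet> b\<close> by (simp add: e_def)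
  have close: "\<exists>d>0. \<forall>s t. 0 < s \<longrightarrow> s < d \<longrightarrow> 0 < t \<longrightarrow> t < d \<longrightarrow>
      \<bar>D\<^sub>2 (z + s *\<^sub>R u + t *\<^sub>R v) u' v' \<bullet> b - D\<^sub>2 z u' v' \<bullet> b\<bar> < e" for u' v' u v
  proof -
    define q where "q = (\<lambda>x::real\<times>real. D\<^sub>2 (z + fst x *\<^sub>R u + snd x *\<^sub>R v) u' v' \<bullet> b)"
    have "continuous_on UNIV q"
      unfolding q_def
      by (intro continuous_intros continuous_on_compose2[OF D2_continuous]) auto
    then have "isCont q 0" by (simp add: continuous_on_eq_continuous_at)
    then obtain d where d: "d > 0" "\<And>x. dist x 0 < d \<Longrightarrow> dist (q x) (q 0) < e"
      using e unfolding continuous_at_eps_delta by blast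
    show ?thesis
    proof (intro exI[of _ "d / 2"] conjI allI impI)
      fix s t :: real assume st: "0 < s" "s < d / 2" "0 < t" "t < d / 2"
      have "norm (s, t) \<le> norm s + norm t" by (rule norm_Pair_le)
      then have "dist (s, t) 0 < d" using st by simp
      from d(2)[OF this] show "\<bar>D\<^sub>2 (z + s *\<^sub>R u + t *\<^sub>R v) u' v' \<bullet> b - D\<^sub>2 z u' v' \<bullet> b\<bar> < e"
        by (simp add: q_def dist_real_def)
    qed (use d in simp)
  qed
  obtain d1 where d1: "d1 > 0" "\<And>s t. 0 < s \<Longrightarrow> s < d1 \<Longrightarrow> 0 < t \<Longrightarrow> t < d1 \<Longrightarrow>
      \<bar>D\<^sub>2 (z + s *\<^sub>R u + t *\<^sub>R v) u v \<bullet> b - D\<^sub>2 z u v \<bullet> b\<bar> < e"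
    using close[of u v u v] by blast
  obtain d2 where d2: "d2 > 0" "\<And>s t. 0 < s \<Longrightarrow> s < d2 \<Longrightarrow> 0 < t \<Longrightarrow> t < d2 \<Longrightarrow>
      \<bar>D\<^sub>2 (z + s *\<^sub>R v + t *\<^sub>R u) v u \<bullet> b - D\<^sub>2 z v u \<bullet> b\<bar> < e"
    using close[of v u v u] by blast
  define h where "h = min d1 d2"
  have h: "0 < h" "h \<le> d1" "h \<le> d2" using d1 d2 by (auto simp: h_def)
  obtain s t where st: "0 < s" "s < h" "0 < t" "t < h"
    "(\<phi> (z + h *\<^sub>R u + h *\<^sub>R v) - \<phi> (z + h *\<^sub>R u) - \<phi> (z + h *\<^sub>R v) + \<phi> z) \<bullet> b
      = h * (h * (D\<^sub>2 (z + s *\<^sub>R u + t *\<^sub>R v) u v \<bullet> b))"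
    by (rule second_difference[OF h(1)])
  obtain s' t' where st': "0 < s'" "s' < h" "0 < t'" "t' < h"
    "(\<phi> (z + h *\<^sub>R v + h *\<^sub>R u) - \<phi> (z + h *\<^sub>R v) - \<phi> (z + h *\<^sub>R u) + \<phi> z) \<bullet> b
      = h * (h * (D\<^sub>2 (z + s' *\<^sub>R v + t' *\<^sub>R u) v u \<bullet> b))"
    by (rule second_difference[OF h(1)])
  have "z + h *\<^sub>R v + h *\<^sub>R u = z + h *\<^sub>R u + h *\<^sub>R v" by simp
  then have "h * (h * (D\<^sub>2 (z + s *\<^sub>R u + t *\<^sub>R v) u v \<bullet> b)) = h * (h * (D\<^sub>2 (z + s' *\<^sub>R v + t' *\<^sub>R u) v u \<bullet> b))"
    using st(5) st'(5) by (simp add: algebra_simps)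
  then have "D\<^sub>2 (z + s *\<^sub>R u + t *\<^sub>R v) u v \<bullet> b = D\<^sub>2 (z + s' *\<^sub>R v + t' *\<^sub>R u) v u \<bullet> b" using h(1) by simp
  moreover have "\<bar>D\<^sub>2 (z + s *\<^sub>R u + t *\<^sub>R v) u v \<bullet> b - D\<^sub>2 z u v \<bullet> b\<bar> < e"
    using st h by (intro d1) auto
  moreover have "\<bar>D\<^sub>2 (z + s' *\<^sub>R v + t' *\<^sub>R u) v u \<bullet> b - D\<^sub>2 z v u \<bullet> b\<bar> < e"
    using st' h by (intro d2) auto
  ultimately show False unfolding e_def by (simp add: abs_if split: if_splits)
qed

lemma D1_Basis: "D\<^sub>1 z u = (\<Sum>b\<in>Basis. (u \<bullet> b) *\<^sub>R D\<^sub>1 z b)"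
proof -
  have "D\<^sub>1 z (\<Sum>b\<in>Basis. (u \<bullet> b) *\<^sub>R b) = (\<Sum>b\<in>Basis. (u \<bullet> b) *\<^sub>R D\<^sub>1 z b)"
    by (simp add: linear_sum[OF D1_linear] linear_cmul[OF D1_linear])
  then show ?thesis by (simp add: euclidean_representation)
qed

lemma D2_Basis: "D\<^sub>2 z u v = (\<Sum>b\<in>Basis. (u \<bullet> b) *\<^sub>R D\<^sub>2 z b v)"
proof -
  have "((\<lambda>z. \<Sum>b\<in>Basis. (u \<bullet> b) *\<^sub>R D\<^sub>1 z b) has_derivative (\<lambda>v. \<Sum>b\<in>Basis. (u \<bullet> b) *\<^sub>R D\<^sub>2 z b v)) (at z)"
    by (intro has_derivative_sum has_derivative_scaleR_right D2_has_derivative)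
  then have "((\<lambda>z. D\<^sub>1 z u) has_derivative (\<lambda>v. \<Sum>b\<in>Basis. (u \<bullet> b) *\<^sub>R D\<^sub>2 z b v)) (at z)"
    by (simp flip: D1_Basis)
  from has_derivative_unique[OF D2_has_derivative this] show ?thesis by metis
qed

text \<open>The derivative of the differential is available in constant directions, so the moving
  direction is expanded in \<open>Basis\<close> before the product rule is applied.\<close>

lemma D1_vector_derivative:
  assumes z: "(z has_vector_derivative z') (at t)" and u: "(u has_vector_derivative u') (at t)"
  shows "((\<lambda>t. D\<^sub>1 (z t) (u t)) has_vector_derivative D\<^sub>2 (z t) (u t) z' + D\<^sub>1 (z t) u') (at t)"
proof -
  have D: "((\<lambda>t. D\<^sub>1 (z t) b) has_vector_derivative D\<^sub>2 (z t) b z') (at t)" for b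
  proof -
    have "((\<lambda>t. D\<^sub>1 (z t) b) has_derivative (\<lambda>h. D\<^sub>2 (z t) b (h *\<^sub>R z'))) (at t)"
      using has_derivative_compose[OF z[unfolded has_vector_derivative_def] D2_has_derivative] .
    then show ?thesis
      using linear_cmul[OF has_derivative_linear[OF D2_has_derivative]] by (simp add: has_vector_derivative_def)
  qed
  have "((\<lambda>t. \<Sum>b\<in>Basis. (u t \<bullet> b) *\<^sub>R D\<^sub>1 (z t) b) has_vector_derivative
      (\<Sum>b\<in>Basis. (u t \<bullet> b) *\<^sub>R D\<^sub>2 (z t) b z' + (u' \<bullet> b) *\<^sub>R D\<^sub>1 (z t) b)) (at t)"
  proof (rule has_vector_derivative_sum)
    fix b :: 'a
    have "((\<lambda>t. u t \<bullet> b) has_vector_derivative (u' \<bullet> b)) (at t)"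
      by (rule bounded_linear.has_vector_derivative[OF bounded_linear_inner_left u])
    then have "((\<lambda>t. u t \<bullet> b) has_field_derivative (u' \<bullet> b)) (at t)"
      by (simp add: has_real_derivative_iff_has_vector_derivative)
    from has_vector_derivative_scaleR[OF this D]
    show "((\<lambda>t. (u t \<bullet> b) *\<^sub>R D\<^sub>1 (z t) b) has_vector_derivative
      ((u t \<bullet> b) *\<^sub>R D\<^sub>2 (z t) b z' + (u' \<bullet> b) *\<^sub>R D\<^sub>1 (z t) b)) (at t)" .
  qed
  moreover have "(\<Sum>b\<in>Basis. (u t \<bullet> b) *\<^sub>R D\<^sub>2 (z t) b z' + (u' \<bullet> b) *\<^sub>R D\<^sub>1 (z t) b) = D\<^sub>2 (z t) (u t) z' + D\<^sub>1 (z t) u'"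
    by (simp add: sum.distrib D2_Basis[of "z t" "u t"] D1_Basis[of "z t" u'])
  ultimately show ?thesis by (simp flip: D1_Basis)
qed

lemma D1_continuous:
  assumes "continuous_on S z" "continuous_on S u"
  shows "continuous_on S (\<lambda>x. D\<^sub>1 (z x) (u x))"
proof -
  have "continuous_on S (\<lambda>x. \<Sum>b\<in>Basis. (u x \<bullet> b) *\<^sub>R D\<^sub>1 (z x) b)"
    by (intro continuous_intros assms continuous_on_compose2[OF smooth_on_imp_continuous[OF D1_smooth] assms(1)]) auto
  then show ?thesis by (simp flip: D1_Basis)
qed

end

section \<open>Continuous phases and the complex determinant of a frame\<close>

text \<open>Near \<open>t\<close> the logarithm \<open>g\<close> coincides with
  \<open>g t + Ln (f s / f t)\<close>: both have the same exponential, and continuity keeps the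
  imaginary part of \<open>g s - g t\<close> below \<open>pi\<close>, within the principal
  branch.\<close>

lemma continuous_log_has_derivative:
  fixes f g :: "real \<Rightarrow> complex"
  assumes f: "(f has_vector_derivative f') (at t)" and g: "continuous_on UNIV g" "\<And>t. f t = exp (g t)"
  shows "(g has_vector_derivative f' / f t) (at t)"
proof -
  have ft: "f t \<noteq> 0" using g(2) by simp
  define q where "q = (\<lambda>s. f s / f t)"
  have q: "(q has_vector_derivative f' / f t) (at t)"
    unfolding q_def using has_vector_derivative_mult_left[OF f, of "inverse (f t)"] by (simp add: divide_inverse)
  have "(Ln has_field_derivative inverse (q t)) (at (q t))"
    by (rule has_field_derivative_Ln) (use ft in \<open>simp add: q_def\<close>)
  then have "((\<lambda>s. Ln (q s)) has_vector_derivative (f' / f t * inverse (q t))) (at t)"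
    using field_vector_diff_chain_at[OF q] by (simp add: o_def)
  then have L: "((\<lambda>s. g t + Ln (q s)) has_vector_derivative f' / f t) (at t)"
    using ft by (auto simp: q_def intro!: derivative_eq_intros)
  have "isCont g t" using g(1) by (simp add: continuous_on_eq_continuous_at)
  then have "isCont (\<lambda>s. Im (g s - g t)) t"
    by (intro continuous_Im continuous_diff continuous_const)
  then obtain d where d: "d > 0" "\<And>s. dist s t < d \<Longrightarrow> dist (Im (g s - g t)) (Im (g t - g t)) < pi"
    unfolding continuous_at_eps_delta using pi_gt_zero by blast
  have "g t + Ln (q s) = g s" if "s \<in> ball t d" for s
  proof -
    have "\<bar>Im (g s - g t)\<bar> < pi" using d(2)[of s] that by (simp add: dist_real_def dist_commute)
    then have "Ln (exp (g s - g t)) = g s - g t" by (intro Ln_exp) auto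
    moreover have "q s = exp (g s - g t)" by (simp add: q_def g(2) exp_diff)
    ultimately show ?thesis by simp
  qed
  then show ?thesis
    using L d(1) unfolding has_vector_derivative_def
    by (elim has_derivative_transform_within_open[where s = "ball t d"]) auto
qed

lemma Im_continuous_log_mono:
  fixes f f' g :: "real \<Rightarrow> complex"
  assumes f: "\<And>t. (f has_vector_derivative f' t) (at t)" and g: "continuous_on UNIV g" "\<And>t. f t = exp (g t)"
    and pos: "\<And>t. 0 \<le> Im (f' t * cnj (f t))" and ab: "a \<le> b"
  shows "Im (g a) \<le> Im (g b)"
proof (rule DERIV_nonneg_imp_nondecreasing[OF ab])
  fix t
  have "((\<lambda>t. Im (g t)) has_vector_derivative Im (f' t / f t)) (at t)"
    by (rule bounded_linear.has_vector_derivative[OF bounded_linear_Im continuous_log_has_derivative[OF f g]])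
  moreover have "0 \<le> Im (f' t / f t)"
  proof -
    have "Im (f' t / f t) = Im (f' t * cnj (f t)) / (cmod (f t))\<^sup>2"
      by (simp add: complex_div_cnj[of "f' t"])
    then show ?thesis using pos by simp
  qed
  ultimately show "\<exists>y. ((\<lambda>t. Im (g t)) has_real_derivative y) (at t) \<and> 0 \<le> y"
    by (auto simp: has_real_derivative_iff_has_vector_derivative)
qed

definition cdet :: "C2 \<Rightarrow> C2 \<Rightarrow> complex" where
  "cdet a b = fst a * snd b - snd a * fst b"

text \<open>The trace of a positive semidefinite quadratic form with respect to the Gram matrix of a
  Lagrangian frame is nonnegative.\<close>

lemma Im_cdet_derivative_nonneg:
  assumes ab: "omega_std a b = 0"
    and pos: "\<And>x y. 0 \<le> omega_std (x *\<^sub>R a + y *\<^sub>R b) (x *\<^sub>R c + y *\<^sub>R d)"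
  shows "0 \<le> Im ((cdet c b + cdet a d) * cnj (cdet a b))"
proof -
  define s11 s12 s22 where "s11 = omega_std a c" and "s12 = (omega_std a d + omega_std b c) / 2" and "s22 = omega_std b d"
  have s12: "2 * s12 = omega_std a d + omega_std b c" by (simp add: s12_def)
  have form: "0 \<le> x\<^sup>2 * s11 + 2 * x * y * s12 + y\<^sup>2 * s22" for x y
  proof -
    have "omega_std (x *\<^sub>R a + y *\<^sub>R b) (x *\<^sub>R c + y *\<^sub>R d) = x\<^sup>2 * s11 + x * y * (2 * s12) + y\<^sup>2 * s22"
      unfolding s12
      by (simp add: omega_std_add_left omega_std_add_right omega_std_scaleR_left omega_std_scaleR_right
        s11_def s22_def power2_eq_square algebra_simps)
    then show ?thesis using pos[of x y] by (simp add: mult_ac)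
  qed
  have eq: "Im ((cdet c b + cdet a d) * cnj (cdet a b)) = s11 * (b \<bullet> b) - 2 * (a \<bullet> b) * s12 + s22 * (a \<bullet> a)"
  proof -
    have "Im ((cdet c b + cdet a d) * cnj (cdet a b)) =
        omega_std a c * (b \<bullet> b) - (a \<bullet> b) * omega_std b c - (a \<bullet> b) * omega_std a d + omega_std b d * (a \<bullet> a)
         - omega_std a b * (b \<bullet> c) + omega_std a b * (a \<bullet> d)"
      by (simp add: cdet_def omega_std_def inner_prod_def inner_complex_def algebra_simps)
    also have "\<dots> = omega_std a c * (b \<bullet> b) - (a \<bullet> b) * (2 * s12) + omega_std b d * (a \<bullet> a)"
      unfolding s12 using ab by (simp add: algebra_simps)
    finally show ?thesis by (simp add: s11_def s22_def mult_ac)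
  qed
  show ?thesis
  proof (cases "a \<bullet> a = 0")
    case True
    then have "a = 0" by simp
    then show ?thesis by (simp add: cdet_def)
  next
    case False
    then have N: "0 < a \<bullet> a" by simp
    have s11: "0 \<le> s11" using form[of 1 0] by simp
    have cs: "(a \<bullet> b)\<^sup>2 \<le> (a \<bullet> a) * (b \<bullet> b)" by (rule Cauchy_Schwarz_ineq)
    \<comment> \<open>These coefficients form \<open>a \<bullet> a\<close> times the component of
      \<open>b\<close> orthogonal to \<open>a\<close>. The remaining part of the trace is
      \<open>s11\<close> times the Gram determinant of the frame, nonnegative by
      Cauchy-Schwarz.\<close>
    have "0 \<le> (a \<bullet> b)\<^sup>2 * s11 + 2 * (- (a \<bullet> b)) * (a \<bullet> a) * s12 + (a \<bullet> a)\<^sup>2 * s22"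
      using form[of "- (a \<bullet> b)" "a \<bullet> a"] by simp
    also have "\<dots> \<le> ((a \<bullet> a) * (b \<bullet> b)) * s11 + 2 * (- (a \<bullet> b)) * (a \<bullet> a) * s12 + (a \<bullet> a)\<^sup>2 * s22"
      using cs s11 by (intro add_right_mono mult_right_mono) auto
    also have "\<dots> = (a \<bullet> a) * (s11 * (b \<bullet> b) - 2 * (a \<bullet> b) * s12 + s22 * (a \<bullet> a))"
      by (simp add: power2_eq_square algebra_simps)
    finally show ?thesis unfolding eq using N by (simp add: zero_le_mult_iff)
  qed
qed

section \<open>The image of the Reeb field on a convex boundary\<close>

context toric_gauge begin

definition DR :: "C2 \<Rightarrow> C2 \<Rightarrow> C2" where
  "DR z v = (of_real (2 * pi * f1 (tau z)) * \<i> * fst v + of_real (2 * pi * (- tau z * k2 (tau z) * dtau z v)) * \<i> * fst z,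
     of_real (2 * pi * f2 (tau z)) * \<i> * snd v + of_real (2 * pi * ((1 - tau z) * k2 (tau z) * dtau z v)) * \<i> * snd z)"

lemma R_has_derivative:
  assumes "z \<noteq> 0"
  shows "(R has_derivative DR z) (at z)"
proof -
  note d1 = has_derivative_of_real[OF has_derivative_mult_right[OF f_tau_has_derivative(1)[OF assms], of "2 * pi"]]
  note d2 = has_derivative_of_real[OF has_derivative_mult_right[OF f_tau_has_derivative(2)[OF assms], of "2 * pi"]]
  have "((\<lambda>z. (of_real (2 * pi * f1 (tau z)) * (\<i> * fst z), of_real (2 * pi * f2 (tau z)) * (\<i> * snd z))) has_derivative DR z) (at z)"
    apply (rule has_derivative_eq_rhs)
     apply (rule has_derivative_Pair)
      apply (rule has_derivative_mult[OF d1 has_derivative_mult_right[OF has_derivative_fst[OF has_derivative_ident]]])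
     apply (rule has_derivative_mult[OF d2 has_derivative_mult_right[OF has_derivative_snd[OF has_derivative_ident]]])
    apply (simp add: DR_def fun_eq_iff mult_ac)
    done
  moreover have "R = (\<lambda>z. (of_real (2 * pi * f1 (tau z)) * (\<i> * fst z), of_real (2 * pi * f2 (tau z)) * (\<i> * snd z)))"
    by (simp add: R_def fun_eq_iff mult.assoc)
  ultimately show ?thesis by simp
qed

lemma DR_linear: "z \<noteq> 0 \<Longrightarrow> linear (DR z)"
  using R_has_derivative has_derivative_linear by blast

end

locale convex_symplectic_image = toric_gauge +
  fixes \<phi> :: "C2 \<Rightarrow> C2"
  assumes sympl: "symplectomorphism \<phi>" and conv: "convex (\<phi> ` X_toric Om)"
begin

lemma smooth_\<phi>: "smooth_on UNIV \<phi>" and bij_\<phi>: "bij \<phi>" and smooth_inv_\<phi>: "smooth_on UNIV (inv \<phi>)"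
  using sympl unfolding symplectomorphism_def diffeomorphism_def by auto

abbreviation "D1 \<equiv> D\<^sub>1 \<phi>"
abbreviation "D2 \<equiv> D\<^sub>2 \<phi>"

lemma omega_D1: "omega_std (D1 z u) (D1 z v) = omega_std u v"
  using sympl unfolding symplectomorphism_def D\<^sub>1_def[OF smooth_\<phi>] by simp

lemma D1_inj: "D1 z u = 0 \<Longrightarrow> u = 0"
proof (rule omega_std_nondegenerate)
  fix w assume "D1 z u = 0"
  then have "omega_std (D1 z u) (D1 z w) = 0" by (simp add: omega_std_def)
  then show "omega_std u w = 0" by (simp add: omega_D1)
qed

definition W :: "C2 \<Rightarrow> C2" where "W z = D1 z (R z)"
definition DW :: "C2 \<Rightarrow> C2 \<Rightarrow> C2" where "DW z v = D2 z (R z) v + D1 z (DR z v)"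

text \<open>\<open>W\<close> is the image of the Reeb vector field, so \<open>\<i> W\<close> points inwards along the boundary of the
  convex body, and the body lies on one side of the corresponding hyperplane.\<close>

lemma support_inequality:
  assumes y: "y \<in> Y" and y2: "y2 \<in> Y"
  shows "0 \<le> omega_std (W y) (\<phi> y2 - \<phi> y)"
proof (rule ccontr)
  assume neg: "\<not> ?thesis"
  define w where "w = \<phi> y2 - \<phi> y"
  \<comment> \<open>The preimage of the straight segment from \<open>\<phi> y\<close> to
    \<open>\<phi> y2\<close>. Convexity keeps it in the region where \<open>FF\<close> is at most 1,
    whereas a negative pairing would make \<open>FF\<close> increase strictly from its initial value
    1.\<close>
  define c where "c = (\<lambda>e. inv \<phi> (\<phi> y + e *\<^sub>R w))"
  define v where "v = frechet_derivative (inv \<phi>) (at (\<phi> y)) w"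
  have c0: "c 0 = y" using bij_\<phi> by (simp add: c_def inv_f_f bij_is_inj)
  have l: "((\<lambda>e. \<phi> y + e *\<^sub>R w) has_derivative (\<lambda>e. e *\<^sub>R w)) (at 0)"
    by (auto intro!: derivative_eq_intros)
  have di: "(inv \<phi> has_derivative frechet_derivative (inv \<phi>) (at (\<phi> y))) (at (\<phi> y))"
    using smooth_on_has_derivative[OF smooth_inv_\<phi>] by simp
  have dc: "(c has_derivative (\<lambda>e. e *\<^sub>R v)) (at 0)"
    unfolding c_def v_def
    using has_derivative_compose[OF l, of "inv \<phi>" "frechet_derivative (inv \<phi>) (at (\<phi> y))"] di linear_cmul[OF has_derivative_linear[OF di]] by simp
  have pc: "\<phi> (c e) = \<phi> y + e *\<^sub>R w" for e
    using bij_\<phi> by (simp add: c_def surj_f_inv_f bij_is_surj)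
  have "((\<lambda>e. \<phi> (c e)) has_derivative (\<lambda>e. D1 y (e *\<^sub>R v))) (at 0)"
    using has_derivative_compose[OF dc, of \<phi>] D1_has_derivative[OF smooth_\<phi>] c0 by simp
  then have "((\<lambda>e. \<phi> y + e *\<^sub>R w) has_derivative (\<lambda>e. D1 y (e *\<^sub>R v))) (at 0)" by (simp add: pc)
  from has_derivative_unique[OF l this] have "1 *\<^sub>R w = D1 y (1 *\<^sub>R v)" by metis
  then have w: "w = D1 y v" by simp
  have XY: "Y \<subseteq> X_toric Om" by (auto simp: X_eq Y_def)
  have cX: "FF (c e) \<le> 1" if "0 \<le> e" "e \<le> 1" for e
  proof -
    have "(1 - e) *\<^sub>R \<phi> y + e *\<^sub>R \<phi> y2 \<in> \<phi> ` X_toric Om"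
      using conv that y y2 XY unfolding convex_alt by blast
    moreover have "(1 - e) *\<^sub>R \<phi> y + e *\<^sub>R \<phi> y2 = \<phi> (c e)" by (simp add: pc w_def algebra_simps)
    ultimately have "c e \<in> X_toric Om" using bij_\<phi> by (auto simp: bij_def dest: injD)
    then show ?thesis by (simp add: X_eq)
  qed
  have "((\<lambda>e. FF (c e)) has_derivative (\<lambda>e. - omega_std (R y) (e *\<^sub>R v))) (at 0)"
    using has_derivative_compose[OF dc, of FF "\<lambda>v. - omega_std (R y) v"] FF_has_derivative[OF Y_nonzero[OF y]] c0
    by (simp only: omega_R) simp
  then have "((\<lambda>e. FF (c e)) has_real_derivative - omega_std (R y) v) (at 0)"
    unfolding has_field_derivative_def
    by (rule has_derivative_eq_rhs) (simp add: omega_std_scaleR_right fun_eq_iff)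
  moreover have "- omega_std (R y) v > 0"
    using neg omega_D1[of y "R y" v] by (simp add: W_def w_def[symmetric] w)
  ultimately obtain d where d: "d > 0" "\<And>h. h > 0 \<Longrightarrow> h < d \<Longrightarrow> FF (c 0) < FF (c (0 + h))"
    using DERIV_pos_inc_right by blast
  define h where "h = min (d / 2) 1"
  have "FF (c 0) < FF (c h)" using d(2)[of h] d(1) by (simp add: h_def)
  moreover have "FF (c h) \<le> 1" using d(1) by (intro cX) (auto simp: h_def)
  moreover have "FF (c 0) = 1" using y by (simp add: c0 Y_def)
  ultimately show False by simp
qed

text \<open>The sum of the support inequalities at the two points: the normal field of a convex
  boundary is a monotone map.\<close>

lemma monotonicity:
  assumes y: "y \<in> Y" and y2: "y2 \<in> Y"
  shows "omega_std (\<phi> y2 - \<phi> y) (W y2 - W y) \<ge> 0"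
  using support_inequality[OF y y2] support_inequality[OF y2 y]
  by (simp add: omega_std_diff_left omega_std_diff_right omega_std_commute[of "W _"])

text \<open>Monotonicity along a curve in \<open>Y\<close>, divided by the square of the parameter,
  passes to the limit. The result is semidefiniteness of the second fundamental form, obtained by
  differentiating the normal field \<open>W\<close> once.\<close>

lemma curvature_nonneg:
  assumes y: "y \<in> Y" and v: "v \<in> tangent_space Y y"
  shows "0 \<le> omega_std (D1 y v) (DW y v)"
proof -
  obtain c \<epsilon> where c: "0 < \<epsilon>" "c ` {-\<epsilon><..<\<epsilon>} \<subseteq> Y" "c (0::real) = y" "(c has_vector_derivative v) (at 0)"
    using v unfolding tangent_space_def mem_Collect_eq by (elim exE conjE) (rule that; assumption)
  have dR: "((\<lambda>t. R (c t)) has_vector_derivative DR y v) (at 0)"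
  proof -
    have "((\<lambda>t. R (c t)) has_derivative (\<lambda>t. DR y (t *\<^sub>R v))) (at 0)"
      using has_derivative_compose[OF c(4)[unfolded has_vector_derivative_def], of R] R_has_derivative[OF Y_nonzero[OF y]] c(3) by simp
    then show ?thesis
      using linear_cmul[OF DR_linear[OF Y_nonzero[OF y]]] by (simp add: has_vector_derivative_def)
  qed
  have dW: "((\<lambda>t. W (c t)) has_vector_derivative DW y v) (at 0)"
    unfolding W_def DW_def using D1_vector_derivative[OF smooth_\<phi> c(4) dR] c(3) by simp
  have d\<phi>: "((\<lambda>t. \<phi> (c t)) has_vector_derivative D1 y v) (at 0)"
  proof -
    have "((\<lambda>t. \<phi> (c t)) has_derivative (\<lambda>t. D1 y (t *\<^sub>R v))) (at 0)"
      using has_derivative_compose[OF c(4)[unfolded has_vector_derivative_def], of \<phi>] D1_has_derivative[OF smooth_\<phi>] c(3) by simp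
    then show ?thesis
      using linear_cmul[OF D1_linear[OF smooth_\<phi>]] by (simp add: has_vector_derivative_def)
  qed
  have t1: "((\<lambda>h. (\<phi> (c h) - \<phi> y) /\<^sub>R h) \<longlongrightarrow> D1 y v) (at 0)"
    using d\<phi> c(3) unfolding has_vector_derivative_iff_tendsto by simp
  have t2: "((\<lambda>h. (W (c h) - W y) /\<^sub>R h) \<longlongrightarrow> DW y v) (at 0)"
    using dW c(3) unfolding has_vector_derivative_iff_tendsto by simp
  have lim: "((\<lambda>h. omega_std ((\<phi> (c h) - \<phi> y) /\<^sub>R h) ((W (c h) - W y) /\<^sub>R h)) \<longlongrightarrow> omega_std (D1 y v) (DW y v)) (at 0)"
    unfolding omega_std_def by (intro tendsto_intros t1 t2)
  have "eventually (\<lambda>h. h \<in> {-\<epsilon><..<\<epsilon>}) (at (0::real))"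
    by (rule eventually_at_in_open') (use c(1) in auto)
  then have "eventually (\<lambda>h. 0 \<le> omega_std ((\<phi> (c h) - \<phi> y) /\<^sub>R h) ((W (c h) - W y) /\<^sub>R h)) (at 0)"
  proof eventually_elim
    case (elim h)
    then have "c h \<in> Y" using c(2) by auto
    have "omega_std ((\<phi> (c h) - \<phi> y) /\<^sub>R h) ((W (c h) - W y) /\<^sub>R h) = (inverse h)\<^sup>2 * omega_std (\<phi> (c h) - \<phi> y) (W (c h) - W y)"
      by (simp add: omega_std_scaleR_left omega_std_scaleR_right power2_eq_square)
    then show ?case using monotonicity[OF y \<open>c h \<in> Y\<close>] by simp
  qed
  then show ?thesis using tendsto_lowerbound[OF lim] by simp
qed

end

lemma cdet_norm: "(cmod (cdet a b))\<^sup>2 = (a \<bullet> a) * (b \<bullet> b) - (a \<bullet> b)\<^sup>2 - (omega_std a b)\<^sup>2"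
  unfolding cmod_power2
  by (simp add: cdet_def omega_std_def inner_prod_def inner_complex_def power2_eq_square algebra_simps)

text \<open>On a Lagrangian pair the squared modulus of \<open>cdet\<close> is the Gram determinant,
  which vanishes only for dependent vectors.\<close>

lemma cdet_Lagrangian_nonzero:
  assumes "omega_std a b = 0" "a \<noteq> 0" "\<And>c. b \<noteq> c *\<^sub>R a"
  shows "cdet a b \<noteq> 0"
proof
  assume "cdet a b = 0"
  then have *: "(a \<bullet> b)\<^sup>2 = (a \<bullet> a) * (b \<bullet> b)" using cdet_norm[of a b] assms(1) by simp
  define c where "c = (a \<bullet> b) / (a \<bullet> a)"
  have N: "a \<bullet> a \<noteq> 0" using assms(2) by simp
  have "(b - c *\<^sub>R a) \<bullet> (b - c *\<^sub>R a) = b \<bullet> b - 2 * c * (a \<bullet> b) + c\<^sup>2 * (a \<bullet> a)"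
    by (simp add: inner_diff_left inner_diff_right inner_commute power2_eq_square algebra_simps)
  also have "\<dots> = b \<bullet> b - (a \<bullet> b)\<^sup>2 / (a \<bullet> a)"
    using N by (simp add: c_def power2_eq_square field_simps)
  also have "\<dots> = 0" using * N by simp
  finally have "b = c *\<^sub>R a" by simp
  then show False using assms(3) by blast
qed

lemma bounded_linear_inverse_injective:
  fixes f :: "'a::euclidean_space \<Rightarrow> 'a"
  assumes "linear f" "\<And>x. f x = 0 \<Longrightarrow> x = 0"
  shows "\<exists>g. bounded_linear g \<and> (\<forall>x. g (f x) = x) \<and> (\<forall>x. f (g x) = x)"
proof -
  have "inj f" using assms by (simp add: linear_injective_0)
  then obtain g where "linear g" "\<And>x. g (f x) = x" "\<And>x. f (g x) = x"
    using linear_injective_isomorphism[OF assms(1)] by blast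
  then show ?thesis using linear_conv_bounded_linear by blast
qed

section \<open>The phase of the Lagrangian frame along the exceptional orbit\<close>

context convex_symplectic_image begin

lemma no_negative_rotation: "k1 1 \<noteq> 3 * k 1"
proof
  assume k3: "k1 1 = 3 * k 1"
  have k1p: "0 < k 1" using k_pos01[of 1] by simp
  have f: "f1 1 = - 2 * k 1" "f2 1 = k 1" using k3 by (simp_all add: f1_def f2_def)
  define c where "c = 2 * pi * k 1"
  have c: "0 < c" using k1p by (simp add: c_def)
  define r where "r = rad2 1"
  have r: "0 < r" using k1p by (simp add: r_def rad2_def)
  define \<gamma> :: "real \<Rightarrow> C2" where "\<gamma> = (\<lambda>t. (0, of_real r * cis (c * t)))"
  define u1 :: "real \<Rightarrow> C2" where "u1 = (\<lambda>t. (0, of_real c * \<i> * (of_real r * cis (c * t))))"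
  \<comment> \<open>A normal vector carried along by the linearised Reeb flow: it rotates with the
    frequency \<open>2 * pi * f1 1 = - 2 * c\<close>, while the orbit itself runs with the frequency
    \<open>c\<close>.\<close>
  define u2 :: "real \<Rightarrow> C2" where "u2 = (\<lambda>t. (cis (- 2 * c * t), 0))"
  have \<gamma>t: "\<gamma> t = torus (1, 0, c * t)" for t
    by (simp add: \<gamma>_def torus_def rad1_def r_def)
  have \<gamma>Y: "\<gamma> t \<in> Y" "tau (\<gamma> t) = 1" for t
    unfolding \<gamma>t by (simp_all add: torus_Y)
  have \<gamma>0: "\<gamma> t \<noteq> 0" for t using Y_nonzero[OF \<gamma>Y(1)] .
  have R\<gamma>: "R (\<gamma> t) = u1 t" for t
    unfolding R_def \<gamma>Y(2) f by (simp add: \<gamma>_def u1_def c_def)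
  have d\<gamma>: "(\<gamma> has_vector_derivative u1 t) (at t)" for t
  proof -
    have "((\<lambda>t. cis (c * t) * of_real r) has_vector_derivative (of_real c * \<i> * (cis (c * t) * of_real r))) (at t)"
      by (rule cis_has_vector_derivative)
    then have "((\<lambda>t. (0::complex, cis (c * t) * of_real r)) has_vector_derivative (0, of_real c * \<i> * (cis (c * t) * of_real r))) (at t)"
      by (intro has_vector_derivative_Pair has_vector_derivative_const)
    then show ?thesis unfolding \<gamma>_def u1_def by (simp add: mult.commute)
  qed
  have du2: "(u2 has_vector_derivative DR (\<gamma> t) (u2 t)) (at t)" for t
  proof -
    have "((\<lambda>t. cis ((- 2 * c) * t) * 1) has_vector_derivative (of_real (- 2 * c) * \<i> * (cis ((- 2 * c) * t) * 1))) (at t)"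
      by (rule cis_has_vector_derivative)
    then have "((\<lambda>t. (cis ((- 2 * c) * t) * 1, 0::complex)) has_vector_derivative (of_real (- 2 * c) * \<i> * (cis ((- 2 * c) * t) * 1), 0)) (at t)"
      by (intro has_vector_derivative_Pair has_vector_derivative_const)
    moreover have "DR (\<gamma> t) (u2 t) = (of_real (- 2 * c) * \<i> * (cis ((- 2 * c) * t) * 1), 0)"
    proof -
      have "dtau (\<gamma> t) (u2 t) = 0" by (simp add: dtau_def inner_C2 \<gamma>_def u2_def)
      then show ?thesis unfolding DR_def \<gamma>Y(2) f by (simp add: u2_def c_def)
    qed
    ultimately show ?thesis unfolding u2_def by simp
  qed
  have dR: "((\<lambda>t. R (\<gamma> t)) has_vector_derivative DR (\<gamma> t) (R (\<gamma> t))) (at t)" for t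
  proof -
    have "((\<lambda>t. R (\<gamma> t)) has_derivative (\<lambda>h. DR (\<gamma> t) (h *\<^sub>R u1 t))) (at t)"
      by (rule has_derivative_compose[OF d\<gamma>[unfolded has_vector_derivative_def] R_has_derivative[OF \<gamma>0]])
    then show ?thesis
      using linear_cmul[OF DR_linear[OF \<gamma>0]] by (simp add: has_vector_derivative_def R\<gamma>)
  qed
  have om12: "omega_std (u1 t) (u2 t) = 0" for t by (simp add: omega_std_def u1_def u2_def)
  have tang: "x *\<^sub>R u1 t + y *\<^sub>R u2 t \<in> tangent_space Y (\<gamma> t)" for x y t
    unfolding tangent_space_omega[OF \<gamma>Y(1)] mem_Collect_eq R\<gamma>
    by (simp add: omega_std_add_right omega_std_scaleR_right omega_std_self om12)
  \<comment> \<open>Undoing the differential at the origin makes the frame at scale 0 exactly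
    \<open>(u1, u2)\<close>. Being symplectic, \<open>L\<close> keeps frames Lagrangian and
    preserves the sign of the curvature form.\<close>
  obtain L where L: "bounded_linear L" "\<And>x. L (D1 0 x) = x" "\<And>x. D1 0 (L x) = x"
    using bounded_linear_inverse_injective[of "D1 0", OF D1_linear[OF smooth_\<phi>]] D1_inj[of 0] by blast
  have Llin: "linear L" using L(1) by (rule bounded_linear.linear)
  have omL: "omega_std (L x) (L y) = omega_std x y" for x y
    using omega_D1[of 0 "L x" "L y"] by (simp add: L(3))
  have LD_inj: "L (D1 z x) = 0 \<Longrightarrow> x = 0" for z x
    using L(3)[of "D1 z x"] D1_inj[of z x] linear_0[OF D1_linear[OF smooth_\<phi>, of 0]] by simp
  \<comment> \<open>The first parameter scales only the base point \<open>\<gamma>\<close>, while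
    the frame \<open>(u1, u2)\<close> stays as it is. Scale 1 is the actual orbit, scale 0 the
    linear model at the origin, and \<open>H\<close> never vanishes in between.\<close>
  define H where "H = (\<lambda>p::real\<times>real. cdet (L (D1 (fst p *\<^sub>R \<gamma> (snd p)) (u1 (snd p)))) (L (D1 (fst p *\<^sub>R \<gamma> (snd p)) (u2 (snd p)))))"
  have c\<gamma>: "continuous_on UNIV \<gamma>" and cu1: "continuous_on UNIV u1" and cu2: "continuous_on UNIV u2"
    unfolding \<gamma>_def u1_def u2_def cis_conv_exp by (intro continuous_intros)+
  have cH: "continuous_on UNIV H"
  proof -
    have s: "continuous_on UNIV (\<lambda>p::real\<times>real. snd p)" by (intro continuous_intros)
    have z: "continuous_on UNIV (\<lambda>p::real\<times>real. fst p *\<^sub>R \<gamma> (snd p))"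
      by (intro continuous_intros continuous_on_compose2[OF c\<gamma> s]) auto
    have a: "continuous_on UNIV (\<lambda>p::real\<times>real. L (D1 (fst p *\<^sub>R \<gamma> (snd p)) (u1 (snd p))))"
      by (intro bounded_linear.continuous_on[OF L(1)] D1_continuous[OF smooth_\<phi>] z continuous_on_compose2[OF cu1 s]) auto
    have b: "continuous_on UNIV (\<lambda>p::real\<times>real. L (D1 (fst p *\<^sub>R \<gamma> (snd p)) (u2 (snd p))))"
      by (intro bounded_linear.continuous_on[OF L(1)] D1_continuous[OF smooth_\<phi>] z continuous_on_compose2[OF cu2 s]) auto
    show ?thesis unfolding H_def cdet_def by (intro continuous_intros a b)
  qed
  have H0: "H p \<noteq> 0" for p
    unfolding H_def
  proof (rule cdet_Lagrangian_nonzero)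
    let ?z = "fst p *\<^sub>R \<gamma> (snd p)" and ?t = "snd p"
    show "omega_std (L (D1 ?z (u1 ?t))) (L (D1 ?z (u2 ?t))) = 0"
      by (simp add: omL omega_D1 om12)
    show "L (D1 ?z (u1 ?t)) \<noteq> 0"
    proof
      assume "L (D1 ?z (u1 ?t)) = 0"
      then have "u1 ?t = 0" by (rule LD_inj)
      then show False using c r by (simp add: u1_def zero_prod_def)
    qed
    show "L (D1 ?z (u2 ?t)) \<noteq> s *\<^sub>R L (D1 ?z (u1 ?t))" for s
    proof
      assume "L (D1 ?z (u2 ?t)) = s *\<^sub>R L (D1 ?z (u1 ?t))"
      then have "L (D1 ?z (u2 ?t - s *\<^sub>R u1 ?t)) = 0"
        by (simp add: linear_diff[OF D1_linear[OF smooth_\<phi>]] linear_cmul[OF D1_linear[OF smooth_\<phi>]] linear_diff[OF Llin] linear_cmul[OF Llin])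
      then have "u2 ?t - s *\<^sub>R u1 ?t = 0" by (rule LD_inj)
      then show False by (simp add: u1_def u2_def zero_prod_def)
    qed
  qed
  obtain g where g: "continuous_on UNIV g" "\<And>p. H p = exp (g p)"
    using continuous_logarithm_on_contractible[OF cH convex_imp_contractible[OF convex_UNIV]] H0 by (metis UNIV_I)
  define T where "T = 2 * pi / c"
  have T: "0 < T" "c * T = 2 * pi" using c by (simp_all add: T_def)
  have cisT: "cis (c * T) = 1" "cis (- 2 * c * T) = 1"
  proof -
    show "cis (c * T) = 1" by (simp add: T)
    have "- 2 * c * T = - 2 * (c * T)" by simp
    also have "\<dots> = 2 * pi * (- 2)" unfolding T(2) by simp
    finally have e: "- 2 * c * T = 2 * pi * (- 2)" .
    show "cis (- 2 * c * T) = 1" unfolding e cis_eq_1_Ints by simp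
  qed
  \<comment> \<open>The number of turns of the determinant over one period of the orbit, at scale
    \<open>\<sigma>\<close>. The loop closes because the frequency of \<open>u2\<close> is an
    integer multiple of that of the orbit.\<close>
  define d where "d = (\<lambda>\<sigma>. Im (g (\<sigma>, T) - g (\<sigma>, 0)) / (2 * pi))"
  have "d \<sigma> \<in> \<int>" for \<sigma>
  proof -
    have "H (\<sigma>, T) = H (\<sigma>, 0)"
      using cisT by (simp add: H_def \<gamma>_def u1_def u2_def)
    then have "exp (g (\<sigma>, T)) = exp (g (\<sigma>, 0))" by (simp add: g(2))
    then obtain n :: int where "g (\<sigma>, T) = g (\<sigma>, 0) + (of_int (2 * n) * pi) * \<i>" unfolding exp_eq by blast
    then have "d \<sigma> = of_int n" by (simp add: d_def)
    then show ?thesis by simp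
  qed
  moreover have "continuous_on UNIV d"
  proof -
    have "continuous_on UNIV (\<lambda>\<sigma>. g (\<sigma>, T))" "continuous_on UNIV (\<lambda>\<sigma>. g (\<sigma>, 0))"
      by (rule continuous_on_compose2[OF g(1)]; auto intro!: continuous_intros)+
    then show ?thesis unfolding d_def by (intro continuous_intros) auto
  qed
  ultimately have d01: "d 1 = d 0" by (intro Ints_valued_constant[of UNIV d]) auto
  \<comment> \<open>In the linear model the determinant is a constant times the product of the two
    rotations, of total frequency \<open>c - 2 * c = - c\<close>.\<close>
  have d0: "d 0 = - 1"
  proof -
    have Hc: "exp (g (0, t)) = cis (- c * t) * H (0, 0)" for t
    proof -
      have "H (0, t) = cdet (u1 t) (u2 t)" for t by (simp add: H_def L(2))
      moreover have "cdet (u1 t) (u2 t) = - (of_real c * \<i> * of_real r) * (cis (c * t) * cis (- 2 * c * t))" for t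
        by (simp add: cdet_def u1_def u2_def)
      moreover have "cis (c * t) * cis (- 2 * c * t) = cis (- c * t)" by (simp add: cis_mult)
      ultimately show ?thesis by (simp add: g(2)[symmetric])
    qed
    define e where "e = (\<lambda>t. (Im (g (0, t)) + c * t) / (2 * pi) - Im (g (0, 0)) / (2 * pi))"
    have "e t \<in> \<int>" for t
    proof -
      have "exp (g (0, t)) = cis (- c * t) * exp (g (0, 0))"
        using Hc[of t] by (simp only: g(2))
      also have "cis (- c * t) = exp (- \<i> * of_real (c * t))" by (simp add: cis_conv_exp)
      finally have "exp (g (0, t)) = exp (- \<i> * of_real (c * t) + g (0, 0))" by (simp only: exp_add)
      then obtain n :: int where n: "g (0, t) = (- \<i> * of_real (c * t) + g (0, 0)) + (of_int (2 * n) * pi) * \<i>" unfolding exp_eq by blast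
      have "Im (g (0, t)) = - (c * t) + Im (g (0, 0)) + 2 * of_int n * pi"
        unfolding n by simp
      then have "(Im (g (0, t)) + c * t) - Im (g (0, 0)) = of_int n * (2 * pi)" by simp
      then have "((Im (g (0, t)) + c * t) - Im (g (0, 0))) / (2 * pi) = of_int n" by simp
      then have "e t = of_int n" by (simp add: e_def diff_divide_distrib)
      then show ?thesis by simp
    qed
    moreover have "continuous_on UNIV e"
    proof -
      have "continuous_on UNIV (\<lambda>t. g (0, t))"
        by (rule continuous_on_compose2[OF g(1)]) (auto intro!: continuous_intros)
      then show ?thesis unfolding e_def by (intro continuous_intros) auto
    qed
    ultimately have "e T = e 0" by (intro Ints_valued_constant[of UNIV e]) auto
    then have "(Im (g (0, T)) + c * T) / (2 * pi) = Im (g (0, 0)) / (2 * pi)" by (simp add: e_def)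
    then have "Im (g (0, T)) + c * T = Im (g (0, 0))" using pi_gt_zero by simp
    then have "Im (g (0, T)) - Im (g (0, 0)) = - (2 * pi)" using T(2) by linarith
    then show ?thesis by (simp add: d_def)
  qed
  define a where "a = (\<lambda>t. L (D1 (\<gamma> t) (u1 t)))"
  define b where "b = (\<lambda>t. L (D1 (\<gamma> t) (u2 t)))"
  define a' where "a' = (\<lambda>t. L (DW (\<gamma> t) (u1 t)))"
  define b' where "b' = (\<lambda>t. L (DW (\<gamma> t) (u2 t)))"
  have da: "(a has_vector_derivative a' t) (at t)" for t
    unfolding a_def a'_def DW_def
    using bounded_linear.has_vector_derivative[OF L(1) D1_vector_derivative[OF smooth_\<phi> d\<gamma> dR]] by (simp add: R\<gamma>)
  \<comment> \<open>The product rule along the orbit yields the second derivative with arguments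
    \<open>u2\<close>, \<open>u1\<close>, whereas \<open>DW\<close> contains it with arguments
    \<open>u1\<close>, \<open>u2\<close>; symmetry reconciles them.\<close>
  have db: "(b has_vector_derivative b' t) (at t)" for t
    unfolding b_def b'_def DW_def R\<gamma> D2_symmetric[OF smooth_\<phi>, of "\<gamma> t" "u1 t"]
    by (rule bounded_linear.has_vector_derivative[OF L(1) D1_vector_derivative[OF smooth_\<phi> d\<gamma> du2]])
  have df: "((\<lambda>t. cdet (a t) (b t)) has_vector_derivative cdet (a' t) (b t) + cdet (a t) (b' t)) (at t)" for t
  proof -
    note a1 = bounded_linear.has_vector_derivative[OF bounded_linear_fst da]
      and a2 = bounded_linear.has_vector_derivative[OF bounded_linear_snd da]
      and b1 = bounded_linear.has_vector_derivative[OF bounded_linear_fst db]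
      and b2 = bounded_linear.has_vector_derivative[OF bounded_linear_snd db]
    show ?thesis unfolding cdet_def
      using has_vector_derivative_diff[OF has_vector_derivative_mult[OF a1 b2] has_vector_derivative_mult[OF a2 b1]]
      by (simp add: algebra_simps)
  qed
  have nonneg: "0 \<le> Im ((cdet (a' t) (b t) + cdet (a t) (b' t)) * cnj (cdet (a t) (b t)))" for t
  proof (rule Im_cdet_derivative_nonneg)
    show "omega_std (a t) (b t) = 0" by (simp add: a_def b_def omL omega_D1 om12)
    fix x y
    have lDW: "DW (\<gamma> t) (x *\<^sub>R u1 t + y *\<^sub>R u2 t) = x *\<^sub>R DW (\<gamma> t) (u1 t) + y *\<^sub>R DW (\<gamma> t) (u2 t)"
      using has_derivative_linear[OF D2_has_derivative[OF smooth_\<phi>]] DR_linear[OF \<gamma>0] D1_linear[OF smooth_\<phi>]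
      by (simp add: DW_def linear_add linear_cmul scaleR_add_right)
    have "0 \<le> omega_std (D1 (\<gamma> t) (x *\<^sub>R u1 t + y *\<^sub>R u2 t)) (DW (\<gamma> t) (x *\<^sub>R u1 t + y *\<^sub>R u2 t))"
      by (rule curvature_nonneg[OF \<gamma>Y(1) tang])
    also have "\<dots> = omega_std (L (D1 (\<gamma> t) (x *\<^sub>R u1 t + y *\<^sub>R u2 t))) (L (DW (\<gamma> t) (x *\<^sub>R u1 t + y *\<^sub>R u2 t)))"
      by (simp add: omL)
    also have "\<dots> = omega_std (x *\<^sub>R a t + y *\<^sub>R b t) (x *\<^sub>R a' t + y *\<^sub>R b' t)"
      unfolding lDW a_def b_def a'_def b'_def
      by (simp add: linear_add[OF D1_linear[OF smooth_\<phi>]] linear_cmul[OF D1_linear[OF smooth_\<phi>]] linear_add[OF Llin] linear_cmul[OF Llin])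
    finally show "0 \<le> omega_std (x *\<^sub>R a t + y *\<^sub>R b t) (x *\<^sub>R a' t + y *\<^sub>R b' t)" .
  qed
  have cg1: "continuous_on UNIV (\<lambda>t. g (1, t))"
    by (rule continuous_on_compose2[OF g(1)]) (auto intro!: continuous_intros)
  have "cdet (a t) (b t) = exp (g (1, t))" for t
    by (simp add: g(2)[symmetric] H_def a_def b_def)
  then have "Im (g (1, 0)) \<le> Im (g (1, T))"
    using Im_continuous_log_mono[OF df cg1 _ nonneg] T(1) by simp
  then have "0 \<le> d 1" by (simp add: d_def)
  then show False using d01 d0 by simp
qed

end

lemma (in toric_gauge) not_symplectically_convex:
  assumes "k1 1 = 3 * k 1"
  shows "\<not> symplectically_convex (X_toric Om)"
proof
  assume "symplectically_convex (X_toric Om)"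
  then obtain \<phi> where "symplectomorphism \<phi>" "convex (\<phi> ` X_toric Om)"
    unfolding symplectically_convex_def by blast
  then interpret convex_symplectic_image k I \<phi> by unfold_locales
  show False using no_negative_rotation assms by simp
qed

section \<open>Approximation by gauge functions\<close>

lemma continuous_moment_map: "continuous_on UNIV moment_map"
  unfolding moment_map_def by (intro continuous_intros)

text \<open>Segments from the origin and rays to infinity are connected, so they can leave or
  re-enter \<open>X\<close> only through the single frontier point on their ray. Normalisation maps
  the compact frontier continuously and bijectively to the sphere; its inverse is continuous, and
  the norm of the inverse is the radius.\<close>

lemma star_shaped_radius:
  fixes X :: "'a::euclidean_space set"
  assumes X: "compact X" "0 \<in> interior X"
    and ray: "\<And>u. u \<noteq> 0 \<Longrightarrow> \<exists>!t. 0 \<le> t \<and> t *\<^sub>R u \<in> frontier X"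
  obtains r where "continuous_on (sphere 0 1) r" "\<And>u. u \<in> sphere 0 1 \<Longrightarrow> 0 < r u"
    "\<And>u s. u \<in> sphere 0 1 \<Longrightarrow> 0 \<le> s \<Longrightarrow> s *\<^sub>R u \<in> X \<longleftrightarrow> s \<le> r u"
proof -
  define r where "r = (\<lambda>u. THE t. 0 \<le> t \<and> t *\<^sub>R u \<in> frontier X)"
  have nz: "u \<noteq> 0" if "u \<in> sphere 0 (1::real)" for u :: 'a using that by auto
  have r: "0 \<le> r u" "r u *\<^sub>R u \<in> frontier X" if "u \<noteq> 0" for u
    using theI'[OF ray[OF that]] by (simp_all add: r_def)
  have ru: "t = r u" if "u \<noteq> 0" "0 \<le> t" "t *\<^sub>R u \<in> frontier X" for t u
    using ray[OF that(1)] that r[OF that(1)] by blast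
  have F0: "0 \<notin> frontier X" using X(2) by (simp add: frontier_def)
  have rpos: "0 < r u" if "u \<noteq> 0" for u
    using r[OF that] F0 by (cases "r u = 0") auto
  have closed: "closed X" using X(1) by (rule compact_imp_closed)
  have FX: "frontier X \<subseteq> X" using closed by (rule frontier_subset_closed)
  have inside: "s *\<^sub>R u \<in> X" if u: "u \<noteq> 0" and s: "0 \<le> s" "s < r u" for u s
  proof (rule ccontr)
    assume "s *\<^sub>R u \<notin> X"
    define S where "S = (\<lambda>t. t *\<^sub>R u) ` {0..s}"
    have "connected S"
      unfolding S_def by (intro connected_continuous_image continuous_intros) auto
    moreover have "S \<inter> X \<noteq> {}" using X(2) interior_subset s by (force simp: S_def)
    moreover have "S - X \<noteq> {}" using \<open>s *\<^sub>R u \<notin> X\<close> s by (force simp: S_def)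
    ultimately have "S \<inter> frontier X \<noteq> {}" by (rule connected_Int_frontier)
    then obtain t where "0 \<le> t" "t \<le> s" "t *\<^sub>R u \<in> frontier X" by (auto simp: S_def)
    then show False using ru[OF u, of t] s by simp
  qed
  have outside: "s *\<^sub>R u \<notin> X" if u: "u \<noteq> 0" and s: "r u < s" for u s
  proof
    assume sX: "s *\<^sub>R u \<in> X"
    define S where "S = (\<lambda>t. t *\<^sub>R u) ` {s..}"
    have "connected S"
      unfolding S_def by (intro connected_continuous_image continuous_intros) auto
    moreover have "S \<inter> X \<noteq> {}" using sX by (force simp: S_def)
    moreover have "S - X \<noteq> {}"
    proof -
      obtain B where B: "0 < B" "\<forall>x\<in>X. norm x \<le> B" using compact_imp_bounded[OF X(1)] bounded_pos by blast
      define t where "t = max s ((B + 1) / norm u)"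
      have "norm (t *\<^sub>R u) \<ge> (B + 1) / norm u * norm u"
        using u rpos[OF u] s by (simp add: t_def abs_of_pos mult_right_mono del: times_divide_eq_left)
      then have "norm (t *\<^sub>R u) > B" using u by simp
      then have "t *\<^sub>R u \<notin> X" using B(2) by force
      moreover have "t *\<^sub>R u \<in> S" unfolding S_def by (intro imageI) (simp add: t_def)
      ultimately show ?thesis by blast
    qed
    ultimately have "S \<inter> frontier X \<noteq> {}" by (rule connected_Int_frontier)
    then obtain t where "s \<le> t" "t *\<^sub>R u \<in> frontier X" by (auto simp: S_def)
    then show False using ru[OF u, of t] s rpos[OF u] by simp
  qed
  define f where "f = (\<lambda>y::'a. y /\<^sub>R norm y)"
  have Fnz: "y \<noteq> 0" if "y \<in> frontier X" for y using that F0 by auto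
  have "continuous_on (f ` frontier X) (\<lambda>u. r u *\<^sub>R u)"
  proof (rule continuous_on_inv)
    show "continuous_on (frontier X) f"
      unfolding f_def using Fnz by (intro continuous_intros) auto
    show "compact (frontier X)" using X(1) by (rule compact_frontier)
    show "\<forall>x\<in>frontier X. r (f x) *\<^sub>R f x = x"
    proof
      fix y assume y: "y \<in> frontier X"
      then have y0: "y \<noteq> 0" by (rule Fnz)
      have "norm y = r (f y)"
        by (rule ru) (use y0 y in \<open>auto simp: f_def\<close>)
      then show "r (f y) *\<^sub>R f y = y" using y0 by (simp add: f_def)
    qed
  qed
  moreover have "f ` frontier X = sphere 0 1"
  proof (intro set_eqI iffI)
    fix u :: 'a assume u: "u \<in> sphere 0 1"
    then have "f (r u *\<^sub>R u) = u" using rpos[OF nz[OF u]] by (simp add: f_def)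
    then show "u \<in> f ` frontier X" using r(2)[OF nz[OF u]] by (metis imageI)
  qed (use Fnz in \<open>auto simp: f_def\<close>)
  ultimately have "continuous_on (sphere 0 1) (\<lambda>u. r u *\<^sub>R u)" by simp
  then have "continuous_on (sphere 0 1) (\<lambda>u. norm (r u *\<^sub>R u))" by (rule continuous_on_norm)
  then have "continuous_on (sphere 0 1) r"
    by (rule continuous_on_eq) (use rpos nz in \<open>auto simp: abs_of_pos\<close>)
  then show thesis
  proof (rule that)
    show "0 < r u" if "u \<in> sphere 0 1" for u using rpos[OF nz[OF that]] .
    show "s *\<^sub>R u \<in> X \<longleftrightarrow> s \<le> r u" if "u \<in> sphere 0 1" "0 \<le> s" for u s
      using inside[OF nz[OF that(1)] that(2)] outside[OF nz[OF that(1)], of s] r(2)[OF nz[OF that(1)]] FX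
      by (cases s "r u" rule: linorder_cases) auto
  qed
qed

text \<open>Membership depends on the moduli of the two coordinates only, so each point may be
  rotated to a multiple of the real unit vector with squared entries \<open>1 - t\<close> and
  \<open>t\<close>. Thus \<open>h\<close> is \<open>\<pi>\<close> times the squared radius along
  this arc.\<close>

lemma star_shaped_toric_polar:
  assumes "star_shaped_toric \<Omega>"
  obtains h where "continuous_on {0..1} h" "\<And>t. t \<in> {0..1} \<Longrightarrow> 0 < h t"
    "X_toric \<Omega> = {z. pi * (z \<bullet> z) \<le> h ((snd z \<bullet> snd z) / (z \<bullet> z))}"
proof -
  define X where "X = X_toric \<Omega>"
  have Om: "compact \<Omega>" "\<exists>\<epsilon>>0. ball 0 \<epsilon> \<inter> quadrant \<subseteq> \<Omega>"
    and ray: "\<And>u. u \<noteq> 0 \<Longrightarrow> \<exists>!t. 0 \<le> t \<and> t *\<^sub>R u \<in> frontier X"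
    using assms unfolding star_shaped_toric_def toric_region_def star_shaped_def X_def by auto
  have mm: "moment_map z \<in> quadrant" for z by (simp add: quadrant_def moment_map_def)
  have cX: "compact X"
  proof -
    have "closed X" unfolding X_def X_toric_def
      using continuous_moment_map compact_imp_closed[OF Om(1)] by (simp add: closed_vimage)
    moreover have "bounded X"
    proof -
      obtain B where B: "\<forall>w\<in>\<Omega>. norm w \<le> B" using compact_imp_bounded[OF Om(1)] unfolding bounded_iff by blast
      have "norm z \<le> sqrt (2 * B)" if "z \<in> X" for z
      proof -
        have n: "norm (moment_map z) \<le> B" using that B by (simp add: X_def X_toric_def)
        have "pi * (cmod (fst z))\<^sup>2 \<le> B" "pi * (cmod (snd z))\<^sup>2 \<le> B"
          using norm_fst_le[of "pi * (cmod (fst z))\<^sup>2" "pi * (cmod (snd z))\<^sup>2"]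
            norm_snd_le[of "pi * (cmod (snd z))\<^sup>2" "pi * (cmod (fst z))\<^sup>2"] n
          by (simp_all add: moment_map_def)
        moreover have "1 * (cmod (fst z))\<^sup>2 \<le> pi * (cmod (fst z))\<^sup>2" "1 * (cmod (snd z))\<^sup>2 \<le> pi * (cmod (snd z))\<^sup>2"
          using pi_gt3 by (intro mult_right_mono; simp)+
        ultimately have "(norm z)\<^sup>2 \<le> 2 * B" by (simp add: norm_prod_def)
        then show ?thesis by (rule real_le_rsqrt)
      qed
      then show ?thesis unfolding bounded_iff by blast
    qed
    ultimately show ?thesis using compact_eq_bounded_closed by blast
  qed
  have X0: "0 \<in> interior X"
  proof -
    obtain \<epsilon> where \<epsilon>: "0 < \<epsilon>" "ball 0 \<epsilon> \<inter> quadrant \<subseteq> \<Omega>" using Om(2) by blast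
    have "open (moment_map -` ball 0 \<epsilon>)" using continuous_moment_map by (simp add: open_vimage)
    moreover have "0 \<in> moment_map -` ball 0 \<epsilon>" using \<epsilon>(1) by (simp add: moment_map_def flip: zero_prod_def)
    moreover have "moment_map -` ball 0 \<epsilon> \<subseteq> X"
    proof
      fix z assume "z \<in> moment_map -` ball 0 \<epsilon>"
      then have "moment_map z \<in> ball 0 \<epsilon> \<inter> quadrant" using mm by blast
      then have "moment_map z \<in> \<Omega>" using \<epsilon>(2) by blast
      then show "z \<in> X" by (simp add: X_def X_toric_def)
    qed
    ultimately show ?thesis by (rule interiorI)
  qed
  obtain r where r: "continuous_on (sphere 0 1) r" "\<And>u. u \<in> sphere 0 1 \<Longrightarrow> 0 < r u"
    "\<And>u s. u \<in> sphere 0 1 \<Longrightarrow> 0 \<le> s \<Longrightarrow> s *\<^sub>R u \<in> X \<longleftrightarrow> s \<le> r u"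
    using star_shaped_radius[OF cX X0 ray] by metis
  define u :: "real \<Rightarrow> C2" where "u = (\<lambda>t. (of_real (sqrt (1 - t)), of_real (sqrt t)))"
  have us: "u t \<in> sphere 0 1" if "t \<in> {0..1}" for t
    using that by (simp add: u_def norm_prod_def)
  have cu: "continuous_on {0..1} u" unfolding u_def by (intro continuous_intros)
  define h where "h = (\<lambda>t. pi * (r (u t))\<^sup>2)"
  have "continuous_on {0..1} h"
    unfolding h_def by (intro continuous_intros continuous_on_compose2[OF r(1) cu]) (use us in auto)
  moreover have hp: "0 < h t" if "t \<in> {0..1}" for t
    using r(2)[OF us[OF that]] by (simp add: h_def)
  moreover have memX: "z \<in> X \<longleftrightarrow> pi * (z \<bullet> z) \<le> h ((snd z \<bullet> snd z) / (z \<bullet> z))" for z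
  proof -
    define t where "t = (snd z \<bullet> snd z) / (z \<bullet> z)"
    have t: "t \<in> {0..1}"
    proof -
      have "snd z \<bullet> snd z \<le> z \<bullet> z" by (simp add: inner_prod_def)
      then show ?thesis by (cases "z = 0") (simp_all add: t_def divide_le_eq_1)
    qed
    have tz: "t * (z \<bullet> z) = snd z \<bullet> snd z" by (cases "z = 0") (simp_all add: t_def)
    then have tz': "(1 - t) * (z \<bullet> z) = fst z \<bullet> fst z" by (simp add: left_diff_distrib inner_prod_def)
    have "moment_map z = moment_map (norm z *\<^sub>R u t)"
      using t tz tz' by (simp add: moment_map_def u_def norm_mult power_mult_distrib power2_norm_eq_inner)
        (simp add: mult.commute)
    then have "z \<in> X \<longleftrightarrow> norm z *\<^sub>R u t \<in> X" by (simp add: X_def X_toric_def)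
    also have "\<dots> \<longleftrightarrow> norm z \<le> r (u t)" by (rule r(3)[OF us[OF t]]) simp
    also have "\<dots> \<longleftrightarrow> (norm z)\<^sup>2 \<le> (r (u t))\<^sup>2"
      using r(2)[OF us[OF t]] by (simp add: power2_le_iff_abs_le)
    also have "\<dots> \<longleftrightarrow> pi * (z \<bullet> z) \<le> h t" by (simp add: h_def power2_norm_eq_inner)
    finally show ?thesis by (simp add: t_def)
  qed
  have "X_toric \<Omega> = {z. pi * (z \<bullet> z) \<le> h ((snd z \<bullet> snd z) / (z \<bullet> z))}"
    by (rule set_eqI) (simp only: mem_Collect_eq X_def[symmetric] memX)
  ultimately show thesis using that[of h] hp by blast
qed

section \<open>Smooth gauges with prescribed slope at the endpoint\<close>

lemma smooth_on_real_polynomial_function: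
  "real_polynomial_function (g :: real \<Rightarrow> real) \<Longrightarrow> smooth_on UNIV g"
  by (induction rule: real_polynomial_function.induct)
     (auto intro: smooth_on_bounded_linear smooth_on_const smooth_on_add smooth_on_mult)

lemma smooth_DERIV:
  fixes f :: "real \<Rightarrow> real"
  assumes "smooth_on UNIV f"
  shows "(f has_real_derivative deriv f x) (at x)" "continuous_on UNIV (deriv f)"
proof -
  show d: "(f has_real_derivative deriv f x) (at x)" for x
    using smooth_on_has_derivative[OF assms, of x]
    by (auto simp: DERIV_deriv_iff_real_differentiable differentiable_def)
  have "deriv f x = frechet_derivative f (at x) 1" for x
  proof -
    have "frechet_derivative f (at x) = (*) (deriv f x)"
      using d[of x] unfolding has_field_derivative_def by (rule frechet_derivative_at[symmetric])
    then show ?thesis by simp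
  qed
  then have "deriv f = (\<lambda>x. frechet_derivative f (at x) 1)" by auto
  then show "continuous_on UNIV (deriv f)"
    using smooth_on_imp_continuous[OF smooth_on_frechet_derivative[OF assms, of 1]] by simp
qed

text \<open>Weierstrass approximation, followed by adding a small multiple of a high power of the variable
  in order to prescribe the logarithmic derivative at the endpoint.\<close>

lemma smooth_approximation:
  fixes q :: "real \<Rightarrow> real"
  assumes q: "continuous_on {0..1} q" and e: "0 < e"
  obtains k0 where "smooth_on UNIV k0" "\<And>t. t \<in> {0..1} \<Longrightarrow> \<bar>k0 t - q t\<bar> < e" "deriv k0 1 = 3 * k0 1"
proof -
  obtain p where p: "real_polynomial_function p" "\<And>t. t \<in> {0..1} \<Longrightarrow> \<bar>q t - p t\<bar> < e / 2"
    using Stone_Weierstrass_real_polynomial_function[OF compact_Icc q, of "e / 2"] e by auto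
  have sp: "smooth_on UNIV p" by (rule smooth_on_real_polynomial_function[OF p(1)])
  \<comment> \<open>Adding \<open>\<beta> * t ^ N\<close> raises the derivative at 1 by
    \<open>\<beta> * N\<close> and the value by \<open>\<beta>\<close>, so the endpoint condition
    reads \<open>\<beta> * (N - 3) = a\<close>. A large \<open>N\<close> makes
    \<open>\<beta>\<close> small, and the 4 in \<open>N\<close> keeps \<open>N - 3\<close>
    positive.\<close>
  define a where "a = 3 * p 1 - deriv p 1"
  obtain n :: nat where n: "2 * \<bar>a\<bar> / e < real n" using reals_Archimedean2 by blast
  define N where "N = n + 4"
  define \<beta> where "\<beta> = a / (real N - 3)"
  have N3: "real N - 3 > 0" by (simp add: N_def)
  have \<beta>: "\<bar>\<beta>\<bar> < e / 2"
  proof -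
    have "2 * \<bar>a\<bar> / e < real N - 3" using n by (simp add: N_def)
    then show ?thesis using e N3 by (simp add: \<beta>_def field_simps)
  qed
  define k0 where "k0 = (\<lambda>t. p t + \<beta> * t ^ N)"
  have s: "smooth_on UNIV k0"
    unfolding k0_def by (intro smooth_intros sp open_UNIV)
  have "(k0 has_real_derivative deriv p 1 + \<beta> * (real N * 1 ^ (N - 1))) (at 1)"
    unfolding k0_def by (auto intro!: derivative_eq_intros smooth_DERIV(1)[OF sp])
  then have "deriv k0 1 = deriv p 1 + \<beta> * real N" by (simp add: DERIV_imp_deriv)
  also have "\<dots> = 3 * k0 1"
  proof -
    have "\<beta> * (real N - 3) = a" using N3 by (simp add: \<beta>_def)
    then show ?thesis by (simp add: k0_def a_def algebra_simps)
  qed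
  finally have d: "deriv k0 1 = 3 * k0 1" .
  have "\<bar>k0 t - q t\<bar> < e" if t: "t \<in> {0..1}" for t
  proof -
    have "\<bar>\<beta> * t ^ N\<bar> \<le> \<bar>\<beta>\<bar> * 1"
      unfolding abs_mult using t by (intro mult_left_mono) (auto simp: power_le_one)
    moreover have "k0 t - q t = - (q t - p t) + \<beta> * t ^ N" by (simp add: k0_def)
    ultimately show ?thesis using p(2)[OF t] \<beta> by linarith
  qed
  then show thesis using that s d by blast
qed

text \<open>The gauge of the region is \<open>1 / h\<close>, so this is the function to approximate;
  the closeness is stated for squared radii because these are what the volume integrates.\<close>

lemma gauge_approximation:
  fixes h :: "real \<Rightarrow> real"
  assumes h: "continuous_on {0..1} h" "\<And>t. t \<in> {0..1} \<Longrightarrow> 0 < h t" and \<delta>: "0 < \<delta>"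
  obtains k0 where "smooth_on UNIV k0" "\<And>t. t \<in> {0..1} \<Longrightarrow> 0 < k0 t" "deriv k0 1 = 3 * k0 1"
    "\<And>t. t \<in> {0..1} \<Longrightarrow> \<bar>(h t)\<^sup>2 - (1 / k0 t)\<^sup>2\<bar> < \<delta>"
proof -
  define q where "q = (\<lambda>t. 1 / h t)"
  have cq: "continuous_on {0..1} q"
    unfolding q_def using h by (intro continuous_intros) (auto simp: less_imp_neq[THEN not_sym])
  obtain x where x: "x \<in> {0..1}" "\<forall>t\<in>{0..1}. q t \<le> q x"
    using continuous_attains_sup[OF compact_Icc _ cq] by auto
  obtain y where y: "y \<in> {0..1}" "\<forall>t\<in>{0..1}. q y \<le> q t"
    using continuous_attains_inf[OF compact_Icc _ cq] by auto
  define m where "m = q y"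
  have m: "0 < m" using h(2)[OF y(1)] by (simp add: m_def q_def)
  have "uniformly_continuous_on {m / 2..q x + 1} (\<lambda>x. (1 / x)\<^sup>2)"
    by (intro compact_uniformly_continuous continuous_intros) (use m in auto)
  then obtain d where d: "0 < d" "\<And>a b. a \<in> {m / 2..q x + 1} \<Longrightarrow> b \<in> {m / 2..q x + 1} \<Longrightarrow> dist b a < d \<Longrightarrow> dist ((1 / b)\<^sup>2) ((1 / a)\<^sup>2) < \<delta>"
    using \<delta> unfolding uniformly_continuous_on_def by metis
  \<comment> \<open>The bounds \<open>m / 2\<close> and 1 keep the approximation inside the compact
    interval away from 0 on which \<open>1 / x^2\<close> is uniformly continuous.\<close>
  define e where "e = min d (min (m / 2) 1)"
  have e: "0 < e" using d(1) m by (simp add: e_def)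
  obtain k0 where k0: "smooth_on UNIV k0" "\<And>t. t \<in> {0..1} \<Longrightarrow> \<bar>k0 t - q t\<bar> < e" "deriv k0 1 = 3 * k0 1"
    using smooth_approximation[OF cq e] by blast
  have *: "k0 t \<in> {m / 2..q x + 1}" "q t \<in> {m / 2..q x + 1}" "dist (q t) (k0 t) < d" if t: "t \<in> {0..1}" for t
  proof -
    have "e \<le> d" "e \<le> m / 2" "e \<le> 1" by (simp_all add: e_def)
    moreover have "m \<le> q t" "q t \<le> q x" using x(2) y(2) t by (auto simp: m_def)
    ultimately show "k0 t \<in> {m / 2..q x + 1}" "q t \<in> {m / 2..q x + 1}" "dist (q t) (k0 t) < d"
      using k0(2)[OF t] m unfolding atLeastAtMost_iff dist_real_def by linarith+
  qed
  show thesis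
  proof (rule that[OF k0(1) _ k0(3)])
    fix t :: real assume t: "t \<in> {0..1}"
    show "0 < k0 t" using *(1)[OF t] m by simp
    have "dist ((1 / q t)\<^sup>2) ((1 / k0 t)\<^sup>2) < \<delta>" by (rule d(2)[OF *[OF t]])
    then show "\<bar>(h t)\<^sup>2 - (1 / k0 t)\<^sup>2\<bar> < \<delta>" by (simp add: q_def dist_real_def)
  qed
qed

text \<open>The factor by which the gauge function is modified near the axis \<open>t = 0\<close>. Since
  \<open>2 t - t\<^sup>2\<close> is critical at \<open>t = 1\<close>, the logarithmic derivative there does not change.\<close>

definition notch :: "real \<Rightarrow> real \<Rightarrow> real \<Rightarrow> real" where
  "notch \<kappa> \<epsilon> t = (2 * t - t\<^sup>2 + \<kappa> * \<epsilon>) / (2 * t - t\<^sup>2 + \<epsilon>)"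

section \<open>Estimates for the notch factor\<close>

lemma parabola_bounds:
  fixes t :: real
  assumes "0 \<le> t" "t \<le> 1"
  shows "t \<le> 2 * t - t\<^sup>2" "2 * t - t\<^sup>2 \<le> 2 * t" "0 \<le> 2 * t - t\<^sup>2"
proof -
  have "t * t \<le> t * 1" using assms by (intro mult_left_mono) auto
  then show "t \<le> 2 * t - t\<^sup>2" by (simp add: power2_eq_square)
  then show "0 \<le> 2 * t - t\<^sup>2" using assms by simp
qed simp

lemma notch_pos:
  assumes "0 < \<kappa>" "0 < \<epsilon>" "t \<in> {0..1}"
  shows "0 < notch \<kappa> \<epsilon> t"
  using parabola_bounds[of t] assms unfolding notch_def by (intro divide_pos_pos add_nonneg_pos) auto

lemma notch_continuous:
  assumes "0 < \<kappa>" "0 < \<epsilon>"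
  shows "continuous_on {0..1} (notch \<kappa> \<epsilon>)"
  unfolding notch_def
proof (intro continuous_intros ballI)
  fix t :: real assume "t \<in> {0..1}"
  then show "2 * t - t\<^sup>2 + \<epsilon> \<noteq> 0" using parabola_bounds[of t] assms by auto
qed

text \<open>Dominated convergence: for \<open>t > 0\<close> the notch factor tends to 1, and its
  inverse never exceeds the larger of 1 and \<open>1 / \<kappa>\<close>. At \<open>t = 0\<close> the
  integrand does not depend on \<open>n\<close>, but a single point has measure zero.\<close>

lemma notch_volume_limit:
  fixes k0 :: "real \<Rightarrow> real"
  assumes k0: "continuous_on {0..1} k0" "\<And>t. t \<in> {0..1} \<Longrightarrow> 0 < k0 t" and \<kappa>: "0 < \<kappa>"
  shows "(\<lambda>n. integral {0..1} (\<lambda>t. \<bar>(1 / k0 t)\<^sup>2 - (1 / (k0 t * notch \<kappa> (1 / real (Suc n)) t))\<^sup>2\<bar>)) \<longlonglongrightarrow> 0"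
proof -
  define F where "F = (\<lambda>n (t::real). \<bar>(1 / k0 t)\<^sup>2 - (1 / (k0 t * notch \<kappa> (1 / real (Suc n)) t))\<^sup>2\<bar>)"
  define g where "g = (\<lambda>t::real. if t = 0 then \<bar>(1 / k0 0)\<^sup>2 - (1 / (k0 0 * \<kappa>))\<^sup>2\<bar> else 0)"
  define C where "C = 1 + (max 1 (1 / \<kappa>))\<^sup>2"
  have kn: "k0 t \<noteq> 0" if "t \<in> {0..1}" for t using k0(2)[OF that] by simp
  have Fc: "continuous_on {0..1} (F n)" for n
  proof -
    have "k0 t * notch \<kappa> (1 / real (Suc n)) t \<noteq> 0" if "t \<in> {0..1}" for t
      using notch_pos[OF \<kappa> _ that, of "1 / real (Suc n)"] k0(2)[OF that] by simp
    then show ?thesis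
      unfolding F_def using kn
      by (intro continuous_intros k0 notch_continuous \<kappa>) auto
  qed
  have lim: "(\<lambda>n. F n t) \<longlonglongrightarrow> g t" if t: "t \<in> {0..1}" for t
  proof (cases "t = 0")
    case True
    have "F n 0 = g 0" for n by (simp add: F_def g_def notch_def)
    then show ?thesis using True by simp
  next
    case False
    define u where "u = 2 * t - t\<^sup>2"
    have u: "0 < u" using parabola_bounds(1)[of t] t False by (simp add: u_def)
    have e: "(\<lambda>n. 1 / real (Suc n)) \<longlonglongrightarrow> 0" using LIMSEQ_inverse_real_of_nat by (simp add: inverse_eq_divide)
    have "(\<lambda>n. F n t) \<longlonglongrightarrow> \<bar>(1 / k0 t)\<^sup>2 - (1 / (k0 t * ((u + \<kappa> * 0) / (u + 0))))\<^sup>2\<bar>"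
      unfolding F_def notch_def u_def[symmetric]
      by (intro tendsto_intros e) (use u kn[OF t] in auto)
    then show ?thesis using u False by (simp add: g_def)
  qed
  have bound: "norm (F n t) \<le> C * (1 / k0 t)\<^sup>2" if t: "t \<in> {0..1}" for n t
  proof -
    define u \<epsilon> where "u = 2 * t - t\<^sup>2" and "\<epsilon> = 1 / real (Suc n)"
    have u: "0 \<le> u" using parabola_bounds(3)[of t] t by (simp add: u_def)
    have \<epsilon>: "0 < \<epsilon>" by (simp add: \<epsilon>_def)
    define \<rho> where "\<rho> = 1 / notch \<kappa> \<epsilon> t"
    have \<rho>0: "0 \<le> \<rho>" using notch_pos[OF \<kappa> \<epsilon> t] by (simp add: \<rho>_def)
    have "\<rho> = (u + \<epsilon>) / (u + \<kappa> * \<epsilon>)" by (simp add: \<rho>_def notch_def u_def)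
    moreover have "u + \<epsilon> \<le> max 1 (1 / \<kappa>) * (u + \<kappa> * \<epsilon>)"
    proof -
      have "u \<le> max 1 (1 / \<kappa>) * u" using u by (simp add: mult_le_cancel_right1)
      moreover have "\<epsilon> \<le> max 1 (1 / \<kappa>) * (\<kappa> * \<epsilon>)"
      proof -
        have "(1 / \<kappa>) * (\<kappa> * \<epsilon>) \<le> max 1 (1 / \<kappa>) * (\<kappa> * \<epsilon>)" using \<kappa> \<epsilon> by (intro mult_right_mono) auto
        then show ?thesis using \<kappa> by simp
      qed
      ultimately show ?thesis by (simp add: distrib_left)
    qed
    moreover have "0 < u + \<kappa> * \<epsilon>" using u \<kappa> \<epsilon> by (intro add_nonneg_pos) auto
    ultimately have "\<rho> \<le> max 1 (1 / \<kappa>)" by (simp add: pos_divide_le_eq)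
    then have r2: "\<rho>\<^sup>2 \<le> (max 1 (1 / \<kappa>))\<^sup>2" using \<rho>0 by (intro power_mono) auto
    have "1 / (k0 t * notch \<kappa> \<epsilon> t) = (1 / k0 t) * \<rho>" by (simp add: \<rho>_def)
    then have "F n t = \<bar>(1 / k0 t)\<^sup>2 - ((1 / k0 t) * \<rho>)\<^sup>2\<bar>" by (simp add: F_def \<epsilon>_def)
    also have "\<dots> \<le> (1 / k0 t)\<^sup>2 + (1 / k0 t)\<^sup>2 * \<rho>\<^sup>2"
      unfolding power_mult_distrib by (smt (verit) zero_le_power2 mult_nonneg_nonneg)
    also have "\<dots> \<le> (1 / k0 t)\<^sup>2 + (1 / k0 t)\<^sup>2 * (max 1 (1 / \<kappa>))\<^sup>2"
      using r2 by (intro add_left_mono mult_left_mono) auto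
    also have "\<dots> = C * (1 / k0 t)\<^sup>2" by (simp add: C_def algebra_simps)
    finally show ?thesis by (simp add: F_def)
  qed
  have "(\<lambda>n. integral {0..1} (F n)) \<longlonglongrightarrow> integral {0..1} g"
  proof (rule dominated_convergence(2)[where h = "\<lambda>t. C * (1 / k0 t)\<^sup>2"])
    show "F n integrable_on {0..1}" for n by (rule integrable_continuous_interval[OF Fc])
    show "(\<lambda>t. C * (1 / k0 t)\<^sup>2) integrable_on {0..1}"
      by (intro integrable_continuous_interval continuous_intros k0) (use kn in auto)
  qed (use bound lim in auto)
  moreover have "integral {0..1} g = 0"
  proof -
    have "integral {0..1} g = integral {0..1} (\<lambda>t::real. 0)"
      by (rule integral_spike[of "{0}"]) (auto simp: g_def)
    then show ?thesis by simp
  qed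
  ultimately show ?thesis by (simp add: F_def)
qed

lemma notch_DERIV:
  assumes "0 < \<epsilon>" "t \<in> {0..1}"
  shows "(notch \<kappa> \<epsilon> has_real_derivative ((1 - \<kappa>) * \<epsilon> * (2 - 2 * t) / (2 * t - t\<^sup>2 + \<epsilon>)\<^sup>2)) (at t)"
proof -
  have D: "2 * t - t\<^sup>2 + \<epsilon> \<noteq> 0" using parabola_bounds[of t] assms by auto
  have "((\<lambda>t. (2 * t - t\<^sup>2 + \<kappa> * \<epsilon>) / (2 * t - t\<^sup>2 + \<epsilon>)) has_real_derivative
      ((2 - 2 * t) * (2 * t - t\<^sup>2 + \<epsilon>) - (2 * t - t\<^sup>2 + \<kappa> * \<epsilon>) * (2 - 2 * t)) / ((2 * t - t\<^sup>2 + \<epsilon>) * (2 * t - t\<^sup>2 + \<epsilon>))) (at t)"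
    using D by (auto intro!: derivative_eq_intros)
  moreover have "(2 - 2 * t) * (2 * t - t\<^sup>2 + \<epsilon>) - (2 * t - t\<^sup>2 + \<kappa> * \<epsilon>) * (2 - 2 * t) = (1 - \<kappa>) * \<epsilon> * (2 - 2 * t)"
    by (simp add: algebra_simps)
  ultimately show ?thesis
    unfolding notch_def by (simp add: power2_eq_square)
qed

lemma notched_gauge:
  assumes s0: "smooth_on UNIV k0" and p0: "\<And>t. t \<in> {0..1} \<Longrightarrow> 0 < k0 t" and \<kappa>: "0 < \<kappa>" and \<epsilon>: "0 < \<epsilon>"
  shows "toric_gauge (\<lambda>t. k0 t * notch \<kappa> \<epsilon> t)
    {t. 0 < k0 t \<and> 0 < 2 * t - t\<^sup>2 + \<kappa> * \<epsilon> \<and> 0 < 2 * t - t\<^sup>2 + \<epsilon>}" (is "toric_gauge ?k ?I")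
proof
  have c0: "continuous_on UNIV k0" by (rule smooth_on_imp_continuous[OF s0])
  show o: "open ?I"
    by (intro open_Collect_conj open_Collect_less continuous_intros c0)
  show "{0..1} \<subseteq> ?I"
  proof
    fix t :: real assume t: "t \<in> {0..1}"
    then have "0 \<le> 2 * t - t\<^sup>2" using parabola_bounds[of t] by simp
    moreover have "0 < \<kappa> * \<epsilon>" using \<kappa> \<epsilon> by simp
    ultimately show "t \<in> ?I" using p0[OF t] \<epsilon> by simp
  qed
  show "smooth_on ?I ?k"
    unfolding notch_def
    by (intro smooth_intros smooth_on_mono[OF s0] o) auto
  show "0 < ?k t" if "t \<in> ?I" for t using that by (simp add: notch_def)
qed

text \<open>The constant \<open>4 * A\<close> depends on neither \<kappa> nor \<epsilon>, although
  the slope of the notch at 0 is of order \<open>1 / \<epsilon>\<close>. In \<open>f1\<close> this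
  slope is multiplied by \<open>t\<close>, and \<open>t * m'\<close> is at most 1. In
  \<open>f2\<close> it is not, but \<open>f1\<close> is positive up to a threshold
  \<open>t0\<close>, and beyond \<open>t0\<close> the condition on \<epsilon> makes the slope at
  most 2.\<close>

lemma notched_frequency:
  fixes kk kd :: "real \<Rightarrow> real"
  assumes c0: "0 < c0" and bd: "\<And>t. t \<in> {0..1} \<Longrightarrow> c0 \<le> a t \<and> a t \<le> A \<and> \<bar>b t\<bar> \<le> A"
    and \<kappa>: "0 < \<kappa>" "\<kappa> \<le> 1" and \<epsilon>: "0 < \<epsilon>" "\<epsilon> \<le> (c0 / (8 * A))\<^sup>2" and t: "t \<in> {0..1}"
    and k: "kk t = a t * notch \<kappa> \<epsilon> t"
    and k1: "kd t = b t * notch \<kappa> \<epsilon> t + a t * ((1 - \<kappa>) * \<epsilon> * (2 - 2 * t) / (2 * t - t\<^sup>2 + \<epsilon>)\<^sup>2)"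
  shows "\<bar>kk t - t * kd t\<bar> \<le> 4 * A" "\<bar>kk t\<bar> \<le> 4 * A"
    "kk t - t * kd t = 0 \<Longrightarrow> 0 < t \<and> \<bar>kk t + (1 - t) * kd t\<bar> \<le> 4 * A"
proof -
  have A: "0 < A" "c0 \<le> A" using bd[OF t] c0 by linarith+
  define u where "u = 2 * t - t\<^sup>2"
  define D where "D = u + \<epsilon>"
  define m where "m = notch \<kappa> \<epsilon> t"
  define m' where "m' = (1 - \<kappa>) * \<epsilon> * (2 - 2 * t) / D\<^sup>2"
  have u: "0 \<le> u" "t \<le> u" "u \<le> 2 * t" using parabola_bounds[of t] t by (auto simp: u_def)
  have D: "0 < D" using u \<epsilon> by (simp add: D_def)
  have mD: "m = (u + \<kappa> * \<epsilon>) / D" by (simp add: m_def notch_def u_def D_def)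
  have ke: "0 < \<kappa> * \<epsilon>" "\<kappa> * \<epsilon> \<le> \<epsilon>" using \<kappa> \<epsilon> by (auto simp: mult_le_cancel_right1)
  have m: "0 < m" "m \<le> 1" unfolding mD using u ke D by (auto simp: D_def divide_le_eq_1)
  have m'0: "0 \<le> m'" unfolding m'_def using \<kappa> \<epsilon> t by (intro divide_nonneg_nonneg mult_nonneg_nonneg) auto
  have t2: "t * (2 - 2 * t) \<le> u" using t by (simp add: u_def power2_eq_square algebra_simps)
  have tm': "t * m' \<le> (1 - \<kappa>) * \<epsilon> * u / D\<^sup>2"
  proof -
    have "t * m' = (1 - \<kappa>) * \<epsilon> * (t * (2 - 2 * t)) / D\<^sup>2" by (simp add: m'_def mult_ac)
    also have "\<dots> \<le> (1 - \<kappa>) * \<epsilon> * u / D\<^sup>2"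
      using t2 \<kappa> \<epsilon> by (intro divide_right_mono mult_left_mono) auto
    finally show ?thesis .
  qed
  have tm'1: "t * m' \<le> 1"
  proof -
    have "(1 - \<kappa>) * \<epsilon> * u \<le> 1 * D * D"
      using \<kappa> \<epsilon> u D by (intro mult_mono) (auto simp: D_def intro: mult_nonneg_nonneg)
    then have "(1 - \<kappa>) * \<epsilon> * u / D\<^sup>2 \<le> 1" using D by (simp add: power2_eq_square)
    then show ?thesis using tm' by linarith
  qed
  have ab: "c0 \<le> a t" "0 < a t" "a t \<le> A" "\<bar>b t\<bar> \<le> A" using bd[OF t] c0 by auto
  have km: "kk t = a t * m" "kd t = b t * m + a t * m'"
    by (simp_all add: k k1 m_def m'_def D_def u_def)
  have am: "0 < a t * m" "a t * m \<le> A"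
    using ab m mult_mono[of "a t" A m 1] by auto
  have bm: "\<bar>b t * m\<bar> \<le> A"
    using ab m mult_mono[of "\<bar>b t\<bar>" A m 1] by (auto simp: abs_mult)
  have tbm: "\<bar>t * (b t * m)\<bar> \<le> A"
    using bm t mult_mono[of t 1 "\<bar>b t * m\<bar>" A] by (auto simp: abs_mult)
  have atm: "0 \<le> a t * (t * m')" "a t * (t * m') \<le> A"
    using ab tm'1 m'0 t mult_mono[of "a t" A "t * m'" 1] by auto
  have f1: "kk t - t * kd t = a t * m - t * (b t * m) - a t * (t * m')"
    by (simp add: km algebra_simps)
  show "\<bar>kk t - t * kd t\<bar> \<le> 4 * A" unfolding f1 using am tbm atm by linarith
  show "\<bar>kk t\<bar> \<le> 4 * A" unfolding km using am A by linarith
  assume z: "kk t - t * kd t = 0"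
  \<comment> \<open>With this threshold the term containing \<open>b\<close>, at most
    \<open>6 * t0 * A * Q\<close>, is three quarters of the main term \<open>c0 * Q\<close>, which
    therefore wins for \<open>t \<le> t0\<close>.\<close>
  define t0 where "t0 = c0 / (8 * A)"
  have t0: "0 < t0" "t0 \<le> 1/8" using c0 A by (auto simp: t0_def field_simps)
  have \<epsilon>0: "\<epsilon> \<le> t0\<^sup>2" using \<epsilon>(2) by (simp add: t0_def)
  have t0t: "t0 < t"
  proof (rule ccontr)
    assume "\<not> t0 < t"
    then have uu: "u \<le> 2 * t0" using u by linarith
    have e2: "\<epsilon> \<le> 2 * t0"
    proof -
      have "t0\<^sup>2 \<le> t0 * 1" unfolding power2_eq_square using t0 by (intro mult_left_mono) auto
      then show ?thesis using \<epsilon>0 t0 by linarith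
    qed
    \<comment> \<open>A lower bound for \<open>D^2 * (m - t * m')\<close>: the mixed terms of order
      \<open>\<epsilon> * u\<close> cancel up to a nonnegative remainder. It stays positive at
      \<open>u = 0\<close> because of \<kappa>.\<close>
    define Q where "Q = u\<^sup>2 + \<kappa> * \<epsilon>\<^sup>2"
    have Q: "0 < Q" unfolding Q_def using \<kappa> \<epsilon> by (intro add_nonneg_pos) auto
    have P1: "Q \<le> D\<^sup>2 * (m - t * m')"
    proof -
      have "D\<^sup>2 * (t * m') \<le> (1 - \<kappa>) * \<epsilon> * u" using tm' D by (simp add: field_simps)
      moreover have "D\<^sup>2 * m = (u + \<kappa> * \<epsilon>) * D" using D by (simp add: mD power2_eq_square)
      moreover have "(u + \<kappa> * \<epsilon>) * D - (1 - \<kappa>) * \<epsilon> * u = Q + 2 * \<kappa> * \<epsilon> * u"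
        by (simp add: D_def Q_def power2_eq_square algebra_simps)
      moreover have "0 \<le> 2 * \<kappa> * \<epsilon> * u" using \<kappa> \<epsilon> u by simp
      ultimately show ?thesis unfolding right_diff_distrib by linarith
    qed
    have P2: "D\<^sup>2 * \<bar>t * (b t * m)\<bar> \<le> A * (6 * t0 * Q)"
    proof -
      have "D\<^sup>2 * \<bar>t * (b t * m)\<bar> = \<bar>b t\<bar> * (t * (D\<^sup>2 * m))"
        using t m by (simp add: abs_mult mult_ac)
      also have "\<dots> \<le> A * (u * (D\<^sup>2 * m))"
        using ab u t m by (intro mult_mono mult_nonneg_nonneg) auto
      also have "u * (D\<^sup>2 * m) = u * (u + \<kappa> * \<epsilon>) * D" using D by (simp add: mD power2_eq_square)
      also have "\<dots> = u * u\<^sup>2 + \<epsilon> * u\<^sup>2 + (\<kappa> * \<epsilon>) * u\<^sup>2 + u * (\<kappa> * \<epsilon>\<^sup>2)"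
        by (simp add: D_def power2_eq_square algebra_simps)
      also have "\<dots> \<le> 2 * t0 * u\<^sup>2 + 2 * t0 * u\<^sup>2 + 2 * t0 * u\<^sup>2 + 2 * t0 * (\<kappa> * \<epsilon>\<^sup>2)"
        using uu e2 ke \<kappa> by (intro add_mono mult_right_mono) auto
      also have "\<dots> \<le> 6 * t0 * Q"
      proof -
        have "0 \<le> t0 * (\<kappa> * \<epsilon>\<^sup>2)" using t0 \<kappa> by simp
        then show ?thesis unfolding Q_def by (simp add: algebra_simps)
      qed
      finally show ?thesis using A by (simp add: mult_left_mono)
    qed
    have "a t * Q \<le> a t * (D\<^sup>2 * (m - t * m'))" using P1 ab by (intro mult_left_mono) auto
    moreover have "c0 * Q \<le> a t * Q" using ab Q by (intro mult_right_mono) auto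
    moreover have "A * (6 * t0 * Q) = 3 / 4 * (c0 * Q)" using A by (simp add: t0_def)
    moreover have "D\<^sup>2 * (kk t - t * kd t) = a t * (D\<^sup>2 * (m - t * m')) - D\<^sup>2 * (t * (b t * m))"
      unfolding f1 by (simp add: algebra_simps)
    moreover have "D\<^sup>2 * (t * (b t * m)) \<le> D\<^sup>2 * \<bar>t * (b t * m)\<bar>" by (intro mult_left_mono) auto
    moreover have "0 < c0 * Q" using c0 Q by simp
    ultimately have "0 < D\<^sup>2 * (kk t - t * kd t)" using P2 by linarith
    then show False using z by simp
  qed
  have "m' \<le> 2"
  proof -
    have "t0 \<le> D" using t0t u \<epsilon> by (simp add: D_def)
    then have "\<epsilon> \<le> D\<^sup>2" using \<epsilon>0 t0 power_mono[of t0 D 2] by linarith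
    moreover have "(1 - \<kappa>) * \<epsilon> * (2 - 2 * t) \<le> 1 * \<epsilon> * 2"
      using \<kappa> \<epsilon> t by (intro mult_mono) auto
    ultimately have "(1 - \<kappa>) * \<epsilon> * (2 - 2 * t) \<le> 2 * D\<^sup>2" by linarith
    then show ?thesis unfolding m'_def using D by (simp add: pos_divide_le_eq)
  qed
  then have am': "0 \<le> a t * m'" "a t * m' \<le> A * 2" using ab m'0 mult_mono[of "a t" A m' 2] by auto
  have "\<bar>(1 - t) * kd t\<bar> \<le> 1 * \<bar>kd t\<bar>"
    unfolding abs_mult using t by (intro mult_right_mono) auto
  also have "\<bar>kd t\<bar> \<le> 3 * A" unfolding km using bm am' by linarith
  finally have "\<bar>kk t + (1 - t) * kd t\<bar> \<le> 4 * A" unfolding km(1) using am by linarith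
  then show "0 < t \<and> \<bar>kk t + (1 - t) * kd t\<bar> \<le> 4 * A" using t0t t0 by linarith
qed

section \<open>Assembling the perturbed domains\<close>

text \<open>Hides the gauge behind existential quantifiers, leaving plain inequalities for the final
  choice of parameters: \<open>T\<close> is the minimal period and \<open>V\<close> the contact
  volume. The volume of the symmetric difference is half the integral of the difference of squares,
  hence \<open>d\<close> there and \<open>2 * d\<close> for \<open>V\<close>.\<close>

lemma notched_domain:
  fixes k0 h :: "real \<Rightarrow> real" and \<Omega> :: "(real \<times> real) set"
  assumes s0: "smooth_on UNIV k0" and p0: "\<And>t. t \<in> {0..1} \<Longrightarrow> 0 < k0 t" and d0: "deriv k0 1 = 3 * k0 1"
    and \<kappa>: "0 < \<kappa>" and \<epsilon>: "0 < \<epsilon>"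
    and c0: "0 < c0" and bd: "\<And>t. t \<in> {0..1} \<Longrightarrow> c0 \<le> k0 t \<and> k0 t \<le> A \<and> \<bar>deriv k0 t\<bar> \<le> A"
    and h: "continuous_on {0..1} h" "\<And>t. t \<in> {0..1} \<Longrightarrow> 0 < h t"
    and X: "X_toric \<Omega> = {z. pi * (z \<bullet> z) \<le> h ((snd z \<bullet> snd z) / (z \<bullet> z))}"
    and d: "integral {0..1} (\<lambda>t. \<bar>(1 / (k0 t * notch \<kappa> \<epsilon> t))\<^sup>2 - (h t)\<^sup>2\<bar>) \<le> 2 * d"
  shows "\<exists>\<Omega>' T V. star_shaped_toric \<Omega>' \<and> \<not> symplectically_convex (X_toric \<Omega>') \<and>
    emeasure lborel (sym_diff (X_toric \<Omega>') (X_toric \<Omega>)) \<le> ennreal d \<and>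
    ru \<Omega>' * sqrt (sys \<Omega>') = (1 / (\<kappa> * k0 0) + (1 + \<epsilon>) / ((1 + \<kappa> * \<epsilon>) * k0 1)) * T / V \<and>
    0 \<le> T \<and> T \<le> 1 / (\<kappa> * k0 0) \<and> \<bar>V - integral {0..1} (\<lambda>t. (h t)\<^sup>2)\<bar> \<le> 2 * d \<and> 0 < V \<and>
    (\<kappa> \<le> 1 \<longrightarrow> \<epsilon> \<le> (c0 / (8 * A))\<^sup>2 \<longrightarrow> 1 / (4 * A) \<le> T)"
proof -
  define k where "k = (\<lambda>t. k0 t * notch \<kappa> \<epsilon> t)"
  interpret toric_gauge k "{t. 0 < k0 t \<and> 0 < 2 * t - t\<^sup>2 + \<kappa> * \<epsilon> \<and> 0 < 2 * t - t\<^sup>2 + \<epsilon>}"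
    unfolding k_def by (rule notched_gauge[OF s0 p0 \<kappa> \<epsilon>])
  have k1: "k1 t = deriv k0 t * notch \<kappa> \<epsilon> t + k0 t * ((1 - \<kappa>) * \<epsilon> * (2 - 2 * t) / (2 * t - t\<^sup>2 + \<epsilon>)\<^sup>2)"
    if t: "t \<in> {0..1}" for t
  proof -
    have "(k has_real_derivative deriv k0 t * notch \<kappa> \<epsilon> t + ((1 - \<kappa>) * \<epsilon> * (2 - 2 * t) / (2 * t - t\<^sup>2 + \<epsilon>)\<^sup>2) * k0 t) (at t)"
      unfolding k_def by (rule DERIV_mult[OF smooth_DERIV(1)[OF s0] notch_DERIV[OF \<epsilon> t]])
    then show ?thesis unfolding k1_def by (simp add: DERIV_imp_deriv mult.commute)
  qed
  have nz: "notch \<kappa> \<epsilon> 0 = \<kappa>" "notch \<kappa> \<epsilon> 1 = (1 + \<kappa> * \<epsilon>) / (1 + \<epsilon>)"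
    using \<epsilon> by (simp_all add: notch_def)
  have kv: "k 0 = \<kappa> * k0 0" "1 / k 1 = (1 + \<epsilon>) / ((1 + \<kappa> * \<epsilon>) * k0 1)"
    by (simp_all add: k_def nz mult.commute)
  have k13: "k1 1 = 3 * k 1" using k1[of 1] d0 by (simp add: k_def)
  have kpos: "0 < k t" if "t \<in> {0..1}" for t using k_pos01 that by simp
  have ck: "continuous_on {0..1} (\<lambda>t. 1 / k t)"
    using kpos by (intro continuous_intros k_continuous01) (auto simp: less_imp_neq[THEN not_sym])
  define J where "J = integral {0..1} (\<lambda>t. \<bar>(1 / k t)\<^sup>2 - (h t)\<^sup>2\<bar>)"
  have J: "J \<le> 2 * d" using d by (simp add: J_def k_def)
  have int: "(\<lambda>t. (1 / k t)\<^sup>2) integrable_on {0..1}" "(\<lambda>t. (h t)\<^sup>2) integrable_on {0..1}"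
    by (intro integrable_continuous_interval continuous_intros h ck)+
  have intabs: "(\<lambda>t. \<bar>(1 / k t)\<^sup>2 - (h t)\<^sup>2\<bar>) integrable_on {0..1}"
    by (intro integrable_continuous_interval continuous_intros h ck)
  have diff: "emeasure lborel (sym_diff (X_toric Om) (X_toric \<Omega>)) \<le> ennreal d"
  proof -
    have "emeasure lborel (sym_diff (X_toric Om) (X_toric \<Omega>)) = ennreal (integral {0..1} (\<lambda>t. \<bar>(1 / k t)\<^sup>2 - (h t)\<^sup>2\<bar> / 2))"
      unfolding X X_polar
      by (rule emeasure_toric_sym_diff[OF ck h(1)]) (use kpos h(2) in \<open>auto intro: less_imp_le\<close>)
    also have "integral {0..1} (\<lambda>t. \<bar>(1 / k t)\<^sup>2 - (h t)\<^sup>2\<bar> / 2) = J / 2" by (simp add: J_def)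
    finally show ?thesis using J by (simp add: ennreal_leI)
  qed
  have V: "\<bar>Vol - integral {0..1} (\<lambda>t. (h t)\<^sup>2)\<bar> \<le> 2 * d"
  proof -
    have "Vol = integral {0..1} (\<lambda>t. (1 / k t)\<^sup>2)" by (simp add: Vol_def power_divide)
    then have "Vol - integral {0..1} (\<lambda>t. (h t)\<^sup>2) = integral {0..1} (\<lambda>t. (1 / k t)\<^sup>2 - (h t)\<^sup>2)"
      using Henstock_Kurzweil_Integration.integral_diff[OF int] by simp
    moreover have "norm (integral {0..1} (\<lambda>t. (1 / k t)\<^sup>2 - (h t)\<^sup>2)) \<le> J"
      unfolding J_def
      by (rule integral_norm_bound_integral[OF integrable_diff[OF int] intabs]) simp
    ultimately show ?thesis using J by simp
  qed
  have T: "1 / (4 * A) \<le> T_min Y" if "\<kappa> \<le> 1" "\<epsilon> \<le> (c0 / (8 * A))\<^sup>2"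
  proof (rule T_min_ge)
    have kt: "k t = k0 t * notch \<kappa> \<epsilon> t" for t by (simp add: k_def)
    note fr = notched_frequency[where a = k0 and b = "deriv k0" and kk = k and kd = k1, OF c0 bd \<kappa> that(1) \<epsilon> that(2) _ kt k1]
    show "0 < 4 * A" using bd[of 0] c0 by simp
    show "\<bar>f1 t\<bar> \<le> 4 * A" if "0 \<le> t" "t \<le> 1" for t
      unfolding f1_def by (rule fr(1)) (use that in auto)
    show "\<bar>f2 1\<bar> \<le> 4 * A"
      using fr(2)[of 1] by (simp add: f2_def)
    show "0 < t \<and> \<bar>f2 t\<bar> \<le> 4 * A" if "0 \<le> t" "t \<le> 1" "f1 t = 0" for t
      unfolding f2_def by (rule fr(3)) (use that in \<open>auto simp: f1_def\<close>)
  qed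
  show ?thesis
  proof (intro exI conjI)
    show "star_shaped_toric Om" by (rule star_shaped_toric_Om)
    show "\<not> symplectically_convex (X_toric Om)" by (rule not_symplectically_convex[OF k13])
    show "ru Om * sqrt (sys Om) = (1 / (\<kappa> * k0 0) + (1 + \<epsilon>) / ((1 + \<kappa> * \<epsilon>) * k0 1)) * T_min Y / Vol"
      using ru_sys by (simp add: kv)
    show "T_min Y \<le> 1 / (\<kappa> * k0 0)" using T_min_le by (simp add: kv)
    show "\<kappa> \<le> 1 \<longrightarrow> \<epsilon> \<le> (c0 / (8 * A))\<^sup>2 \<longrightarrow> 1 / (4 * A) \<le> T_min Y" using T by blast
  qed (rule diff T_min_nonneg V Vol_pos)+
qed

theorem theorem1p1:
  fixes \<Omega> :: "(real \<times> real) set" and \<delta> \<eta> M :: real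
  assumes "star_shaped_toric \<Omega>" and "\<delta> > 0" and "\<eta> > 0" and "M > 0"
  shows "\<exists>\<Omega>\<^sub>1 \<Omega>\<^sub>2. star_shaped_toric \<Omega>\<^sub>1 \<and> star_shaped_toric \<Omega>\<^sub>2 \<and>
    emeasure lborel (sym_diff (X_toric \<Omega>\<^sub>1) (X_toric \<Omega>)) < ennreal \<delta> \<and>
    emeasure lborel (sym_diff (X_toric \<Omega>\<^sub>2) (X_toric \<Omega>)) < ennreal \<delta> \<and>
    ru \<Omega>\<^sub>1 * sqrt (sys \<Omega>\<^sub>1) < \<eta> \<and>
    ru \<Omega>\<^sub>2 * sqrt (sys \<Omega>\<^sub>2) > M \<and>
    \<not> symplectically_convex (X_toric \<Omega>\<^sub>1) \<and>
    \<not> symplectically_convex (X_toric \<Omega>\<^sub>2)"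
proof -
  obtain h where h: "continuous_on {0..1} h" "\<And>t. t \<in> {0..1} \<Longrightarrow> 0 < h t"
    and X: "X_toric \<Omega> = {z. pi * (z \<bullet> z) \<le> h ((snd z \<bullet> snd z) / (z \<bullet> z))}"
    using star_shaped_toric_polar[OF assms(1)] by blast
  define V0 where "V0 = integral {0..1} (\<lambda>t. (h t)\<^sup>2)"
  have V0: "0 < V0"
  proof -
    obtain x where x: "x \<in> {0..1}" "\<forall>t\<in>{0..1}. h x \<le> h t"
      using continuous_attains_inf[OF compact_Icc _ h(1)] by auto
    have "integral {0..1} (\<lambda>t::real. (h x)\<^sup>2) \<le> V0"
      unfolding V0_def
      by (intro integral_le integrable_continuous_interval continuous_intros h(1) power_mono)
         (use x h(2)[OF x(1)] in auto)
    then show ?thesis using h(2)[OF x(1)] by (simp add: less_le_trans[OF zero_less_power])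
  qed
  \<comment> \<open>The 8 gives \<open>2 * d \<le> V0 / 4\<close>, so that all perturbed contact
    volumes lie between 3/4 and 5/4 of \<open>V0\<close>.\<close>
  define d where "d = min (\<delta> / 2) (V0 / 8)"
  have d: "0 < d" "d < \<delta>" "2 * d \<le> V0 / 4" using assms(2) V0 by (auto simp: d_def)
  obtain k0 where s0: "smooth_on UNIV k0" and p0: "\<And>t. t \<in> {0..1} \<Longrightarrow> 0 < k0 t" and d0: "deriv k0 1 = 3 * k0 1"
    and close: "\<And>t. t \<in> {0..1} \<Longrightarrow> \<bar>(h t)\<^sup>2 - (1 / k0 t)\<^sup>2\<bar> < d"
    using gauge_approximation[OF h d(1)] by metis
  have ck0: "continuous_on {0..1} k0" "continuous_on {0..1} (deriv k0)"
    using smooth_on_imp_continuous[OF s0] smooth_DERIV(2)[OF s0] continuous_on_subset by blast+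
  obtain x where x: "x \<in> {0..1}" "\<forall>t\<in>{0..1}. k0 x \<le> k0 t"
    using continuous_attains_inf[OF compact_Icc _ ck0(1)] by auto
  obtain y where y: "y \<in> {0..1}" "\<forall>t\<in>{0..1}. k0 t \<le> k0 y"
    using continuous_attains_sup[OF compact_Icc _ ck0(1)] by auto
  have "continuous_on {0..1} (\<lambda>t. \<bar>deriv k0 t\<bar>)" by (intro continuous_intros ck0)
  then obtain w where w: "w \<in> {0..1}" "\<forall>t\<in>{0..1}. \<bar>deriv k0 t\<bar> \<le> \<bar>deriv k0 w\<bar>"
    using continuous_attains_sup[OF compact_Icc] by (metis atLeastAtMost_iff empty_iff order_refl zero_le_one)
  define c0 A where "c0 = k0 x" and "A = max (k0 y) \<bar>deriv k0 w\<bar>"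
  have c0: "0 < c0" using p0[OF x(1)] by (simp add: c0_def)
  have bd: "c0 \<le> k0 t \<and> k0 t \<le> A \<and> \<bar>deriv k0 t\<bar> \<le> A" if "t \<in> {0..1}" for t
    using x(2) y(2) w(2) that unfolding c0_def A_def by (meson max.coboundedI1 max.coboundedI2)
  have A: "0 < A" using bd[of 0] c0 by simp
  have k00: "0 < k0 0" and k01: "0 < k0 1" using p0 by auto
  \<comment> \<open>The depth \<kappa> is arbitrary and the width \<epsilon> adapts to it: half of
    the allowance \<open>2 * d\<close> goes to the smooth approximation of \<open>h\<close>, the
    other half to the notch.\<close>
  have family: "\<exists>\<epsilon>. 0 < \<epsilon> \<and> \<epsilon> \<le> 1 \<and> \<epsilon> \<le> (c0 / (8 * A))\<^sup>2 \<and>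
      integral {0..1} (\<lambda>t. \<bar>(1 / (k0 t * notch \<kappa> \<epsilon> t))\<^sup>2 - (h t)\<^sup>2\<bar>) \<le> 2 * d" if \<kappa>: "0 < \<kappa>" for \<kappa>
  proof -
    define e where "e = (\<lambda>n. 1 / real (Suc n))"
    have ep: "0 < e n" "e n \<le> 1" for n by (simp_all add: e_def)
    have "e \<longlonglongrightarrow> 0" unfolding e_def using LIMSEQ_inverse_real_of_nat by (simp add: inverse_eq_divide)
    moreover have "0 < (c0 / (8 * A))\<^sup>2" using c0 A by simp
    ultimately have "eventually (\<lambda>n. e n < (c0 / (8 * A))\<^sup>2) sequentially" by (rule order_tendstoD)
    moreover have "eventually (\<lambda>n. integral {0..1} (\<lambda>t. \<bar>(1 / k0 t)\<^sup>2 - (1 / (k0 t * notch \<kappa> (e n) t))\<^sup>2\<bar>) < d) sequentially"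
      unfolding e_def by (rule order_tendstoD(2)[OF notch_volume_limit[OF ck0(1) p0 \<kappa>] d(1)])
    ultimately obtain n where n: "e n < (c0 / (8 * A))\<^sup>2"
      "integral {0..1} (\<lambda>t. \<bar>(1 / k0 t)\<^sup>2 - (1 / (k0 t * notch \<kappa> (e n) t))\<^sup>2\<bar>) < d"
      using eventually_happens[OF eventually_conj] by (metis (no_types, lifting) sequentially_bot)
    have kn: "k0 t \<noteq> 0" "k0 t * notch \<kappa> (e n) t \<noteq> 0" if "t \<in> {0..1}" for t
      using p0[OF that] notch_pos[OF \<kappa> ep(1) that, of n] by auto
    have c: "continuous_on {0..1} (\<lambda>t. (1 / (k0 t * notch \<kappa> (e n) t))\<^sup>2)" "continuous_on {0..1} (\<lambda>t. (1 / k0 t)\<^sup>2)"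
      by (intro continuous_intros ck0 notch_continuous[OF \<kappa> ep(1)]; use kn in auto)+
    have "integral {0..1} (\<lambda>t. \<bar>(1 / (k0 t * notch \<kappa> (e n) t))\<^sup>2 - (h t)\<^sup>2\<bar>) \<le>
        integral {0..1} (\<lambda>t. \<bar>(1 / k0 t)\<^sup>2 - (1 / (k0 t * notch \<kappa> (e n) t))\<^sup>2\<bar> + d)"
    proof (rule integral_le)
      fix t :: real assume "t \<in> {0..1}"
      from close[OF this] show "\<bar>(1 / (k0 t * notch \<kappa> (e n) t))\<^sup>2 - (h t)\<^sup>2\<bar> \<le> \<bar>(1 / k0 t)\<^sup>2 - (1 / (k0 t * notch \<kappa> (e n) t))\<^sup>2\<bar> + d"
        by linarith
    qed (intro integrable_continuous_interval continuous_intros c h(1))+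
    also have "\<dots> = integral {0..1} (\<lambda>t. \<bar>(1 / k0 t)\<^sup>2 - (1 / (k0 t * notch \<kappa> (e n) t))\<^sup>2\<bar>) + integral {0..1} (\<lambda>t::real. d)"
      by (rule Henstock_Kurzweil_Integration.integral_add) (intro integrable_continuous_interval continuous_intros c)+
    also have "\<dots> \<le> 2 * d" using n(2) by simp
    finally show ?thesis using n(1) ep[of n] by (intro exI[of _ "e n"]) auto
  qed
  \<comment> \<open>For a notch of depth \<open>\<kappa> \<ge> 1\<close> and width
    \<open>\<epsilon> \<le> 1\<close> the product is at most \<open>c1 / \<kappa>\<close>: the 2
    bounds \<open>1 + \<epsilon>\<close>, the factor \<open>1 / k0 0\<close> comes from the short
    orbit on the axis, and 3/4 from the volume.\<close>
  define c1 where "c1 = (1 / k0 0 + 2 / k0 1) * (1 / k0 0) / (3 / 4 * V0)"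
  have c1: "0 < c1" using k00 k01 V0 by (simp add: c1_def add_pos_pos)
  define \<kappa>1 where "\<kappa>1 = max 1 (2 * c1 / \<eta>)"
  have \<kappa>1: "1 \<le> \<kappa>1" "2 * c1 \<le> \<kappa>1 * \<eta>"
  proof -
    have "2 * c1 / \<eta> * \<eta> \<le> \<kappa>1 * \<eta>" using assms(3) by (intro mult_right_mono) (auto simp: \<kappa>1_def)
    then show "2 * c1 \<le> \<kappa>1 * \<eta>" using assms(3) by simp
  qed (simp add: \<kappa>1_def)
  obtain \<epsilon>1 where \<epsilon>1: "0 < \<epsilon>1" "\<epsilon>1 \<le> 1"
    "integral {0..1} (\<lambda>t. \<bar>(1 / (k0 t * notch \<kappa>1 \<epsilon>1 t))\<^sup>2 - (h t)\<^sup>2\<bar>) \<le> 2 * d"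
    using family[of \<kappa>1] \<kappa>1(1) by auto
  obtain \<Omega>1 T1 V1 where 1: "star_shaped_toric \<Omega>1" "\<not> symplectically_convex (X_toric \<Omega>1)"
    "emeasure lborel (sym_diff (X_toric \<Omega>1) (X_toric \<Omega>)) \<le> ennreal d"
    "ru \<Omega>1 * sqrt (sys \<Omega>1) = (1 / (\<kappa>1 * k0 0) + (1 + \<epsilon>1) / ((1 + \<kappa>1 * \<epsilon>1) * k0 1)) * T1 / V1"
    "0 \<le> T1" "T1 \<le> 1 / (\<kappa>1 * k0 0)" "\<bar>V1 - V0\<bar> \<le> 2 * d" "0 < V1"
    using notched_domain[OF s0 p0 d0 less_le_trans[OF zero_less_one \<kappa>1(1)] \<epsilon>1(1) c0 bd h X \<epsilon>1(3)]
    unfolding V0_def by blast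
  have small: "ru \<Omega>1 * sqrt (sys \<Omega>1) < \<eta>"
  proof -
    have V1: "3 / 4 * V0 \<le> V1" using 1(7) d(3) by linarith
    have "1 / (\<kappa>1 * k0 0) \<le> 1 / (1 * k0 0)"
      using \<kappa>1(1) k00 by (intro divide_left_mono mult_right_mono) auto
    moreover have "(1 + \<epsilon>1) / ((1 + \<kappa>1 * \<epsilon>1) * k0 1) \<le> 2 / (1 * k0 1)"
      using \<epsilon>1 \<kappa>1(1) k01 by (intro frac_le mult_right_mono) auto
    ultimately have a: "1 / (\<kappa>1 * k0 0) + (1 + \<epsilon>1) / ((1 + \<kappa>1 * \<epsilon>1) * k0 1) \<le> 1 / k0 0 + 2 / k0 1" by simp
    have "ru \<Omega>1 * sqrt (sys \<Omega>1) \<le> (1 / k0 0 + 2 / k0 1) * (1 / (\<kappa>1 * k0 0)) / (3 / 4 * V0)"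
      unfolding 1(4)
    proof (rule frac_le)
      show "(1 / (\<kappa>1 * k0 0) + (1 + \<epsilon>1) / ((1 + \<kappa>1 * \<epsilon>1) * k0 1)) * T1 \<le> (1 / k0 0 + 2 / k0 1) * (1 / (\<kappa>1 * k0 0))"
        using a 1(5,6) k00 k01 by (intro mult_mono) auto
      show "0 \<le> (1 / k0 0 + 2 / k0 1) * (1 / (\<kappa>1 * k0 0))" using k00 k01 \<kappa>1(1) by simp
    qed (use V0 V1 in auto)
    also have "\<dots> = c1 / \<kappa>1" by (simp add: c1_def)
    also have "\<dots> < \<eta>"
      using \<kappa>1 c1 by (simp add: pos_divide_less_eq mult.commute)
    finally show ?thesis .
  qed
  \<comment> \<open>For a spike only the summand \<open>1 / (\<kappa> * k0 0)\<close> of the Ruelle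
    invariant is kept; with the period at least \<open>1 / (4 * A)\<close> and the volume at most
    \<open>5 / 4 * V0\<close> the product is at least \<open>c2 / \<kappa>\<close>.\<close>
  define c2 where "c2 = (1 / k0 0) * (1 / (4 * A)) / (5 / 4 * V0)"
  have c2: "0 < c2" using k00 A V0 by (simp add: c2_def)
  define \<kappa>2 where "\<kappa>2 = min 1 (c2 / (2 * M))"
  have \<kappa>2: "0 < \<kappa>2" "\<kappa>2 \<le> 1" "M * \<kappa>2 < c2"
  proof -
    show "0 < \<kappa>2" "\<kappa>2 \<le> 1" using c2 assms(4) by (auto simp: \<kappa>2_def)
    have "M * \<kappa>2 \<le> M * (c2 / (2 * M))" using assms(4) by (intro mult_left_mono) (auto simp: \<kappa>2_def)
    also have "\<dots> < c2" using assms(4) c2 by simp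
    finally show "M * \<kappa>2 < c2" .
  qed
  obtain \<epsilon>2 where \<epsilon>2: "0 < \<epsilon>2" "\<epsilon>2 \<le> (c0 / (8 * A))\<^sup>2"
    "integral {0..1} (\<lambda>t. \<bar>(1 / (k0 t * notch \<kappa>2 \<epsilon>2 t))\<^sup>2 - (h t)\<^sup>2\<bar>) \<le> 2 * d"
    using family[OF \<kappa>2(1)] by auto
  obtain \<Omega>2 T2 V2 where 2: "star_shaped_toric \<Omega>2" "\<not> symplectically_convex (X_toric \<Omega>2)"
    "emeasure lborel (sym_diff (X_toric \<Omega>2) (X_toric \<Omega>)) \<le> ennreal d"
    "ru \<Omega>2 * sqrt (sys \<Omega>2) = (1 / (\<kappa>2 * k0 0) + (1 + \<epsilon>2) / ((1 + \<kappa>2 * \<epsilon>2) * k0 1)) * T2 / V2"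
    "\<bar>V2 - V0\<bar> \<le> 2 * d" "0 < V2" "1 / (4 * A) \<le> T2"
    using notched_domain[OF s0 p0 d0 \<kappa>2(1) \<epsilon>2(1) c0 bd h X \<epsilon>2(3)] \<kappa>2(2) \<epsilon>2(2)
    unfolding V0_def by blast
  have large: "M < ru \<Omega>2 * sqrt (sys \<Omega>2)"
  proof -
    have V2: "V2 \<le> 5 / 4 * V0" using 2(5) d(3) by linarith
    have nonneg: "0 \<le> (1 + \<epsilon>2) / ((1 + \<kappa>2 * \<epsilon>2) * k0 1)" using \<epsilon>2(1) \<kappa>2(1) k01 by simp
    have "M < c2 / \<kappa>2" using \<kappa>2(1,3) by (simp add: pos_less_divide_eq)
    also have "\<dots> = (1 / (\<kappa>2 * k0 0)) * (1 / (4 * A)) / (5 / 4 * V0)" by (simp add: c2_def mult.commute)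
    also have "\<dots> \<le> ru \<Omega>2 * sqrt (sys \<Omega>2)"
      unfolding 2(4)
    proof (rule frac_le)
      show "1 / (\<kappa>2 * k0 0) * (1 / (4 * A)) \<le> (1 / (\<kappa>2 * k0 0) + (1 + \<epsilon>2) / ((1 + \<kappa>2 * \<epsilon>2) * k0 1)) * T2"
        using nonneg 2(7) \<kappa>2(1) k00 A by (intro mult_mono) auto
      have "0 \<le> T2" using 2(7) A by (meson divide_nonneg_pos less_le_trans mult_pos_pos order_less_imp_le zero_less_divide_1_iff zero_less_numeral)
      then show "0 \<le> (1 / (\<kappa>2 * k0 0) + (1 + \<epsilon>2) / ((1 + \<kappa>2 * \<epsilon>2) * k0 1)) * T2"
        using nonneg \<kappa>2(1) k00 by simp
    qed (use 2(6) V2 in auto)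
    finally show ?thesis .
  qed
  have "ennreal d < ennreal \<delta>" using d by (simp add: ennreal_lessI)
  then show ?thesis using 1 2 small large le_less_trans by blast
qed

end
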